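(* Let $M$ be a smooth $n$-dimensional manifold, $\Phi\to M$ a smooth fibre bundle, $k\ge1$, $\mathcal{Q}:=J^{k-1}\Phi$, $\mathcal{P}:=V^*\mathcal{Q}\otimes_{\mathcal{Q}}\Lambda^{n-1}M$, and let $\mathcal{L}=L\,d^nx$ be a $k$-th order Lagrangian density on $J^k\Phi$ for which the equations $p^{(\mu_1\dots\mu_k)}=\partial L/\partial\varphi_{\mu_1\dots\mu_k}$ can be solved uniquely and smoothly for the highest-order derivatives $\varphi_{\mu_1\dots\mu_k}$. Let $h$ and $H$ be the associated functions on $\mathcal{P}$ defined (in coordinates) in the context. Then the $(n+1)$-form $$\Omega=\sum_{m=0}^{k-1}dp^{\mu_1\dots\mu_m\lambda}\wedge dx^1\wedge\cdots\wedge\underbrace{d\varphi_{\mu_1\dots\mu_m}}_{\lambda\text{-th place}}\wedge\cdots\wedge dx^n-dH\wedge dx^1\wedge\cdots\wedge dx^n$$ is defined unambiguously on the phase bundle $\mathcal{P}$, i.e. it does not depend on the choice of trivialisation and coordinates of $\Phi\to M$. Moreover, a section $\sigma$ of $\mathcal{P}\to M$ satisfies $$\sigma^*(X\lrcorner\,\Omega)=0\quad\text{for all vector fields }X\text{ on }\mathcal{P}$$ if and only if (1) $\sigma$ is holonomic, i.e. its projection to $\mathcal{Q}=J^{k-1}\Phi$ is $j^{k-1}f$ for a section $f$ of $\Phi$; and (2) $\sigma$ satisfies the field equations $$\varphi_{\mu_1\dots\mu_k}=\frac{\partial h}{\partial p^{(\mu_1\dots\mu_k)}},\qquad p^{(\mu_1\dots\mu_m)}=-\frac{\partial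 h}{\partial\varphi_{\mu_1\dots\mu_m}}-\partial_\lambda p^{\mu_1\dots\mu_m\lambda}\ \ (1\le m\le k-1),\qquad 0=-\frac{\partial h}{\partial\varphi}-\partial_\lambda p^\lambda,$$ where $\varphi_{\mu_1\dots\mu_k}$ denotes the $k$-th derivatives of $f$.
   Context: $\Lambda^iM:=\bigwedge^iT^*M$; $V^*\mathcal{Q}$ is the dual of the vertical tangent bundle of $\mathcal{Q}\to M$; $\delta$ is the vertical differential. Coordinates on $\Phi$: $(x^\mu,\varphi)$, the index labelling field components being suppressed (summed over); on $J^m\Phi$: $\varphi_{\mu_1\dots\mu_i}$, $0\le i\le m$, symmetric in the indices. A point of $\mathcal{P}$ is $$p=\sum_{m=0}^{k-1}p^{\mu_1\dots\mu_m\lambda}\,\delta\varphi_{\mu_1\dots\mu_m}\otimes(\partial_\lambda\lrcorner\, d^nx),$$ with $p^{\mu_1\dots\mu_m\lambda}$ symmetric in $\mu_1,\dots,\mu_m$ only (repeated indices summed over all values); $(\ )$ denotes total symmetrisation. Coordinates on $\mathcal{P}$ are the $x^\mu$, $\varphi_{\mu_1\dots\mu_m}$ and $p^{\mu_1\dots\mu_m\lambda}$, $0\le m\le k-1$. Partial derivatives with respect to symmetric quantities are the totally symmetric coefficients in the differential, e.g. $dh=\dots+\frac{\partial h}{\partial\varphi_{\mu_1\dots\mu_m}}d\varphi_{\mu_1\dots\mu_m}+\frac{\partial h}{\partial p^{(\mu_1\dots\mu_k)}}dp^{(\mu_1\dots\mu_k)}$ with sums over all index values. Definition of $h$ (Legendre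 transform of $L$ in the highest-order derivatives) and $H$: $$h:=p^{(\mu_1\dots\mu_k)}\varphi_{\mu_1\dots\mu_k}-L,$$ where $\varphi_{\mu_1\dots\mu_k}$ is expressed, by solving $p^{(\mu_1\dots\mu_k)}=\partial L/\partial\varphi_{\mu_1\dots\mu_k}$, through $x^\mu$, the $\varphi_{\mu_1\dots\mu_m}$ with $m\le k-1$, and $p^{(\mu_1\dots\mu_k)}$, so that $h$ is a function of these variables; and $$H:=\sum_{m=0}^{k-1}p^{\mu_1\dots\mu_m\lambda}\varphi_{\mu_1\dots\mu_m\lambda}-L=\sum_{m=1}^{k-1}p^{(\mu_1\dots\mu_m)}\varphi_{\mu_1\dots\mu_m}+h,$$ a function on $\mathcal{P}$, with the same substitution for $\varphi_{\mu_1\dots\mu_k}$. *)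

theory Defs
  imports "HOL-Analysis.Analysis" "HOL-Combinatorics.Combinatorics"
begin

section \<open>Smooth manifolds\<close>

primrec Ck_on :: "nat \<Rightarrow> 'a::euclidean_space set \<Rightarrow> ('a \<Rightarrow> 'b::real_normed_vector) \<Rightarrow> bool" where
  "Ck_on 0 S f \<longleftrightarrow> continuous_on S f"
| "Ck_on (Suc r) S f \<longleftrightarrow> (\<forall>x\<in>S. f differentiable (at x)) \<and>
     (\<forall>v. Ck_on r S (\<lambda>x. frechet_derivative f (at x) v))"

definition smooth_on :: "'a::euclidean_space set \<Rightarrow> ('a \<Rightarrow> 'b::real_normed_vector) \<Rightarrow> bool" where
  "smooth_on S f \<longleftrightarrow> open S \<and> (\<forall>r. Ck_on r S f)"

text \<open>A chart is a pair of a domain and a coordinate map; only the values of the map on the domain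
  matter. The carrier and the topology of a manifold are determined by its atlas.\<close>

type_synonym ('p, 'e) chart = "'p set \<times> ('p \<Rightarrow> 'e)"

abbreviation dom_of :: "('p, 'e) chart \<Rightarrow> 'p set" where "dom_of \<equiv> fst"

abbreviation coords :: "('p, 'e) chart \<Rightarrow> 'p \<Rightarrow> 'e" where "coords \<equiv> snd"

definition image_of :: "('p, 'e) chart \<Rightarrow> 'e set" where
  "image_of c = coords c ` dom_of c"

definition uncoords :: "('p, 'e) chart \<Rightarrow> 'e \<Rightarrow> 'p" where
  "uncoords c = inv_into (dom_of c) (coords c)"

definition carrier_of :: "('p, 'e) chart set \<Rightarrow> 'p set" where
  "carrier_of A = (\<Union>c\<in>A. dom_of c)"

definition smooth_atlas :: "('p, 'e::euclidean_space) chart set \<Rightarrow> bool" where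
  "smooth_atlas A \<longleftrightarrow>
     (\<forall>c\<in>A. inj_on (coords c) (dom_of c) \<and> open (image_of c)) \<and>
     (\<forall>c\<in>A. \<forall>d\<in>A. smooth_on (coords c ` (dom_of c \<inter> dom_of d)) (coords d \<circ> uncoords c))"

text \<open>The coarsest topology making chart domains open and charts continuous; for a smooth atlas
  the generating sets are a base.\<close>

definition manifold_topology :: "('p, 'e::euclidean_space) chart set \<Rightarrow> 'p topology" where
  "manifold_topology A =
     topology_generated_by {{p \<in> dom_of c. coords c p \<in> V} | c V. c \<in> A \<and> open V}"

definition smooth_manifold :: "('p, 'e::euclidean_space) chart set \<Rightarrow> bool" where
  "smooth_manifold A \<longleftrightarrow> smooth_atlas A \<and>
     (\<forall>c. dom_of c \<subseteq> carrier_of A \<and> smooth_atlas (insert c A) \<longrightarrow> c \<in> A) \<and>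
     Hausdorff_space (manifold_topology A) \<and> second_countable (manifold_topology A)"

definition smooth_map ::
  "('p, 'e::euclidean_space) chart set \<Rightarrow> ('q, 'd::euclidean_space) chart set \<Rightarrow> ('p \<Rightarrow> 'q) \<Rightarrow> bool" where
  "smooth_map A B F \<longleftrightarrow> F ` carrier_of A \<subseteq> carrier_of B \<and>
     (\<forall>c\<in>A. \<forall>d\<in>B. smooth_on (coords c ` (dom_of c \<inter> F -` dom_of d)) (coords d \<circ> F \<circ> uncoords c))"

definition diffeomorphism ::
  "('p, 'e::euclidean_space) chart set \<Rightarrow> ('q, 'd::euclidean_space) chart set \<Rightarrow> ('p \<Rightarrow> 'q) \<Rightarrow> bool" where
  "diffeomorphism A B F \<longleftrightarrow> bij_betw F (carrier_of A) (carrier_of B) \<and>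
     smooth_map A B F \<and> smooth_map B A (inv_into (carrier_of A) F)"

definition restrict_atlas :: "('p, 'e) chart set \<Rightarrow> 'p set \<Rightarrow> ('p, 'e) chart set" where
  "restrict_atlas A S = (\<lambda>c. (dom_of c \<inter> S, coords c)) ` A"

definition prod_atlas :: "('p, 'e) chart set \<Rightarrow> ('q, 'd) chart set \<Rightarrow> ('p \<times> 'q, 'e \<times> 'd) chart set" where
  "prod_atlas A B = {(dom_of c \<times> dom_of d, map_prod (coords c) (coords d)) | c d. c \<in> A \<and> d \<in> B}"


subsection \<open>Tangent vectors, vector fields and differential forms\<close>

text \<open>A tangent vector at a point is the family of its components in all charts around the point,
  related by the derivatives of the transition maps (and \<open>0\<close> on irrelevant arguments, so that a
  tangent vector is determined by its components).\<close>

type_synonym ('p, 'e) tangent = "('p, 'e) chart \<Rightarrow> 'e"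

definition tangent_space :: "('p, 'e::euclidean_space) chart set \<Rightarrow> 'p \<Rightarrow> ('p, 'e) tangent set" where
  "tangent_space A p = {v.
     (\<forall>c\<in>A. \<forall>d\<in>A. p \<in> dom_of c \<inter> dom_of d \<longrightarrow>
        v d = frechet_derivative (coords d \<circ> uncoords c) (at (coords c p)) (v c)) \<and>
     (\<forall>c. \<not> (c \<in> A \<and> p \<in> dom_of c) \<longrightarrow> v c = 0)}"

definition coord_vector ::
  "('p, 'e::euclidean_space) chart set \<Rightarrow> 'p \<Rightarrow> ('p, 'e) chart \<Rightarrow> 'e \<Rightarrow> ('p, 'e) tangent" where
  "coord_vector A p c e = (\<lambda>d. if d \<in> A \<and> p \<in> dom_of d
     then frechet_derivative (coords d \<circ> uncoords c) (at (coords c p)) e else 0)"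

definition smooth_vector_field ::
  "('p, 'e::euclidean_space) chart set \<Rightarrow> ('p \<Rightarrow> ('p, 'e) tangent) \<Rightarrow> bool" where
  "smooth_vector_field A X \<longleftrightarrow> (\<forall>p\<in>carrier_of A. X p \<in> tangent_space A p) \<and>
     (\<forall>c\<in>A. smooth_on (image_of c) (\<lambda>y. X (uncoords c y) c))"

text \<open>The differential of \<open>F\<close> at \<open>p\<close>; the choice of the chart around \<open>p\<close> is immaterial.\<close>

definition push_forward ::
  "('p, 'e::euclidean_space) chart set \<Rightarrow> ('q, 'd::euclidean_space) chart set \<Rightarrow> ('p \<Rightarrow> 'q) \<Rightarrow> 'p
     \<Rightarrow> ('p, 'e) tangent \<Rightarrow> ('q, 'd) tangent" where
  "push_forward A B F p v = (\<lambda>d. if d \<in> B \<and> F p \<in> dom_of d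
     then let c = (SOME c. c \<in> A \<and> p \<in> dom_of c)
          in frechet_derivative (coords d \<circ> F \<circ> uncoords c) (at (coords c p)) (v c)
     else 0)"

definition alternating_form ::
  "('p, 'e::euclidean_space) chart set \<Rightarrow> 'p \<Rightarrow> nat \<Rightarrow> (('p, 'e) tangent list \<Rightarrow> real) \<Rightarrow> bool" where
  "alternating_form A p r w \<longleftrightarrow>
     (\<forall>vs. length vs = r \<and> set vs \<subseteq> tangent_space A p \<longrightarrow>
        (\<forall>i<r. \<forall>u\<in>tangent_space A p. \<forall>v\<in>tangent_space A p. \<forall>a b.
           w (vs[i := (\<lambda>c. a *\<^sub>R u c + b *\<^sub>R v c)]) = a * w (vs[i := u]) + b * w (vs[i := v])) \<and>
        (\<forall>i<r. \<forall>j<r. i \<noteq> j \<and> vs ! i = vs ! j \<longrightarrow> w vs = 0)) \<and>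
     (\<forall>vs. \<not> (length vs = r \<and> set vs \<subseteq> tangent_space A p) \<longrightarrow> w vs = 0)"

definition differential_form ::
  "('p, 'e::euclidean_space) chart set \<Rightarrow> nat \<Rightarrow> ('p \<Rightarrow> ('p, 'e) tangent list \<Rightarrow> real) \<Rightarrow> bool" where
  "differential_form A r w \<longleftrightarrow>
     (\<forall>p\<in>carrier_of A. alternating_form A p r (w p)) \<and> (\<forall>p. p \<notin> carrier_of A \<longrightarrow> w p = (\<lambda>_. 0)) \<and>
     (\<forall>c\<in>A. \<forall>es. length es = r \<longrightarrow>
        smooth_on (image_of c) (\<lambda>y. w (uncoords c y) (map (coord_vector A (uncoords c y) c) es)))"

definition interior_product ::
  "('p \<Rightarrow> ('p, 'e) tangent) \<Rightarrow> ('p \<Rightarrow> ('p, 'e) tangent list \<Rightarrow> real)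
     \<Rightarrow> 'p \<Rightarrow> ('p, 'e) tangent list \<Rightarrow> real" where
  "interior_product X w = (\<lambda>p vs. w p (X p # vs))"

definition pull_back ::
  "('p, 'e::euclidean_space) chart set \<Rightarrow> ('q, 'd::euclidean_space) chart set \<Rightarrow> ('p \<Rightarrow> 'q)
     \<Rightarrow> ('q \<Rightarrow> ('q, 'd) tangent list \<Rightarrow> real) \<Rightarrow> 'p \<Rightarrow> ('p, 'e) tangent list \<Rightarrow> real" where
  "pull_back A B F w = (\<lambda>p vs. w (F p) (map (push_forward A B F p) vs))"

definition form_vanishes ::
  "('p, 'e::euclidean_space) chart set \<Rightarrow> nat \<Rightarrow> ('p \<Rightarrow> ('p, 'e) tangent list \<Rightarrow> real) \<Rightarrow> bool" where
  "form_vanishes A r w \<longleftrightarrow>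
     (\<forall>p\<in>carrier_of A. \<forall>vs. length vs = r \<and> set vs \<subseteq> tangent_space A p \<longrightarrow> w p vs = 0)"

text \<open>Wedge product of covectors, normalised so that
  \<open>(\<alpha>\<^sub>1 \<and> \<dots> \<and> \<alpha>\<^sub>r)(v\<^sub>1, \<dots>, v\<^sub>r) = det (\<alpha>\<^sub>i(v\<^sub>j))\<close>.\<close>

definition wedge :: "('v \<Rightarrow> real) list \<Rightarrow> 'v list \<Rightarrow> real" where
  "wedge \<alpha>s vs = (\<Sum>\<pi> | \<pi> permutes {..<length \<alpha>s}.
     of_int (sign \<pi>) * (\<Prod>i<length \<alpha>s. (\<alpha>s ! i) (vs ! \<pi> i)))"


section \<open>Fibre bundles and jets\<close>

record ('m, 'f, 'n::finite, 'c::finite) fibre_bundle =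
  base :: "('m, real^'n) chart set"
  total :: "('f, (real^'n) \<times> (real^'c)) chart set"
  proj :: "'f \<Rightarrow> 'm"

text \<open>\<open>'n\<close> indexes the coordinates of the base and \<open>'c\<close> the field components; \<open>F\<close> is the typical
  fibre.\<close>

definition smooth_fibre_bundle ::
  "('m, 'f, 'n::{finite,linorder}, 'c::finite) fibre_bundle \<Rightarrow> ('g, real^'c) chart set \<Rightarrow> bool" where
  "smooth_fibre_bundle B F \<longleftrightarrow>
     smooth_manifold (base B) \<and> smooth_manifold (total B) \<and> smooth_manifold F \<and>
     smooth_map (total B) (base B) (proj B) \<and>
     (\<forall>x\<in>carrier_of (base B). \<exists>S \<tau>. openin (manifold_topology (base B)) S \<and> x \<in> S \<and>
        diffeomorphism (restrict_atlas (total B) (proj B -` S))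
                       (prod_atlas (restrict_atlas (base B) S) F) \<tau> \<and>
        (\<forall>y\<in>carrier_of (total B). proj B y \<in> S \<longrightarrow> fst (\<tau> y) = proj B y))"

text \<open>Adapted coordinates \<open>(x\<^sup>\<mu>, \<phi>)\<close>: a chart of the base and a chart of the total space whose first
  component is the base coordinate. The charts induced by a local trivialisation together with
  charts of the base and of the typical fibre are of this kind.\<close>

type_synonym ('m, 'f, 'n, 'c) adapted =
  "('m, real^'n) chart \<times> ('f, (real^'n) \<times> (real^'c)) chart"

definition adapted_charts ::
  "('m, 'f, 'n::{finite,linorder}, 'c::finite) fibre_bundle \<Rightarrow> ('m, 'f, 'n, 'c) adapted set" where
  "adapted_charts B = {(b, t). b \<in> base B \<and> t \<in> total B \<and>
     (\<forall>y\<in>dom_of t. proj B y \<in> dom_of b \<and> fst (coords t y) = coords b (proj B y))}"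

definition local_section ::
  "('m, 'f, 'n::{finite,linorder}, 'c::finite) fibre_bundle \<Rightarrow> 'm \<Rightarrow> ('m \<Rightarrow> 'f) \<Rightarrow> bool" where
  "local_section B x f \<longleftrightarrow> (\<exists>S. openin (manifold_topology (base B)) S \<and> x \<in> S \<and>
     smooth_map (restrict_atlas (base B) S) (total B) f \<and> (\<forall>z\<in>S. proj B (f z) = z))"

definition global_section ::
  "('m, 'f, 'n::{finite,linorder}, 'c::finite) fibre_bundle \<Rightarrow> ('m \<Rightarrow> 'f) \<Rightarrow> bool" where
  "global_section B f \<longleftrightarrow> smooth_map (base B) (total B) f \<and> (\<forall>x\<in>carrier_of (base B). proj B (f x) = x)"

text \<open>\<open>pd [\<mu>\<^sub>1, \<dots>, \<mu>\<^sub>m] g\<close> is the iterated partial derivative \<open>\<partial>\<^sub>\<mu>\<^sub>1 \<dots> \<partial>\<^sub>\<mu>\<^sub>m g\<close>.\<close>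

primrec pd :: "'n::finite list \<Rightarrow> (real^'n \<Rightarrow> 'b::real_normed_vector) \<Rightarrow> real^'n \<Rightarrow> 'b" where
  "pd [] g = g"
| "pd (\<mu> # \<mu>s) g = (\<lambda>x. frechet_derivative (pd \<mu>s g) (at x) (axis \<mu> 1))"

definition field_rep ::
  "('m, 'f, 'n::{finite,linorder}, 'c::finite) adapted \<Rightarrow> ('m \<Rightarrow> 'f) \<Rightarrow> (real, 'n) vec \<Rightarrow> real^'c" where
  "field_rep a f = snd \<circ> coords (snd a) \<circ> f \<circ> uncoords (fst a)"

text \<open>The \<open>m\<close>-jet of \<open>f\<close> at \<open>x\<close> is the base point together with the class of all local sections whose
  derivatives up to order \<open>m\<close> at \<open>x\<close> are those of \<open>f\<close>.\<close>

type_synonym ('m, 'f) jet = "'m \<times> ('m \<Rightarrow> 'f) set"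

definition jet ::
  "('m, 'f, 'n::{finite,linorder}, 'c::finite) fibre_bundle \<Rightarrow> nat \<Rightarrow> ('m \<Rightarrow> 'f) \<Rightarrow> 'm \<Rightarrow> ('m, 'f) jet" where
  "jet B m f x = (x, {g. local_section B x g \<and> g x = f x \<and>
     (\<forall>a\<in>adapted_charts B. f x \<in> dom_of (snd a) \<longrightarrow>
        (\<forall>\<mu>s. length \<mu>s \<le> m \<longrightarrow>
           pd \<mu>s (field_rep a g) (coords (fst a) x) = pd \<mu>s (field_rep a f) (coords (fst a) x)))})"

definition jet_space ::
  "('m, 'f, 'n::{finite,linorder}, 'c::finite) fibre_bundle \<Rightarrow> nat \<Rightarrow> ('m, 'f) jet set" where
  "jet_space B m = {jet B m f x | f x. x \<in> carrier_of (base B) \<and> local_section B x f}"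

definition jet_rep :: "('m, 'f) jet \<Rightarrow> 'm \<Rightarrow> 'f" where
  "jet_rep j = (SOME f. f \<in> snd j)"

definition jet_value :: "('m, 'f) jet \<Rightarrow> 'f" where
  "jet_value j = jet_rep j (fst j)"

text \<open>The coordinate \<open>\<phi>\<^sub>\<mu>\<^sub>1\<^sub>\<dots>\<^sub>\<mu>\<^sub>m\<close> of a jet.\<close>

definition jet_coord ::
  "('m, 'f, 'n::{finite,linorder}, 'c::finite) adapted \<Rightarrow> ('m, 'f) jet \<Rightarrow> 'n list \<Rightarrow> real^'c" where
  "jet_coord a j \<mu>s = pd \<mu>s (field_rep a (jet_rep j)) (coords (fst a) (fst j))"


subsection \<open>Symmetric index families\<close>

text \<open>Quantities symmetric in \<open>\<mu>\<^sub>1, \<dots>, \<mu>\<^sub>m\<close> are indexed by multisets. The order \<open>k\<close> of the theory is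
  \<open>CARD('k)\<close> (hence arbitrary with \<open>k \<ge> 1\<close>): \<open>('n, 'k) lower_index\<close> consists of the multi-indices of
  order \<open>m < k\<close>, \<open>('n, 'k) top_index\<close> of those of order \<open>k\<close>.\<close>

typedef ('n, 'k::finite) lower_index = "{I :: 'n multiset. size I < CARD('k)}"
  by (rule exI[of _ "{#}"]) simp

typedef ('n, 'k::finite) top_index = "{I :: 'n multiset. size I = CARD('k)}"
  by (rule exI[of _ "replicate_mset CARD('k) undefined"]) simp

lemma finite_msets_bounded: "finite {I :: 'n::finite multiset. size I \<le> r}"
proof -
  have "{I :: 'n multiset. size I \<le> r} \<subseteq> mset ` {xs. set xs \<subseteq> UNIV \<and> length xs \<le> r}"
  proof
    fix I :: "'n multiset" assume "I \<in> {I. size I \<le> r}"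
    moreover obtain xs where "mset xs = I" using ex_mset by blast
    ultimately show "I \<in> mset ` {xs. set xs \<subseteq> UNIV \<and> length xs \<le> r}" by force
  qed
  then show ?thesis
    by (rule finite_subset) (intro finite_imageI finite_lists_length_le finite)
qed

instance lower_index :: (finite, finite) finite
proof
  have "finite {I :: 'a multiset. size I < CARD('b)}"
    by (rule finite_subset[OF _ finite_msets_bounded[of "CARD('b)"]]) auto
  then show "finite (UNIV :: ('a, 'b) lower_index set)"
    by (simp add: type_definition.univ[OF type_definition_lower_index])
qed

instance top_index :: (finite, finite) finite
proof
  have "finite {I :: 'a multiset. size I = CARD('b)}"
    by (rule finite_subset[OF _ finite_msets_bounded[of "CARD('b)"]]) auto
  then show "finite (UNIV :: ('a, 'b) top_index set)"
    by (simp add: type_definition.univ[OF type_definition_top_index])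
qed

definition low :: "'n list \<Rightarrow> ('n, 'k::finite) lower_index" where
  "low \<mu>s = Abs_lower_index (mset \<mu>s)"

definition top_of :: "'n list \<Rightarrow> ('n, 'k::finite) top_index" where
  "top_of \<mu>s = Abs_top_index (mset \<mu>s)"

text \<open>Number of index tuples that are rearrangements of the given one.\<close>

definition arrangements :: "'n list \<Rightarrow> nat" where
  "arrangements \<mu>s = card {\<nu>s. mset \<nu>s = mset \<mu>s}"

text \<open>Coordinates on \<open>J\<^sup>k\<^sup>-\<^sup>1\<Phi>\<close>, on \<open>J\<^sup>k\<Phi>\<close> and on the phase bundle. In the last one
  \<open>p $ low [\<mu>\<^sub>1, \<dots>, \<mu>\<^sub>m] $ \<kappa> $ i\<close> is the component of \<open>p\<^sup>\<mu>\<^sup>1\<^sup>\<dots>\<^sup>\<mu>\<^sup>m\<^sup>\<kappa>\<close> belonging to the field component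
  \<open>i\<close>.\<close>

type_synonym ('n, 'c, 'k) fields = "((real, 'c) vec, ('n, 'k) lower_index) vec"
type_synonym ('n, 'c, 'k) tops = "((real, 'c) vec, ('n, 'k) top_index) vec"
type_synonym ('n, 'c, 'k) momenta = "(((real, 'c) vec, 'n) vec, ('n, 'k) lower_index) vec"

type_synonym ('n, 'c, 'k) Qcoord = "(real^'n) \<times> ('n, 'c, 'k) fields"
type_synonym ('n, 'c, 'k) Jcoord = "(real^'n) \<times> ('n, 'c, 'k) fields \<times> ('n, 'c, 'k) tops"
type_synonym ('n, 'c, 'k) Pcoord = "(real^'n) \<times> ('n, 'c, 'k) fields \<times> ('n, 'c, 'k) momenta"

definition lower_coords ::
  "('m, 'f, 'n::{finite,linorder}, 'c::finite) adapted \<Rightarrow> ('m, 'f) jet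
     \<Rightarrow> ('n, 'c, 'k::finite) fields" where
  "lower_coords a j = (\<chi> I. jet_coord a j (sorted_list_of_multiset (Rep_lower_index I)))"

definition top_coords ::
  "('m, 'f, 'n::{finite,linorder}, 'c::finite) adapted \<Rightarrow> ('m, 'f) jet
     \<Rightarrow> ('n, 'c, 'k::finite) tops" where
  "top_coords a j = (\<chi> I. jet_coord a j (sorted_list_of_multiset (Rep_top_index I)))"

definition Qchart ::
  "('m, 'f, 'n::{finite,linorder}, 'c::finite) fibre_bundle \<Rightarrow> ('m, 'f, 'n, 'c) adapted
     \<Rightarrow> (('m, 'f) jet, ('n, 'c, 'k::finite) Qcoord) chart" where
  "Qchart B a = ({j \<in> jet_space B (CARD('k) - 1). jet_value j \<in> dom_of (snd a)},
     \<lambda>j. (coords (fst a) (fst j), lower_coords a j))"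

definition Jchart ::
  "('m, 'f, 'n::{finite,linorder}, 'c::finite) fibre_bundle \<Rightarrow> ('m, 'f, 'n, 'c) adapted
     \<Rightarrow> (('m, 'f) jet, ('n, 'c, 'k::finite) Jcoord) chart" where
  "Jchart B a = ({j \<in> jet_space B CARD('k). jet_value j \<in> dom_of (snd a)},
     \<lambda>j. (coords (fst a) (fst j), lower_coords a j, top_coords a j))"

definition Qatlas ::
  "('m, 'f, 'n::{finite,linorder}, 'c::finite) fibre_bundle
     \<Rightarrow> (('m, 'f) jet, ('n, 'c, 'k::finite) Qcoord) chart set" where
  "Qatlas B = Qchart B ` adapted_charts B"


section \<open>The phase bundle\<close>

text \<open>\<open>dx\<^sup>1, \<dots>, dx\<^sup>n\<close> and \<open>d\<^sup>nx\<close> on coordinate vectors of the base.\<close>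

definition base_indices :: "'n::{finite,linorder} list" where
  "base_indices = sorted_list_of_set UNIV"

definition volume :: "(real^'n::{finite,linorder}) list \<Rightarrow> real" where
  "volume = wedge (map (\<lambda>\<mu> v. v $ \<mu>) base_indices)"

definition vertical_space ::
  "('m, 'f, 'n::{finite,linorder}, 'c::finite) fibre_bundle \<Rightarrow> ('m, 'f) jet
     \<Rightarrow> (('m, 'f) jet, ('n, 'c, 'k::finite) Qcoord) tangent set" where
  "vertical_space B q = {v \<in> tangent_space (Qatlas B) q. push_forward (Qatlas B) (base B) fst q v = (\<lambda>_. 0)}"

text \<open>An element of the fibre of \<open>V\<^sup>*\<Q> \<otimes> \<Lambda>\<^sup>n\<^sup>-\<^sup>1M\<close> over \<open>q\<close> is regarded as a function of a vertical
  tangent vector at \<open>q\<close> and of \<open>n - 1\<close> tangent vectors of the base;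
  \<open>momentum B a q p\<close> is \<open>\<Sum> p\<^sup>\<mu>\<^sup>1\<^sup>\<dots>\<^sup>\<mu>\<^sup>m\<^sup>\<kappa> \<delta>\<phi>\<^sub>\<mu>\<^sub>1\<^sub>\<dots>\<^sub>\<mu>\<^sub>m \<otimes> (\<partial>\<^sub>\<kappa> \<lrcorner> d\<^sup>nx)\<close> in the coordinates \<open>a\<close>.\<close>

type_synonym ('m, 'f, 'n, 'c, 'k) phase =
  "('m, 'f) jet \<times>
   ((('m, 'f) jet, ('n, 'c, 'k) Qcoord) tangent \<Rightarrow> ('m, real^'n) tangent list \<Rightarrow> real)"

definition momentum ::
  "('m, 'f, 'n::{finite,linorder}, 'c::finite) fibre_bundle \<Rightarrow> ('m, 'f, 'n, 'c) adapted \<Rightarrow> ('m, 'f) jet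
     \<Rightarrow> ('n, 'c, 'k::finite) momenta
     \<Rightarrow> (('m, 'f) jet, ('n, 'c, 'k) Qcoord) tangent \<Rightarrow> ('m, (real, 'n) vec) tangent list \<Rightarrow> real" where
  "momentum B a q p = (\<lambda>v ws.
     if v \<in> vertical_space B q \<and> length ws = CARD('n) - 1 \<and> set ws \<subseteq> tangent_space (base B) (fst q)
     then \<Sum>m<CARD('k). \<Sum>\<mu>s | length \<mu>s = m. \<Sum>\<kappa>\<in>UNIV. \<Sum>i\<in>UNIV.
            p $ low \<mu>s $ \<kappa> $ i * snd (v (Qchart B a)) $ low \<mu>s $ i
              * volume (axis \<kappa> 1 # map (\<lambda>w. w (fst a)) ws)
     else 0)"

definition phase_space ::
  "('m, 'f, 'n::{finite,linorder}, 'c::finite) fibre_bundle \<Rightarrow> ('m, 'f, 'n, 'c, 'k::finite) phase set" where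
  "phase_space B = {(q, momentum B a q p) | q a p.
     a \<in> adapted_charts B \<and> q \<in> dom_of (Qchart B a :: (('m, 'f) jet, ('n, 'c, 'k) Qcoord) chart)}"

definition Pchart ::
  "('m, 'f, 'n::{finite,linorder}, 'c::finite) fibre_bundle \<Rightarrow> ('m, 'f, 'n, 'c) adapted
     \<Rightarrow> (('m, 'f, 'n, 'c, 'k::finite) phase, ('n, 'c, 'k) Pcoord) chart" where
  "Pchart B a =
     ({P \<in> phase_space B. jet_value (fst P) \<in> dom_of (snd a)},
      \<lambda>P. (coords (fst a) (fst (fst P)), lower_coords a (fst P),
           THE p. snd P = momentum B a (fst P) p))"

definition Patlas ::
  "('m, 'f, 'n::{finite,linorder}, 'c::finite) fibre_bundle
     \<Rightarrow> (('m, 'f, 'n, 'c, 'k::finite) phase, ('n, 'c, 'k) Pcoord) chart set" where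
  "Patlas B = Pchart B ` adapted_charts B"

definition phase_section ::
  "('m, 'f, 'n::{finite,linorder}, 'c::finite) fibre_bundle
     \<Rightarrow> ('m \<Rightarrow> ('m, 'f, 'n, 'c, 'k::finite) phase) \<Rightarrow> bool" where
  "phase_section B \<sigma> \<longleftrightarrow> smooth_map (base B) (Patlas B) \<sigma> \<and>
     (\<forall>x\<in>carrier_of (base B). fst (fst (\<sigma> x)) = x)"

text \<open>The total symmetrisation \<open>p\<^sup>(\<^sup>\<mu>\<^sup>1\<^sup>\<dots>\<^sup>\<mu>\<^sup>m\<^sup>)\<close>, where the last index of \<open>p\<^sup>\<mu>\<^sup>1\<^sup>\<dots>\<^sup>\<mu>\<^sup>m\<close> is the
  distinguished one.\<close>

definition sym_mom ::
  "('n::finite, 'c::finite, 'k::finite) momenta \<Rightarrow> 'n list \<Rightarrow> real^'c" where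
  "sym_mom p \<mu>s = (1 / fact (length \<mu>s)) *\<^sub>R (\<Sum>\<pi> | \<pi> permutes {..<length \<mu>s}.
     let \<nu>s = permute_list \<pi> \<mu>s in p $ low (butlast \<nu>s) $ last \<nu>s)"

definition top_mom ::
  "('n::{finite,linorder}, 'c::finite, 'k::finite) momenta \<Rightarrow> ('n, 'c, 'k) tops" where
  "top_mom p = (\<chi> I. sym_mom p (sorted_list_of_multiset (Rep_top_index I)))"


section \<open>Lagrangian, Legendre transform and the form \<open>\<Omega>\<close>\<close>

text \<open>A Lagrangian density assigns to a \<open>k\<close>-jet over \<open>x\<close> an \<open>n\<close>-form on the tangent space of the base at
  \<open>x\<close>; \<open>L\<close> is its coefficient with respect to \<open>d\<^sup>nx\<close>, i.e. its value on \<open>\<partial>\<^sub>1, \<dots>, \<partial>\<^sub>n\<close>.\<close>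

type_synonym ('m, 'f, 'n) density = "('m, 'f) jet \<Rightarrow> ('m, real^'n) tangent list \<Rightarrow> real"

definition lagr ::
  "('m, 'f, 'n::{finite,linorder}, 'c::finite) fibre_bundle \<Rightarrow> ('m, 'f, 'n) density
     \<Rightarrow> ('m, 'f, 'n, 'c) adapted \<Rightarrow> ('n, 'c, 'k::finite) Jcoord \<Rightarrow> real" where
  "lagr B Lag a y = (let j = uncoords (Jchart B a) y in
     Lag j (map (\<lambda>\<mu>. coord_vector (base B) (fst j) (fst a) (axis \<mu> 1)) base_indices))"

definition lagrangian_density ::
  "'k::finite itself \<Rightarrow> ('m, 'f, 'n::{finite,linorder}, 'c::finite) fibre_bundle
     \<Rightarrow> ('m, 'f, 'n) density \<Rightarrow> bool" where
  "lagrangian_density k B Lag \<longleftrightarrow>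
     (\<forall>j\<in>jet_space B CARD('k). alternating_form (base B) (fst j) CARD('n) (Lag j)) \<and>
     (\<forall>a\<in>adapted_charts B.
        smooth_on (image_of (Jchart B a)) (lagr B Lag a :: ('n, 'c, 'k) Jcoord \<Rightarrow> real))"

text \<open>Partial derivatives with respect to symmetric quantities are the symmetric coefficients \<open>s\<close> in
  \<open>d\<psi> = \<dots> + \<Sum> s\<^sup>\<mu>\<^sup>1\<^sup>\<dots>\<^sup>\<mu>\<^sup>m d\<phi>\<^sub>\<mu>\<^sub>1\<^sub>\<dots>\<^sub>\<mu>\<^sub>m\<close>, the sum being over all index tuples. Each independent coordinate
  occurs in that sum once for every rearrangement of its indices, whence the division.\<close>

definition d_low ::
  "(('n::finite, 'c::finite, 'k::finite) Jcoord \<Rightarrow> real) \<Rightarrow> ('n, 'c, 'k) Jcoord \<Rightarrow> 'n list \<Rightarrow> real^'c" where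
  "d_low \<psi> y \<mu>s =
     (\<chi> i. frechet_derivative \<psi> (at y) (0, axis (low \<mu>s) (axis i 1), 0) / real (arrangements \<mu>s))"

definition d_top ::
  "(('n::finite, 'c::finite, 'k::finite) Jcoord \<Rightarrow> real) \<Rightarrow> ('n, 'c, 'k) Jcoord \<Rightarrow> 'n list \<Rightarrow> real^'c" where
  "d_top \<psi> y \<mu>s =
     (\<chi> i. frechet_derivative \<psi> (at y) (0, 0, axis (top_of \<mu>s) (axis i 1)) / real (arrangements \<mu>s))"

text \<open>The equations \<open>p\<^sup>(\<^sup>\<mu>\<^sup>1\<^sup>\<dots>\<^sup>\<mu>\<^sup>k\<^sup>) = \<partial>L/\<partial>\<phi>\<^sub>\<mu>\<^sub>1\<^sub>\<dots>\<^sub>\<mu>\<^sub>k\<close>; \<open>(x, \<phi>, P)\<close> are the base point, the lower jet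
  coordinates and the symmetrised top momenta, \<open>u\<close> the highest-order derivatives.\<close>

definition legendre_eqs ::
  "('m, 'f, 'n::{finite,linorder}, 'c::finite) fibre_bundle \<Rightarrow> ('m, 'f, 'n) density
     \<Rightarrow> ('m, 'f, 'n, 'c) adapted \<Rightarrow> ('n, 'c, 'k::finite) Jcoord \<Rightarrow> ('n, 'c, 'k) tops \<Rightarrow> bool" where
  "legendre_eqs B Lag a = (\<lambda>(x, \<phi>, P) u.
     \<forall>\<mu>s. length \<mu>s = CARD('k) \<longrightarrow> P $ top_of \<mu>s = d_top (lagr B Lag a) (x, \<phi>, u) \<mu>s)"

definition legendre_sol ::
  "('m, 'f, 'n::{finite,linorder}, 'c::finite) fibre_bundle \<Rightarrow> ('m, 'f, 'n) density
     \<Rightarrow> ('m, 'f, 'n, 'c) adapted \<Rightarrow> ('n, 'c, 'k::finite) Jcoord \<Rightarrow> ('n, 'c, 'k) tops" where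
  "legendre_sol B Lag a y = (THE u. legendre_eqs B Lag a y u)"

definition regular_lagrangian ::
  "'k::finite itself \<Rightarrow> ('m, 'f, 'n::{finite,linorder}, 'c::finite) fibre_bundle
     \<Rightarrow> ('m, 'f, 'n) density \<Rightarrow> bool" where
  "regular_lagrangian k B Lag \<longleftrightarrow> (\<forall>a\<in>adapted_charts B.
     let D = {(x, \<phi>, P). (x, \<phi>) \<in> image_of (Qchart B a)} :: ('n, 'c, 'k) Jcoord set in
       (\<forall>y\<in>D. \<exists>!u. legendre_eqs B Lag a y u) \<and> smooth_on D (legendre_sol B Lag a))"

definition legendre_h ::
  "('m, 'f, 'n::{finite,linorder}, 'c::finite) fibre_bundle \<Rightarrow> ('m, 'f, 'n) density
     \<Rightarrow> ('m, 'f, 'n, 'c) adapted \<Rightarrow> ('n, 'c, 'k::finite) Jcoord \<Rightarrow> real" where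
  "legendre_h B Lag a = (\<lambda>(x, \<phi>, P).
     let u = legendre_sol B Lag a (x, \<phi>, P) in
       (\<Sum>\<mu>s | length \<mu>s = CARD('k). \<Sum>i\<in>UNIV. P $ top_of \<mu>s $ i * u $ top_of \<mu>s $ i)
         - lagr B Lag a (x, \<phi>, u))"

definition jet_entry ::
  "('n::finite, 'c::finite, 'k::finite) fields \<Rightarrow> ('n, 'c, 'k) tops \<Rightarrow> 'n list \<Rightarrow> real^'c" where
  "jet_entry \<phi> u \<mu>s = (if length \<mu>s < CARD('k) then \<phi> $ low \<mu>s else u $ top_of \<mu>s)"

definition hamiltonian ::
  "('m, 'f, 'n::{finite,linorder}, 'c::finite) fibre_bundle \<Rightarrow> ('m, 'f, 'n) density
     \<Rightarrow> ('m, 'f, 'n, 'c) adapted \<Rightarrow> ('n, 'c, 'k::finite) Pcoord \<Rightarrow> real" where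
  "hamiltonian B Lag a = (\<lambda>(x, \<phi>, p).
     let u = legendre_sol B Lag a (x, \<phi>, top_mom p) in
       (\<Sum>m<CARD('k). \<Sum>\<mu>s | length \<mu>s = m. \<Sum>\<kappa>\<in>UNIV. \<Sum>i\<in>UNIV.
          p $ low \<mu>s $ \<kappa> $ i * jet_entry \<phi> u (\<mu>s @ [\<kappa>]) $ i)
         - lagr B Lag a (x, \<phi>, u))"

text \<open>The coordinate differentials and the coordinate expression of \<open>\<Omega>\<close> at the point with
  coordinates \<open>y\<close>, evaluated on coordinate vectors.\<close>

definition dx :: "'n \<Rightarrow> ('n::finite, 'c::finite, 'k::finite) Pcoord \<Rightarrow> real" where
  "dx \<mu> = (\<lambda>(x, \<phi>, p). x $ \<mu>)"

definition dphi :: "'n list \<Rightarrow> 'c \<Rightarrow> ('n::finite, 'c::finite, 'k::finite) Pcoord \<Rightarrow> real" where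
  "dphi \<mu>s i = (\<lambda>(x, \<phi>, p). \<phi> $ low \<mu>s $ i)"

definition dp :: "'n list \<Rightarrow> 'n \<Rightarrow> 'c \<Rightarrow> ('n::finite, 'c::finite, 'k::finite) Pcoord \<Rightarrow> real" where
  "dp \<mu>s \<kappa> i = (\<lambda>(x, \<phi>, p). p $ low \<mu>s $ \<kappa> $ i)"

definition Omega_coord ::
  "('m, 'f, 'n::{finite,linorder}, 'c::finite) fibre_bundle \<Rightarrow> ('m, 'f, 'n) density
     \<Rightarrow> ('m, 'f, 'n, 'c) adapted \<Rightarrow> ('n, 'c, 'k::finite) Pcoord \<Rightarrow> ('n, 'c, 'k) Pcoord list \<Rightarrow> real" where
  "Omega_coord B Lag a y vs =
     (\<Sum>m<CARD('k). \<Sum>\<mu>s | length \<mu>s = m. \<Sum>\<kappa>\<in>UNIV. \<Sum>i\<in>UNIV.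
        wedge (dp \<mu>s \<kappa> i # map (\<lambda>\<nu>. if \<nu> = \<kappa> then dphi \<mu>s i else dx \<nu>) base_indices) vs)
     - wedge (frechet_derivative (hamiltonian B Lag a) (at y) # map dx base_indices) vs"

definition represented_by_Omega ::
  "('m, 'f, 'n::{finite,linorder}, 'c::finite) fibre_bundle \<Rightarrow> ('m, 'f, 'n) density
     \<Rightarrow> (('m, 'f, 'n, 'c, 'k::finite) phase
           \<Rightarrow> (('m, 'f, 'n, 'c, 'k) phase, ('n, 'c, 'k) Pcoord) tangent list \<Rightarrow> real) \<Rightarrow> bool" where
  "represented_by_Omega B Lag \<Omega> \<longleftrightarrow>
     (\<forall>a\<in>adapted_charts B. \<forall>P\<in>dom_of (Pchart B a).
        \<forall>vs. length vs = Suc CARD('n) \<and> set vs \<subseteq> tangent_space (Patlas B) P \<longrightarrow>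
          \<Omega> P vs = Omega_coord B Lag a (coords (Pchart B a) P) (map (\<lambda>v. v (Pchart B a)) vs))"


section \<open>Holonomic sections and field equations\<close>

definition holonomic_with ::
  "('m, 'f, 'n::{finite,linorder}, 'c::finite) fibre_bundle
     \<Rightarrow> ('m \<Rightarrow> ('m, 'f, 'n, 'c, 'k::finite) phase) \<Rightarrow> ('m \<Rightarrow> 'f) \<Rightarrow> bool" where
  "holonomic_with B \<sigma> f \<longleftrightarrow> global_section B f \<and>
     (\<forall>x\<in>carrier_of (base B). fst (\<sigma> x) = jet B (CARD('k) - 1) f x)"

text \<open>The momentum coordinates of \<open>\<sigma>\<close> as functions of the base coordinates.\<close>

definition mom_rep ::
  "('m, 'f, 'n::{finite,linorder}, 'c::finite) fibre_bundle \<Rightarrow> ('m, 'f, 'n, 'c) adapted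
     \<Rightarrow> ('m \<Rightarrow> ('m, 'f, 'n, 'c, 'k::finite) phase) \<Rightarrow> (real, 'n) vec \<Rightarrow> ('n, 'c, 'k) momenta" where
  "mom_rep B a \<sigma> = (\<lambda>\<xi>. snd (snd (coords (Pchart B a) (\<sigma> (uncoords (fst a) \<xi>)))))"

definition divergence ::
  "((real, 'n) vec \<Rightarrow> ('n::finite, 'c::finite, 'k::finite) momenta) \<Rightarrow> (real, 'n) vec \<Rightarrow> 'n list \<Rightarrow> real^'c" where
  "divergence p \<xi> \<mu>s = (\<Sum>\<kappa>\<in>UNIV. pd [\<kappa>] (\<lambda>\<zeta>. p \<zeta> $ low \<mu>s $ \<kappa>) \<xi>)"

definition field_equations ::
  "('m, 'f, 'n::{finite,linorder}, 'c::finite) fibre_bundle \<Rightarrow> ('m, 'f, 'n) density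
     \<Rightarrow> ('m \<Rightarrow> ('m, 'f, 'n, 'c, 'k::finite) phase) \<Rightarrow> ('m \<Rightarrow> 'f) \<Rightarrow> bool" where
  "field_equations B Lag \<sigma> f \<longleftrightarrow>
     (\<forall>a\<in>adapted_charts B. \<forall>x\<in>carrier_of (base B). f x \<in> dom_of (snd a) \<longrightarrow>
        (let \<xi> = coords (fst a) x;
             \<phi> = fst (snd (coords (Pchart B a) (\<sigma> x)));
             p = mom_rep B a \<sigma>;
             h = legendre_h B Lag a;
             y = (\<xi>, \<phi>, top_mom (p \<xi>))
         in (\<forall>\<mu>s. length \<mu>s = CARD('k) \<longrightarrow> pd \<mu>s (field_rep a f) \<xi> = d_top h y \<mu>s) \<and>
            (\<forall>\<mu>s. 1 \<le> length \<mu>s \<and> length \<mu>s \<le> CARD('k) - 1 \<longrightarrow>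
               sym_mom (p \<xi>) \<mu>s = - d_low h y \<mu>s - divergence p \<xi> \<mu>s) \<and>
            0 = - d_low h y [] - divergence p \<xi> []))"

end

theory Submission
  imports Defs
begin

text \<open>The form \<open>\<Omega>\<close> is the exterior derivative of the Poincare--Cartan form \<open>\<theta>\<close>, which is the pairing of the
  momentum with the contact forms \<open>d\<phi>\<^sub>\<mu>\<^sub>1\<^sub>\<dots>\<^sub>\<mu>\<^sub>m - \<phi>\<^sub>\<mu>\<^sub>1\<^sub>\<dots>\<^sub>\<mu>\<^sub>m\<^sub>\<nu> dx\<^sup>\<nu>\<close> plus \<open>L d\<^sup>nx\<close>. Jet coordinate changes map
  holonomic directions to holonomic directions and top-order coordinates affinely; by the Legendre
  equations the top-order derivatives at which \<open>\<theta>\<close> is evaluated are therefore chart independent, so \<open>\<theta>\<close> and with it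
  \<open>\<Omega>\<close> are invariant.

  For a section \<open>\<sigma>\<close>, the form \<open>\<sigma>\<^sup>*(X \<lrcorner> \<Omega>)\<close> depends only on the part of \<open>X\<close> vertical relative to the image of
  \<open>d\<sigma>\<close>. Its momentum components give \<open>\<partial>\<^sub>\<kappa>\<phi>\<^sub>\<mu>\<^sub>1\<^sub>\<dots>\<^sub>\<mu>\<^sub>m = \<phi>\<^sub>\<mu>\<^sub>1\<^sub>\<dots>\<^sub>\<mu>\<^sub>m\<^sub>\<kappa>\<close>, with \<open>\<partial>h/\<partial>p\<close> in place of the top-order
  derivatives, i.e. holonomy and the first field equation; its field components give the others. Every
  vertical vector at a point occurs as a value of some \<open>X\<close> because of bump functions.\<close>

section \<open>Calculus of smooth functions\<close>

text \<open>The obstacle is that the top-order derivatives are not coordinates on the phase bundle,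
  while \<open>L\<close> and \<open>H\<close> depend on them. The Legendre solution is covariant
  because both sides of its equations acquire the same Jacobian determinant: \<open>L\<close> is the
  coefficient of an n-form, and pairing the symmetrised top momentum with an increment
  \<open>w\<close> is the trace of the endomorphism e \<mapsto> \<open>pr p (jent 0 w e)\<close> of
  the base coordinate space, which a coordinate change conjugates up to that determinant. Uniqueness
  of the solution does the rest. Invariance passes from \<theta> to \<Omega> by differentiating the
  identity for \<theta> along one argument and antisymmetrising; second derivatives of the
  transition map drop out by symmetry. Explicit formulas for jet transition maps are avoided: a
  coordinate tuple is replaced by a polynomial section with that jet, and statements are read off
  from the section. The vector fields are cut off only in the coordinates of \<Phi>, so the
  Hausdorff property of the total space is what extends them by zero.\<close>

lemma frechet_derivative_eqI:
  "(f has_derivative f') (at x) \<Longrightarrow> frechet_derivative f (at x) = f'"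
  using frechet_derivative_at by metis

lemma has_derivative_cong_open:
  assumes "open S" "x \<in> S" "\<And>y. y \<in> S \<Longrightarrow> f y = g y"
  shows "(f has_derivative D) (at x) \<longleftrightarrow> (g has_derivative D) (at x)"
  using assms has_derivative_transform_within_open by (metis (no_types, lifting))

lemma frechet_derivative_cong_open:
  assumes "open S" "x \<in> S" "\<And>y. y \<in> S \<Longrightarrow> f y = g y"
  shows "frechet_derivative f (at x) = frechet_derivative g (at x)"
  unfolding frechet_derivative_def using has_derivative_cong_open[OF assms] by simp

lemma differentiable_cong_open:
  assumes "open S" "x \<in> S" "\<And>y. y \<in> S \<Longrightarrow> f y = g y"
  shows "f differentiable (at x) \<longleftrightarrow> g differentiable (at x)"
  unfolding differentiable_def using has_derivative_cong_open[OF assms] by simp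

lemma Ck_on_subset: "Ck_on r S f \<Longrightarrow> T \<subseteq> S \<Longrightarrow> Ck_on r T f"
  by (induction r arbitrary: f) (auto intro: continuous_on_subset)

lemma Ck_on_cong:
  assumes "open S" "\<And>x. x \<in> S \<Longrightarrow> f x = g x"
  shows "Ck_on r S f \<longleftrightarrow> Ck_on r S g"
  using assms(2)
proof (induction r arbitrary: f g)
  case 0
  then show ?case by (simp cong: continuous_on_cong)
next
  case (Suc r)
  have "frechet_derivative f (at x) = frechet_derivative g (at x)" if "x \<in> S" for x
    using frechet_derivative_cong_open[OF assms(1) that Suc.prems] .
  then have "Ck_on r S (\<lambda>x. frechet_derivative f (at x) v) \<longleftrightarrow>
      Ck_on r S (\<lambda>x. frechet_derivative g (at x) v)" for v
    by (intro Suc.IH) simp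
  moreover have "(\<forall>x\<in>S. f differentiable (at x)) \<longleftrightarrow> (\<forall>x\<in>S. g differentiable (at x))"
    using differentiable_cong_open[OF assms(1), of _ f g] Suc.prems by blast
  ultimately show ?case by simp
qed

lemma Ck_on_SucD: "Ck_on (Suc r) S f \<Longrightarrow> Ck_on r S f"
proof (induction r arbitrary: f)
  case 0
  then show ?case
    by (auto intro!: continuous_at_imp_continuous_on differentiable_imp_continuous_within)
qed auto

text \<open>Derivatives are taken in the full space and not within \<open>S\<close>, so
  neighbourhoods may be used freely. This allows smoothness to be checked near each point, with
  different formulas at different points.\<close>

lemma Ck_on_local:
  assumes "\<And>x. x \<in> S \<Longrightarrow> \<exists>U. open U \<and> x \<in> U \<and> Ck_on r U f"
  shows "Ck_on r S f"
  using assms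
proof (induction r arbitrary: f)
  case 0
  then show ?case
    by (force intro!: continuous_at_imp_continuous_on simp: continuous_on_eq_continuous_at)
next
  case (Suc r)
  show ?case
    unfolding Ck_on.simps
  proof (intro conjI ballI allI)
    show "f differentiable (at x)" if "x \<in> S" for x using Suc.prems[OF that] by auto
    show "Ck_on r S (\<lambda>x. frechet_derivative f (at x) v)" for v
      using Suc.prems by (intro Suc.IH) fastforce
  qed
qed

lemma frechet_has_derivative:
  "f differentiable (at x) \<Longrightarrow> (f has_derivative frechet_derivative f (at x)) (at x)"
  by (simp add: frechet_derivative_works)

lemma Ck_on_const: "Ck_on r S (\<lambda>x. c)"
  by (induction r arbitrary: c) auto

lemma Ck_on_add:
  assumes "open S" "Ck_on r S f" "Ck_on r S g"
  shows "Ck_on r S (\<lambda>x. f x + g x)"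
  using assms(2,3)
proof (induction r arbitrary: f g)
  case 0
  then show ?case by (auto intro: continuous_intros)
next
  case (Suc r)
  have D: "((\<lambda>x. f x + g x) has_derivative
      (\<lambda>v. frechet_derivative f (at x) v + frechet_derivative g (at x) v)) (at x)" if "x \<in> S" for x
    using Suc.prems that by (auto intro!: has_derivative_add frechet_has_derivative)
  have "Ck_on r S (\<lambda>x. frechet_derivative (\<lambda>x. f x + g x) (at x) v)" for v
  proof (subst Ck_on_cong[OF assms(1)])
    show "frechet_derivative (\<lambda>x. f x + g x) (at x) v =
      frechet_derivative f (at x) v + frechet_derivative g (at x) v" if "x \<in> S" for x
      using frechet_derivative_eqI[OF D[OF that]] by simp
    show "Ck_on r S (\<lambda>x. frechet_derivative f (at x) v + frechet_derivative g (at x) v)"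
      using Suc by auto
  qed
  then show ?case using D by (auto simp: differentiable_def)
qed

lemma Ck_on_sum:
  assumes "open S" "\<And>i. i \<in> I \<Longrightarrow> Ck_on r S (f i)"
  shows "Ck_on r S (\<lambda>x. \<Sum>i\<in>I. f i x)"
  using assms(2) by (induction I rule: infinite_finite_induct) (auto intro: Ck_on_add Ck_on_const assms(1))

lemma Ck_on_bounded_linear:
  assumes "open S" "bounded_linear L" "Ck_on r S f"
  shows "Ck_on r S (\<lambda>x. L (f x))"
  using assms(3)
proof (induction r arbitrary: f)
  case 0
  then show ?case using bounded_linear.continuous_on[OF assms(2)] by auto
next
  case (Suc r)
  have D: "((\<lambda>x. L (f x)) has_derivative (\<lambda>v. L (frechet_derivative f (at x) v))) (at x)" if "x \<in> S" for x
    using Suc.prems that by (auto intro!: bounded_linear.has_derivative[OF assms(2)] frechet_has_derivative)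
  have "Ck_on r S (\<lambda>x. frechet_derivative (\<lambda>x. L (f x)) (at x) v)" for v
  proof (subst Ck_on_cong[OF assms(1)])
    show "frechet_derivative (\<lambda>x. L (f x)) (at x) v = L (frechet_derivative f (at x) v)" if "x \<in> S" for x
      using frechet_derivative_eqI[OF D[OF that]] by simp
    show "Ck_on r S (\<lambda>x. L (frechet_derivative f (at x) v))"
      using Suc by auto
  qed
  then show ?case using D by (auto simp: differentiable_def)
qed

text \<open>The product rule leaves one factor undifferentiated in each term; its order is lowered
  by \<open>Ck_on_SucD\<close>. Products, scalar multiples, inner products and later the momentum
  pairing \<open>pr\<close> are all instances.\<close>

lemma Ck_on_bounded_bilinear:
  assumes "open S" "bounded_bilinear B" "Ck_on r S f" "Ck_on r S g"
  shows "Ck_on r S (\<lambda>x. B (f x) (g x))"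
  using assms(3,4)
proof (induction r arbitrary: f g)
  case 0
  then show ?case using bounded_bilinear.continuous_on[OF assms(2)] by auto
next
  case (Suc r)
  have D: "((\<lambda>x. B (f x) (g x)) has_derivative (\<lambda>v. B (f x) (frechet_derivative g (at x) v) +
       B (frechet_derivative f (at x) v) (g x))) (at x)" if "x \<in> S" for x
    using Suc.prems that by (auto intro!: bounded_bilinear.FDERIV[OF assms(2)] frechet_has_derivative)
  have "Ck_on r S (\<lambda>x. frechet_derivative (\<lambda>x. B (f x) (g x)) (at x) v)" for v
  proof (subst Ck_on_cong[OF assms(1)])
    show "frechet_derivative (\<lambda>x. B (f x) (g x)) (at x) v = B (f x) (frechet_derivative g (at x) v) +
       B (frechet_derivative f (at x) v) (g x)" if "x \<in> S" for x
      using frechet_derivative_eqI[OF D[OF that]] by simp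
    show "Ck_on r S (\<lambda>x. B (f x) (frechet_derivative g (at x) v) +
       B (frechet_derivative f (at x) v) (g x))"
      using Suc by (intro Ck_on_add[OF assms(1)] Suc.IH) (auto intro: Ck_on_SucD)
  qed
  then show ?case using D by (auto simp: differentiable_def)
qed

lemma smooth_onD_open: "smooth_on S f \<Longrightarrow> open S"
  by (simp add: smooth_on_def)

lemma smooth_on_differentiable: "smooth_on S f \<Longrightarrow> x \<in> S \<Longrightarrow> f differentiable (at x)"
  unfolding smooth_on_def using Ck_on.simps(2) by blast

lemma smooth_on_has_derivative:
  "smooth_on S f \<Longrightarrow> x \<in> S \<Longrightarrow> (f has_derivative frechet_derivative f (at x)) (at x)"
  by (simp add: frechet_has_derivative smooth_on_differentiable)

lemma smooth_on_linear:
  "smooth_on S f \<Longrightarrow> x \<in> S \<Longrightarrow> linear (frechet_derivative f (at x))"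
  by (simp add: linear_frechet_derivative smooth_on_differentiable)

lemma smooth_on_continuous: "smooth_on S f \<Longrightarrow> continuous_on S f"
  unfolding smooth_on_def using Ck_on.simps(1) by blast

lemma smooth_on_frechet1: "smooth_on S f \<Longrightarrow> smooth_on S (\<lambda>x. frechet_derivative f (at x) v)"
  unfolding smooth_on_def using Ck_on.simps(2) by blast

lemma smooth_on_subset: "smooth_on S f \<Longrightarrow> open T \<Longrightarrow> T \<subseteq> S \<Longrightarrow> smooth_on T f"
  unfolding smooth_on_def using Ck_on_subset by blast

lemma smooth_on_cong:
  "smooth_on S f \<Longrightarrow> (\<And>x. x \<in> S \<Longrightarrow> f x = g x) \<Longrightarrow> smooth_on S g"
  unfolding smooth_on_def using Ck_on_cong by blast

lemma smooth_on_local: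
  assumes "\<And>x. x \<in> S \<Longrightarrow> \<exists>U. x \<in> U \<and> U \<subseteq> S \<and> smooth_on U f"
  shows "smooth_on S f"
proof -
  have "open S" using assms by (subst open_subopen) (metis smooth_onD_open)
  moreover have "Ck_on r S f" for r
    using assms by (intro Ck_on_local) (metis smooth_on_def)
  ultimately show ?thesis by (simp add: smooth_on_def)
qed

lemma smooth_on_const: "open S \<Longrightarrow> smooth_on S (\<lambda>x. c)"
  by (simp add: smooth_on_def Ck_on_const)

lemma smooth_on_bounded_linear: "bounded_linear L \<Longrightarrow> smooth_on S f \<Longrightarrow> smooth_on S (\<lambda>x. L (f x))"
  by (simp add: smooth_on_def Ck_on_bounded_linear)

lemma smooth_on_add: "smooth_on S f \<Longrightarrow> smooth_on S g \<Longrightarrow> smooth_on S (\<lambda>x. f x + g x)"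
  by (simp add: smooth_on_def Ck_on_add)

lemma smooth_on_sum:
  "open S \<Longrightarrow> (\<And>i. i \<in> I \<Longrightarrow> smooth_on S (f i)) \<Longrightarrow> smooth_on S (\<lambda>x. \<Sum>i\<in>I. f i x)"
  by (simp add: smooth_on_def Ck_on_sum)

lemma smooth_on_bounded_bilinear:
  "bounded_bilinear B \<Longrightarrow> smooth_on S f \<Longrightarrow> smooth_on S g \<Longrightarrow> smooth_on S (\<lambda>x. B (f x) (g x))"
  by (simp add: smooth_on_def Ck_on_bounded_bilinear)

lemmas smooth_on_scaleR = smooth_on_bounded_bilinear[OF bounded_bilinear_scaleR]
lemmas smooth_on_mult = smooth_on_bounded_bilinear[OF bounded_bilinear_mult]
lemmas smooth_on_inner = smooth_on_bounded_bilinear[OF bounded_bilinear_inner]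
lemmas smooth_on_uminus = smooth_on_bounded_linear[OF bounded_linear_minus[OF bounded_linear_ident]]
lemmas smooth_on_fst = smooth_on_bounded_linear[OF bounded_linear_fst]
lemmas smooth_on_snd = smooth_on_bounded_linear[OF bounded_linear_snd]
lemmas smooth_on_nth = smooth_on_bounded_linear[OF bounded_linear_vec_nth]

lemma smooth_on_diff: "smooth_on S f \<Longrightarrow> smooth_on S g \<Longrightarrow> smooth_on S (\<lambda>x. f x - g x)"
  using smooth_on_add[OF _ smooth_on_uminus, of S f g] by simp

lemma smooth_on_ident: "open S \<Longrightarrow> smooth_on S (\<lambda>x. x)"
proof -
  assume "open S"
  moreover have "Ck_on r S (\<lambda>x. x)" for r
    by (cases r) (auto intro: Ck_on_const)
  ultimately show ?thesis by (simp add: smooth_on_def)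
qed

lemma smooth_on_linear_map:
  fixes L :: "'a::euclidean_space \<Rightarrow> 'b::real_normed_vector"
  shows "linear L \<Longrightarrow> open S \<Longrightarrow> smooth_on S L"
  using smooth_on_bounded_linear[OF _ smooth_on_ident] linear_conv_bounded_linear by blast

lemma smooth_on_Pair:
  assumes "smooth_on S f" "smooth_on S g"
  shows "smooth_on S (\<lambda>x. (f x, g x))"
proof -
  have "smooth_on S (\<lambda>x. (f x, 0) + (0, g x))"
    using assms
    by (intro smooth_on_add smooth_on_bounded_linear[of "\<lambda>x. (x, 0)"] smooth_on_bounded_linear[of "\<lambda>x. (0, x)"]
        bounded_linear_Pair bounded_linear_ident bounded_linear_zero)
  then show ?thesis by simp
qed

lemma bounded_linear_axis: "bounded_linear (axis i :: 'a::euclidean_space \<Rightarrow> 'a^'n)"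
  by (auto simp: linear_conv_bounded_linear[symmetric] vec_eq_iff axis_def intro!: linearI)

lemma vec_eq_sum_axis: "v = (\<Sum>i\<in>UNIV. axis i (v $ i))"
  for v :: "'a::comm_monoid_add^'n"
  by (simp add: vec_eq_iff axis_def)

lemma smooth_on_vec:
  fixes f :: "'a::euclidean_space \<Rightarrow> 'b::euclidean_space^'n"
  assumes "open S" "\<And>i. smooth_on S (\<lambda>x. f x $ i)"
  shows "smooth_on S f"
proof -
  have "smooth_on S (\<lambda>x. \<Sum>i\<in>UNIV. axis i (f x $ i))"
    by (intro smooth_on_sum smooth_on_bounded_linear[OF bounded_linear_axis] assms)
  then show ?thesis by (rule smooth_on_cong) (rule vec_eq_sum_axis[symmetric])
qed

text \<open>\<open>Ck_on\<close> controls the derivative only in a fixed direction, but the chain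
  rule produces directions that vary with the point. Expanding them in \<open>Basis\<close> returns
  to fixed directions with smooth coefficients.\<close>

lemma frechet_derivative_basis_sum:
  assumes "f differentiable (at x)"
  shows "frechet_derivative f (at x) v = (\<Sum>b\<in>Basis. (v \<bullet> b) *\<^sub>R frechet_derivative f (at x) b)"
proof -
  have "linear (frechet_derivative f (at x))" using assms by (rule linear_frechet_derivative)
  then have "frechet_derivative f (at x) (\<Sum>b\<in>Basis. (v \<bullet> b) *\<^sub>R b) =
      (\<Sum>b\<in>Basis. (v \<bullet> b) *\<^sub>R frechet_derivative f (at x) b)"
    by (simp add: linear_sum linear_scale)
  then show ?thesis by (simp add: euclidean_representation)
qed

lemma frechet_derivative_comp:
  assumes "f differentiable (at x)" "g differentiable (at (f x))"
  shows "frechet_derivative (\<lambda>x. g (f x)) (at x) v =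
    frechet_derivative g (at (f x)) (frechet_derivative f (at x) v)"
  using frechet_derivative_compose[OF assms] by (simp add: o_def)

text \<open>Only the outer function is generalised: the derivative of the composite is a sum of
  smooth coefficients coming from \<open>f\<close> times composites of \<open>f\<close> with
  derivatives of \<open>g\<close> in basis directions, and the latter are again smooth on
  \<open>T\<close>.\<close>

lemma Ck_on_compose:
  assumes "smooth_on S f" "smooth_on T g" "f ` S \<subseteq> T"
  shows "Ck_on r S (\<lambda>x. g (f x))"
  using assms(2)
proof (induction r arbitrary: g)
  case 0
  have "continuous_on S (\<lambda>x. g (f x))"
    using continuous_on_compose2[OF smooth_on_continuous[OF 0] smooth_on_continuous[OF assms(1)] assms(3)] .
  then show ?case by simp
next
  case (Suc r)
  have op: "open S" using assms(1) by (rule smooth_onD_open)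
  have D: "(\<lambda>x. g (f x)) differentiable (at x)"
    "frechet_derivative (\<lambda>x. g (f x)) (at x) v =
     (\<Sum>b\<in>Basis. (frechet_derivative f (at x) v \<bullet> b) *\<^sub>R frechet_derivative g (at (f x)) b)"
    if "x \<in> S" for x v
  proof -
    have f: "f differentiable (at x)" using assms(1) that by (rule smooth_on_differentiable)
    have g: "g differentiable (at (f x))"
      using Suc.prems that assms(3) by (intro smooth_on_differentiable[of T]) auto
    show "(\<lambda>x. g (f x)) differentiable (at x)"
      using differentiable_chain_at[OF f g] by (simp add: o_def)
    show "frechet_derivative (\<lambda>x. g (f x)) (at x) v =
     (\<Sum>b\<in>Basis. (frechet_derivative f (at x) v \<bullet> b) *\<^sub>R frechet_derivative g (at (f x)) b)"
      unfolding frechet_derivative_comp[OF f g] by (rule frechet_derivative_basis_sum[OF g])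
  qed
  have "Ck_on r S (\<lambda>x. frechet_derivative (\<lambda>x. g (f x)) (at x) v)" for v
  proof (subst Ck_on_cong[OF op D(2)])
    have "Ck_on r S (\<lambda>x. frechet_derivative f (at x) v)" 
      using smooth_on_frechet1[OF assms(1)] by (simp add: smooth_on_def)
    then show "Ck_on r S (\<lambda>x. \<Sum>b\<in>Basis. (frechet_derivative f (at x) v \<bullet> b) *\<^sub>R frechet_derivative g (at (f x)) b)"
      by (intro Ck_on_sum op Ck_on_bounded_bilinear[OF op bounded_bilinear_scaleR]
          Ck_on_bounded_bilinear[OF op bounded_bilinear_inner] Ck_on_const Suc.IH
          smooth_on_frechet1[OF Suc.prems]) auto
  qed auto
  then show ?case using D(1) by simp
qed

lemma smooth_on_compose:
  "smooth_on T g \<Longrightarrow> smooth_on S f \<Longrightarrow> f ` S \<subseteq> T \<Longrightarrow> smooth_on S (\<lambda>x. g (f x))"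
  using Ck_on_compose smooth_onD_open unfolding smooth_on_def[of S "\<lambda>x. g (f x)"] by blast

lemma smooth_on_prod:
  fixes f :: "'i \<Rightarrow> 'a::euclidean_space \<Rightarrow> real"
  shows "open S \<Longrightarrow> (\<And>i. i \<in> I \<Longrightarrow> smooth_on S (f i)) \<Longrightarrow> smooth_on S (\<lambda>x. \<Prod>i\<in>I. f i x)"
  by (induction I rule: infinite_finite_induct) (auto intro: smooth_on_mult smooth_on_const)

text \<open>The derivative is a polynomial in \<open>inverse\<close> itself, so the order can be
  raised by one each time.\<close>

lemma Ck_on_inverse: "Ck_on r (- {0}) (inverse :: real \<Rightarrow> real)"
proof (induction r)
  case 0
  then show ?case by (auto intro!: continuous_intros)
next
  case (Suc r)
  have D: "(inverse has_derivative (\<lambda>v. - (inverse x * v * inverse x))) (at x)" if "x \<noteq> 0" for x :: real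
    using has_derivative_inverse'[OF that] by simp
  have "Ck_on r (- {0}) (\<lambda>x::real. frechet_derivative inverse (at x) v)" for v
  proof (subst Ck_on_cong)
    show "frechet_derivative inverse (at x) v = - (inverse x * v * inverse x)" if "x \<in> - {0}" for x :: real
      using that frechet_derivative_eqI[OF D] by auto
    show "Ck_on r (- {0}) (\<lambda>x::real. - (inverse x * v * inverse x))"
      by (intro Ck_on_bounded_linear[OF _ bounded_linear_minus[OF bounded_linear_ident]]
          Ck_on_bounded_bilinear[OF _ bounded_bilinear_mult] Ck_on_const Suc) auto
  qed auto
  then show ?case using D by (auto simp: differentiable_def)
qed

lemma smooth_on_inverse:
  fixes f :: "'a::euclidean_space \<Rightarrow> real"
  assumes "smooth_on S f" "\<And>x. x \<in> S \<Longrightarrow> f x \<noteq> 0"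
  shows "smooth_on S (\<lambda>x. inverse (f x))"
  by (rule smooth_on_compose[OF _ assms(1), of "- {0}"])
     (use assms(2) in \<open>auto simp: smooth_on_def Ck_on_inverse\<close>)

lemma smooth_on_open_vimage:
  assumes "smooth_on S f" "open V"
  shows "open {x \<in> S. f x \<in> V}"
  using continuous_open_preimage[OF smooth_on_continuous[OF assms(1)] smooth_onD_open[OF assms(1)] assms(2)]
  by (simp add: vimage_def Int_def conj_commute)

subsection \<open>Symmetry of second derivatives\<close>

text \<open>The mean value theorem is applied twice to the second difference over a parallelogram:
  in direction \<open>v\<close> to the increment of \<open>f\<close> under the shift by
  \<open>t *\<^sub>R w\<close>, and then in direction \<open>w\<close> to the derivative so
  obtained.\<close>

lemma second_difference_mvt:
  fixes f :: "'a::euclidean_space \<Rightarrow> real"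
  assumes f: "smooth_on S f" and t: "t > 0"
    and sub: "\<And>s r. \<bar>s\<bar> \<le> t \<Longrightarrow> \<bar>r\<bar> \<le> t \<Longrightarrow> x + s *\<^sub>R v + r *\<^sub>R w \<in> S"
  shows "\<exists>s r. 0 < s \<and> s < t \<and> 0 < r \<and> r < t \<and>
    f (x + t *\<^sub>R v + t *\<^sub>R w) - f (x + t *\<^sub>R v) - f (x + t *\<^sub>R w) + f x =
    t * t * frechet_derivative (\<lambda>x. frechet_derivative f (at x) v) (at (x + s *\<^sub>R v + r *\<^sub>R w)) w"
proof -
  have line: "((\<lambda>s. g (z + s *\<^sub>R e)) has_real_derivative frechet_derivative g (at (z + s *\<^sub>R e)) e) (at s)"
    if "smooth_on S g" "z + s *\<^sub>R e \<in> S" for g :: "'a \<Rightarrow> real" and z e s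
  proof -
    have "((\<lambda>s. z + s *\<^sub>R e) has_derivative (\<lambda>h. h *\<^sub>R e)) (at s)"
      by (auto intro!: derivative_eq_intros)
    from has_derivative_compose[OF this smooth_on_has_derivative[OF that]]
    show ?thesis
      using linear_scale[OF smooth_on_linear[OF that]]
      by (simp add: has_field_derivative_def mult_commute_abs)
  qed
  define h where "h s = f ((x + t *\<^sub>R w) + s *\<^sub>R v) - f (x + s *\<^sub>R v)" for s
  define g where "g = (\<lambda>x. frechet_derivative f (at x) v)"
  have g: "smooth_on S g" unfolding g_def by (rule smooth_on_frechet1[OF f])
  have h: "(h has_real_derivative g ((x + t *\<^sub>R w) + s *\<^sub>R v) - g (x + s *\<^sub>R v)) (at s)" if "0 \<le> s" "s \<le> t" for s
  proof -
    have "x + s *\<^sub>R v + t *\<^sub>R w \<in> S" "x + s *\<^sub>R v \<in> S" using sub[of s t] sub[of s 0] that t by simp_all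
    then have "(x + t *\<^sub>R w) + s *\<^sub>R v \<in> S" "x + s *\<^sub>R v \<in> S" by (simp_all add: add.assoc add.commute add.left_commute)
    from line[OF f this(1)] line[OF f this(2)] show ?thesis
      unfolding h_def[abs_def] g_def by (rule DERIV_diff)
  qed
  obtain s where s: "0 < s" "s < t" "h t - h 0 = (t - 0) * (g ((x + t *\<^sub>R w) + s *\<^sub>R v) - g (x + s *\<^sub>R v))"
    using MVT2[OF t h] by blast
  have "x + s *\<^sub>R v + r *\<^sub>R w \<in> S" if "0 \<le> r" "r \<le> t" for r using sub[of s r] that s by simp
  then obtain r where r: "0 < r" "r < t"
    "g ((x + s *\<^sub>R v) + t *\<^sub>R w) - g ((x + s *\<^sub>R v) + 0 *\<^sub>R w) = (t - 0) * frechet_derivative g (at ((x + s *\<^sub>R v) + r *\<^sub>R w)) w"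
    using MVT2[OF t, of "\<lambda>r. g ((x + s *\<^sub>R v) + r *\<^sub>R w)", OF line[OF g]] by blast
  have "f (x + t *\<^sub>R v + t *\<^sub>R w) - f (x + t *\<^sub>R v) - f (x + t *\<^sub>R w) + f x = h t - h 0"
    by (simp add: h_def add.commute add.left_commute)
  also have "\<dots> = t * (g ((x + s *\<^sub>R v) + t *\<^sub>R w) - g (x + s *\<^sub>R v))"
    unfolding s(3) by (simp add: add.commute add.left_commute)
  also have "\<dots> = t * t * frechet_derivative g (at ((x + s *\<^sub>R v) + r *\<^sub>R w)) w"
    using r(3) by simp
  finally show ?thesis using s r unfolding g_def by blast
qed

text \<open>The second difference does not depend on the order of \<open>v\<close> and
  \<open>w\<close>, so a value of one mixed derivative near \<open>x\<close> equals a value of the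
  other. By continuity both are within \<open>e\<close>, half the supposed gap, of their values at
  \<open>x\<close>.\<close>

lemma second_derivative_symmetric_real:
  fixes f :: "'a::euclidean_space \<Rightarrow> real"
  assumes f: "smooth_on S f" and x: "x \<in> S"
  shows "frechet_derivative (\<lambda>x. frechet_derivative f (at x) v) (at x) w =
    frechet_derivative (\<lambda>x. frechet_derivative f (at x) w) (at x) v" (is "?G v w x = ?G w v x")
proof (rule ccontr)
  assume ne: "?G v w x \<noteq> ?G w v x"
  define e where "e = \<bar>?G v w x - ?G w v x\<bar> / 2"
  have e: "e > 0" using ne by (simp add: e_def)
  have op: "open S" using f by (rule smooth_onD_open)
  have cont: "isCont (?G v w) x" for v w
    using smooth_on_continuous[OF smooth_on_frechet1[OF smooth_on_frechet1[OF f]]] op x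
    by (simp add: continuous_on_eq_continuous_at)
  obtain d1 where d1: "d1 > 0" "\<And>y. dist y x < d1 \<Longrightarrow> \<bar>?G v w y - ?G v w x\<bar> < e"
    using cont[of v w] e unfolding continuous_at_eps_delta by (auto simp: dist_real_def)
  obtain d2 where d2: "d2 > 0" "\<And>y. dist y x < d2 \<Longrightarrow> \<bar>?G w v y - ?G w v x\<bar> < e"
    using cont[of w v] e unfolding continuous_at_eps_delta by (auto simp: dist_real_def)
  obtain d3 where d3: "d3 > 0" "ball x d3 \<subseteq> S" using op x openE by blast
  define d where "d = Min {d1, d2, d3}"
  \<comment> \<open>Small enough that the whole parallelogram stays within distance \<open>d\<close>
    of \<open>x\<close>; the summand 1 covers the case of zero directions.\<close>
  define t where "t = d / (2 * (norm v + norm w + 1))"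
  have d: "d > 0" "d \<le> d1" "d \<le> d2" "d \<le> d3" using d1 d2 d3 by (auto simp: d_def)
  have N: "norm v + norm w + 1 > 0" by (smt (verit) norm_ge_zero)
  have t: "t > 0" unfolding t_def using d N by simp
  have near: "dist (x + s *\<^sub>R v + r *\<^sub>R w) x < d" if "\<bar>s\<bar> \<le> t" "\<bar>r\<bar> \<le> t" for s r
  proof -
    have "dist (x + s *\<^sub>R v + r *\<^sub>R w) x = norm (s *\<^sub>R v + r *\<^sub>R w)" by (simp add: dist_norm)
    also have "\<dots> \<le> \<bar>s\<bar> * norm v + \<bar>r\<bar> * norm w" by (metis norm_scaleR norm_triangle_ineq)
    also have "\<dots> \<le> t * norm v + t * norm w" using that by (intro add_mono mult_right_mono) auto
    also have "\<dots> \<le> t * (norm v + norm w + 1)" using t by (simp add: algebra_simps)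
    also have "\<dots> = d / 2" unfolding t_def using N by (simp add: field_simps)
    also have "\<dots> < d" using d by simp
    finally show ?thesis .
  qed
  have near': "dist (x + r *\<^sub>R w + s *\<^sub>R v) x < d" if "\<bar>s\<bar> \<le> t" "\<bar>r\<bar> \<le> t" for s r
    using near[OF that] by (simp add: algebra_simps)
  have inS: "y \<in> S" if "dist y x < d" for y
    using that d d3 by (auto simp: dist_commute)
  obtain s r where 1: "0 < s" "s < t" "0 < r" "r < t"
    "f (x + t *\<^sub>R v + t *\<^sub>R w) - f (x + t *\<^sub>R v) - f (x + t *\<^sub>R w) + f x = t * t * ?G v w (x + s *\<^sub>R v + r *\<^sub>R w)"
    using second_difference_mvt[OF f t inS[OF near]] by blast
  obtain s' r' where 2: "0 < s'" "s' < t" "0 < r'" "r' < t"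
    "f (x + t *\<^sub>R w + t *\<^sub>R v) - f (x + t *\<^sub>R w) - f (x + t *\<^sub>R v) + f x = t * t * ?G w v (x + s' *\<^sub>R w + r' *\<^sub>R v)"
    using second_difference_mvt[OF f t inS[OF near']] by blast
  have comm: "x + t *\<^sub>R w + t *\<^sub>R v = x + t *\<^sub>R v + t *\<^sub>R w" by simp
  have "t * t * ?G v w (x + s *\<^sub>R v + r *\<^sub>R w) = t * t * ?G w v (x + s' *\<^sub>R w + r' *\<^sub>R v)"
    using 1(5) 2(5) unfolding comm by linarith
  then have "?G v w (x + s *\<^sub>R v + r *\<^sub>R w) = ?G w v (x + s' *\<^sub>R w + r' *\<^sub>R v)" using t by simp
  moreover have "\<bar>?G v w (x + s *\<^sub>R v + r *\<^sub>R w) - ?G v w x\<bar> < e"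
    using 1 near[of s r] d by (intro d1) auto
  moreover have "\<bar>?G w v (x + s' *\<^sub>R w + r' *\<^sub>R v) - ?G w v x\<bar> < e"
    using 2 near'[of r' s'] d by (intro d2) auto
  ultimately show False unfolding e_def by (simp add: abs_if split: if_splits)
qed

lemma second_derivative_symmetric:
  fixes f :: "'a::euclidean_space \<Rightarrow> 'b::euclidean_space"
  assumes f: "smooth_on S f" and x: "x \<in> S"
  shows "frechet_derivative (\<lambda>x. frechet_derivative f (at x) v) (at x) w =
    frechet_derivative (\<lambda>x. frechet_derivative f (at x) w) (at x) v"
proof (rule euclidean_eqI)
  fix b :: 'b assume "b \<in> Basis"
  have fb: "smooth_on S (\<lambda>x. f x \<bullet> b)"
    by (intro smooth_on_inner f smooth_on_const smooth_onD_open[OF f])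
  have inner: "frechet_derivative (\<lambda>x. g x \<bullet> b) (at y) u = frechet_derivative g (at y) u \<bullet> b"
    if "smooth_on S g" "y \<in> S" for g :: "'a \<Rightarrow> 'b" and y u
    using frechet_derivative_eqI[OF has_derivative_inner_left[OF smooth_on_has_derivative[OF that], of b]]
    by simp
  have "frechet_derivative (\<lambda>x. frechet_derivative (\<lambda>x. f x \<bullet> b) (at x) v) (at x) w =
     frechet_derivative (\<lambda>x. frechet_derivative f (at x) v) (at x) w \<bullet> b" for v w
    using frechet_derivative_cong_open[OF smooth_onD_open[OF f] x, of "\<lambda>x. frechet_derivative (\<lambda>x. f x \<bullet> b) (at x) v"
       "\<lambda>x. frechet_derivative f (at x) v \<bullet> b"] inner[OF f] inner[OF smooth_on_frechet1[OF f] x]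
    by simp
  then show "frechet_derivative (\<lambda>x. frechet_derivative f (at x) v) (at x) w \<bullet> b =
    frechet_derivative (\<lambda>x. frechet_derivative f (at x) w) (at x) v \<bullet> b"
    using second_derivative_symmetric_real[OF fb x, of v w] by simp
qed

subsection \<open>Bump functions\<close>

text \<open>The powers of \<open>inverse x\<close> make the family closed under differentiation up
  to linear combinations, so smoothness is proved for all \<open>m\<close> at once. The bump
  function is built from \<open>m = 0\<close>.\<close>

definition flat_exp :: "nat \<Rightarrow> real \<Rightarrow> real" where
  "flat_exp m x = (if x > 0 then inverse x ^ m * exp (- inverse x) else 0)"

lemma flat_exp_tendsto_0: "((\<lambda>h. flat_exp m h) \<longlongrightarrow> 0) (at 0)"
proof -
  have "((\<lambda>y::real. y ^ m / exp y) \<longlongrightarrow> 0) at_top" by (rule tendsto_power_div_exp_0)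
  then have "((\<lambda>h::real. inverse h ^ m / exp (inverse h)) \<longlongrightarrow> 0) (at_right 0)"
    using filterlim_compose filterlim_inverse_at_top_right by blast
  then have "((\<lambda>h. flat_exp m h) \<longlongrightarrow> 0) (at_right 0)"
    by (rule tendsto_cong[THEN iffD1, rotated])
       (auto simp: flat_exp_def eventually_at_filter exp_minus divide_inverse)
  moreover have "((\<lambda>h. flat_exp m h) \<longlongrightarrow> 0) (at_left 0)"
    by (rule tendsto_cong[THEN iffD1, of "\<lambda>_. 0"]) (auto simp: flat_exp_def eventually_at_filter)
  ultimately show ?thesis by (simp add: filterlim_split_at_real filterlim_split_at)
qed

text \<open>At 0 the difference quotient of \<open>flat_exp m\<close> is
  \<open>flat_exp (Suc m)\<close>, which tends to 0; this is how the family closes up across the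
  gluing point.\<close>

lemma flat_exp_deriv:
  "(flat_exp m has_real_derivative flat_exp (m + 2) x - real m * flat_exp (Suc m) x) (at x)"
proof (cases "x = 0")
  case True
  have "((\<lambda>h. flat_exp m h / h) \<longlongrightarrow> 0) (at 0)"
  proof (rule tendsto_cong[THEN iffD1, OF _ flat_exp_tendsto_0])
    show "\<forall>\<^sub>F h in at 0. flat_exp (Suc m) h = flat_exp m h / h"
      by (auto simp: flat_exp_def eventually_at_filter divide_inverse)
  qed
  then show ?thesis using True by (simp add: DERIV_def flat_exp_def)
next
  case False
  show ?thesis
  proof (cases "x > 0")
    case True
    have "((\<lambda>x. inverse x ^ m * exp (- inverse x)) has_real_derivative
       flat_exp (m + 2) x - real m * flat_exp (Suc m) x) (at x)"
      using True
      by (auto intro!: derivative_eq_intros simp: flat_exp_def power2_eq_square algebra_simps)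
         (cases m; simp add: power2_eq_square)
    then show ?thesis
      by (rule has_field_derivative_transform_within_open[of _ _ _ "{0<..}"])
         (use True in \<open>auto simp: flat_exp_def\<close>)
  next
    case neg: False
    have "((\<lambda>x. 0) has_real_derivative 0) (at x)" by simp
    then have "(flat_exp m has_real_derivative 0) (at x)"
      by (rule has_field_derivative_transform_within_open[of _ _ _ "{..<0}"])
         (use neg False in \<open>auto simp: flat_exp_def\<close>)
    then show ?thesis using neg by (simp add: flat_exp_def)
  qed
qed

lemma smooth_on_flat_exp: "smooth_on UNIV (flat_exp m)"
proof -
  have "Ck_on r UNIV (flat_exp m)" for r
  proof (induction r arbitrary: m)
    case 0
    have "isCont (flat_exp m) x" for x using flat_exp_deriv DERIV_isCont by blast
    then show ?case by (simp add: continuous_at_imp_continuous_on)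
  next
    case (Suc r)
    have D: "(flat_exp m has_derivative (\<lambda>v. (flat_exp (m + 2) x + (- real m) * flat_exp (Suc m) x) * v)) (at x)" for x
      using flat_exp_deriv[of m x] by (simp add: has_field_derivative_def)
    have "Ck_on r UNIV (\<lambda>x. frechet_derivative (flat_exp m) (at x) v)" for v
      unfolding frechet_derivative_eqI[OF D]
      by (intro Ck_on_bounded_bilinear[OF _ bounded_bilinear_mult] Ck_on_add Ck_on_const Suc) auto
    then show ?case using D by (auto simp: differentiable_def)
  qed
  then show ?thesis by (simp add: smooth_on_def)
qed

lemma bump_function:
  fixes y0 :: "'a::euclidean_space"
  assumes "r > 0"
  shows "\<exists>\<beta>. smooth_on UNIV \<beta> \<and> \<beta> y0 = (1::real) \<and> (\<forall>y. y \<notin> cball y0 r \<longrightarrow> \<beta> y = 0)"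
proof -
  define \<beta> where "\<beta> y = inverse (flat_exp 0 (r\<^sup>2)) * flat_exp 0 (r\<^sup>2 - (y - y0) \<bullet> (y - y0))" for y
  have "smooth_on UNIV \<beta>" unfolding \<beta>_def[abs_def]
    by (intro smooth_on_mult smooth_on_const smooth_on_compose[OF smooth_on_flat_exp] smooth_on_diff
        smooth_on_inner smooth_on_ident) auto
  moreover have "\<beta> y0 = 1" using assms by (simp add: \<beta>_def flat_exp_def)
  moreover have "\<beta> y = 0" if "y \<notin> cball y0 r" for y
  proof -
    have "r < norm (y - y0)" using that by (simp add: dist_norm norm_minus_commute)
    then have "r\<^sup>2 \<le> (norm (y - y0))\<^sup>2" using assms by (intro power_mono) auto
    then show ?thesis by (simp add: \<beta>_def flat_exp_def power2_norm_eq_inner)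
  qed
  ultimately show ?thesis by blast
qed

section \<open>Iterated partial derivatives\<close>

lemma smooth_on_pd: "smooth_on S g \<Longrightarrow> smooth_on S (pd \<mu>s g)"
  by (induction \<mu>s) (auto intro: smooth_on_frechet1)

lemma pd_cong_open:
  assumes "open S" "\<And>y. y \<in> S \<Longrightarrow> g y = h y" "x \<in> S"
  shows "pd \<mu>s g x = pd \<mu>s h x"
  using assms(3)
proof (induction \<mu>s arbitrary: x)
  case (Cons \<mu> \<mu>s)
  then show ?case using frechet_derivative_cong_open[OF assms(1) Cons.prems, of "pd \<mu>s g" "pd \<mu>s h"] by simp
qed (simp add: assms(2))

lemma pd_append: "pd (xs @ ys) g = pd xs (pd ys g)"
  by (induction xs) auto

lemma pd_swap:
  fixes g :: "real^'n \<Rightarrow> 'b::euclidean_space"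
  assumes "smooth_on S g" "x \<in> S"
  shows "pd (a # b # xs) g x = pd (b # a # xs) g x"
  using second_derivative_symmetric[OF smooth_on_pd[OF assms(1)] assms(2)] by simp

lemma pd_move:
  fixes g :: "real^'n \<Rightarrow> 'b::euclidean_space"
  assumes "smooth_on S g" "x \<in> S"
  shows "pd (ys @ a # zs) g x = pd (a # ys @ zs) g x"
  using assms(2)
proof (induction ys arbitrary: x)
  case (Cons y ys)
  have "pd ((y # ys) @ a # zs) g x = pd (y # a # ys @ zs) g x"
    using frechet_derivative_cong_open[OF smooth_onD_open[OF assms(1)] Cons.prems Cons.IH] by simp
  also have "\<dots> = pd (a # y # ys @ zs) g x"
    by (rule pd_swap[OF assms(1) Cons.prems])
  finally show ?case by simp
qed simp

text \<open>The head of the first list is located in the second and moved to the front. The tails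
  are compared on all of \<open>S\<close>, since an equality at one point could not be
  differentiated.\<close>

lemma pd_perm:
  fixes g :: "real^'n \<Rightarrow> 'b::euclidean_space"
  assumes "smooth_on S g" "x \<in> S" "mset \<mu>s = mset \<nu>s"
  shows "pd \<mu>s g x = pd \<nu>s g x"
  using assms(2,3)
proof (induction \<mu>s arbitrary: x \<nu>s)
  case (Cons a \<mu>s)
  have "a \<in> set \<nu>s" using Cons.prems(2) by (metis list.set_intros(1) mset_eq_setD)
  then obtain ys zs where \<nu>s: "\<nu>s = ys @ a # zs" using split_list by metis
  then have "mset \<mu>s = mset (ys @ zs)" using Cons.prems(2) by simp
  then have "pd (a # \<mu>s) g x = pd (a # ys @ zs) g x"
    using frechet_derivative_cong_open[OF smooth_onD_open[OF assms(1)] Cons.prems(1), of "pd \<mu>s g" "pd (ys @ zs) g"] Cons.IH by simp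
  then show ?case using pd_move[OF assms(1) Cons.prems(1)] \<nu>s by simp
qed simp

lemma frechet_derivative_sum_axis:
  fixes f :: "real^'n \<Rightarrow> 'b::real_normed_vector"
  assumes "f differentiable (at x)"
  shows "frechet_derivative f (at x) v = (\<Sum>\<nu>\<in>UNIV. v $ \<nu> *\<^sub>R frechet_derivative f (at x) (axis \<nu> 1))"
proof -
  have "linear (frechet_derivative f (at x))" using assms by (rule linear_frechet_derivative)
  then have "frechet_derivative f (at x) (\<Sum>\<nu>\<in>UNIV. v $ \<nu> *\<^sub>R axis \<nu> 1) =
      (\<Sum>\<nu>\<in>UNIV. v $ \<nu> *\<^sub>R frechet_derivative f (at x) (axis \<nu> 1))"
    by (simp add: linear_sum linear_scale)
  then show ?thesis by (simp add: basis_expansion scalar_mult_eq_scaleR[symmetric])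
qed

subsection \<open>Agreement of derivatives up to a given order\<close>

text \<open>Equality of jets of order \<open>m\<close> at \<open>x\<close>, phrased with derivatives
  in all directions instead of partial derivatives along axes. In this form it is stable under
  composition on either side, by induction on \<open>m\<close> with the product and chain
  rules.\<close>

primrec agree :: "nat \<Rightarrow> 'a \<Rightarrow> ('a::euclidean_space \<Rightarrow> 'b::euclidean_space) \<Rightarrow> ('a \<Rightarrow> 'b) \<Rightarrow> bool" where
  "agree 0 x f g \<longleftrightarrow> f x = g x"
| "agree (Suc m) x f g \<longleftrightarrow> f x = g x \<and>
     (\<forall>v. agree m x (\<lambda>y. frechet_derivative f (at y) v) (\<lambda>y. frechet_derivative g (at y) v))"

lemma agree_value: "agree m x f g \<Longrightarrow> f x = g x"
  by (cases m) auto

lemma agree_SucD: "agree (Suc m) x f g \<Longrightarrow> agree m x f g"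
  by (induction m arbitrary: f g) auto

lemma agree_refl: "agree m x f f"
  by (induction m arbitrary: f) auto

lemma agree_cong:
  assumes "open S" "x \<in> S" "\<And>y. y \<in> S \<Longrightarrow> f y = f' y" "\<And>y. y \<in> S \<Longrightarrow> g y = g' y"
  shows "agree m x f g \<longleftrightarrow> agree m x f' g'"
  using assms(3,4)
proof (induction m arbitrary: f f' g g')
  case (Suc m)
  have f: "frechet_derivative f (at y) = frechet_derivative f' (at y)" if "y \<in> S" for y
    by (rule frechet_derivative_cong_open[OF assms(1) that Suc.prems(1)])
  have g: "frechet_derivative g (at y) = frechet_derivative g' (at y)" if "y \<in> S" for y
    by (rule frechet_derivative_cong_open[OF assms(1) that Suc.prems(2)])
  have "agree m x (\<lambda>y. frechet_derivative f (at y) v) (\<lambda>y. frechet_derivative g (at y) v) \<longleftrightarrow>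
    agree m x (\<lambda>y. frechet_derivative f' (at y) v) (\<lambda>y. frechet_derivative g' (at y) v)" for v
    by (intro Suc.IH) (simp_all add: f g)
  then show ?case using Suc.prems assms(2) by simp
qed (use assms(2) in simp)

lemma agree_bounded_linear:
  assumes L: "bounded_linear L" and "smooth_on S f" "smooth_on S g" "x \<in> S" "agree m x f g"
  shows "agree m x (\<lambda>y. L (f y)) (\<lambda>y. L (g y))"
  using assms(2,3,5)
proof (induction m arbitrary: f g)
  case (Suc m)
  have D: "frechet_derivative (\<lambda>y. L (h y)) (at y) v = L (frechet_derivative h (at y) v)"
    if "smooth_on S h" "y \<in> S" for h y v
    using frechet_derivative_eqI[OF bounded_linear.has_derivative[OF L smooth_on_has_derivative[OF that]]] by simp
  have A: "agree m x (\<lambda>y. L (frechet_derivative f (at y) v)) (\<lambda>y. L (frechet_derivative g (at y) v))" for v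
    using Suc.prems by (intro Suc.IH smooth_on_frechet1) auto
  have "agree m x (\<lambda>y. frechet_derivative (\<lambda>y. L (f y)) (at y) v) (\<lambda>y. frechet_derivative (\<lambda>y. L (g y)) (at y) v)" for v
    by (rule agree_cong[OF smooth_onD_open[OF assms(2)] assms(4) D[OF Suc.prems(1)] D[OF Suc.prems(2)], THEN iffD2])
       (assumption | rule A)+
  then show ?case using agree_value[OF Suc.prems(3)] by simp
qed simp

lemma agree_add:
  assumes "smooth_on S f" "smooth_on S g" "smooth_on S f'" "smooth_on S g'" "x \<in> S"
    "agree m x f f'" "agree m x g g'"
  shows "agree m x (\<lambda>y. f y + g y) (\<lambda>y. f' y + g' y)"
  using assms(1-4,6,7)
proof (induction m arbitrary: f g f' g')
  case (Suc m)
  have D: "frechet_derivative (\<lambda>y. h y + k y) (at y) v = frechet_derivative h (at y) v + frechet_derivative k (at y) v"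
    if "smooth_on S h" "smooth_on S k" "y \<in> S" for h k :: "'a \<Rightarrow> 'b" and y v
    using frechet_derivative_eqI[OF has_derivative_add[OF smooth_on_has_derivative[OF that(1,3)]
        smooth_on_has_derivative[OF that(2,3)]]] by simp
  have A: "agree m x (\<lambda>y. frechet_derivative f (at y) v + frechet_derivative g (at y) v)
     (\<lambda>y. frechet_derivative f' (at y) v + frechet_derivative g' (at y) v)" for v
    using Suc.prems by (intro Suc.IH smooth_on_frechet1) auto
  have "agree m x (\<lambda>y. frechet_derivative (\<lambda>y. f y + g y) (at y) v) (\<lambda>y. frechet_derivative (\<lambda>y. f' y + g' y) (at y) v)" for v
    by (rule agree_cong[OF smooth_onD_open[OF assms(1)] assms(5) D[OF Suc.prems(1,2)] D[OF Suc.prems(3,4)], THEN iffD2])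
       (assumption | rule A)+
  then show ?case using agree_value[OF Suc.prems(5)] agree_value[OF Suc.prems(6)] by simp
qed simp

lemma agree_sum:
  assumes "\<And>i. i \<in> I \<Longrightarrow> smooth_on S (f i)" "\<And>i. i \<in> I \<Longrightarrow> smooth_on S (g i)" "open S" "x \<in> S"
    "\<And>i. i \<in> I \<Longrightarrow> agree m x (f i) (g i)"
  shows "agree m x (\<lambda>y. \<Sum>i\<in>I. f i y) (\<lambda>y. \<Sum>i\<in>I. g i y)"
  using assms(1,2,5)
proof (induction I rule: infinite_finite_induct)
  case (insert i I)
  have "agree m x (\<lambda>y. f i y + (\<Sum>i\<in>I. f i y)) (\<lambda>y. g i y + (\<Sum>i\<in>I. g i y))"
    using insert assms(3,4) by (intro agree_add[of S] smooth_on_sum) auto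
  then show ?case using insert by simp
qed (auto intro: agree_refl)

lemma agree_bounded_bilinear:
  assumes B: "bounded_bilinear B"
    and "smooth_on S f" "smooth_on S g" "smooth_on S f'" "smooth_on S g'" "x \<in> S"
    "agree m x f f'" "agree m x g g'"
  shows "agree m x (\<lambda>y. B (f y) (g y)) (\<lambda>y. B (f' y) (g' y))"
  using assms(2-5,7,8)
proof (induction m arbitrary: f g f' g')
  case (Suc m)
  have D: "frechet_derivative (\<lambda>y. B (h y) (k y)) (at y) v =
      B (h y) (frechet_derivative k (at y) v) + B (frechet_derivative h (at y) v) (k y)"
    if "smooth_on S h" "smooth_on S k" "y \<in> S" for h k y v
    using frechet_derivative_eqI[OF bounded_bilinear.FDERIV[OF B smooth_on_has_derivative[OF that(1,3)]
        smooth_on_has_derivative[OF that(2,3)]]] by simp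
  have A: "agree m x (\<lambda>y. B (f y) (frechet_derivative g (at y) v) + B (frechet_derivative f (at y) v) (g y))
     (\<lambda>y. B (f' y) (frechet_derivative g' (at y) v) + B (frechet_derivative f' (at y) v) (g' y))" for v
    using Suc.prems assms(6) agree_SucD[OF Suc.prems(5)] agree_SucD[OF Suc.prems(6)]
    by (intro agree_add[of S] Suc.IH smooth_on_frechet1 smooth_on_bounded_bilinear[OF B]) auto
  have "agree m x (\<lambda>y. frechet_derivative (\<lambda>y. B (f y) (g y)) (at y) v) (\<lambda>y. frechet_derivative (\<lambda>y. B (f' y) (g' y)) (at y) v)" for v
    by (rule agree_cong[OF smooth_onD_open[OF assms(2)] assms(6) D[OF Suc.prems(1,2)] D[OF Suc.prems(3,4)], THEN iffD2])
       (assumption | rule A)+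
  then show ?case using agree_value[OF Suc.prems(5)] agree_value[OF Suc.prems(6)] by simp
qed simp

lemma frechet_derivative_compose_basis:
  assumes "smooth_on S f" "smooth_on T g" "f ` S \<subseteq> T" "x \<in> S"
  shows "frechet_derivative (\<lambda>x. g (f x)) (at x) v =
    (\<Sum>b\<in>Basis. (frechet_derivative f (at x) v \<bullet> b) *\<^sub>R frechet_derivative g (at (f x)) b)"
proof -
  have f: "f differentiable (at x)" using assms(1,4) by (rule smooth_on_differentiable)
  have g: "g differentiable (at (f x))" using assms by (intro smooth_on_differentiable[of T]) auto
  show ?thesis unfolding frechet_derivative_comp[OF f g] by (rule frechet_derivative_basis_sum[OF g])
qed

text \<open>By the chain rule the derivative is a sum of products of a derivative of
  \<open>f\<close>, for which agreement is given, and a derivative of \<open>\<Phi>\<close> composed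
  with \<open>f\<close>, for which the induction hypothesis applies with another
  \<open>\<Phi>\<close>.\<close>

lemma agree_compose_left:
  assumes "smooth_on S f" "smooth_on S g" "smooth_on T \<Phi>" "f ` S \<subseteq> T" "g ` S \<subseteq> T" "x \<in> S" "agree m x f g"
  shows "agree m x (\<lambda>y. \<Phi> (f y)) (\<lambda>y. \<Phi> (g y))"
  using assms(3,7)
proof (induction m arbitrary: \<Phi>)
  case (Suc m)
  have op: "open S" using assms(1) by (rule smooth_onD_open)
  have m: "agree m x f g" using Suc.prems(2) by (rule agree_SucD)
  have A: "agree m x (\<lambda>y. \<Sum>b\<in>Basis. (frechet_derivative f (at y) v \<bullet> b) *\<^sub>R frechet_derivative \<Phi> (at (f y)) b)
      (\<lambda>y. \<Sum>b\<in>Basis. (frechet_derivative g (at y) v \<bullet> b) *\<^sub>R frechet_derivative \<Phi> (at (g y)) b)" for v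
    using assms(1,2,4-6) Suc.prems m op
    by (intro agree_sum[of _ S] agree_bounded_bilinear[OF bounded_bilinear_scaleR, of S]
        agree_bounded_bilinear[OF bounded_bilinear_inner, of S] agree_refl Suc.IH
        smooth_on_frechet1 smooth_on_scaleR smooth_on_inner smooth_on_const
        smooth_on_compose[OF smooth_on_frechet1[of T]]) auto
  have "agree m x (\<lambda>y. frechet_derivative (\<lambda>y. \<Phi> (f y)) (at y) v) (\<lambda>y. frechet_derivative (\<lambda>y. \<Phi> (g y)) (at y) v)" for v
    by (rule agree_cong[OF op assms(6) frechet_derivative_compose_basis[OF assms(1) Suc.prems(1) assms(4)]
        frechet_derivative_compose_basis[OF assms(2) Suc.prems(1) assms(5)], THEN iffD2])
       (assumption | rule A)+
  then show ?case using agree_value[OF m] by simp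
qed simp

lemma agree_compose_right:
  assumes "smooth_on T f" "smooth_on T g" "smooth_on S \<psi>" "\<psi> ` S \<subseteq> T" "x \<in> S" "agree m (\<psi> x) f g"
  shows "agree m x (\<lambda>y. f (\<psi> y)) (\<lambda>y. g (\<psi> y))"
  using assms(1,2,6)
proof (induction m arbitrary: f g)
  case (Suc m)
  have op: "open S" using assms(3) by (rule smooth_onD_open)
  have A: "agree m x (\<lambda>y. \<Sum>b\<in>Basis. (frechet_derivative \<psi> (at y) v \<bullet> b) *\<^sub>R frechet_derivative f (at (\<psi> y)) b)
      (\<lambda>y. \<Sum>b\<in>Basis. (frechet_derivative \<psi> (at y) v \<bullet> b) *\<^sub>R frechet_derivative g (at (\<psi> y)) b)" for v
    using assms(3-5) Suc.prems op
    by (intro agree_sum[of _ S] agree_bounded_bilinear[OF bounded_bilinear_scaleR, of S]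
        agree_refl Suc.IH smooth_on_frechet1 smooth_on_scaleR smooth_on_inner smooth_on_const
        smooth_on_compose[OF smooth_on_frechet1[of T]]) auto
  have "agree m x (\<lambda>y. frechet_derivative (\<lambda>y. f (\<psi> y)) (at y) v) (\<lambda>y. frechet_derivative (\<lambda>y. g (\<psi> y)) (at y) v)" for v
    by (rule agree_cong[OF op assms(5) frechet_derivative_compose_basis[OF assms(3) Suc.prems(1) assms(4)]
        frechet_derivative_compose_basis[OF assms(3) Suc.prems(2) assms(4)], THEN iffD2]) (assumption | rule A)+
  then show ?case using Suc.prems(3) by simp
qed simp

text \<open>\<open>agree\<close> strips off the innermost derivative while \<open>pd\<close> strips
  off the outermost, so index lists are split at their last entry. Linearity reduces arbitrary
  directions to the axes.\<close>

lemma agree_iff_pd: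
  fixes f g :: "real^'n \<Rightarrow> 'b::euclidean_space"
  assumes "smooth_on S f" "smooth_on S g" "x \<in> S"
  shows "agree m x f g \<longleftrightarrow> (\<forall>\<mu>s. length \<mu>s \<le> m \<longrightarrow> pd \<mu>s f x = pd \<mu>s g x)"
  using assms(1,2)
proof (induction m arbitrary: f g)
  case (Suc m)
  define D where "D f v = (\<lambda>y. frechet_derivative f (at y) v)" for f :: "real^'n \<Rightarrow> 'b" and v
  have smD: "smooth_on S (D f v)" "smooth_on S (D g v)" for v
    unfolding D_def by (intro smooth_on_frechet1 Suc.prems)+
  have axes: "(\<forall>v. agree m x (D f v) (D g v)) \<longleftrightarrow> (\<forall>\<nu>. agree m x (D f (axis \<nu> 1)) (D g (axis \<nu> 1)))"
  proof (intro iffI allI)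
    fix v assume *: "\<forall>\<nu>. agree m x (D f (axis \<nu> 1)) (D g (axis \<nu> 1))"
    have A: "agree m x (\<lambda>y. \<Sum>\<nu>\<in>UNIV. v $ \<nu> *\<^sub>R D f (axis \<nu> 1) y) (\<lambda>y. \<Sum>\<nu>\<in>UNIV. v $ \<nu> *\<^sub>R D g (axis \<nu> 1) y)"
      using * smD assms(3) smooth_onD_open[OF assms(1)]
      by (intro agree_sum[of _ S] agree_bounded_linear[OF bounded_linear_scaleR_right, of S]
           smooth_on_bounded_linear[OF bounded_linear_scaleR_right]) auto
    have E: "D h v y = (\<Sum>\<nu>\<in>UNIV. v $ \<nu> *\<^sub>R D h (axis \<nu> 1) y)" if "smooth_on S h" "y \<in> S" for h y
      unfolding D_def using smooth_on_differentiable[OF that] by (rule frechet_derivative_sum_axis)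
    show "agree m x (D f v) (D g v)"
      by (rule agree_cong[OF smooth_onD_open[OF assms(1)] assms(3) E[OF Suc.prems(1)] E[OF Suc.prems(2)], THEN iffD2])
         (assumption | rule A)+
  qed blast
  have snoc: "pd \<mu>s (D h (axis \<nu> 1)) = pd (\<mu>s @ [\<nu>]) h" for \<mu>s \<nu> h
    by (simp add: pd_append D_def)
  have "agree (Suc m) x f g \<longleftrightarrow> f x = g x \<and> (\<forall>\<nu> \<mu>s. length \<mu>s \<le> m \<longrightarrow> pd (\<mu>s @ [\<nu>]) f x = pd (\<mu>s @ [\<nu>]) g x)"
    unfolding agree.simps D_def[symmetric] axes unfolding Suc.IH[OF smD] snoc ..
  also have "\<dots> \<longleftrightarrow> (\<forall>\<mu>s. length \<mu>s \<le> Suc m \<longrightarrow> pd \<mu>s f x = pd \<mu>s g x)" (is "?L \<longleftrightarrow> ?R")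
  proof
    assume ?L
    show ?R
    proof (intro allI impI)
      fix \<mu>s :: "'n list" assume "length \<mu>s \<le> Suc m"
      then show "pd \<mu>s f x = pd \<mu>s g x" using \<open>?L\<close> by (cases \<mu>s rule: rev_cases) auto
    qed
  next
    assume R: ?R
    have "pd (\<mu>s @ [\<nu>]) f x = pd (\<mu>s @ [\<nu>]) g x" if "length \<mu>s \<le> m" for \<mu>s \<nu>
      using that R[rule_format, of "\<mu>s @ [\<nu>]"] by simp
    moreover have "f x = g x" using R[rule_format, of "[]"] by simp
    ultimately show ?L by blast
  qed
  finally show ?case .
qed simp

subsection \<open>Polynomials with prescribed derivatives\<close>

text \<open>\<open>jpoly c r\<close> is the homogeneous Taylor term of degree \<open>r\<close>, written recursively by Euler's formula;
  no factorials of multi-indices occur, and differentiation just shifts the coefficient family.\<close>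

primrec jpoly :: "nat \<Rightarrow> ('n::finite multiset \<Rightarrow> 'b::euclidean_space) \<Rightarrow> real^'n \<Rightarrow> 'b" where
  "jpoly 0 c z = c {#}"
| "jpoly (Suc r) c z = (1 / real (Suc r)) *\<^sub>R (\<Sum>\<nu>\<in>UNIV. z $ \<nu> *\<^sub>R jpoly r (\<lambda>I. c (add_mset \<nu> I)) z)"

lemma smooth_on_jpoly:
  assumes "open S" "\<And>I. smooth_on S (\<lambda>w. C w I)" "smooth_on S Z"
  shows "smooth_on S (\<lambda>w. jpoly r (C w) (Z w))"
  using assms(2)
proof (induction r arbitrary: C)
  case (Suc r)
  have "smooth_on S (\<lambda>w. jpoly r (\<lambda>I. C w (add_mset \<nu> I)) (Z w))" for \<nu>
    by (rule Suc.IH) (rule Suc.prems)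
  then show ?case unfolding jpoly.simps
    by (intro smooth_on_bounded_linear[OF bounded_linear_scaleR_right] smooth_on_sum smooth_on_scaleR smooth_on_nth assms)
qed simp

lemma smooth_jpoly: "smooth_on UNIV (jpoly r c)"
  using smooth_on_jpoly[of UNIV "\<lambda>_. c" "\<lambda>z. z" r] by (simp add: smooth_on_const smooth_on_ident)

text \<open>Differentiating the factors \<open>z $ \<mu>\<close> gives one copy of the asserted
  polynomial, and differentiating the polynomials gives \<open>Suc r\<close> copies by Euler's
  formula; together they cancel the prefactor \<open>1 / real (Suc (Suc r))\<close>.\<close>

lemma jpoly_deriv:
  "frechet_derivative (jpoly (Suc r) c) (at z) (axis \<nu> 1) = jpoly r (\<lambda>I. c (add_mset \<nu> I)) z"
proof (induction r arbitrary: c)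
  case 0
  have "((\<lambda>z. \<Sum>\<mu>\<in>UNIV. z $ \<mu> *\<^sub>R c {#\<mu>#}) has_derivative (\<lambda>v. \<Sum>\<mu>\<in>UNIV. v $ \<mu> *\<^sub>R c {#\<mu>#})) (at z)"
    by (auto intro!: derivative_eq_intros bounded_linear.has_derivative[OF bounded_linear_vec_nth])
  then have "((jpoly (Suc 0) c) has_derivative (\<lambda>v. \<Sum>\<mu>\<in>UNIV. v $ \<mu> *\<^sub>R c {#\<mu>#})) (at z)"
    by (simp add: jpoly.simps[abs_def])
  then show ?case
    by (simp only: frechet_derivative_eqI)
       (simp add: axis_def if_distrib[of "\<lambda>x. x *\<^sub>R _"] cong: if_cong)
next
  case (Suc r)
  let ?c = "\<lambda>\<mu> I. c (add_mset \<mu> I)"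
  have J: "(jpoly (Suc r) c' has_derivative frechet_derivative (jpoly (Suc r) c') (at z)) (at z)" for c'
    by (rule smooth_on_has_derivative[OF smooth_jpoly]) simp
  have "((\<lambda>z. \<Sum>\<mu>\<in>UNIV. z $ \<mu> *\<^sub>R jpoly (Suc r) (?c \<mu>) z) has_derivative
      (\<lambda>v. \<Sum>\<mu>\<in>UNIV. z $ \<mu> *\<^sub>R frechet_derivative (jpoly (Suc r) (?c \<mu>)) (at z) v + v $ \<mu> *\<^sub>R jpoly (Suc r) (?c \<mu>) z)) (at z)"
    by (intro has_derivative_sum has_derivative_scaleR bounded_linear.has_derivative[OF bounded_linear_vec_nth]
        has_derivative_ident J)
  from has_derivative_scaleR_right[OF this, of "1 / real (Suc (Suc r))"]
  have "(jpoly (Suc (Suc r)) c has_derivative (\<lambda>v. (1 / real (Suc (Suc r))) *\<^sub>R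
      (\<Sum>\<mu>\<in>UNIV. z $ \<mu> *\<^sub>R frechet_derivative (jpoly (Suc r) (?c \<mu>)) (at z) v + v $ \<mu> *\<^sub>R jpoly (Suc r) (?c \<mu>) z))) (at z)"
    by (subst jpoly.simps(2)[abs_def])
  then have "frechet_derivative (jpoly (Suc (Suc r)) c) (at z) (axis \<nu> 1) =
    (1 / real (Suc (Suc r))) *\<^sub>R
      (\<Sum>\<mu>\<in>UNIV. z $ \<mu> *\<^sub>R frechet_derivative (jpoly (Suc r) (?c \<mu>)) (at z) (axis \<nu> 1) + axis \<nu> 1 $ \<mu> *\<^sub>R jpoly (Suc r) (?c \<mu>) z)"
    by (simp only: frechet_derivative_eqI)
  also have "(\<Sum>\<mu>\<in>UNIV. z $ \<mu> *\<^sub>R frechet_derivative (jpoly (Suc r) (?c \<mu>)) (at z) (axis \<nu> 1) + axis \<nu> 1 $ \<mu> *\<^sub>R jpoly (Suc r) (?c \<mu>) z)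
     = (\<Sum>\<mu>\<in>UNIV. z $ \<mu> *\<^sub>R jpoly r (\<lambda>I. ?c \<nu> (add_mset \<mu> I)) z) + jpoly (Suc r) (?c \<nu>) z"
    unfolding Suc.IH sum.distrib
    by (simp add: axis_def if_distrib[of "\<lambda>x. x *\<^sub>R _"] add_mset_commute cong: if_cong del: jpoly.simps(2))
  also have "(\<Sum>\<mu>\<in>UNIV. z $ \<mu> *\<^sub>R jpoly r (\<lambda>I. ?c \<nu> (add_mset \<mu> I)) z) = real (Suc r) *\<^sub>R jpoly (Suc r) (?c \<nu>) z"
    by simp
  also have "real (Suc r) *\<^sub>R jpoly (Suc r) (?c \<nu>) z + jpoly (Suc r) (?c \<nu>) z = real (Suc (Suc r)) *\<^sub>R jpoly (Suc r) (?c \<nu>) z"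
    by (simp add: of_nat_Suc[of "Suc r"] scaleR_left_distrib add.commute del: jpoly.simps(2) of_nat_Suc)
  finally show ?case by (simp del: jpoly.simps(2))
qed

definition taylor :: "nat \<Rightarrow> ('n::finite multiset \<Rightarrow> 'b::euclidean_space) \<Rightarrow> real^'n \<Rightarrow> real^'n \<Rightarrow> 'b" where
  "taylor m c x z = (\<Sum>r\<le>m. jpoly r c (z - x))"

lemma smooth_on_taylor:
  assumes "open S" "\<And>I. smooth_on S (\<lambda>w. C w I)" "smooth_on S X" "smooth_on S Z"
  shows "smooth_on S (\<lambda>w. taylor m (C w) (X w) (Z w))"
  unfolding taylor_def by (intro smooth_on_sum smooth_on_jpoly smooth_on_diff assms)

lemma smooth_taylor: "smooth_on UNIV (taylor m c x)"
  using smooth_on_taylor[of UNIV "\<lambda>_. c" "\<lambda>_. x" "\<lambda>z. z" m] by (simp add: smooth_on_const smooth_on_ident)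

lemma taylor_deriv:
  "frechet_derivative (taylor (Suc m) c x) (at z) (axis \<nu> 1) = taylor m (\<lambda>I. c (add_mset \<nu> I)) x z"
proof -
  have "((\<lambda>z. jpoly r c (z - x)) has_derivative frechet_derivative (jpoly r c) (at (z - x))) (at z)" for r
  proof -
    have "((\<lambda>z. z - x) has_derivative (\<lambda>v. v)) (at z)" by (auto intro!: derivative_eq_intros)
    from has_derivative_compose[OF this smooth_on_has_derivative[OF smooth_jpoly UNIV_I]] show ?thesis .
  qed
  then have "((\<lambda>z. \<Sum>r\<le>Suc m. jpoly r c (z - x)) has_derivative
      (\<lambda>v. \<Sum>r\<le>Suc m. frechet_derivative (jpoly r c) (at (z - x)) v)) (at z)"
    by (intro has_derivative_sum)
  then have "frechet_derivative (taylor (Suc m) c x) (at z) (axis \<nu> 1) =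
      (\<Sum>r\<le>Suc m. frechet_derivative (jpoly r c) (at (z - x)) (axis \<nu> 1))"
    unfolding taylor_def[abs_def] by (simp only: frechet_derivative_eqI)
  also have "\<dots> = (\<Sum>r\<le>m. frechet_derivative (jpoly (Suc r) c) (at (z - x)) (axis \<nu> 1))"
    by (subst sum.atMost_Suc_shift) (simp add: jpoly.simps(1)[abs_def] del: jpoly.simps(2))
  finally show ?thesis unfolding jpoly_deriv taylor_def .
qed

lemma pd_taylor:
  "length \<mu>s \<le> m \<Longrightarrow> pd \<mu>s (taylor m c x) = taylor (m - length \<mu>s) (\<lambda>I. c (mset \<mu>s + I)) x"
proof (induction \<mu>s)
  case (Cons \<mu> \<mu>s)
  obtain m' where m': "m - length \<mu>s = Suc m'" 
    using Cons.prems by (cases "m - length \<mu>s") auto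
  then have m'': "m - length (\<mu> # \<mu>s) = m'" by simp
  have "pd \<mu>s (taylor m c x) = taylor (Suc m') (\<lambda>I. c (mset \<mu>s + I)) x"
    using Cons m' by simp
  then show ?case unfolding m'' pd.simps by (auto simp: taylor_deriv)
qed simp

lemma taylor_center: "taylor m c x x = c {#}"
proof -
  have "jpoly r c 0 = 0" if "r \<noteq> 0" for r using that by (cases r) auto
  then have "(\<Sum>r\<le>m. jpoly r c 0) = (\<Sum>r\<in>{0}. jpoly r c 0)"
    by (intro sum.mono_neutral_right) auto
  then show ?thesis by (simp add: taylor_def)
qed

lemma pd_taylor_center: "length \<mu>s \<le> m \<Longrightarrow> pd \<mu>s (taylor m c x) x = c (mset \<mu>s)"
  by (simp add: pd_taylor taylor_center)

text \<open>A partial derivative in the first argument with the parameter frozen is the derivative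
  of the joint function in direction \<open>(axis \<mu> 1, 0)\<close>, so joint smoothness is
  kept.\<close>

lemma smooth_on_pd_param:
  fixes G :: "(real^'n) \<times> 'w::euclidean_space \<Rightarrow> 'b::real_normed_vector"
  assumes "smooth_on S G"
  shows "smooth_on S (\<lambda>y. pd \<mu>s (\<lambda>\<zeta>. G (\<zeta>, snd y)) (fst y))"
proof (induction \<mu>s)
  case (Cons \<mu> \<mu>s)
  let ?K = "\<lambda>y. pd \<mu>s (\<lambda>\<zeta>. G (\<zeta>, snd y)) (fst y)"
  have "smooth_on S (\<lambda>y. frechet_derivative ?K (at y) (axis \<mu> 1, 0))"
    by (rule smooth_on_frechet1[OF Cons])
  moreover have "frechet_derivative ?K (at y) (axis \<mu> 1, 0) = pd (\<mu> # \<mu>s) (\<lambda>\<zeta>. G (\<zeta>, snd y)) (fst y)"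
    if "y \<in> S" for y
  proof -
    have "((\<lambda>\<zeta>. (\<zeta>, snd y)) has_derivative (\<lambda>v. (v, 0))) (at (fst y))"
      by (auto intro!: derivative_eq_intros)
    moreover have "(?K has_derivative frechet_derivative ?K (at y)) (at (fst y, snd y))"
      using smooth_on_has_derivative[OF Cons that] by simp
    ultimately have "((\<lambda>\<zeta>. ?K (\<zeta>, snd y)) has_derivative (\<lambda>v. frechet_derivative ?K (at y) (v, 0))) (at (fst y))"
      by (rule has_derivative_compose)
    then show ?thesis by (simp add: frechet_derivative_eqI)
  qed
  ultimately show ?case by (rule smooth_on_cong)
qed (use assms in simp)

section \<open>Determinants and wedge products\<close>

subsection \<open>Alternating functions of the rows of a matrix\<close>

definition set_row :: "'n \<Rightarrow> real^'n \<Rightarrow> real^'n^'n \<Rightarrow> real^'n^'n" where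
  "set_row k c A = (\<chi> i. if i = k then c else A $ i)"

lemma set_row_nth [simp]: "set_row k c A $ i = (if i = k then c else A $ i)"
  by (simp add: set_row_def)

lemma det_set_row_lin:
  "det (set_row k (a *\<^sub>R c + b *\<^sub>R d) A) = a * det (set_row k c A) + b * det (set_row k d A)"
  for A :: "real^'n::finite^'n"
  using det_row_add[of k "\<lambda>_. a *\<^sub>R c" "\<lambda>_. b *\<^sub>R d" "($) A"]
      det_row_mul[of k a "\<lambda>_. c" "($) A"] det_row_mul[of k b "\<lambda>_. d" "($) A"]
  by (simp add: set_row_def scalar_mult_eq_scaleR cong: if_cong)

lemma set_row_same: "set_row k (A $ k) A = A"
  by (simp add: vec_eq_iff)

text \<open>Exchanging two rows changes the sign, as one sees by expanding the value at the matrix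
  that has the sum of the two rows in both places. Only vanishing is transported, so the sign of
  \<open>p\<close> does not appear.\<close>

lemma alternating_rows_permute:
  fixes f :: "real^'n::finite^'n \<Rightarrow> real"
  assumes lin: "\<And>A k a b c d. f (set_row k (a *\<^sub>R c + b *\<^sub>R d) A) = a * f (set_row k c A) + b * f (set_row k d A)"
    and alt: "\<And>A i j. i \<noteq> j \<Longrightarrow> A $ i = A $ j \<Longrightarrow> f A = 0"
    and p: "p permutes UNIV" and zero: "f A = 0"
  shows "f (\<chi> i. A $ p i) = 0"
proof -
  have add: "f (set_row k (c + d) B) = f (set_row k c B) + f (set_row k d B)" for k c d B
    using lin[of k 1 c 1 d B] by simp
  have neg: "f (\<chi> i. B $ Transposition.transpose a b i) = - f B" if ab: "a \<noteq> b" for B a b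
  proof -
    define R where "R c d = set_row a c (set_row b d B)" for c d
    have 1: "R (c + c') d = set_row a (c + c') (set_row b d B)" for c c' d by (simp add: R_def)
    have addl: "f (R (c + c') d) = f (R c d) + f (R c' d)" for c c' d by (simp add: R_def add)
    have comm: "R c d = set_row b d (set_row a c B)" for c d using ab by (auto simp: R_def vec_eq_iff)
    have addr: "f (R c (d + d')) = f (R c d) + f (R c d')" for c d d' by (simp add: comm add)
    have eq: "f (R c c) = 0" for c using ab by (intro alt[of a b]) (auto simp: R_def)
    have "0 = f (R (B $ a) (B $ b)) + f (R (B $ b) (B $ a))"
      using eq[of "B $ a + B $ b"] unfolding addl unfolding addr by (simp add: eq)
    moreover have "R (B $ a) (B $ b) = B" by (simp add: R_def vec_eq_iff)
    moreover have "R (B $ b) (B $ a) = (\<chi> i. B $ Transposition.transpose a b i)"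
      using ab by (auto simp: R_def vec_eq_iff Transposition.transpose_def)
    ultimately show ?thesis by simp
  qed
  show ?thesis using p finite_class.finite_UNIV zero
  proof (induction arbitrary: A rule: permutes_induct)
    case (swap a b p)
    show ?case
    proof (cases "a = b")
      case False
      have "f (\<chi> i. A $ (Transposition.transpose a b \<circ> p) i) = f (\<chi> i. (\<chi> i. A $ Transposition.transpose a b i) $ p i)" by simp
      also have "\<dots> = 0" using swap neg[OF False, of A] by (intro swap.IH) simp
      finally show ?thesis .
    qed (use swap in simp)
  qed simp
qed

text \<open>Induction on the set \<open>S\<close> of rows that may differ from unit vectors,
  expanding one such row at a time. When all rows are unit vectors, either two coincide or the
  matrix is a row permutation of the identity.\<close>

lemma alternating_rows_zero:
  fixes f :: "real^'n::finite^'n \<Rightarrow> real"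
  assumes lin: "\<And>A k a b c d. f (set_row k (a *\<^sub>R c + b *\<^sub>R d) A) = a * f (set_row k c A) + b * f (set_row k d A)"
    and alt: "\<And>A i j. i \<noteq> j \<Longrightarrow> A $ i = A $ j \<Longrightarrow> f A = 0"
    and one: "f (mat 1) = 0"
  shows "f A = 0"
proof -
  have "f A = 0" if "\<And>j. j \<notin> S \<Longrightarrow> \<exists>\<nu>. A $ j = axis \<nu> 1" for S A
    using finite[of S] that
  proof (induction S arbitrary: A rule: finite_induct)
    case empty
    then have "\<forall>j. \<exists>\<nu>. A $ j = axis \<nu> 1" by simp
    then obtain \<rho> where \<rho>: "\<And>j. A $ j = axis (\<rho> j) 1" by metis
    show ?case
    proof (cases "inj \<rho>")
      case True
      then have p: "\<rho> permutes UNIV" by (simp add: permutes_def bij_def finite_UNIV_inj_surj flip: bij_iff)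
      have "A = (\<chi> i. (mat 1 :: real^'n^'n) $ \<rho> i)"
        using \<rho> by (auto simp: vec_eq_iff mat_def axis_def)
      then show ?thesis using alternating_rows_permute[OF lin alt p one] by simp
    next
      case False
      then obtain i j where "i \<noteq> j" "\<rho> i = \<rho> j" by (auto simp: inj_def)
      then show ?thesis using alt[of i j A] \<rho> by simp
    qed
  next
    case (insert k S)
    define g where "g c = f (set_row k c A)" for c
    have "linear g"
      using lin[of k 1 _ 1 _ A] lin[of k _ _ 0 _ A] by (auto simp: g_def intro!: linearI)
    moreover have "g (axis \<nu> 1) = 0" for \<nu>
      unfolding g_def using insert.prems by (intro insert.IH) auto
    ultimately have "g (\<Sum>\<nu>\<in>UNIV. A $ k $ \<nu> *\<^sub>R axis \<nu> 1) = 0"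
      by (simp add: linear_sum linear_scale)
    then show ?case
      using set_row_same[of k A] basis_expansion[of "A $ k"] by (simp add: g_def scalar_mult_eq_scaleR)
  qed
  from this[of UNIV] show ?thesis by simp
qed

text \<open>Applied to the values of a Lagrangian density on frames of the base, this yields the
  Jacobian factor of its coefficient.\<close>

lemma alternating_rows_det:
  fixes f :: "real^'n::finite^'n \<Rightarrow> real"
  assumes lin: "\<And>A k a b c d. f (set_row k (a *\<^sub>R c + b *\<^sub>R d) A) = a * f (set_row k c A) + b * f (set_row k d A)"
    and alt: "\<And>A i j. i \<noteq> j \<Longrightarrow> A $ i = A $ j \<Longrightarrow> f A = 0"
  shows "f A = det A * f (mat 1)"
proof -
  have "f A - det A * f (mat 1) = 0"
  proof (rule alternating_rows_zero[of "\<lambda>A. f A - det A * f (mat 1)"])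
    show "i \<noteq> j \<Longrightarrow> A $ i = A $ j \<Longrightarrow> f A - det A * f (mat 1) = 0" for A :: "real^'n^'n" and i j
      using alt[of i j A] det_identical_rows[of i j A] by (simp add: row_def vec_eq_iff)
  qed (simp_all add: lin det_set_row_lin algebra_simps)
  then show ?thesis by simp
qed

subsection \<open>The derivative of the determinant\<close>

text \<open>The derivative of \<open>det\<close> at \<open>M\<close> in direction \<open>B\<close>.
  It occurs because replacing the \<kappa>-th factor of d^nx and summing over \<kappa> replaces one
  row of a determinant at a time.\<close>

definition dmix :: "real^'n::finite^'n \<Rightarrow> real^'n^'n \<Rightarrow> real" where
  "dmix M B = (\<Sum>\<kappa>\<in>UNIV. det (set_row \<kappa> (B $ \<kappa>) M))"

lemma det_has_derivative:
  "((\<lambda>s. det (M + s *\<^sub>R B)) has_real_derivative dmix M B) (at 0)"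
proof -
  have "((\<lambda>s. \<Sum>p | p permutes UNIV. of_int (sign p) * (\<Prod>i\<in>UNIV. M $ i $ p i + s * B $ i $ p i))
     has_real_derivative (\<Sum>p | p permutes UNIV. of_int (sign p) *
       (\<Sum>i\<in>UNIV. B $ i $ p i * (\<Prod>j\<in>UNIV - {i}. M $ j $ p j + 0 * B $ j $ p j)))) (at 0)"
    by (intro DERIV_sum DERIV_cmult has_field_derivative_prod) (auto intro!: derivative_eq_intros)
  moreover have "(\<Sum>p | p permutes UNIV. of_int (sign p) *
       (\<Sum>i\<in>UNIV. B $ i $ p i * (\<Prod>j\<in>UNIV - {i}. M $ j $ p j + 0 * B $ j $ p j))) = dmix M B"
  proof -
    have "(\<Prod>i\<in>UNIV. set_row \<kappa> (B $ \<kappa>) M $ i $ p i) = B $ \<kappa> $ p \<kappa> * (\<Prod>j\<in>UNIV - {\<kappa>}. M $ j $ p j)" for \<kappa> and p :: "'a \<Rightarrow> 'a"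
      by (subst prod.remove[of _ \<kappa>]) auto
    then show ?thesis
      unfolding dmix_def det_def sum_distrib_left
      by (subst sum.swap) (auto intro!: sum.cong)
  qed
  ultimately show ?thesis by (simp add: det_def)
qed

text \<open>Differentiate det(A(M + sB)) = det A det(M + sB) at s = 0; this covers singular
  \<open>A\<close> and \<open>M\<close> as well.\<close>

lemma dmix_mult: "dmix (A ** M) (A ** B) = det A * dmix M B"
proof -
  have "A ** M + s *\<^sub>R (A ** B) = A ** (M + s *\<^sub>R B)" for s
    by (simp add: matrix_add_ldistrib matrix_scalar_ac scalar_matrix_assoc[symmetric])
  then have "((\<lambda>s. det A * det (M + s *\<^sub>R B)) has_real_derivative dmix (A ** M) (A ** B)) (at 0)"
    using det_has_derivative[of "A ** M" "A ** B"] by (simp add: det_mul)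
  moreover have "((\<lambda>s. det A * det (M + s *\<^sub>R B)) has_real_derivative det A * dmix M B) (at 0)"
    by (intro DERIV_cmult det_has_derivative)
  ultimately show ?thesis by (rule DERIV_unique)
qed

lemma dmix_add: "dmix M (B + C) = dmix M B + dmix M C"
  by (simp add: dmix_def sum.distrib det_set_row_lin[of _ 1 _ 1, simplified])

lemma dmix_scaleR: "dmix M (a *\<^sub>R B) = a * dmix M B"
  by (simp add: dmix_def sum_distrib_left det_set_row_lin[of _ a _ 0, simplified])

lemma det_set_row_comb:
  "det (set_row k (\<Sum>i\<in>UNIV. x $ i *\<^sub>R M $ i) M) = x $ k * det M" for M :: "real^'n::finite^'n"
proof -
  have "row i M = M $ i" for i by (simp add: row_def vec_eq_iff)
  then show ?thesis using cramer_lemma_transpose[of k x M]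
    by (simp add: set_row_def scalar_mult_eq_scaleR cong: if_cong)
qed

text \<open>In the modified rows only the diagonal entries of \<open>C\<close> survive, whence the
  trace. This is what later cancels the momentum terms of the Hamiltonian.\<close>

lemma dmix_matrix_mult: "dmix M (C ** M) = (\<Sum>\<kappa>\<in>UNIV. C $ \<kappa> $ \<kappa>) * det M"
proof -
  have "(C ** M) $ \<kappa> = (\<Sum>i\<in>UNIV. C $ \<kappa> $ i *\<^sub>R M $ i)" for \<kappa>
    by (simp add: vec_eq_iff matrix_matrix_mult_def)
  then show ?thesis by (simp add: dmix_def det_set_row_comb sum_distrib_right)
qed

subsection \<open>Wedge products\<close>

lemma wedge_cong:
  assumes "length \<alpha>s = length \<beta>s"
    "\<And>i j. i < length \<alpha>s \<Longrightarrow> j < length \<alpha>s \<Longrightarrow> (\<alpha>s ! i) (vs ! j) = (\<beta>s ! i) (ws ! j)"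
  shows "wedge \<alpha>s vs = wedge \<beta>s ws"
  unfolding wedge_def assms(1)[symmetric]
  by (intro sum.cong refl arg_cong2[where f = "(*)"] prod.cong assms(2))
     (auto dest: permutes_in_image)

lemma wedge_Cons_def:
  "wedge (\<gamma> # \<beta>s) vs = (\<Sum>\<pi> | \<pi> permutes {..<Suc (length \<beta>s)}.
     of_int (sign \<pi>) * (\<gamma> (vs ! \<pi> 0) * (\<Prod>i<length \<beta>s. (\<beta>s ! i) (vs ! \<pi> (Suc i)))))"
  by (simp add: wedge_def prod.lessThan_Suc_shift del: prod.lessThan_Suc)

lemma wedge_Cons_sum:
  assumes "\<And>v. v \<in> set (take (Suc (length \<beta>s)) vs) \<Longrightarrow> \<gamma> v = a * \<delta> v + (\<Sum>k\<in>K. b k * \<epsilon> k v)" 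
    and len: "length vs = Suc (length \<beta>s)"
  shows "wedge (\<gamma> # \<beta>s) vs = a * wedge (\<delta> # \<beta>s) vs + (\<Sum>k\<in>K. b k * wedge (\<epsilon> k # \<beta>s) vs)"
proof -
  let ?P = "\<lambda>\<pi>. of_int (sign \<pi>) * (\<Prod>i<length \<beta>s. (\<beta>s ! i) (vs ! \<pi> (Suc i)))"
  have "\<gamma> (vs ! \<pi> 0) = a * \<delta> (vs ! \<pi> 0) + (\<Sum>k\<in>K. b k * \<epsilon> k (vs ! \<pi> 0))"
    if "\<pi> permutes {..<Suc (length \<beta>s)}" for \<pi>
    using that permutes_in_image[OF that, of 0] by (intro assms(1)) (simp add: len)
  then have "wedge (\<gamma> # \<beta>s) vs = (\<Sum>\<pi> | \<pi> permutes {..<Suc (length \<beta>s)}.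
      a * (\<delta> (vs ! \<pi> 0) * ?P \<pi>) + (\<Sum>k\<in>K. b k * (\<epsilon> k (vs ! \<pi> 0) * ?P \<pi>)))"
    unfolding wedge_Cons_def by (intro sum.cong) (auto simp: algebra_simps sum_distrib_left sum_distrib_right)
  also have "\<dots> = a * wedge (\<delta> # \<beta>s) vs + (\<Sum>k\<in>K. b k * wedge (\<epsilon> k # \<beta>s) vs)"
    unfolding wedge_Cons_def sum.distrib sum_distrib_left
    by (subst (2) sum.swap) (simp add: algebra_simps sum_distrib_left)
  finally show ?thesis .
qed

text \<open>Exchanging covectors amounts to composing the permutation with a transposition on the
  right; exchanging vectors, used further below, composes on the left.\<close>

lemma wedge_swap_covectors:
  assumes "i < length \<alpha>s" "j < length \<alpha>s" "i \<noteq> j"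
  shows "wedge (\<alpha>s[i := \<alpha>s ! j, j := \<alpha>s ! i]) vs = - wedge \<alpha>s vs"
proof -
  let ?n = "length \<alpha>s" let ?t = "Transposition.transpose i j"
  have t: "?t permutes {..<?n}" using assms by (intro permutes_swap_id) auto
  have "wedge (\<alpha>s[i := \<alpha>s ! j, j := \<alpha>s ! i]) vs =
    (\<Sum>\<pi> | \<pi> permutes {..<?n}. of_int (sign \<pi>) * (\<Prod>l<?n. (\<alpha>s ! ?t l) (vs ! \<pi> l)))"
    unfolding wedge_def length_list_update
    using assms by (intro sum.cong refl arg_cong2[where f = "(*)"] prod.cong)
      (auto simp: nth_list_update Transposition.transpose_def)
  also have "\<dots> = (\<Sum>\<pi> | \<pi> permutes {..<?n}. of_int (sign (\<pi> \<circ> ?t)) * (\<Prod>l<?n. (\<alpha>s ! ?t l) (vs ! \<pi> (?t l))))"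
    by (subst sum_permutations_compose_right[OF t]) simp
  also have "\<dots> = (\<Sum>\<pi> | \<pi> permutes {..<?n}. - (of_int (sign \<pi>) * (\<Prod>l<?n. (\<alpha>s ! l) (vs ! \<pi> l))))"
  proof (intro sum.cong refl)
    fix \<pi> assume "\<pi> \<in> {\<pi>. \<pi> permutes {..<?n}}"
    then have "permutation \<pi>" by (auto simp: permutation_permutes)
    then have "sign (\<pi> \<circ> ?t) = - sign \<pi>"
      using assms(3) by (simp add: sign_compose permutation_swap_id sign_swap_id)
    moreover have "(\<Prod>l<?n. (\<alpha>s ! ?t l) (vs ! \<pi> (?t l))) = (\<Prod>l<?n. (\<alpha>s ! l) (vs ! \<pi> l))"
      using prod.permute[OF t, of "\<lambda>l. (\<alpha>s ! l) (vs ! \<pi> l)"] by (simp add: o_def)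
    ultimately show "of_int (sign (\<pi> \<circ> ?t)) * (\<Prod>l<?n. (\<alpha>s ! ?t l) (vs ! \<pi> (?t l))) =
        - (of_int (sign \<pi>) * (\<Prod>l<?n. (\<alpha>s ! l) (vs ! \<pi> l)))" by simp
  qed
  finally show ?thesis by (simp add: wedge_def sum_negf)
qed

lemma wedge_equal_covectors:
  assumes "i < length \<alpha>s" "j < length \<alpha>s" "i \<noteq> j" "\<alpha>s ! i = \<alpha>s ! j"
  shows "wedge \<alpha>s vs = 0"
proof -
  have "\<alpha>s[i := \<alpha>s ! j, j := \<alpha>s ! i] = \<alpha>s"
    using assms by (intro nth_equalityI) (auto simp: nth_list_update)
  then show ?thesis using wedge_swap_covectors[OF assms(1-3), of vs] by simp
qed

lemma wedge_equal_vectors: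
  assumes "i < length \<alpha>s" "j < length \<alpha>s" "i \<noteq> j" "vs ! i = vs ! j"
  shows "wedge \<alpha>s vs = 0"
proof -
  let ?n = "length \<alpha>s" let ?t = "Transposition.transpose i j"
  have t: "?t permutes {..<?n}" using assms by (intro permutes_swap_id) auto
  have "wedge \<alpha>s vs = (\<Sum>\<pi> | \<pi> permutes {..<?n}. of_int (sign (?t \<circ> \<pi>)) * (\<Prod>l<?n. (\<alpha>s ! l) (vs ! ?t (\<pi> l))))"
    unfolding wedge_def by (subst setum_permutations_compose_left[OF t]) simp
  also have "\<dots> = (\<Sum>\<pi> | \<pi> permutes {..<?n}. - (of_int (sign \<pi>) * (\<Prod>l<?n. (\<alpha>s ! l) (vs ! \<pi> l))))"
  proof (intro sum.cong refl)
    fix \<pi> assume "\<pi> \<in> {\<pi>. \<pi> permutes {..<?n}}"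
    then have "permutation \<pi>" by (auto simp: permutation_permutes)
    then have "sign (?t \<circ> \<pi>) = - sign \<pi>"
      using assms(3) by (simp add: sign_compose permutation_swap_id sign_swap_id)
    moreover have "vs ! ?t l = vs ! l" for l using assms(4) by (auto simp: Transposition.transpose_def)
    ultimately show "of_int (sign (?t \<circ> \<pi>)) * (\<Prod>l<?n. (\<alpha>s ! l) (vs ! ?t (\<pi> l))) =
        - (of_int (sign \<pi>) * (\<Prod>l<?n. (\<alpha>s ! l) (vs ! \<pi> l)))" by simp
  qed
  finally show ?thesis by (simp add: wedge_def sum_negf)
qed

lemma wedge_linear_slot:
  fixes vs :: "'v::real_vector list"
  assumes "\<And>\<alpha>. \<alpha> \<in> set \<alpha>s \<Longrightarrow> linear \<alpha>" "j < length \<alpha>s" "length vs = length \<alpha>s"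
  shows "wedge \<alpha>s (vs[j := a *\<^sub>R u + b *\<^sub>R v]) = a * wedge \<alpha>s (vs[j := u]) + b * wedge \<alpha>s (vs[j := v])"
proof -
  let ?n = "length \<alpha>s"
  \<comment> \<open>In the product for \<open>\<pi>\<close> the slot \<open>j\<close> is met exactly
    once, by the covector with index \<open>inv \<pi> j\<close>.\<close>
  have P: "(\<Prod>i<?n. (\<alpha>s ! i) (vs[j := w] ! \<pi> i)) =
      (\<alpha>s ! inv \<pi> j) w * (\<Prod>i\<in>{..<?n} - {inv \<pi> j}. (\<alpha>s ! i) (vs ! \<pi> i))"
    if \<pi>: "\<pi> permutes {..<?n}" for \<pi> w
  proof -
    have "inv \<pi> j \<in> {..<?n}" using permutes_in_image[OF permutes_inv[OF \<pi>], of j] assms(2) by simp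
    moreover have "\<pi> (inv \<pi> j) = j" using permutes_inverses[OF \<pi>] by simp
    moreover have "j \<noteq> \<pi> i" if "i \<noteq> inv \<pi> j" for i using that permutes_inverses[OF \<pi>] by metis
    ultimately show ?thesis using assms(2,3)
      by (subst prod.remove[of _ "inv \<pi> j"]) (auto intro!: prod.cong)
  qed
  have L: "linear (\<alpha>s ! inv \<pi> j)" if \<pi>: "\<pi> permutes {..<?n}" for \<pi>
    using permutes_in_image[OF permutes_inv[OF \<pi>], of j] assms(2) by (intro assms(1)) auto
  show ?thesis
    unfolding wedge_def sum_distrib_left sum.distrib[symmetric]
    by (intro sum.cong refl) (simp add: P linear_add[OF L] linear_scale[OF L] algebra_simps)
qed

lemma permutes_Suc_lift:
  assumes "\<rho> permutes {..<n}"
  shows "(\<lambda>i. case i of 0 \<Rightarrow> 0 | Suc j \<Rightarrow> Suc (\<rho> j)) permutes {..<Suc n}" (is ?A)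
    and "sign (\<lambda>i. case i of 0 \<Rightarrow> 0 | Suc j \<Rightarrow> Suc (\<rho> j)) = sign \<rho>" (is ?B)
proof -
  have eq: "(\<lambda>i. case i of 0 \<Rightarrow> 0 | Suc j \<Rightarrow> Suc (\<rho> j)) = map_permutation {..<n} Suc \<rho>"
  proof
    fix i show "(case i of 0 \<Rightarrow> 0 | Suc j \<Rightarrow> Suc (\<rho> j)) = map_permutation {..<n} Suc \<rho> i"
    proof (cases i)
      case 0
      then show ?thesis by (auto simp: map_permutation_def restrict_id_def)
    next
      case (Suc j)
      show ?thesis
      proof (cases "j < n")
        case True
        then show ?thesis using map_permutation_apply[of Suc "{..<n}" j \<rho>] Suc by simp
      next
        case False
        then show ?thesis using Suc permutes_not_in[OF assms, of j]
          by (auto simp: map_permutation_def restrict_id_def)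
      qed
    qed
  qed
  have "map_permutation {..<n} Suc \<rho> permutes Suc ` {..<n}"
    by (intro map_permutation_permutes[OF _ assms]) (simp add: bij_betw_def)
  then show ?A unfolding eq by (rule permutes_subset) auto
  show ?B unfolding eq by (intro sign_map_permutation assms) auto
qed

text \<open>Antisymmetrising over the first slot as well counts every term of the determinant once for each
  permutation of the last \<open>n\<close> covectors.\<close>

lemma wedge_Cons_expand:
  "fact (length \<beta>s) * wedge (\<gamma> # \<beta>s) vs = (\<Sum>\<pi> | \<pi> permutes {..<Suc (length \<beta>s)}.
     of_int (sign \<pi>) * (\<gamma> (vs ! \<pi> 0) * wedge \<beta>s (map (\<lambda>i. vs ! \<pi> (Suc i)) [0..<length \<beta>s])))"
proof -
  let ?n = "length \<beta>s"
  let ?S = "{\<pi>. \<pi> permutes {..<Suc ?n}}" and ?R = "{\<rho>. \<rho> permutes {..<?n}}"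
  let ?hat = "\<lambda>\<rho> i. case i of 0 \<Rightarrow> 0 | Suc j \<Rightarrow> Suc (\<rho> j)"
  have lift: "(\<Sum>\<pi>\<in>?S. of_int (sign \<pi>) * of_int (sign \<rho>) * (\<gamma> (vs ! \<pi> 0) * (\<Prod>i<?n. (\<beta>s ! i) (vs ! \<pi> (Suc (\<rho> i))))))
      = wedge (\<gamma> # \<beta>s) vs" if \<rho>: "\<rho> permutes {..<?n}" for \<rho>
  proof -
    have "permutation (?hat \<rho>)" using permutes_Suc_lift(1)[OF \<rho>] by (auto simp: permutation_permutes)
    then have "of_int (sign \<pi>) * of_int (sign \<rho>) = real_of_int (sign (\<pi> \<circ> ?hat \<rho>))" if "\<pi> \<in> ?S" for \<pi>
      using that permutes_Suc_lift(2)[OF \<rho>] by (subst sign_compose) (auto simp: permutation_permutes)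
    then have "(\<Sum>\<pi>\<in>?S. of_int (sign \<pi>) * of_int (sign \<rho>) * (\<gamma> (vs ! \<pi> 0) * (\<Prod>i<?n. (\<beta>s ! i) (vs ! \<pi> (Suc (\<rho> i))))))
      = (\<Sum>\<pi>\<in>?S. (\<lambda>\<pi>. of_int (sign \<pi>) * (\<gamma> (vs ! \<pi> 0) * (\<Prod>i<?n. (\<beta>s ! i) (vs ! \<pi> (Suc i))))) (\<pi> \<circ> ?hat \<rho>))"
      by (intro sum.cong) auto
    also have "\<dots> = wedge (\<gamma> # \<beta>s) vs"
      unfolding wedge_Cons_def by (rule sum_permutations_compose_right[OF permutes_Suc_lift(1)[OF \<rho>], symmetric])
    finally show ?thesis .
  qed
  have "(\<Sum>\<pi>\<in>?S. of_int (sign \<pi>) * (\<gamma> (vs ! \<pi> 0) * wedge \<beta>s (map (\<lambda>i. vs ! \<pi> (Suc i)) [0..<?n])))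
     = (\<Sum>\<pi>\<in>?S. \<Sum>\<rho>\<in>?R. of_int (sign \<pi>) * of_int (sign \<rho>) *
         (\<gamma> (vs ! \<pi> 0) * (\<Prod>i<?n. (\<beta>s ! i) (vs ! \<pi> (Suc (\<rho> i))))))"
  proof (intro sum.cong refl)
    fix \<pi>
    have nth: "map (\<lambda>i. vs ! \<pi> (Suc i)) [0..<?n] ! \<rho> i = vs ! \<pi> (Suc (\<rho> i))" if "\<rho> \<in> ?R" "i < ?n" for \<rho> i
      using that permutes_in_image[of \<rho> "{..<?n}" i] by simp
    show "of_int (sign \<pi>) * (\<gamma> (vs ! \<pi> 0) * wedge \<beta>s (map (\<lambda>i. vs ! \<pi> (Suc i)) [0..<?n])) =
      (\<Sum>\<rho>\<in>?R. of_int (sign \<pi>) * of_int (sign \<rho>) * (\<gamma> (vs ! \<pi> 0) * (\<Prod>i<?n. (\<beta>s ! i) (vs ! \<pi> (Suc (\<rho> i))))))"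
      unfolding wedge_def sum_distrib_left by (intro sum.cong refl) (simp add: nth del: nth_map)
  qed
  also have "\<dots> = (\<Sum>\<rho>\<in>?R. wedge (\<gamma> # \<beta>s) vs)"
    by (subst sum.swap) (intro sum.cong lift, auto)
  also have "\<dots> = fact ?n * wedge (\<gamma> # \<beta>s) vs"
    by (simp add: card_permutations)
  finally show ?thesis ..
qed

text \<open>Only permutations that send the first covector to the first vector contribute; they are
  the lifts of the permutations of the remaining slots.\<close>

lemma wedge_Cons_vanishing:
  assumes "\<And>j. j < length \<beta>s \<Longrightarrow> \<gamma> (us ! j) = 0"
  shows "wedge (\<gamma> # \<beta>s) (v # us) = \<gamma> v * wedge \<beta>s us"
proof -
  let ?n = "length \<beta>s"
  let ?S = "{\<pi>. \<pi> permutes {..<Suc ?n}}" and ?R = "{\<rho>. \<rho> permutes {..<?n}}"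
  let ?hat = "\<lambda>\<rho> i. case i of 0 \<Rightarrow> 0 | Suc j \<Rightarrow> Suc (\<rho> j)"
  let ?f = "\<lambda>\<pi>. of_int (sign \<pi>) * (\<gamma> ((v # us) ! \<pi> 0) * (\<Prod>i<?n. (\<beta>s ! i) ((v # us) ! \<pi> (Suc i))))"
  have img: "?hat ` ?R = {\<pi>\<in>?S. \<pi> 0 = 0}"
  proof (intro equalityI subsetI)
    fix \<pi> assume "\<pi> \<in> {\<pi>\<in>?S. \<pi> 0 = 0}"
    then have \<pi>: "\<pi> permutes {..<Suc ?n}" "\<pi> 0 = 0" by auto
    have nz: "\<pi> (Suc i) \<noteq> 0" for i using \<pi> permutes_inj[OF \<pi>(1)] by (metis injD nat.distinct(1))
    define \<rho> where "\<rho> i = \<pi> (Suc i) - 1" for i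
    have S: "Suc (\<rho> i) = \<pi> (Suc i)" for i using nz[of i] by (simp add: \<rho>_def)
    have "inj \<rho>" using permutes_inj[OF \<pi>(1)] S by (metis (no_types, lifting) injD injI Suc_inject)
    moreover have "\<rho> i = i" if "i \<notin> {..<?n}" for i using permutes_not_in[OF \<pi>(1), of "Suc i"] that by (simp add: \<rho>_def)
    moreover have "\<rho> i \<in> {..<?n}" if "i \<in> {..<?n}" for i
      using permutes_in_image[OF \<pi>(1), of "Suc i"] that S[of i] by simp
    ultimately have "\<rho> permutes {..<?n}"
      by (intro inj_imp_permutes[of _ "{..<?n}"]) (auto intro: inj_on_subset)
    moreover have "\<pi> = ?hat \<rho>" using S \<pi>(2) by (auto simp: fun_eq_iff split: nat.split)
    ultimately show "\<pi> \<in> ?hat ` ?R" by blast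
  qed (use permutes_Suc_lift(1) in auto)
  have inj: "inj_on ?hat ?R"
    by (rule inj_onI) (metis (no_types, lifting) ext nat.case(2) nat.inject)
  have "wedge (\<gamma> # \<beta>s) (v # us) = (\<Sum>\<pi>\<in>{\<pi>\<in>?S. \<pi> 0 = 0}. ?f \<pi>)"
    unfolding wedge_Cons_def
  proof (intro sum.mono_neutral_right ballI)
    fix \<pi> assume "\<pi> \<in> ?S - {\<pi>\<in>?S. \<pi> 0 = 0}"
    then have "\<pi> 0 \<noteq> 0" "\<pi> 0 < Suc ?n" using permutes_in_image[of \<pi> "{..<Suc ?n}" 0] by auto
    then have "\<gamma> ((v # us) ! \<pi> 0) = 0" using assms by (cases "\<pi> 0") auto
    then show "?f \<pi> = 0" by simp
  qed (auto intro: finite_permutations)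
  also have "\<dots> = (\<Sum>\<rho>\<in>?R. ?f (?hat \<rho>))"
    unfolding img[symmetric] by (subst sum.reindex[OF inj]) simp
  also have "\<dots> = (\<Sum>\<rho>\<in>?R. \<gamma> v * (of_int (sign \<rho>) * (\<Prod>i<?n. (\<beta>s ! i) (us ! \<rho> i))))"
    by (intro sum.cong refl) (simp add: permutes_Suc_lift(2))
  finally show ?thesis by (simp add: wedge_def sum_distrib_left)
qed

subsection \<open>Wedge products indexed by the coordinates of the base\<close>

lemma base_indices: "set (base_indices :: 'n::{finite,linorder} list) = UNIV" "distinct (base_indices :: 'n list)"
  "length (base_indices :: 'n list) = CARD('n)"
  by (simp_all add: base_indices_def)

lemma bij_base_indices: "bij_betw ((!) (base_indices :: 'n::{finite,linorder} list)) {..<CARD('n)} UNIV"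
  by (rule bij_betw_nth) (simp_all add: base_indices)

lemma length_eq_map_base_indices:
  assumes "length vs = CARD('n::{finite,linorder})"
  obtains G :: "'n::{finite,linorder} \<Rightarrow> 'v" where "vs = map G base_indices"
proof
  let ?i = "inv_into {..<CARD('n)} ((!) (base_indices :: 'n list))"
  show "vs = map (\<lambda>\<nu>. vs ! ?i \<nu>) (base_indices :: 'n list)"
    using assms bij_base_indices[where 'n = 'n]
    by (auto intro!: nth_equalityI simp: base_indices(3) bij_betw_inv_into_left)
qed

text \<open>\<open>wedge\<close> permutes list positions and \<open>det\<close> permutes the index
  type; conjugation with the enumeration \<open>base_indices\<close> matches the permutations and
  their signs.\<close>

lemma wedge_map_base_indices:
  "wedge (map F base_indices) (map G base_indices) = det (\<chi> \<mu> \<nu>. F \<mu> (G \<nu>))"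
  for F :: "'n::{finite,linorder} \<Rightarrow> 'v \<Rightarrow> real"
proof -
  let ?b = "(!) (base_indices :: 'n list)" and ?N = "{..<CARD('n)}"
  note bij = bij_base_indices[where 'n = 'n]
  have inj: "inj_on ?b ?N" using bij by (simp add: bij_betw_def)
  let ?f = "\<lambda>\<pi>. of_int (sign \<pi>) * (\<Prod>i<CARD('n). F (?b i) (G (?b (\<pi> i))))"
  have "wedge (map F base_indices) (map G base_indices) = (\<Sum>\<pi> | \<pi> permutes ?N. ?f \<pi>)"
  proof -
    have "\<pi> i < CARD('n)" if "\<pi> permutes ?N" "i < CARD('n)" for \<pi> i
      using that permutes_in_image[of \<pi> ?N i] by simp
    then show ?thesis unfolding wedge_def length_map base_indices(3)
      by (intro sum.cong refl arg_cong2[where f = "(*)"] prod.cong) (simp_all add: base_indices(3))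
  qed
  also have "\<dots> = (\<Sum>p | p permutes UNIV. of_int (sign p) * (\<Prod>\<mu>\<in>UNIV. F \<mu> (G (p \<mu>))))"
  proof (rule sum.reindex_bij_witness[of _ "map_permutation UNIV (inv_into ?N ?b)" "map_permutation ?N ?b"])
    fix \<pi> assume "\<pi> \<in> {\<pi>. \<pi> permutes ?N}"
    then have \<pi>: "\<pi> permutes ?N" by simp
    show "map_permutation UNIV (inv_into ?N ?b) (map_permutation ?N ?b \<pi>) = \<pi>"
      by (rule map_permutation_compose_inv[OF bij \<pi>]) (simp add: bij_betw_inv_into_left[OF bij])
    show "map_permutation ?N ?b \<pi> \<in> {p. p permutes UNIV}"
      using map_permutation_permutes[OF bij \<pi>] by simp
    have "(\<Prod>\<mu>\<in>UNIV. F \<mu> (G (map_permutation ?N ?b \<pi> \<mu>))) = (\<Prod>i\<in>?N. F (?b i) (G (map_permutation ?N ?b \<pi> (?b i))))"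
      by (rule prod.reindex_bij_betw[OF bij, symmetric])
    also have "\<dots> = (\<Prod>i<CARD('n). F (?b i) (G (?b (\<pi> i))))"
      by (intro prod.cong refl) (simp add: map_permutation_apply[OF inj])
    finally show "of_int (sign (map_permutation ?N ?b \<pi>)) * (\<Prod>\<mu>\<in>UNIV. F \<mu> (G (map_permutation ?N ?b \<pi> \<mu>))) = ?f \<pi>"
      using sign_map_permutation[OF inj \<pi>] by simp
  next
    fix p assume "p \<in> {p. p permutes (UNIV :: 'n set)}"
    then have p: "p permutes (UNIV :: 'n set)" by simp
    show "map_permutation ?N ?b (map_permutation UNIV (inv_into ?N ?b) p) = p"
      by (rule map_permutation_compose_inv[OF bij_betw_inv_into[OF bij] p]) (simp add: bij_betw_inv_into_right[OF bij])
    show "map_permutation UNIV (inv_into ?N ?b) p \<in> {\<pi>. \<pi> permutes ?N}"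
      using map_permutation_permutes[OF bij_betw_inv_into[OF bij] p] by simp
  qed
  finally show ?thesis by (simp add: det_def)
qed

lemma volume_map: "volume (map G base_indices) = det (\<chi> \<mu> \<nu>. G \<nu> $ \<mu>)"
  for G :: "'n::{finite,linorder} \<Rightarrow> (real, 'n) vec"
  unfolding volume_def by (rule wedge_map_base_indices)

lemma wedge_replace_comb:
  fixes \<xi> :: "'n::{finite,linorder} \<Rightarrow> 'v \<Rightarrow> real"
  assumes "length us = CARD('n)" "\<And>u. u \<in> set us \<Longrightarrow> \<beta> u = (\<Sum>\<nu>\<in>UNIV. b $ \<nu> * \<xi> \<nu> u)"
  shows "wedge (map (\<lambda>\<nu>. if \<nu> = \<kappa> then \<beta> else \<xi> \<nu>) base_indices) us = b $ \<kappa> * wedge (map \<xi> base_indices) us"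
proof -
  obtain G :: "'n \<Rightarrow> 'v" where us: "us = map G base_indices" using length_eq_map_base_indices[OF assms(1)] by blast
  let ?M = "(\<chi> \<mu> \<nu>. \<xi> \<mu> (G \<nu>)) :: ((real, 'n) vec, 'n) vec"
  have "(\<chi> \<mu> \<nu>. (if \<mu> = \<kappa> then \<beta> else \<xi> \<mu>) (G \<nu>)) = set_row \<kappa> (\<Sum>i\<in>UNIV. b $ i *\<^sub>R ?M $ i) ?M"
    using assms(2) by (auto simp: vec_eq_iff us base_indices(1))
  then show ?thesis unfolding us wedge_map_base_indices by (simp only: det_set_row_comb)
qed

text \<open>Both formulas evaluate a wedge product on \<open>X, u\<^sub>1, \<dots>, u\<^sub>n\<close> where on the \<open>u\<^sub>j\<close> all covectors are
  combinations of \<open>\<xi>\<^sup>1, \<dots>, \<xi>\<^sup>n\<close>: only the part of \<open>X\<close> transversal to them contributes.\<close>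

lemma wedge_transversal:
  fixes \<xi> :: "'n::{finite,linorder} \<Rightarrow> 'v \<Rightarrow> real"
  assumes len: "length us = CARD('n)" and \<gamma>: "\<And>u. u \<in> set us \<Longrightarrow> \<gamma> u = (\<Sum>\<nu>\<in>UNIV. g $ \<nu> * \<xi> \<nu> u)"
  shows "wedge (\<gamma> # map \<xi> base_indices) (X # us) =
    (\<gamma> X - (\<Sum>\<nu>\<in>UNIV. g $ \<nu> * \<xi> \<nu> X)) * wedge (map \<xi> base_indices) us" (is ?A)
    and "(\<And>u. u \<in> set us \<Longrightarrow> \<beta> u = (\<Sum>\<nu>\<in>UNIV. b $ \<nu> * \<xi> \<nu> u)) \<Longrightarrow>
    wedge (\<gamma> # map (\<lambda>\<nu>. if \<nu> = \<kappa> then \<beta> else \<xi> \<nu>) base_indices) (X # us) =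
    ((\<gamma> X - (\<Sum>\<nu>\<in>UNIV. g $ \<nu> * \<xi> \<nu> X)) * b $ \<kappa> - g $ \<kappa> * (\<beta> X - (\<Sum>\<nu>\<in>UNIV. b $ \<nu> * \<xi> \<nu> X)))
      * wedge (map \<xi> base_indices) us"
proof -
  note b3 = base_indices(3)[where 'n = 'n]
  \<comment> \<open>The vectors carry no linear structure, so a covector vanishing on
    \<open>us\<close> is written as a multiple of the indicator function of \<open>X\<close>; this
    works when \<open>X\<close> is not among \<open>us\<close>.\<close>
  define \<theta> where "\<theta> v = (if v = X then 1 else 0 :: real)" for v
  have idx: "\<exists>i<CARD('n). (base_indices :: 'n list) ! i = \<nu>" for \<nu>
    using base_indices(1)[where 'n = 'n] b3 by (metis UNIV_I in_set_conv_nth)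
  have split: "wedge (\<gamma>' # map F base_indices) (X # us) = (\<gamma>' X - (\<Sum>\<nu>\<in>UNIV. g' $ \<nu> * \<xi> \<nu> X)) * wedge (map F base_indices) us
      + (\<Sum>\<nu>\<in>UNIV. g' $ \<nu> * wedge (\<xi> \<nu> # map F base_indices) (X # us))"
    if X: "X \<notin> set us" and \<gamma>': "\<And>u. u \<in> set us \<Longrightarrow> \<gamma>' u = (\<Sum>\<nu>\<in>UNIV. g' $ \<nu> * \<xi> \<nu> u)" for \<gamma>' g' and F :: "'n \<Rightarrow> 'v \<Rightarrow> real"
  proof -
    have "wedge (\<gamma>' # map F base_indices) (X # us) = (\<gamma>' X - (\<Sum>\<nu>\<in>UNIV. g' $ \<nu> * \<xi> \<nu> X)) * wedge (\<theta> # map F base_indices) (X # us)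
      + (\<Sum>\<nu>\<in>UNIV. g' $ \<nu> * wedge (\<xi> \<nu> # map F base_indices) (X # us))"
      using \<gamma>' X len b3 by (intro wedge_Cons_sum) (auto simp: \<theta>_def)
    moreover have "wedge (\<theta> # map F base_indices) (X # us) = \<theta> X * wedge (map F base_indices) us"
      using X len b3 by (intro wedge_Cons_vanishing) (auto simp: \<theta>_def)
    ultimately show ?thesis by (simp add: \<theta>_def)
  qed
  have A: "wedge (\<gamma>' # map \<xi> base_indices) (X # us) =
    (\<gamma>' X - (\<Sum>\<nu>\<in>UNIV. g' $ \<nu> * \<xi> \<nu> X)) * wedge (map \<xi> base_indices) us"
    if X: "X \<notin> set us" and \<gamma>': "\<And>u. u \<in> set us \<Longrightarrow> \<gamma>' u = (\<Sum>\<nu>\<in>UNIV. g' $ \<nu> * \<xi> \<nu> u)" for \<gamma>' g'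
  proof -
    have "wedge (\<xi> \<nu> # map \<xi> base_indices) (X # us) = 0" for \<nu>
    proof -
      obtain i where "i < CARD('n)" "(base_indices :: 'n list) ! i = \<nu>" using idx by blast
      then show ?thesis using b3 by (intro wedge_equal_covectors[of 0 _ "Suc i"]) auto
    qed
    then show ?thesis by (simp add: split[OF X \<gamma>'])
  qed
  \<comment> \<open>If \<open>X\<close> repeats one of \<open>us\<close>, the wedge vanishes, and so
    do the brackets on the right, because \<open>\<gamma>\<close> and \<open>\<beta>\<close> are
    then given by their combinations at \<open>X\<close> too.\<close>
  have dup: "wedge (\<gamma>' # map F base_indices) (X # us) = 0" if X: "X \<in> set us" for \<gamma>' and F :: "'n \<Rightarrow> 'v \<Rightarrow> real"
  proof -
    obtain j where "j < length us" "us ! j = X" using X by (auto simp: in_set_conv_nth)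
    then show ?thesis using len b3 by (intro wedge_equal_vectors[of 0 _ "Suc j"]) auto
  qed
  show ?A
  proof (cases "X \<in> set us")
    case True
    then show ?thesis using \<gamma>[OF True] by (simp only: dup) simp
  qed (rule A[OF _ \<gamma>])
  assume \<beta>: "\<And>u. u \<in> set us \<Longrightarrow> \<beta> u = (\<Sum>\<nu>\<in>UNIV. b $ \<nu> * \<xi> \<nu> u)"
  show "wedge (\<gamma> # map (\<lambda>\<nu>. if \<nu> = \<kappa> then \<beta> else \<xi> \<nu>) base_indices) (X # us) =
    ((\<gamma> X - (\<Sum>\<nu>\<in>UNIV. g $ \<nu> * \<xi> \<nu> X)) * b $ \<kappa> - g $ \<kappa> * (\<beta> X - (\<Sum>\<nu>\<in>UNIV. b $ \<nu> * \<xi> \<nu> X)))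
      * wedge (map \<xi> base_indices) us"
  proof (cases "X \<in> set us")
    case True
    then show ?thesis using \<gamma>[OF True] \<beta>[OF True] by (simp only: dup) simp
  next
    case False
    let ?F = "\<lambda>\<nu>. if \<nu> = \<kappa> then \<beta> else \<xi> \<nu>"
    \<comment> \<open>After the first covector is expanded, \<xi> \<nu> occurs twice unless \<nu> =
      \<kappa>; in that case exchanging it with \<open>\<beta>\<close> restores the full list of the
      \<xi> at the cost of a sign.\<close>
    have terms: "wedge (\<xi> \<nu> # map ?F base_indices) (X # us) =
       (if \<nu> = \<kappa> then - ((\<beta> X - (\<Sum>\<nu>\<in>UNIV. b $ \<nu> * \<xi> \<nu> X)) * wedge (map \<xi> base_indices) us) else 0)" for \<nu>
    proof -
      obtain i where i: "i < CARD('n)" "(base_indices :: 'n list) ! i = \<nu>" using idx by blast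
      show ?thesis
      proof (cases "\<nu> = \<kappa>")
        case True
        have "(\<xi> \<kappa> # map ?F base_indices)[0 := \<beta>, Suc i := \<xi> \<kappa>] = \<beta> # map \<xi> base_indices"
        proof (rule nth_equalityI)
          fix j assume "j < length ((\<xi> \<kappa> # map ?F base_indices)[0 := \<beta>, Suc i := \<xi> \<kappa>])"
          then show "(\<xi> \<kappa> # map ?F base_indices)[0 := \<beta>, Suc i := \<xi> \<kappa>] ! j = (\<beta> # map \<xi> base_indices) ! j"
            using i True b3 base_indices(2)[where 'n = 'n]
            by (cases j) (auto simp: nth_list_update nth_eq_iff_index_eq)
        qed simp
        then have "- wedge (\<xi> \<kappa> # map ?F base_indices) (X # us) = wedge (\<beta> # map \<xi> base_indices) (X # us)"
          using wedge_swap_covectors[of 0 "\<xi> \<kappa> # map ?F base_indices" "Suc i" "X # us"] i True b3 by simp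
        then show ?thesis using A[OF False \<beta>] True by simp
      next
        case ne: False
        then show ?thesis using i b3 by simp (intro wedge_equal_covectors[of 0 _ "Suc i"], auto)
      qed
    qed
    have "wedge (map ?F base_indices) us = b $ \<kappa> * wedge (map \<xi> base_indices) us"
      by (rule wedge_replace_comb[OF len \<beta>])
    moreover have "(\<Sum>\<nu>\<in>UNIV. g $ \<nu> * wedge (\<xi> \<nu> # map ?F base_indices) (X # us)) =
      g $ \<kappa> * - ((\<beta> X - (\<Sum>\<nu>\<in>UNIV. b $ \<nu> * \<xi> \<nu> X)) * wedge (map \<xi> base_indices) us)"
      unfolding terms by (simp add: if_distrib[of "\<lambda>x. _ * x"] cong: if_cong)
    moreover have "wedge (\<gamma> # map ?F base_indices) (X # us) = (\<gamma> X - (\<Sum>\<nu>\<in>UNIV. g $ \<nu> * \<xi> \<nu> X)) * wedge (map ?F base_indices) us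
      + (\<Sum>\<nu>\<in>UNIV. g $ \<nu> * wedge (\<xi> \<nu> # map ?F base_indices) (X # us))"
      by (rule split[OF False \<gamma>])
    ultimately show ?thesis by (simp only:) (simp add: algebra_simps)
  qed
qed

subsection \<open>Exterior derivatives commute with pull-backs\<close>

text \<open>Leibniz rule with constant covectors and moving vectors. For each permutation the sum
  over factors becomes a sum over vector slots through \<open>l = \<pi> i\<close>.\<close>

lemma wedge_has_derivative:
  assumes "\<And>\<beta>. \<beta> \<in> set \<beta>s \<Longrightarrow> bounded_linear \<beta>" "\<And>j. j < length \<beta>s \<Longrightarrow> (g j has_derivative g' j) (at y)"
  shows "((\<lambda>y. wedge \<beta>s (map (\<lambda>j. g j y) [0..<length \<beta>s])) has_derivative
    (\<lambda>v. \<Sum>l<length \<beta>s. wedge \<beta>s ((map (\<lambda>j. g j y) [0..<length \<beta>s])[l := g' l v]))) (at y)"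
proof -
  let ?n = "length \<beta>s" let ?S = "{\<pi>. \<pi> permutes {..<?n}}"
  have in_n: "\<pi> i < ?n" if "\<pi> \<in> ?S" "i < ?n" for \<pi> i
    using that permutes_in_image[of \<pi> "{..<?n}" i] by simp
  have bl: "bounded_linear (\<beta>s ! i)" if "i < ?n" for i using that by (intro assms(1)) auto
  have "((\<lambda>y. \<Sum>\<pi>\<in>?S. of_int (sign \<pi>) * (\<Prod>i<?n. (\<beta>s ! i) (g (\<pi> i) y))) has_derivative
     (\<lambda>v. \<Sum>\<pi>\<in>?S. of_int (sign \<pi>) * (\<Sum>i<?n. (\<beta>s ! i) (g' (\<pi> i) v) * (\<Prod>j\<in>{..<?n} - {i}. (\<beta>s ! j) (g (\<pi> j) y))))) (at y)"
  proof (rule has_derivative_sum, rule has_derivative_mult_right, rule has_derivative_prod)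
    fix \<pi> i assume "\<pi> \<in> ?S" "i \<in> {..<?n}"
    then show "((\<lambda>y. (\<beta>s ! i) (g (\<pi> i) y)) has_derivative (\<lambda>v. (\<beta>s ! i) (g' (\<pi> i) v))) (at y)"
      using in_n by (intro bounded_linear.has_derivative[OF bl assms(2)]) auto
  qed
  moreover have "(\<Sum>\<pi>\<in>?S. of_int (sign \<pi>) * (\<Sum>i<?n. (\<beta>s ! i) (g' (\<pi> i) v) * (\<Prod>j\<in>{..<?n} - {i}. (\<beta>s ! j) (g (\<pi> j) y))))
     = (\<Sum>l<?n. wedge \<beta>s ((map (\<lambda>j. g j y) [0..<?n])[l := g' l v]))" for v
  proof -
    have "(\<Sum>i<?n. (\<beta>s ! i) (g' (\<pi> i) v) * (\<Prod>j\<in>{..<?n} - {i}. (\<beta>s ! j) (g (\<pi> j) y))) =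
       (\<Sum>l<?n. \<Prod>i<?n. (\<beta>s ! i) ((map (\<lambda>j. g j y) [0..<?n])[l := g' l v] ! \<pi> i))" if \<pi>: "\<pi> \<in> ?S" for \<pi>
    proof -
      have "(\<Sum>i<?n. (\<beta>s ! i) (g' (\<pi> i) v) * (\<Prod>j\<in>{..<?n} - {i}. (\<beta>s ! j) (g (\<pi> j) y))) =
         (\<Sum>i<?n. (\<Prod>j<?n. (\<beta>s ! j) ((map (\<lambda>j. g j y) [0..<?n])[\<pi> i := g' (\<pi> i) v] ! \<pi> j)))"
      proof (intro sum.cong refl)
        fix i assume i: "i \<in> {..<?n}"
        have "\<pi> i \<noteq> \<pi> j" if "j \<noteq> i" for j using \<pi> that permutes_inj by (metis injD mem_Collect_eq)
        then show "(\<beta>s ! i) (g' (\<pi> i) v) * (\<Prod>j\<in>{..<?n} - {i}. (\<beta>s ! j) (g (\<pi> j) y)) =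
          (\<Prod>j<?n. (\<beta>s ! j) ((map (\<lambda>j. g j y) [0..<?n])[\<pi> i := g' (\<pi> i) v] ! \<pi> j))"
          using i in_n[OF \<pi>] by (subst (2) prod.remove[of _ i]) (auto intro!: prod.cong)
      qed
      also have "\<dots> = (\<Sum>l<?n. \<Prod>i<?n. (\<beta>s ! i) ((map (\<lambda>j. g j y) [0..<?n])[l := g' l v] ! \<pi> i))"
        using \<pi> by (intro sum.reindex_bij_betw[of \<pi>] permutes_imp_bij) simp
      finally show ?thesis .
    qed
    then have "(\<Sum>\<pi>\<in>?S. of_int (sign \<pi>) * (\<Sum>i<?n. (\<beta>s ! i) (g' (\<pi> i) v) * (\<Prod>j\<in>{..<?n} - {i}. (\<beta>s ! j) (g (\<pi> j) y)))) =
      (\<Sum>\<pi>\<in>?S. \<Sum>l<?n. of_int (sign \<pi>) * (\<Prod>i<?n. (\<beta>s ! i) ((map (\<lambda>j. g j y) [0..<?n])[l := g' l v] ! \<pi> i)))"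
      by (simp add: sum_distrib_left)
    also have "\<dots> = (\<Sum>l<?n. wedge \<beta>s ((map (\<lambda>j. g j y) [0..<?n])[l := g' l v]))"
      unfolding wedge_def by (rule sum.swap)
    finally show ?thesis .
  qed
  moreover have "wedge \<beta>s (map (\<lambda>j. g j y) [0..<?n]) = (\<Sum>\<pi>\<in>?S. of_int (sign \<pi>) * (\<Prod>i<?n. (\<beta>s ! i) (g (\<pi> i) y)))" for y
    unfolding wedge_def using in_n by (intro sum.cong refl arg_cong2[where f = "(*)"] prod.cong) auto
  ultimately show ?thesis by simp
qed

text \<open>The covectors in \<open>\<beta>\<close> and \<open>\<beta>'\<close> are constant, so
  taking the exterior derivative amounts to differentiating the coefficients. The identity
  \<open>eq\<close> is differentiated in the direction of one vector with the others held fixed, and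
  the result is antisymmetrised with \<open>wedge_Cons_expand\<close>.\<close>

lemma exterior_derivative_pull_back:
  fixes T :: "'a::euclidean_space \<Rightarrow> 'b::euclidean_space"
  assumes T: "smooth_on U T" and y: "y \<in> U"
    and \<beta>: "\<And>i. i \<in> I \<Longrightarrow> length (\<beta> i) = n"
    and \<beta>': "\<And>j. j \<in> J \<Longrightarrow> length (\<beta>' j) = n" "\<And>j b. j \<in> J \<Longrightarrow> b \<in> set (\<beta>' j) \<Longrightarrow> bounded_linear b"
    and c: "\<And>i. i \<in> I \<Longrightarrow> (c i has_derivative D i) (at y)"
    and c': "\<And>j. j \<in> J \<Longrightarrow> (c' j has_derivative D' j) (at (T y))"
    and eq: "\<And>z ws. z \<in> U \<Longrightarrow> length ws = n \<Longrightarrow> (\<Sum>i\<in>I. c i z * wedge (\<beta> i) ws) =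
        (\<Sum>j\<in>J. c' j (T z) * wedge (\<beta>' j) (map (frechet_derivative T (at z)) ws))"
    and vs: "length vs = Suc n"
  shows "(\<Sum>i\<in>I. wedge (D i # \<beta> i) vs) = (\<Sum>j\<in>J. wedge (D' j # \<beta>' j) (map (frechet_derivative T (at y)) vs))"
proof -
  let ?S = "{\<pi>. \<pi> permutes {..<Suc n}}"
  define DT where "DT z = frechet_derivative T (at z)" for z
  define H where "H u w = frechet_derivative (\<lambda>z. DT z u) (at y) w" for u w
  have H_sym: "H u w = H w u" for u w
    unfolding H_def DT_def by (rule second_derivative_symmetric[OF T y])
  have DT: "((\<lambda>z. DT z u) has_derivative H u) (at y)" for u
    unfolding H_def DT_def by (rule smooth_on_has_derivative[OF smooth_on_frechet1[OF T] y])
  define w where "w \<pi> = map (\<lambda>i. vs ! \<pi> (Suc i)) [0..<n]" for \<pi>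
  \<comment> \<open>The part in which the derivative hits a moving vector \<open>DT z u\<close>,
    that is, where a second derivative of \<open>T\<close> enters.\<close>
  define R where "R \<pi> l = (\<Sum>j\<in>J. c' j (T y) * wedge (\<beta>' j)
      ((map (\<lambda>i. DT y (vs ! \<pi> (Suc i))) [0..<n])[l := H (vs ! \<pi> (Suc l)) (vs ! \<pi> 0)]))" for \<pi> l
  have in_n: "\<pi> i < Suc n" if "\<pi> \<in> ?S" "i < Suc n" for \<pi> i
    using that permutes_in_image[of \<pi> "{..<Suc n}" i] by simp
  have deriv: "(\<Sum>i\<in>I. D i (vs ! \<pi> 0) * wedge (\<beta> i) (w \<pi>)) =
     (\<Sum>j\<in>J. D' j (DT y (vs ! \<pi> 0)) * wedge (\<beta>' j) (map (DT y) (w \<pi>))) + (\<Sum>l<n. R \<pi> l)" for \<pi>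
  proof -
    have A: "((\<lambda>z. \<Sum>i\<in>I. c i z * wedge (\<beta> i) (w \<pi>)) has_derivative (\<lambda>v. \<Sum>i\<in>I. D i v * wedge (\<beta> i) (w \<pi>))) (at y)"
      by (intro has_derivative_sum has_derivative_mult_left c)
    have B: "((\<lambda>z. \<Sum>j\<in>J. c' j (T z) * wedge (\<beta>' j) (map (\<lambda>i. DT z (vs ! \<pi> (Suc i))) [0..<n])) has_derivative
      (\<lambda>v. \<Sum>j\<in>J. c' j (T y) * (\<Sum>l<n. wedge (\<beta>' j) ((map (\<lambda>i. DT y (vs ! \<pi> (Suc i))) [0..<n])[l := H (vs ! \<pi> (Suc l)) v]))
        + D' j (DT y v) * wedge (\<beta>' j) (map (\<lambda>i. DT y (vs ! \<pi> (Suc i))) [0..<n]))) (at y)"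
    proof (intro has_derivative_sum has_derivative_mult)
      fix j assume j: "j \<in> J"
      show "((\<lambda>z. c' j (T z)) has_derivative (\<lambda>v. D' j (DT y v))) (at y)"
        unfolding DT_def by (rule has_derivative_compose[OF smooth_on_has_derivative[OF T y] c'[OF j]])
      show "((\<lambda>z. wedge (\<beta>' j) (map (\<lambda>i. DT z (vs ! \<pi> (Suc i))) [0..<n])) has_derivative
        (\<lambda>v. \<Sum>l<n. wedge (\<beta>' j) ((map (\<lambda>i. DT y (vs ! \<pi> (Suc i))) [0..<n])[l := H (vs ! \<pi> (Suc l)) v]))) (at y)"
        using wedge_has_derivative[of "\<beta>' j" "\<lambda>i z. DT z (vs ! \<pi> (Suc i))" "\<lambda>i. H (vs ! \<pi> (Suc i))" y]
          \<beta>'(2)[OF j] DT \<beta>'(1)[OF j] by simp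
    qed
    have "(\<Sum>i\<in>I. c i z * wedge (\<beta> i) (w \<pi>)) =
        (\<Sum>j\<in>J. c' j (T z) * wedge (\<beta>' j) (map (\<lambda>i. DT z (vs ! \<pi> (Suc i))) [0..<n]))" if "z \<in> U" for z
      using eq[OF that, of "w \<pi>"] by (simp add: w_def DT_def o_def)
    from has_derivative_unique[OF has_derivative_transform_within_open[OF A smooth_onD_open[OF T] y this] B]
    have "(\<lambda>v. \<Sum>i\<in>I. D i v * wedge (\<beta> i) (w \<pi>)) =
      (\<lambda>v. \<Sum>j\<in>J. c' j (T y) * (\<Sum>l<n. wedge (\<beta>' j) ((map (\<lambda>i. DT y (vs ! \<pi> (Suc i))) [0..<n])[l := H (vs ! \<pi> (Suc l)) v]))
        + D' j (DT y v) * wedge (\<beta>' j) (map (\<lambda>i. DT y (vs ! \<pi> (Suc i))) [0..<n]))"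
      .
    from fun_cong[OF this, of "vs ! \<pi> 0"] show ?thesis
      unfolding R_def by (subst sum.swap) (simp add: sum.distrib w_def o_def sum_distrib_left)
  qed
  \<comment> \<open>\<open>R\<close> is unchanged when the vectors in positions 0 and
    \<open>Suc l\<close> are exchanged, as \<open>H\<close> is symmetric, while the sign of the
    permutation flips.\<close>
  have cancel: "(\<Sum>\<pi>\<in>?S. of_int (sign \<pi>) * R \<pi> l) = 0" if l: "l < n" for l
  proof -
    let ?t = "Transposition.transpose 0 (Suc l)"
    have t: "?t permutes {..<Suc n}" using l by (intro permutes_swap_id) auto
    have "(\<Sum>\<pi>\<in>?S. of_int (sign \<pi>) * R \<pi> l) = (\<Sum>\<pi>\<in>?S. of_int (sign (\<pi> \<circ> ?t)) * R (\<pi> \<circ> ?t) l)"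
      by (rule sum_permutations_compose_right[OF t])
    also have "\<dots> = (\<Sum>\<pi>\<in>?S. - (of_int (sign \<pi>) * R \<pi> l))"
    proof (intro sum.cong refl)
      fix \<pi> assume "\<pi> \<in> ?S"
      then have "permutation \<pi>" by (auto simp: permutation_permutes)
      then have "sign (\<pi> \<circ> ?t) = - sign \<pi>"
        by (simp add: sign_compose permutation_swap_id sign_swap_id)
      moreover have "(map (\<lambda>i. DT y (vs ! (\<pi> \<circ> ?t) (Suc i))) [0..<n])[l := H (vs ! (\<pi> \<circ> ?t) (Suc l)) (vs ! (\<pi> \<circ> ?t) 0)] =
          (map (\<lambda>i. DT y (vs ! \<pi> (Suc i))) [0..<n])[l := H (vs ! \<pi> (Suc l)) (vs ! \<pi> 0)]"
        using l H_sym by (intro nth_equalityI) (auto simp: nth_list_update Transposition.transpose_def)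
      then have "R (\<pi> \<circ> ?t) l = R \<pi> l" unfolding R_def by (simp only:)
      ultimately show "of_int (sign (\<pi> \<circ> ?t)) * R (\<pi> \<circ> ?t) l = - (of_int (sign \<pi>) * R \<pi> l)" by simp
    qed
    finally show ?thesis by (simp add: sum_negf)
  qed
  have expand: "fact n * wedge (D i # \<beta> i) vs =
      (\<Sum>\<pi>\<in>?S. of_int (sign \<pi>) * (D i (vs ! \<pi> 0) * wedge (\<beta> i) (w \<pi>)))" if "i \<in> I" for i
    using wedge_Cons_expand[of "\<beta> i" "D i" vs] \<beta>[OF that] by (simp only: w_def)
  have expand': "fact n * wedge (D' j # \<beta>' j) (map (DT y) vs) = (\<Sum>\<pi>\<in>?S. of_int (sign \<pi>) *
      (D' j (map (DT y) vs ! \<pi> 0) * wedge (\<beta>' j) (map (\<lambda>i. map (DT y) vs ! \<pi> (Suc i)) [0..<n])))"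
    if "j \<in> J" for j
    using wedge_Cons_expand[of "\<beta>' j" "D' j" "map (DT y) vs"] \<beta>'(1)[OF that] by (simp only:)
  have "fact n * (\<Sum>i\<in>I. wedge (D i # \<beta> i) vs) =
     (\<Sum>i\<in>I. \<Sum>\<pi>\<in>?S. of_int (sign \<pi>) * (D i (vs ! \<pi> 0) * wedge (\<beta> i) (w \<pi>)))"
    unfolding sum_distrib_left by (intro sum.cong refl expand)
  also have "\<dots> = (\<Sum>\<pi>\<in>?S. of_int (sign \<pi>) * (\<Sum>i\<in>I. D i (vs ! \<pi> 0) * wedge (\<beta> i) (w \<pi>)))"
    by (subst sum.swap) (simp add: sum_distrib_left)
  also have "\<dots> = (\<Sum>\<pi>\<in>?S. of_int (sign \<pi>) * (\<Sum>j\<in>J. D' j (DT y (vs ! \<pi> 0)) * wedge (\<beta>' j) (map (DT y) (w \<pi>))))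
      + (\<Sum>\<pi>\<in>?S. \<Sum>l<n. of_int (sign \<pi>) * R \<pi> l)"
    unfolding deriv by (simp add: distrib_left sum.distrib sum_distrib_left)
  also have "(\<Sum>\<pi>\<in>?S. \<Sum>l<n. of_int (sign \<pi>) * R \<pi> l) = 0"
    by (subst sum.swap) (simp add: cancel)
  also have "(\<Sum>\<pi>\<in>?S. of_int (sign \<pi>) * (\<Sum>j\<in>J. D' j (DT y (vs ! \<pi> 0)) * wedge (\<beta>' j) (map (DT y) (w \<pi>)))) =
     (\<Sum>j\<in>J. \<Sum>\<pi>\<in>?S. of_int (sign \<pi>) * (D' j (map (DT y) vs ! \<pi> 0) *
        wedge (\<beta>' j) (map (\<lambda>i. map (DT y) vs ! \<pi> (Suc i)) [0..<n])))"
  proof (subst sum.swap, unfold sum_distrib_left, intro sum.cong refl)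
    fix \<pi> j assume \<pi>: "\<pi> \<in> ?S"
    have "map (DT y) (w \<pi>) = map (\<lambda>i. map (DT y) vs ! \<pi> (Suc i)) [0..<n]"
      unfolding w_def using in_n[OF \<pi>] vs by (intro nth_equalityI) auto
    moreover have "DT y (vs ! \<pi> 0) = map (DT y) vs ! \<pi> 0" using in_n[OF \<pi>, of 0] vs by simp
    ultimately show "of_int (sign \<pi>) * (D' j (DT y (vs ! \<pi> 0)) * wedge (\<beta>' j) (map (DT y) (w \<pi>))) =
       of_int (sign \<pi>) * (D' j (map (DT y) vs ! \<pi> 0) * wedge (\<beta>' j) (map (\<lambda>i. map (DT y) vs ! \<pi> (Suc i)) [0..<n]))"
      by simp
  qed
  also have "\<dots> = fact n * (\<Sum>j\<in>J. wedge (D' j # \<beta>' j) (map (DT y) vs))"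
    unfolding sum_distrib_left by (intro sum.cong refl expand'[symmetric])
  finally show ?thesis unfolding DT_def by simp
qed

section \<open>Charts, tangent vectors and the manifold topology\<close>

lemma smooth_atlas_inj: "smooth_atlas A \<Longrightarrow> c \<in> A \<Longrightarrow> inj_on (coords c) (dom_of c)"
  by (simp add: smooth_atlas_def)

lemma uncoords_coords:
  "smooth_atlas A \<Longrightarrow> c \<in> A \<Longrightarrow> p \<in> dom_of c \<Longrightarrow> uncoords c (coords c p) = p"
  by (simp add: uncoords_def smooth_atlas_inj inv_into_f_f)

lemma coords_uncoords: "y \<in> image_of c \<Longrightarrow> coords c (uncoords c y) = y"
  by (simp add: uncoords_def image_of_def f_inv_into_f)

lemma uncoords_in_dom: "y \<in> image_of c \<Longrightarrow> uncoords c y \<in> dom_of c"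
  by (simp add: uncoords_def image_of_def inv_into_into)

lemma coords_in_image: "p \<in> dom_of c \<Longrightarrow> coords c p \<in> image_of c"
  by (simp add: image_of_def)

lemma coords_image_iff:
  assumes "smooth_atlas A" "c \<in> A"
  shows "y \<in> coords c ` (dom_of c \<inter> S) \<longleftrightarrow> y \<in> image_of c \<and> uncoords c y \<in> S"
  using uncoords_coords[OF assms] coords_uncoords[of y c] uncoords_in_dom[of y c]
  by (force simp: image_of_def)

lemma transition_smooth:
  "smooth_atlas A \<Longrightarrow> c \<in> A \<Longrightarrow> d \<in> A \<Longrightarrow>
    smooth_on (coords c ` (dom_of c \<inter> dom_of d)) (coords d \<circ> uncoords c)"
  by (simp add: smooth_atlas_def)

lemma transition_has_derivative:
  assumes "smooth_atlas A" "c \<in> A" "d \<in> A" "p \<in> dom_of c" "p \<in> dom_of d"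
  shows "((coords d \<circ> uncoords c) has_derivative
    frechet_derivative (coords d \<circ> uncoords c) (at (coords c p))) (at (coords c p))"
  by (rule smooth_on_has_derivative[OF transition_smooth[OF assms(1-3)]]) (use assms in auto)

lemma transition_linear:
  assumes "smooth_atlas A" "c \<in> A" "d \<in> A" "p \<in> dom_of c" "p \<in> dom_of d"
  shows "linear (frechet_derivative (coords d \<circ> uncoords c) (at (coords c p)))"
  using transition_has_derivative[OF assms] by (rule has_derivative_linear)

lemma frechet_derivative_chain_open:
  assumes "open S" "x \<in> S" "\<And>y. y \<in> S \<Longrightarrow> h y = g (f y)"
    "f differentiable (at x)" "g differentiable (at (f x))"
  shows "frechet_derivative h (at x) v = frechet_derivative g (at (f x)) (frechet_derivative f (at x) v)"
  using frechet_derivative_cong_open[OF assms(1-3)] frechet_derivative_comp[OF assms(4,5)] by simp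

lemma transition_differentiable:
  assumes "smooth_atlas A" "c \<in> A" "d \<in> A" "p \<in> dom_of c" "p \<in> dom_of d"
  shows "(coords d \<circ> uncoords c) differentiable (at (coords c p))"
  using transition_has_derivative[OF assms] unfolding differentiable_def by blast

lemma transition_chain:
  assumes A: "smooth_atlas A" "c \<in> A" "d \<in> A" "e \<in> A" and p: "p \<in> dom_of c" "p \<in> dom_of d" "p \<in> dom_of e"
  shows "frechet_derivative (coords e \<circ> uncoords c) (at (coords c p)) v =
    frechet_derivative (coords e \<circ> uncoords d) (at (coords d p))
      (frechet_derivative (coords d \<circ> uncoords c) (at (coords c p)) v)"
proof -
  let ?S = "coords c ` (dom_of c \<inter> dom_of d) \<inter> coords c ` (dom_of c \<inter> dom_of e)"
  have op: "open ?S" using A by (intro open_Int smooth_onD_open[OF transition_smooth])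
  have in_S: "coords c p \<in> ?S" using p by blast
  have "(coords e \<circ> uncoords c) y = (coords e \<circ> uncoords d) ((coords d \<circ> uncoords c) y)" if "y \<in> ?S" for y
    using that A by (auto simp: coords_image_iff[OF A(1,2)] uncoords_coords[OF A(1,3)])
  then have "frechet_derivative (coords e \<circ> uncoords c) (at (coords c p)) v =
    frechet_derivative (coords e \<circ> uncoords d) (at ((coords d \<circ> uncoords c) (coords c p)))
      (frechet_derivative (coords d \<circ> uncoords c) (at (coords c p)) v)"
  proof (rule frechet_derivative_chain_open[OF op in_S])
    have "(coords d \<circ> uncoords c) (coords c p) = coords d p" by (simp add: uncoords_coords[OF A(1,2) p(1)])
    then show "(coords e \<circ> uncoords d) differentiable at ((coords d \<circ> uncoords c) (coords c p))"
      using transition_differentiable[OF A(1,3,4) p(2,3)] by (simp only:)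
  qed (assumption | rule transition_differentiable[OF A(1,2,3) p(1,2)])+
  then show ?thesis using A p by (simp add: uncoords_coords)
qed

lemma transition_id:
  assumes "smooth_atlas A" "c \<in> A" "p \<in> dom_of c"
  shows "frechet_derivative (coords c \<circ> uncoords c) (at (coords c p)) v = v"
proof -
  have "open (image_of c)" using assms by (simp add: smooth_atlas_def)
  then have "frechet_derivative (coords c \<circ> uncoords c) (at (coords c p)) = frechet_derivative (\<lambda>y. y) (at (coords c p))"
    using assms(3) by (intro frechet_derivative_cong_open[of "image_of c"]) (auto simp: coords_uncoords coords_in_image)
  then show ?thesis by simp
qed

lemma tangentD:
  "v \<in> tangent_space A p \<Longrightarrow> c \<in> A \<Longrightarrow> d \<in> A \<Longrightarrow> p \<in> dom_of c \<Longrightarrow> p \<in> dom_of d \<Longrightarrow>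
    v d = frechet_derivative (coords d \<circ> uncoords c) (at (coords c p)) (v c)"
  unfolding tangent_space_def by blast

lemma tangent_zero: "v \<in> tangent_space A p \<Longrightarrow> \<not> (c \<in> A \<and> p \<in> dom_of c) \<Longrightarrow> v c = 0"
  unfolding tangent_space_def by blast

lemma tangentI:
  assumes "\<And>c d. c \<in> A \<Longrightarrow> d \<in> A \<Longrightarrow> p \<in> dom_of c \<Longrightarrow> p \<in> dom_of d \<Longrightarrow>
      v d = frechet_derivative (coords d \<circ> uncoords c) (at (coords c p)) (v c)"
    "\<And>c. \<not> (c \<in> A \<and> p \<in> dom_of c) \<Longrightarrow> v c = 0"
  shows "v \<in> tangent_space A p"
  unfolding tangent_space_def using assms by blast

lemma coord_vector_same:
  "smooth_atlas A \<Longrightarrow> c \<in> A \<Longrightarrow> p \<in> dom_of c \<Longrightarrow> coord_vector A p c e c = e"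
  by (simp add: coord_vector_def transition_id)

lemma coord_vector_tangent:
  assumes "smooth_atlas A" "c \<in> A" "p \<in> dom_of c"
  shows "coord_vector A p c e \<in> tangent_space A p"
proof (rule tangentI)
  fix c' d assume "c' \<in> A" "d \<in> A" "p \<in> dom_of c'" "p \<in> dom_of d"
  then show "coord_vector A p c e d = frechet_derivative (coords d \<circ> uncoords c') (at (coords c' p)) (coord_vector A p c e c')"
    using transition_chain[OF assms(1,2) _ _ assms(3), of c' d e] by (simp add: coord_vector_def)
qed (auto simp: coord_vector_def)

lemma tangent_eq_coord_vector:
  assumes "v \<in> tangent_space A p" "c \<in> A" "p \<in> dom_of c"
  shows "v = coord_vector A p c (v c)"
proof
  fix d
  show "v d = coord_vector A p c (v c) d"
  proof (cases "d \<in> A \<and> p \<in> dom_of d")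
    case True
    then show ?thesis using tangentD[OF assms(1,2) _ assms(3), of d] by (simp add: coord_vector_def)
  next
    case False
    then show ?thesis using tangent_zero[OF assms(1) False] by (auto simp: coord_vector_def)
  qed
qed

lemma tangent_eqI:
  assumes "v \<in> tangent_space A p" "w \<in> tangent_space A p" "c \<in> A" "p \<in> dom_of c" "v c = w c"
  shows "v = w"
  using tangent_eq_coord_vector[OF assms(1,3,4)] tangent_eq_coord_vector[OF assms(2,3,4)] assms(5) by simp

lemma tangent_lincomb:
  assumes "smooth_atlas A" "u \<in> tangent_space A p" "v \<in> tangent_space A p"
  shows "(\<lambda>c. a *\<^sub>R u c + b *\<^sub>R v c) \<in> tangent_space A p"
proof -
  have "a *\<^sub>R u d + b *\<^sub>R v d = frechet_derivative (coords d \<circ> uncoords c) (at (coords c p)) (a *\<^sub>R u c + b *\<^sub>R v c)"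
    if "c \<in> A" "d \<in> A" "p \<in> dom_of c" "p \<in> dom_of d" for c d
    using tangentD[OF assms(2) that] tangentD[OF assms(3) that] transition_linear[OF assms(1) that]
    by (simp add: linear_add linear_scale)
  moreover have "a *\<^sub>R u c + b *\<^sub>R v c = 0" if "\<not> (c \<in> A \<and> p \<in> dom_of c)" for c
    using tangent_zero[OF assms(2) that] tangent_zero[OF assms(3) that] by simp
  ultimately show ?thesis by (rule tangentI)
qed

lemma smooth_mapD:
  "smooth_map A B F \<Longrightarrow> c \<in> A \<Longrightarrow> d \<in> B \<Longrightarrow>
    smooth_on (coords c ` (dom_of c \<inter> F -` dom_of d)) (coords d \<circ> F \<circ> uncoords c)"
  by (simp add: smooth_map_def)

text \<open>The chart picked by \<open>SOME\<close> in \<open>push_forward\<close> is compared with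
  \<open>c\<close> through their transition map; tangent vectors transform by the derivative of the
  same map.\<close>

lemma push_forward_eq:
  assumes A: "smooth_atlas A" and F: "smooth_map A B F" and c: "c \<in> A" "p \<in> dom_of c"
    and d: "d \<in> B" "F p \<in> dom_of d" and v: "v \<in> tangent_space A p"
  shows "push_forward A B F p v d =
    frechet_derivative (coords d \<circ> F \<circ> uncoords c) (at (coords c p)) (v c)"
proof -
  define c' where "c' = (SOME c. c \<in> A \<and> p \<in> dom_of c)"
  have c': "c' \<in> A" "p \<in> dom_of c'" using someI[of "\<lambda>c. c \<in> A \<and> p \<in> dom_of c" c] c by (auto simp: c'_def)
  let ?S = "coords c ` (dom_of c \<inter> dom_of c') \<inter> coords c ` (dom_of c \<inter> F -` dom_of d)"
  have op: "open ?S" using A F c c' d by (intro open_Int smooth_onD_open[OF transition_smooth] smooth_onD_open[OF smooth_mapD])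
  have in_S: "coords c p \<in> ?S" using c c' d by blast
  have "(coords d \<circ> F \<circ> uncoords c) y = (coords d \<circ> F \<circ> uncoords c') ((coords c' \<circ> uncoords c) y)" if "y \<in> ?S" for y
    using that by (auto simp: coords_image_iff[OF A c(1)] uncoords_coords[OF A c'(1)])
  then have "frechet_derivative (coords d \<circ> F \<circ> uncoords c) (at (coords c p)) (v c) = frechet_derivative (coords d \<circ> F \<circ> uncoords c') (at ((coords c' \<circ> uncoords c) (coords c p)))
      (frechet_derivative (coords c' \<circ> uncoords c) (at (coords c p)) (v c))"
  proof (rule frechet_derivative_chain_open[OF op in_S])
    show "(coords c' \<circ> uncoords c) differentiable at (coords c p)"
      by (rule transition_differentiable[OF A c(1) c'(1) c(2) c'(2)])
    have "coords c' p \<in> coords c' ` (dom_of c' \<inter> F -` dom_of d)" using c'(2) d(2) by blast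
    then have "(coords d \<circ> F \<circ> uncoords c') differentiable at (coords c' p)"
      by (rule smooth_on_differentiable[OF smooth_mapD[OF F c'(1) d(1)]])
    then show "(coords d \<circ> F \<circ> uncoords c') differentiable at ((coords c' \<circ> uncoords c) (coords c p))"
      by (simp add: uncoords_coords[OF A c])
  qed
  then have "frechet_derivative (coords d \<circ> F \<circ> uncoords c) (at (coords c p)) (v c) =
      frechet_derivative (coords d \<circ> F \<circ> uncoords c') (at (coords c' p)) (v c')"
    by (simp add: uncoords_coords[OF A c] tangentD[OF v c(1) c'(1) c(2) c'(2)])
  then show ?thesis using d by (simp add: push_forward_def c'_def[symmetric])
qed

lemma push_forward_tangent:
  assumes A: "smooth_atlas A" and B: "smooth_atlas B" and F: "smooth_map A B F"
    and p: "p \<in> carrier_of A" and v: "v \<in> tangent_space A p"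
  shows "push_forward A B F p v \<in> tangent_space B (F p)"
proof -
  obtain c where c: "c \<in> A" "p \<in> dom_of c" using p by (auto simp: carrier_of_def)
  have "push_forward A B F p v e = frechet_derivative (coords e \<circ> uncoords d) (at (coords d (F p))) (push_forward A B F p v d)"
    if d: "d \<in> B" "F p \<in> dom_of d" and e: "e \<in> B" "F p \<in> dom_of e" for d e
  proof -
    let ?S = "coords c ` (dom_of c \<inter> F -` dom_of d) \<inter> coords c ` (dom_of c \<inter> F -` dom_of e)"
    have op: "open ?S" using F c d e by (intro open_Int smooth_onD_open[OF smooth_mapD])
    have in_S: "coords c p \<in> ?S" using c d e by blast
    have "(coords e \<circ> F \<circ> uncoords c) y = (coords e \<circ> uncoords d) ((coords d \<circ> F \<circ> uncoords c) y)" if "y \<in> ?S" for y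
      using that by (auto simp: coords_image_iff[OF A c(1)] uncoords_coords[OF B d(1)])
    then have "frechet_derivative (coords e \<circ> F \<circ> uncoords c) (at (coords c p)) (v c) = frechet_derivative (coords e \<circ> uncoords d) (at ((coords d \<circ> F \<circ> uncoords c) (coords c p)))
      (frechet_derivative (coords d \<circ> F \<circ> uncoords c) (at (coords c p)) (v c))"
    proof (rule frechet_derivative_chain_open[OF op in_S])
      show "(coords d \<circ> F \<circ> uncoords c) differentiable at (coords c p)"
        using c d by (intro smooth_on_differentiable[OF smooth_mapD[OF F c(1) d(1)]]) auto
      show "(coords e \<circ> uncoords d) differentiable at ((coords d \<circ> F \<circ> uncoords c) (coords c p))"
        using transition_differentiable[OF B d(1) e(1) d(2) e(2)]
        by (simp add: uncoords_coords[OF A c])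
    qed
    then show ?thesis
      by (simp add: push_forward_eq[OF A F c d v] push_forward_eq[OF A F c e v] uncoords_coords[OF A c])
  qed
  then show ?thesis by (rule tangentI) (auto simp: push_forward_def)
qed

lemma openin_chart_vimage:
  "c \<in> A \<Longrightarrow> open V \<Longrightarrow> openin (manifold_topology A) {p \<in> dom_of c. coords c p \<in> V}"
  unfolding manifold_topology_def by (intro topology_generated_by_Basis) blast

lemma openin_dom: "c \<in> A \<Longrightarrow> openin (manifold_topology A) (dom_of c)"
  using openin_chart_vimage[of c A UNIV] by simp

lemma openin_carrier: "openin (manifold_topology A) (carrier_of A)"
  unfolding carrier_of_def by (intro openin_Union) (auto intro: openin_dom)

text \<open>The induction follows the generation of the topology; for a generating set the claim is
  the openness of a preimage under a transition map.\<close>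

lemma open_coords_image:
  assumes A: "smooth_atlas A" and U: "openin (manifold_topology A) U" and c: "c \<in> A"
  shows "open (coords c ` (dom_of c \<inter> U))"
proof -
  have "generate_topology_on {{p \<in> dom_of c. coords c p \<in> V} | c V. c \<in> A \<and> open V} U"
    using U unfolding manifold_topology_def openin_topology_generated_by_iff .
  then show ?thesis
  proof induction
    case (Int a b)
    have "coords c ` (dom_of c \<inter> (a \<inter> b)) = coords c ` (dom_of c \<inter> a) \<inter> coords c ` (dom_of c \<inter> b)"
      by (intro set_eqI) (auto simp only: coords_image_iff[OF A c] Int_iff)
    then show ?case using Int by (simp add: open_Int)
  next
    case (UN K)
    have "coords c ` (dom_of c \<inter> \<Union> K) = (\<Union>k\<in>K. coords c ` (dom_of c \<inter> k))" by blast
    then show ?case using UN by auto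
  next
    case (Basis s)
    then obtain d V where s: "s = {p \<in> dom_of d. coords d p \<in> V}" "d \<in> A" "open V" by auto
    have "coords c ` (dom_of c \<inter> s) = {y \<in> coords c ` (dom_of c \<inter> dom_of d). (coords d \<circ> uncoords c) y \<in> V}"
      unfolding s(1) by (intro set_eqI)
        (auto simp: coords_image_iff[OF A c] uncoords_coords[OF A c] coords_in_image)
    then show ?case using smooth_on_open_vimage[OF transition_smooth[OF A c s(2)] s(3)] by simp
  qed simp
qed

text \<open>Compact sets are closed in a Hausdorff space, so a function supported in a compact part
  of one chart vanishes on an open part of any other. This permits the extension of cut-off vector
  fields by zero.\<close>

lemma open_uncoords_notin_compact:
  assumes A: "smooth_atlas A" "Hausdorff_space (manifold_topology A)" and c: "c \<in> A" and d: "d \<in> A"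
    and K: "compact K" "K \<subseteq> image_of c"
  shows "open (coords d ` (dom_of d \<inter> - uncoords c ` K))"
proof -
  let ?M = "manifold_topology A"
  have top: "topspace ?M = carrier_of A"
  proof
    show "topspace ?M \<subseteq> carrier_of A"
      unfolding manifold_topology_def topology_generated_by_topspace carrier_of_def by auto
    show "carrier_of A \<subseteq> topspace ?M" by (rule openin_subset[OF openin_carrier])
  qed
  have "continuous_map (top_of_set (image_of c)) ?M (uncoords c)"
    unfolding continuous_map_def
  proof (intro conjI allI impI)
    show "uncoords c \<in> topspace (top_of_set (image_of c)) \<rightarrow> topspace ?M"
      using c by (auto simp: top carrier_of_def intro: uncoords_in_dom)
    fix U assume U: "openin ?M U"
    have "{x \<in> topspace (top_of_set (image_of c)). uncoords c x \<in> U} = coords c ` (dom_of c \<inter> U)"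
      by (intro set_eqI) (auto simp: coords_image_iff[OF A(1) c] uncoords_coords[OF A(1) c] coords_in_image)
    moreover have "coords c ` (dom_of c \<inter> U) \<subseteq> image_of c" by (auto simp: image_of_def)
    ultimately show "openin (top_of_set (image_of c)) {x \<in> topspace (top_of_set (image_of c)). uncoords c x \<in> U}"
      using open_coords_image[OF A(1) U c] by (metis open_subset)
  qed
  moreover have "compactin (top_of_set (image_of c)) K"
    using K by (simp add: compactin_subtopology)
  ultimately have "compactin ?M (uncoords c ` K)" by (rule image_compactin[rotated])
  then have "closedin ?M (uncoords c ` K)" by (rule compactin_imp_closedin[OF A(2)])
  then have "openin ?M (carrier_of A - uncoords c ` K)" by (simp add: closedin_def top)
  moreover have "dom_of d \<subseteq> carrier_of A" using d by (auto simp: carrier_of_def)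
  then have "dom_of d \<inter> (carrier_of A - uncoords c ` K) = dom_of d \<inter> - uncoords c ` K" by blast
  ultimately show ?thesis using open_coords_image[OF A(1) _ d] by metis
qed

section \<open>Coordinates on jet bundles\<close>

subsection \<open>Multi-indices\<close>

lemma Rep_low: "length \<mu>s < CARD('k) \<Longrightarrow> Rep_lower_index (low \<mu>s :: ('n, 'k::finite) lower_index) = mset \<mu>s"
  by (simp add: low_def Abs_lower_index_inverse)

lemma Rep_top_of: "length \<mu>s = CARD('k) \<Longrightarrow> Rep_top_index (top_of \<mu>s :: ('n, 'k::finite) top_index) = mset \<mu>s"
  by (simp add: top_of_def Abs_top_index_inverse)

abbreviation low_list :: "('n::linorder, 'k::finite) lower_index \<Rightarrow> 'n list" where
  "low_list I \<equiv> sorted_list_of_multiset (Rep_lower_index I)"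

abbreviation top_list :: "('n::linorder, 'k::finite) top_index \<Rightarrow> 'n list" where
  "top_list I \<equiv> sorted_list_of_multiset (Rep_top_index I)"

lemma length_low_list: "length (low_list (I :: ('n::linorder, 'k::finite) lower_index)) < CARD('k)"
  using Rep_lower_index[of I] by (simp flip: size_mset)

lemma length_top_list: "length (top_list (I :: ('n::linorder, 'k::finite) top_index)) = CARD('k)"
  using Rep_top_index[of I] by (simp flip: size_mset)

lemma low_low_list [simp]: "low (low_list I) = I"
  by (simp add: low_def Rep_lower_index_inverse)

lemma top_of_top_list [simp]: "top_of (top_list I) = I"
  by (simp add: top_of_def Rep_top_index_inverse)

lemma low_eqI: "mset \<mu>s = mset \<nu>s \<Longrightarrow> low \<mu>s = low \<nu>s"
  by (simp add: low_def)

lemma top_of_eqI: "mset \<mu>s = mset \<nu>s \<Longrightarrow> top_of \<mu>s = top_of \<nu>s"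
  by (simp add: top_of_def)

lemma jet_entry_eqI: "mset \<mu>s = mset \<nu>s \<Longrightarrow> jet_entry \<phi> u \<mu>s = jet_entry \<phi> u \<nu>s"
  using mset_eq_length[of \<mu>s \<nu>s] by (simp add: jet_entry_def low_eqI[of \<mu>s \<nu>s] top_of_eqI[of \<mu>s \<nu>s])

text \<open>The vector \<open>(\<phi>\<^sub>\<mu>\<^sub>1\<^sub>\<dots>\<^sub>\<mu>\<^sub>m\<^sub>\<nu> e\<^sup>\<nu>)\<close>: the derivative in direction \<open>e\<close> of the lower jet coordinates of
  a section with jet coordinates \<open>(\<phi>, u)\<close>.\<close>

definition jent :: "('n::{finite,linorder}, 'c::finite, 'k::finite) fields \<Rightarrow> ('n, 'c, 'k) tops \<Rightarrow> (real, 'n) vec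
    \<Rightarrow> ('n, 'c, 'k) fields" where
  "jent \<phi> u e = (\<chi> I. \<Sum>\<nu>\<in>UNIV. e $ \<nu> *\<^sub>R jet_entry \<phi> u (low_list I @ [\<nu>]))"

lemma jent_low:
  assumes "length \<mu>s < CARD('k)"
  shows "jent \<phi> u e $ (low \<mu>s :: ('n::{finite,linorder}, 'k::finite) lower_index) =
    (\<Sum>\<nu>\<in>UNIV. e $ \<nu> *\<^sub>R jet_entry \<phi> u (\<mu>s @ [\<nu>]))"
proof -
  have "jet_entry \<phi> u (low_list (low \<mu>s :: ('n, 'k) lower_index) @ [\<nu>]) = jet_entry \<phi> u (\<mu>s @ [\<nu>])" for \<nu>
    by (rule jet_entry_eqI) (simp add: Rep_low[OF assms])
  then show ?thesis by (simp add: jent_def)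
qed

text \<open>Coefficients of a Taylor polynomial of degree k with the given jet coordinates. The
  value 0 beyond order k is a default that such a polynomial never reads.\<close>

definition jet_family :: "('n::{finite,linorder}, 'c::finite, 'k::finite) fields \<Rightarrow> ('n, 'c, 'k) tops \<Rightarrow> 'n multiset \<Rightarrow> (real, 'c) vec" where
  "jet_family \<phi> u I = (if size I < CARD('k) then \<phi> $ Abs_lower_index I
     else if size I = CARD('k) then u $ Abs_top_index I else 0)"

lemma jet_family_low: "length \<mu>s < CARD('k) \<Longrightarrow>
    jet_family \<phi> u (mset \<mu>s) = \<phi> $ (low \<mu>s :: ('n::{finite,linorder}, 'k::finite) lower_index)"
  by (simp add: jet_family_def low_def)

lemma jet_family_top: "length \<mu>s = CARD('k) \<Longrightarrow>
    jet_family \<phi> u (mset \<mu>s) = u $ (top_of \<mu>s :: ('n::{finite,linorder}, 'k::finite) top_index)"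
  by (simp add: jet_family_def top_of_def)

lemma agree_Pair_ident:
  assumes "smooth_on S f" "smooth_on S g" "x \<in> S" "agree m x f g"
  shows "agree m x (\<lambda>y. (y, f y)) (\<lambda>y. (y, g y))"
proof -
  have op: "open S" using assms(1) by (rule smooth_onD_open)
  have "agree m x (\<lambda>y. (y, 0) + (0, f y)) (\<lambda>y. (y, 0) + (0, g y))"
    using assms op
    by (intro agree_add[of S] agree_refl agree_bounded_linear[of "\<lambda>y. (0, y)" S] smooth_on_Pair smooth_on_ident smooth_on_const
        bounded_linear_Pair bounded_linear_ident bounded_linear_zero) auto
  then show ?thesis by simp
qed

subsection \<open>Jets in adapted coordinates\<close>

locale jet_bundle =
  fixes B :: "('m, 'f, 'n::{finite,linorder}, 'c::finite) fibre_bundle"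
    and K :: "'k::finite itself"
  assumes base_atlas: "smooth_atlas (base B)"
    and total_atlas: "smooth_atlas (total B)"
    and total_Hausdorff: "Hausdorff_space (manifold_topology (total B))"
begin

abbreviation "Q \<equiv> (Qchart B :: ('m, 'f, 'n, 'c) adapted \<Rightarrow> (('m, 'f) jet, ('n, 'c, 'k) Qcoord) chart)"
abbreviation "J \<equiv> (Jchart B :: ('m, 'f, 'n, 'c) adapted \<Rightarrow> (('m, 'f) jet, ('n, 'c, 'k) Jcoord) chart)"

lemma adapted_base: "a \<in> adapted_charts B \<Longrightarrow> fst a \<in> base B"
  by (auto simp: adapted_charts_def)

lemma adapted_total: "a \<in> adapted_charts B \<Longrightarrow> snd a \<in> total B"
  by (auto simp: adapted_charts_def)

lemma adapted_proj:
  "a \<in> adapted_charts B \<Longrightarrow> y \<in> dom_of (snd a) \<Longrightarrow> proj B y \<in> dom_of (fst a)"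
  "a \<in> adapted_charts B \<Longrightarrow> y \<in> dom_of (snd a) \<Longrightarrow> fst (coords (snd a) y) = coords (fst a) (proj B y)"
  by (auto simp: adapted_charts_def)

lemmas base_uncoords_coords = uncoords_coords[OF base_atlas]
lemmas total_uncoords_coords = uncoords_coords[OF total_atlas]

lemma total_image_base:
  assumes "a \<in> adapted_charts B" "(\<xi>, u) \<in> image_of (snd a)"
  shows "\<xi> \<in> image_of (fst a)" "proj B (uncoords (snd a) (\<xi>, u)) = uncoords (fst a) \<xi>"
proof -
  let ?y = "uncoords (snd a) (\<xi>, u)"
  have y: "?y \<in> dom_of (snd a)" "coords (snd a) ?y = (\<xi>, u)"
    using assms by (simp_all add: uncoords_in_dom coords_uncoords)
  then have *: "coords (fst a) (proj B ?y) = \<xi>" "proj B ?y \<in> dom_of (fst a)"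
    using adapted_proj[OF assms(1) y(1)] by simp_all
  then show "\<xi> \<in> image_of (fst a)" using coords_in_image by metis
  show "proj B ?y = uncoords (fst a) \<xi>"
    using base_uncoords_coords[OF adapted_base[OF assms(1)] *(2)] * by simp
qed

lemma local_section_base:
  assumes "a \<in> adapted_charts B" "local_section B x f" "f x \<in> dom_of (snd a)"
  shows "x \<in> dom_of (fst a)"
  using adapted_proj(1)[OF assms(1,3)] assms(2) by (auto simp: local_section_def)

lemma local_section_rep:
  assumes a: "a \<in> adapted_charts B" and f: "local_section B x f" "f x \<in> dom_of (snd a)"
  obtains V where "open V" "coords (fst a) x \<in> V" "V \<subseteq> image_of (fst a)" "smooth_on V (field_rep a f)"
    "\<And>\<xi>. \<xi> \<in> V \<Longrightarrow> f (uncoords (fst a) \<xi>) \<in> dom_of (snd a)"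
    "\<And>\<xi>. \<xi> \<in> V \<Longrightarrow> coords (snd a) (f (uncoords (fst a) \<xi>)) = (\<xi>, field_rep a f \<xi>)"
    "\<And>\<xi>. \<xi> \<in> V \<Longrightarrow> local_section B (uncoords (fst a) \<xi>) f"
proof -
  obtain S where S: "openin (manifold_topology (base B)) S" "x \<in> S"
    "smooth_map (restrict_atlas (base B) S) (total B) f" "\<forall>z\<in>S. proj B (f z) = z"
    using f by (auto simp: local_section_def)
  let ?b = "fst a" and ?t = "snd a"
  let ?br = "(dom_of ?b \<inter> S, coords ?b)"
  define V where "V = coords ?b ` (dom_of ?b \<inter> (S \<inter> f -` dom_of ?t))"
  have b: "?b \<in> base B" and t: "?t \<in> total B" using a by (auto intro: adapted_base adapted_total)
  have x: "x \<in> dom_of ?b" using local_section_base[OF a f] .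
  have V: "\<xi> \<in> V \<longleftrightarrow> \<xi> \<in> image_of ?b \<and> uncoords ?b \<xi> \<in> S \<and> f (uncoords ?b \<xi>) \<in> dom_of ?t" for \<xi>
    unfolding V_def coords_image_iff[OF base_atlas b] by simp
  have "?br \<in> restrict_atlas (base B) S" using b by (auto simp: restrict_atlas_def)
  from smooth_mapD[OF S(3) this t] have sm: "smooth_on V (coords ?t \<circ> f \<circ> uncoords ?br)"
    by (simp add: V_def Int_assoc)
  \<comment> \<open>The inverse of the chart restricted to \<open>S\<close> is a choice over a
    smaller domain, so its agreement with \<open>uncoords ?b\<close> has to be derived from
    injectivity.\<close>
  have "uncoords ?br \<xi> = uncoords ?b \<xi>" if "\<xi> \<in> V" for \<xi>
  proof -
    have "\<xi> \<in> image_of ?br" using that by (auto simp: V_def image_of_def)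
    then have "uncoords ?br \<xi> \<in> dom_of ?b" "coords ?b (uncoords ?br \<xi>) = \<xi>"
      using uncoords_in_dom[of \<xi> ?br] coords_uncoords[of \<xi> ?br] by auto
    then show ?thesis using base_uncoords_coords[OF b] by metis
  qed
  then have sm': "smooth_on V (\<lambda>\<xi>. coords ?t (f (uncoords ?b \<xi>)))"
    by (intro smooth_on_cong[OF sm]) simp
  have fst: "coords ?t (f (uncoords ?b \<xi>)) = (\<xi>, field_rep a f \<xi>)" if "\<xi> \<in> V" for \<xi>
  proof -
    have "fst (coords ?t (f (uncoords ?b \<xi>))) = coords ?b (proj B (f (uncoords ?b \<xi>)))"
      using that V by (intro adapted_proj(2)[OF a]) auto
    also have "\<dots> = \<xi>" using that V S(4) by (auto simp: coords_uncoords)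
    finally show ?thesis by (simp add: field_rep_def prod_eq_iff)
  qed
  show ?thesis
  proof (rule that[of V])
    show "open V" using sm by (rule smooth_onD_open)
    show "coords ?b x \<in> V" using x S(2) f(2) by (auto simp: V_def)
    show "V \<subseteq> image_of ?b" using V by blast
    show "smooth_on V (field_rep a f)"
      by (rule smooth_on_cong[OF smooth_on_snd[OF sm']]) (simp add: field_rep_def)
    show "local_section B (uncoords ?b \<xi>) f" if "\<xi> \<in> V" for \<xi>
      using that V S unfolding local_section_def by auto
  qed (use V fst in auto)
qed

text \<open>In the second chart the local expression of \<open>f\<close> is the transition map of
  the total space applied to the graph of the old expression, precomposed with the base transition.
  \<open>W\<close> is shrunk until all these maps are defined and the old expression is used only on
  \<open>V\<close>.\<close>

lemma field_rep_change:
  assumes a: "a \<in> adapted_charts B" and a': "a' \<in> adapted_charts B"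
    and f: "local_section B x f" "f x \<in> dom_of (snd a)" "f x \<in> dom_of (snd a')"
    and V: "open V" "coords (fst a) x \<in> V"
  obtains W where "open W" "coords (fst a') x \<in> W" "W \<subseteq> coords (fst a') ` (dom_of (fst a') \<inter> dom_of (fst a))"
    "(coords (fst a) \<circ> uncoords (fst a')) ` W \<subseteq> V"
    "\<And>\<zeta>. \<zeta> \<in> W \<Longrightarrow> ((coords (fst a) \<circ> uncoords (fst a')) \<zeta>, field_rep a f ((coords (fst a) \<circ> uncoords (fst a')) \<zeta>))
        \<in> coords (snd a) ` (dom_of (snd a) \<inter> dom_of (snd a'))"
    "\<And>\<zeta>. \<zeta> \<in> W \<Longrightarrow> field_rep a' f \<zeta> = snd ((coords (snd a') \<circ> uncoords (snd a))
        ((coords (fst a) \<circ> uncoords (fst a')) \<zeta>, field_rep a f ((coords (fst a) \<circ> uncoords (fst a')) \<zeta>)))"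
proof -
  let ?b = "fst a" and ?t = "snd a" and ?b' = "fst a'" and ?t' = "snd a'"
  let ?\<chi> = "coords ?b \<circ> uncoords ?b'"
  note b = adapted_base[OF a] and b' = adapted_base[OF a'] and t = adapted_total[OF a]
  obtain U where U: "open U" "coords ?b x \<in> U" "U \<subseteq> image_of ?b"
    "\<And>\<xi>. \<xi> \<in> U \<Longrightarrow> f (uncoords ?b \<xi>) \<in> dom_of ?t"
    "\<And>\<xi>. \<xi> \<in> U \<Longrightarrow> coords ?t (f (uncoords ?b \<xi>)) = (\<xi>, field_rep a f \<xi>)"
    using local_section_rep[OF a f(1,2)] by metis
  obtain U' where U': "open U'" "coords ?b' x \<in> U'" "U' \<subseteq> image_of ?b'"
    "\<And>\<xi>. \<xi> \<in> U' \<Longrightarrow> f (uncoords ?b' \<xi>) \<in> dom_of ?t'"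
    using local_section_rep[OF a' f(1,3)] by metis
  have x: "x \<in> dom_of ?b" "x \<in> dom_of ?b'" using local_section_base[OF a f(1,2)] local_section_base[OF a' f(1,3)] .
  have sm: "smooth_on (coords ?b' ` (dom_of ?b' \<inter> dom_of ?b)) ?\<chi>"
    by (rule transition_smooth[OF base_atlas b' b])
  define W where "W = {\<zeta> \<in> coords ?b' ` (dom_of ?b' \<inter> dom_of ?b). ?\<chi> \<zeta> \<in> U \<inter> V} \<inter> U'"
  have eqs: "(?\<chi> \<zeta>, field_rep a f (?\<chi> \<zeta>)) = coords ?t (f (uncoords ?b' \<zeta>))"
     "f (uncoords ?b' \<zeta>) \<in> dom_of ?t" "f (uncoords ?b' \<zeta>) \<in> dom_of ?t'" if "\<zeta> \<in> W" for \<zeta>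
  proof -
    have "uncoords ?b (?\<chi> \<zeta>) = uncoords ?b' \<zeta>"
      using that base_uncoords_coords[OF b] by (auto simp: W_def coords_image_iff[OF base_atlas b'])
    then show "(?\<chi> \<zeta>, field_rep a f (?\<chi> \<zeta>)) = coords ?t (f (uncoords ?b' \<zeta>))" "f (uncoords ?b' \<zeta>) \<in> dom_of ?t"
      using that U(4)[of "?\<chi> \<zeta>"] U(5)[of "?\<chi> \<zeta>"] by (auto simp: W_def)
    show "f (uncoords ?b' \<zeta>) \<in> dom_of ?t'" using that U'(4) by (auto simp: W_def)
  qed
  show ?thesis
  proof (rule that[of W])
    show "open W" unfolding W_def by (intro open_Int smooth_on_open_vimage[OF sm] U V U')
    show "coords ?b' x \<in> W" using x U(2) V(2) U'(2) base_uncoords_coords[OF b' x(2)] by (auto simp: W_def)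
    show "(?\<chi> \<zeta>, field_rep a f (?\<chi> \<zeta>)) \<in> coords ?t ` (dom_of ?t \<inter> dom_of ?t')" if "\<zeta> \<in> W" for \<zeta>
      unfolding eqs(1)[OF that] using eqs(2,3)[OF that] by blast
    show "field_rep a' f \<zeta> = snd ((coords ?t' \<circ> uncoords ?t) (?\<chi> \<zeta>, field_rep a f (?\<chi> \<zeta>)))" if "\<zeta> \<in> W" for \<zeta>
      unfolding eqs(1)[OF that] using total_uncoords_coords[OF t eqs(2)[OF that]] by (simp add: field_rep_def)
  qed (auto simp: W_def)
qed

text \<open>Composition with the total transition on the left and with the base transition on the
  right preserves \<open>agree\<close>; hence a single adapted chart decides whether two sections
  have the same jet.\<close>

lemma agree_change:
  assumes a: "a \<in> adapted_charts B" and a': "a' \<in> adapted_charts B"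
    and f: "local_section B x f" and g: "local_section B x g" and eq: "g x = f x"
    and dom: "f x \<in> dom_of (snd a)" "f x \<in> dom_of (snd a')"
    and ag: "\<forall>\<mu>s. length \<mu>s \<le> m \<longrightarrow> pd \<mu>s (field_rep a g) (coords (fst a) x) = pd \<mu>s (field_rep a f) (coords (fst a) x)"
  shows "\<forall>\<mu>s. length \<mu>s \<le> m \<longrightarrow> pd \<mu>s (field_rep a' g) (coords (fst a') x) = pd \<mu>s (field_rep a' f) (coords (fst a') x)"
proof -
  let ?b = "fst a" and ?t = "snd a" and ?b' = "fst a'" and ?t' = "snd a'"
  let ?\<chi> = "coords ?b \<circ> uncoords ?b'" and ?F = "field_rep a f" and ?G = "field_rep a g"
  let ?O = "coords ?t ` (dom_of ?t \<inter> dom_of ?t')" and ?\<Phi> = "coords ?t' \<circ> uncoords ?t"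
  note b = adapted_base[OF a] and b' = adapted_base[OF a'] and t = adapted_total[OF a] and t' = adapted_total[OF a']
  obtain Vf where Vf: "open Vf" "coords ?b x \<in> Vf" "smooth_on Vf ?F"
    using local_section_rep[OF a f dom(1)] by metis
  obtain Vg where Vg: "open Vg" "coords ?b x \<in> Vg" "smooth_on Vg ?G"
    using local_section_rep[OF a g] dom(1) eq by metis
  obtain Vf' where Vf': "open Vf'" "coords ?b' x \<in> Vf'" "smooth_on Vf' (field_rep a' f)"
    using local_section_rep[OF a' f dom(2)] by metis
  obtain Vg' where Vg': "open Vg'" "coords ?b' x \<in> Vg'" "smooth_on Vg' (field_rep a' g)"
    using local_section_rep[OF a' g] dom(2) eq by metis
  define V where "V = Vf \<inter> Vg"
  have V: "open V" "coords ?b x \<in> V" "smooth_on V ?F" "smooth_on V ?G"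
    using Vf Vg by (auto simp: V_def intro: smooth_on_subset)
  have sm\<Phi>: "smooth_on ?O (\<lambda>y. snd (?\<Phi> y))"
    by (rule smooth_on_snd[OF transition_smooth[OF total_atlas t t']])
  have pair: "smooth_on V (\<lambda>\<xi>. (\<xi>, h \<xi>))" if "smooth_on V h" for h :: "(real, 'n) vec \<Rightarrow> (real, 'c) vec"
    by (intro smooth_on_Pair that smooth_on_ident V)
  \<comment> \<open>Here both graphs lie in the domain of the total transition map, so the
    composition lemmas apply to \<open>f\<close> and \<open>g\<close> on a common open set.\<close>
  define V1 where "V1 = {\<xi> \<in> V. (\<xi>, ?F \<xi>) \<in> ?O} \<inter> {\<xi> \<in> V. (\<xi>, ?G \<xi>) \<in> ?O}"
  have V1: "open V1" "V1 \<subseteq> V"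
    unfolding V1_def
    by (auto intro!: open_Int smooth_on_open_vimage[OF pair] V smooth_onD_open[OF sm\<Phi>])
  obtain Wf where Wf: "open Wf" "coords ?b' x \<in> Wf" "Wf \<subseteq> coords ?b' ` (dom_of ?b' \<inter> dom_of ?b)" "?\<chi> ` Wf \<subseteq> V"
    "\<And>\<zeta>. \<zeta> \<in> Wf \<Longrightarrow> (?\<chi> \<zeta>, ?F (?\<chi> \<zeta>)) \<in> ?O" "\<And>\<zeta>. \<zeta> \<in> Wf \<Longrightarrow> field_rep a' f \<zeta> = snd (?\<Phi> (?\<chi> \<zeta>, ?F (?\<chi> \<zeta>)))"
    using field_rep_change[OF a a' f dom V(1,2)] by metis
  obtain Wg where Wg: "open Wg" "coords ?b' x \<in> Wg" "Wg \<subseteq> coords ?b' ` (dom_of ?b' \<inter> dom_of ?b)" "?\<chi> ` Wg \<subseteq> V"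
    "\<And>\<zeta>. \<zeta> \<in> Wg \<Longrightarrow> (?\<chi> \<zeta>, ?G (?\<chi> \<zeta>)) \<in> ?O" "\<And>\<zeta>. \<zeta> \<in> Wg \<Longrightarrow> field_rep a' g \<zeta> = snd (?\<Phi> (?\<chi> \<zeta>, ?G (?\<chi> \<zeta>)))"
    using field_rep_change[OF a a' g _ _ V(1,2)] dom eq by metis
  define W where "W = Wf \<inter> Wg \<inter> Vf' \<inter> Vg'"
  have W: "open W" "coords ?b' x \<in> W" "?\<chi> ` W \<subseteq> V1"
    using Wf Wg Vf' Vg' by (auto simp: W_def V1_def)
  have sm\<chi>: "smooth_on W ?\<chi>"
    using Wf(3) W(1) by (intro smooth_on_subset[OF transition_smooth[OF base_atlas b' b]]) (auto simp: W_def)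
  have x: "x \<in> dom_of ?b'" using local_section_base[OF a' f dom(2)] .
  have \<chi>x: "?\<chi> (coords ?b' x) = coords ?b x" by (simp add: base_uncoords_coords[OF b' x])
  have xV1: "coords ?b x \<in> V1" using W(2,3) \<chi>x by auto
  note pr = smooth_on_subset[OF pair[OF V(3)] V1] smooth_on_subset[OF pair[OF V(4)] V1]
  have "agree m (coords ?b x) ?G ?F" using ag agree_iff_pd[OF V(4,3,2)] by simp
  then have "agree m (coords ?b x) (\<lambda>\<xi>. (\<xi>, ?G \<xi>)) (\<lambda>\<xi>. (\<xi>, ?F \<xi>))"
    by (intro agree_Pair_ident[OF V(4,3,2)])
  then have "agree m (coords ?b x) (\<lambda>\<xi>. snd (?\<Phi> (\<xi>, ?G \<xi>))) (\<lambda>\<xi>. snd (?\<Phi> (\<xi>, ?F \<xi>)))"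
    by (intro agree_compose_left[OF pr(2,1) sm\<Phi> _ _ xV1]) (auto simp: V1_def)
  then have "agree m (coords ?b' x) (\<lambda>\<zeta>. snd (?\<Phi> (?\<chi> \<zeta>, ?G (?\<chi> \<zeta>)))) (\<lambda>\<zeta>. snd (?\<Phi> (?\<chi> \<zeta>, ?F (?\<chi> \<zeta>))))"
    by (intro agree_compose_right[OF smooth_on_compose[OF sm\<Phi> pr(2)] smooth_on_compose[OF sm\<Phi> pr(1)] sm\<chi> W(3,2)])
       (auto simp: V1_def \<chi>x simp del: o_apply)
  then have "agree m (coords ?b' x) (field_rep a' g) (field_rep a' f)"
    by (rule agree_cong[OF W(1,2), THEN iffD2, rotated 2]) (use Wf(6) Wg(6) in \<open>auto simp: W_def\<close>)
  moreover have "smooth_on W (field_rep a' g)" "smooth_on W (field_rep a' f)"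
    using Vf' Vg' W(1) by (auto simp: W_def intro: smooth_on_subset)
  ultimately show ?thesis using agree_iff_pd[of W "field_rep a' g" "field_rep a' f" "coords ?b' x" m] W(2) by blast
qed

lemma jet_eq_iff:
  assumes a: "a \<in> adapted_charts B" and f: "local_section B x f" "f x \<in> dom_of (snd a)" and g: "local_section B x g"
  shows "jet B m g x = jet B m f x \<longleftrightarrow> g x = f x \<and> (\<forall>\<mu>s. length \<mu>s \<le> m \<longrightarrow>
     pd \<mu>s (field_rep a g) (coords (fst a) x) = pd \<mu>s (field_rep a f) (coords (fst a) x))"
proof
  assume "jet B m g x = jet B m f x"
  moreover have "g \<in> snd (jet B m g x)" using g by (simp add: jet_def)
  ultimately have "g \<in> snd (jet B m f x)" by simp
  then show "g x = f x \<and> (\<forall>\<mu>s. length \<mu>s \<le> m \<longrightarrow>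
     pd \<mu>s (field_rep a g) (coords (fst a) x) = pd \<mu>s (field_rep a f) (coords (fst a) x))"
    using a f by (auto simp: jet_def)
next
  assume *: "g x = f x \<and> (\<forall>\<mu>s. length \<mu>s \<le> m \<longrightarrow>
     pd \<mu>s (field_rep a g) (coords (fst a) x) = pd \<mu>s (field_rep a f) (coords (fst a) x))"
  then have "pd \<mu>s (field_rep a' g) (coords (fst a') x) = pd \<mu>s (field_rep a' f) (coords (fst a') x)"
    if "a' \<in> adapted_charts B" "f x \<in> dom_of (snd a')" "length \<mu>s \<le> m" for a' \<mu>s
    using agree_change[OF a that(1) f(1) g _ f(2) that(2)] that(3) by blast
  then show "jet B m g x = jet B m f x"
    using * by (auto simp: jet_def)
qed

lemma jet_rep_props:
  assumes "local_section B x f"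
  shows "local_section B x (jet_rep (jet B m f x))" "jet_rep (jet B m f x) x = f x"
    "\<And>a \<mu>s. a \<in> adapted_charts B \<Longrightarrow> f x \<in> dom_of (snd a) \<Longrightarrow> length \<mu>s \<le> m \<Longrightarrow>
       pd \<mu>s (field_rep a (jet_rep (jet B m f x))) (coords (fst a) x) = pd \<mu>s (field_rep a f) (coords (fst a) x)"
proof -
  have "f \<in> snd (jet B m f x)" using assms by (simp add: jet_def)
  then have "jet_rep (jet B m f x) \<in> snd (jet B m f x)" unfolding jet_rep_def by (rule someI[of "\<lambda>g. g \<in> snd (jet B m f x)"])
  then show "local_section B x (jet_rep (jet B m f x))" "jet_rep (jet B m f x) x = f x"
    "\<And>a \<mu>s. a \<in> adapted_charts B \<Longrightarrow> f x \<in> dom_of (snd a) \<Longrightarrow> length \<mu>s \<le> m \<Longrightarrow>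
       pd \<mu>s (field_rep a (jet_rep (jet B m f x))) (coords (fst a) x) = pd \<mu>s (field_rep a f) (coords (fst a) x)"
    unfolding jet_def by auto
qed

lemma fst_jet [simp]: "fst (jet B m f x) = x"
  by (simp add: jet_def)

lemma jet_value_jet: "local_section B x f \<Longrightarrow> jet_value (jet B m f x) = f x"
  by (simp add: jet_value_def jet_rep_props(2))

lemma jet_coord_jet:
  "local_section B x f \<Longrightarrow> a \<in> adapted_charts B \<Longrightarrow> f x \<in> dom_of (snd a) \<Longrightarrow> length \<mu>s \<le> m \<Longrightarrow>
    jet_coord a (jet B m f x) \<mu>s = pd \<mu>s (field_rep a f) (coords (fst a) x)"
  by (simp add: jet_coord_def jet_rep_props(3))

text \<open>A local section with prescribed derivatives at one point, having a Taylor polynomial as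
  coordinate expression. Where the graph of the polynomial leaves the chart, its values are
  meaningless.\<close>

definition poly_section :: "('m, 'f, 'n, 'c) adapted \<Rightarrow> nat \<Rightarrow> ('n multiset \<Rightarrow> (real, 'c) vec) \<Rightarrow> (real, 'n) vec \<Rightarrow> 'm \<Rightarrow> 'f" where
  "poly_section a m c x z = uncoords (snd a) (coords (fst a) z, taylor m c x (coords (fst a) z))"

lemma poly_section:
  assumes a: "a \<in> adapted_charts B" and x: "(x, c {#}) \<in> image_of (snd a)"
  shows "local_section B (uncoords (fst a) x) (poly_section a m c x)"
    "poly_section a m c x (uncoords (fst a) x) = uncoords (snd a) (x, c {#})"
    "\<exists>V. open V \<and> x \<in> V \<and> (\<forall>\<xi>\<in>V. field_rep a (poly_section a m c x) \<xi> = taylor m c x \<xi>)"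
    "\<And>\<mu>s. length \<mu>s \<le> m \<Longrightarrow> pd \<mu>s (field_rep a (poly_section a m c x)) x = c (mset \<mu>s)"
proof -
  let ?b = "fst a" and ?t = "snd a" and ?g = "taylor m c x" and ?f = "poly_section a m c x"
  note b = adapted_base[OF a] and t = adapted_total[OF a]
  define V where "V = {\<xi> \<in> UNIV. (\<xi>, ?g \<xi>) \<in> image_of ?t}"
  have opt: "open (image_of ?t)" using t total_atlas by (simp add: smooth_atlas_def)
  have smg: "smooth_on UNIV (\<lambda>\<xi>. (\<xi>, ?g \<xi>))" by (intro smooth_on_Pair smooth_on_ident smooth_taylor open_UNIV)
  have opV: "open V" unfolding V_def by (rule smooth_on_open_vimage[OF smg opt])
  have xV: "x \<in> V" using x by (simp add: V_def taylor_center)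
  have Vb: "\<xi> \<in> image_of ?b" if "\<xi> \<in> V" for \<xi>
    using that total_image_base(1)[OF a] by (auto simp: V_def)
  show 3: "\<exists>V. open V \<and> x \<in> V \<and> (\<forall>\<xi>\<in>V. field_rep a (poly_section a m c x) \<xi> = taylor m c x \<xi>)"
  proof (intro exI[of _ V] conjI ballI opV xV)
    show "field_rep a ?f \<xi> = ?g \<xi>" if "\<xi> \<in> V" for \<xi>
      using that Vb[OF that] by (simp add: field_rep_def poly_section_def coords_uncoords V_def)
  qed
  show "poly_section a m c x (uncoords (fst a) x) = uncoords (snd a) (x, c {#})"
    using Vb[OF xV] by (simp add: poly_section_def coords_uncoords taylor_center)
  show "pd \<mu>s (field_rep a (poly_section a m c x)) x = c (mset \<mu>s)" if "length \<mu>s \<le> m" for \<mu>s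
  proof -
    obtain V where "open V" "x \<in> V" "\<And>\<xi>. \<xi> \<in> V \<Longrightarrow> field_rep a ?f \<xi> = ?g \<xi>" using 3 by blast
    then have "pd \<mu>s (field_rep a ?f) x = pd \<mu>s ?g x" by (intro pd_cong_open)
    then show ?thesis using that by (simp add: pd_taylor_center)
  qed
  define S where "S = {z \<in> dom_of ?b. coords ?b z \<in> V}"
  show "local_section B (uncoords (fst a) x) (poly_section a m c x)"
    unfolding local_section_def
  proof (intro exI[of _ S] conjI ballI)
    show "openin (manifold_topology (base B)) S" unfolding S_def by (rule openin_chart_vimage[OF b opV])
    show "uncoords ?b x \<in> S" using Vb[OF xV] xV by (simp add: S_def uncoords_in_dom coords_uncoords)
    show "proj B (?f z) = z" if "z \<in> S" for z
      using that total_image_base(2)[OF a, of "coords ?b z" "?g (coords ?b z)"] base_uncoords_coords[OF b, of z]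
      by (simp add: S_def V_def poly_section_def)
    show "smooth_map (restrict_atlas (base B) S) (total B) ?f"
      unfolding smooth_map_def
    proof (intro conjI ballI)
      show "?f ` carrier_of (restrict_atlas (base B) S) \<subseteq> carrier_of (total B)"
      proof (rule image_subsetI)
        fix z assume "z \<in> carrier_of (restrict_atlas (base B) S)"
        then have "z \<in> S" by (auto simp: carrier_of_def restrict_atlas_def)
        then have "?f z \<in> dom_of ?t" by (simp add: S_def V_def poly_section_def uncoords_in_dom)
        then show "?f z \<in> carrier_of (total B)" using t by (auto simp: carrier_of_def)
      qed
      fix c' d assume c': "c' \<in> restrict_atlas (base B) S" and d: "d \<in> total B"
      then obtain c0 where c0: "c0 \<in> base B" "c' = (dom_of c0 \<inter> S, coords c0)" by (auto simp: restrict_atlas_def)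
      let ?\<chi> = "coords ?b \<circ> uncoords c0"
      let ?\<theta> = "\<lambda>\<eta>. (?\<chi> \<eta>, ?g (?\<chi> \<eta>))"
      define D1 where "D1 = {\<eta> \<in> coords c0 ` (dom_of c0 \<inter> dom_of ?b). ?\<chi> \<eta> \<in> V}"
      note tr = transition_smooth[OF base_atlas c0(1) b]
      have "open D1" unfolding D1_def by (rule smooth_on_open_vimage[OF tr opV])
      then have sm\<theta>: "smooth_on D1 ?\<theta>"
        by (intro smooth_on_compose[OF smg] smooth_on_subset[OF tr]) (auto simp: D1_def)
      define D where "D = {\<eta> \<in> D1. ?\<theta> \<eta> \<in> coords ?t ` (dom_of ?t \<inter> dom_of d)}"
      note trt = transition_smooth[OF total_atlas t d]
      have opD: "open D" unfolding D_def by (rule smooth_on_open_vimage[OF sm\<theta> smooth_onD_open[OF trt]])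
      have D_eq: "coords c' ` (dom_of c' \<inter> ?f -` dom_of d) = D"
      proof -
        have A: "coords c' ` (dom_of c' \<inter> ?f -` dom_of d) = coords c0 ` (dom_of c0 \<inter> (S \<inter> ?f -` dom_of d))"
          by (simp add: c0 Int_assoc)
        have "\<eta> \<in> coords c0 ` (dom_of c0 \<inter> (S \<inter> ?f -` dom_of d)) \<longleftrightarrow> \<eta> \<in> D" for \<eta>
          unfolding D_def D1_def coords_image_iff[OF base_atlas c0(1)] mem_Collect_eq
            coords_image_iff[OF total_atlas t]
          by (simp add: S_def V_def poly_section_def)
        then show ?thesis unfolding A by (rule set_eqI)
      qed
      have "smooth_on D (\<lambda>\<eta>. (coords d \<circ> uncoords ?t) (?\<theta> \<eta>))"
        by (rule smooth_on_compose[OF trt smooth_on_subset[OF sm\<theta> opD]]) (auto simp: D_def)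
      then have "smooth_on D (coords d \<circ> ?f \<circ> uncoords c')"
      proof (rule smooth_on_cong)
        fix \<eta> assume "\<eta> \<in> D"
        then have "\<eta> \<in> image_of c'" unfolding D_eq[symmetric] by (auto simp: image_of_def)
        then have "uncoords c' \<eta> \<in> dom_of c0" "coords c0 (uncoords c' \<eta>) = \<eta>"
          using uncoords_in_dom[of \<eta> c'] coords_uncoords[of \<eta> c'] by (auto simp: c0(2))
        then have "uncoords c' \<eta> = uncoords c0 \<eta>" using base_uncoords_coords[OF c0(1)] by metis
        then show "(coords d \<circ> uncoords ?t) (?\<theta> \<eta>) = (coords d \<circ> ?f \<circ> uncoords c') \<eta>"
          by (simp add: poly_section_def)
      qed
      then show "smooth_on (coords c' ` (dom_of c' \<inter> ?f -` dom_of d)) (coords d \<circ> ?f \<circ> uncoords c')"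
        unfolding D_eq .
    qed
  qed
qed

end

section \<open>Jet coordinates as charts: injectivity, images, overlaps and transition maps\<close>

context jet_bundle begin

definition jlow :: "('m, 'f, 'n, 'c) adapted \<Rightarrow> ('m \<Rightarrow> 'f) \<Rightarrow> (real, 'n) vec \<Rightarrow> ('n, 'c, 'k) fields" where
  "jlow a f \<xi> = (\<chi> I. pd (low_list I) (field_rep a f) \<xi>)"

definition jtop :: "('m, 'f, 'n, 'c) adapted \<Rightarrow> ('m \<Rightarrow> 'f) \<Rightarrow> (real, 'n) vec \<Rightarrow> ('n, 'c, 'k) tops" where
  "jtop a f \<xi> = (\<chi> I. pd (top_list I) (field_rep a f) \<xi>)"

text \<open>Coordinates are read off at sorted index lists; symmetry of partial derivatives makes
  every other ordering equivalent.\<close>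

lemma jlow_low:
  assumes "smooth_on V (field_rep a f)" "\<xi> \<in> V" "length \<mu>s < CARD('k)"
  shows "jlow a f \<xi> $ low \<mu>s = pd \<mu>s (field_rep a f) \<xi>"
  unfolding jlow_def using pd_perm[OF assms(1,2), of "low_list (low \<mu>s :: ('n, 'k) lower_index)" \<mu>s] Rep_low[OF assms(3)]
  by simp

lemma jtop_top_of:
  assumes "smooth_on V (field_rep a f)" "\<xi> \<in> V" "length \<mu>s = CARD('k)"
  shows "jtop a f \<xi> $ top_of \<mu>s = pd \<mu>s (field_rep a f) \<xi>"
  unfolding jtop_def using pd_perm[OF assms(1,2), of "top_list (top_of \<mu>s :: ('n, 'k) top_index)" \<mu>s] Rep_top_of[OF assms(3)]
  by simp

lemma jet_entry_section:
  assumes "smooth_on V (field_rep a f)" "\<xi> \<in> V" "length \<mu>s \<le> CARD('k)"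
  shows "jet_entry (jlow a f \<xi>) (jtop a f \<xi>) \<mu>s = pd \<mu>s (field_rep a f) \<xi>"
  using assms(3) jlow_low[OF assms(1,2), of \<mu>s] jtop_top_of[OF assms(1,2), of \<mu>s] by (auto simp: jet_entry_def)

lemma jlow_Nil: "jlow a f \<xi> $ low [] = field_rep a f \<xi>"
  by (simp add: jlow_def Rep_low)

lemma Q_jet:
  assumes a: "a \<in> adapted_charts B" and f: "local_section B x f" "f x \<in> dom_of (snd a)"
  shows "jet B (CARD('k) - 1) f x \<in> dom_of (Q a)"
    "coords (Q a) (jet B (CARD('k) - 1) f x) = (coords (fst a) x, jlow a f (coords (fst a) x))"
proof -
  have "x \<in> carrier_of (base B)"
    using local_section_base[OF a f] adapted_base[OF a] by (auto simp: carrier_of_def)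
  then show "jet B (CARD('k) - 1) f x \<in> dom_of (Q a)"
    using f by (auto simp: Qchart_def jet_space_def jet_value_jet)
  have "length (low_list I) \<le> CARD('k) - 1" for I :: "('n, 'k) lower_index"
    using length_low_list[of I] by simp
  then show "coords (Q a) (jet B (CARD('k) - 1) f x) = (coords (fst a) x, jlow a f (coords (fst a) x))"
    using jet_coord_jet[OF f(1) a f(2)] by (simp add: Qchart_def lower_coords_def jlow_def)
qed

lemma J_jet:
  assumes a: "a \<in> adapted_charts B" and f: "local_section B x f" "f x \<in> dom_of (snd a)"
  shows "jet B CARD('k) f x \<in> dom_of (J a)"
    "coords (J a) (jet B CARD('k) f x) = (coords (fst a) x, jlow a f (coords (fst a) x), jtop a f (coords (fst a) x))"
proof -
  have "x \<in> carrier_of (base B)"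
    using local_section_base[OF a f] adapted_base[OF a] by (auto simp: carrier_of_def)
  then show "jet B CARD('k) f x \<in> dom_of (J a)"
    using f by (auto simp: Jchart_def jet_space_def jet_value_jet)
  have "length (low_list I) \<le> CARD('k)" for I :: "('n, 'k) lower_index"
    using length_low_list[of I] by simp
  then show "coords (J a) (jet B CARD('k) f x) = (coords (fst a) x, jlow a f (coords (fst a) x), jtop a f (coords (fst a) x))"
    using jet_coord_jet[OF f(1) a f(2)]
    by (simp add: Jchart_def lower_coords_def top_coords_def jlow_def jtop_def length_top_list)
qed

lemma Q_domE:
  assumes "q \<in> dom_of (Q a)"
  obtains f where "local_section B (fst q) f" "f (fst q) \<in> dom_of (snd a)" "q = jet B (CARD('k) - 1) f (fst q)"
  using assms by (auto simp: Qchart_def jet_space_def jet_value_jet)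

lemma J_domE:
  assumes "q \<in> dom_of (J a)"
  obtains f where "local_section B (fst q) f" "f (fst q) \<in> dom_of (snd a)" "q = jet B CARD('k) f (fst q)"
  using assms by (auto simp: Jchart_def jet_space_def jet_value_jet)

lemma section_value_eqI:
  assumes a: "a \<in> adapted_charts B" and f: "local_section B x f" "f x \<in> dom_of (snd a)"
    and g: "local_section B x g" "g x \<in> dom_of (snd a)"
    and eq: "field_rep a g (coords (fst a) x) = field_rep a f (coords (fst a) x)"
  shows "g x = f x"
proof -
  have "coords (snd a) (g x) = coords (snd a) (f x)"
  proof -
    have rep: "coords (snd a) (h x) = (coords (fst a) x, field_rep a h (coords (fst a) x))"
      if h: "local_section B x h" "h x \<in> dom_of (snd a)" for h
    proof -
      obtain V where V: "coords (fst a) x \<in> V"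
        "\<And>\<xi>. \<xi> \<in> V \<Longrightarrow> coords (snd a) (h (uncoords (fst a) \<xi>)) = (\<xi>, field_rep a h \<xi>)"
        using local_section_rep[OF a h] by metis
      from V(2)[OF V(1)] show ?thesis
        using base_uncoords_coords[OF adapted_base[OF a] local_section_base[OF a h]] by simp
    qed
    show ?thesis by (simp add: rep f g eq)
  qed
  then show ?thesis using smooth_atlas_inj[OF total_atlas adapted_total[OF a]] f(2) g(2) by (auto dest: inj_onD)
qed

text \<open>The coordinates determine the base point and all derivatives below order k, and the
  entry at \<open>low []\<close> determines the value in the fibre; by \<open>jet_eq_iff\<close>
  this fixes the jet.\<close>

lemma Q_inj:
  assumes a: "a \<in> adapted_charts B"
  shows "inj_on (coords (Q a)) (dom_of (Q a))"
proof (rule inj_onI)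
  fix q q' assume q: "q \<in> dom_of (Q a)" "q' \<in> dom_of (Q a)" and eq: "coords (Q a) q = coords (Q a) q'"
  obtain f where f: "local_section B (fst q) f" "f (fst q) \<in> dom_of (snd a)" "q = jet B (CARD('k) - 1) f (fst q)"
    by (rule Q_domE[OF q(1)])
  obtain g where g: "local_section B (fst q') g" "g (fst q') \<in> dom_of (snd a)" "q' = jet B (CARD('k) - 1) g (fst q')"
    by (rule Q_domE[OF q(2)])
  have "coords (fst a) (fst q) = coords (fst a) (fst q')"
    using eq Q_jet(2)[OF a f(1,2)] Q_jet(2)[OF a g(1,2)] f(3) g(3) by simp
  then have fst: "fst q = fst q'"
    using smooth_atlas_inj[OF base_atlas adapted_base[OF a]] local_section_base[OF a f(1,2)] local_section_base[OF a g(1,2)]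
    by (auto dest: inj_onD)
  note g' = g[unfolded fst[symmetric]]
  let ?\<xi> = "coords (fst a) (fst q)"
  have jl: "jlow a f ?\<xi> = jlow a g ?\<xi>"
    using eq Q_jet(2)[OF a f(1,2)] Q_jet(2)[OF a g'(1,2)] f(3) g'(3) by simp
  obtain V where V: "?\<xi> \<in> V" "smooth_on V (field_rep a f)" using local_section_rep[OF a f(1,2)] by metis
  obtain W where W: "?\<xi> \<in> W" "smooth_on W (field_rep a g)" using local_section_rep[OF a g'(1,2)] by metis
  have "pd \<mu>s (field_rep a g) ?\<xi> = pd \<mu>s (field_rep a f) ?\<xi>" if "length \<mu>s \<le> CARD('k) - 1" for \<mu>s
  proof -
    have "length \<mu>s < CARD('k)" using that zero_less_card_finite[where 'a = 'k] by linarith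
    then show ?thesis using jlow_low[OF V(2,1), of \<mu>s] jlow_low[OF W(2,1), of \<mu>s] jl by simp
  qed
  moreover have "g (fst q) = f (fst q)"
    using jl by (intro section_value_eqI[OF a f(1,2) g'(1,2)]) (simp flip: jlow_Nil)
  ultimately show "q = q'"
    using f(3) g'(3) jet_eq_iff[OF a f(1,2) g'(1)] by metis
qed

lemma J_inj:
  assumes a: "a \<in> adapted_charts B"
  shows "inj_on (coords (J a)) (dom_of (J a))"
proof (rule inj_onI)
  fix q q' assume q: "q \<in> dom_of (J a)" "q' \<in> dom_of (J a)" and eq: "coords (J a) q = coords (J a) q'"
  obtain f where f: "local_section B (fst q) f" "f (fst q) \<in> dom_of (snd a)" "q = jet B CARD('k) f (fst q)"
    by (rule J_domE[OF q(1)])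
  obtain g where g: "local_section B (fst q') g" "g (fst q') \<in> dom_of (snd a)" "q' = jet B CARD('k) g (fst q')"
    by (rule J_domE[OF q(2)])
  have "coords (fst a) (fst q) = coords (fst a) (fst q')"
    using eq J_jet(2)[OF a f(1,2)] J_jet(2)[OF a g(1,2)] f(3) g(3) by simp
  then have fst: "fst q = fst q'"
    using smooth_atlas_inj[OF base_atlas adapted_base[OF a]] local_section_base[OF a f(1,2)] local_section_base[OF a g(1,2)]
    by (auto dest: inj_onD)
  note g' = g[unfolded fst[symmetric]]
  let ?\<xi> = "coords (fst a) (fst q)"
  have jl: "jlow a f ?\<xi> = jlow a g ?\<xi>" "jtop a f ?\<xi> = jtop a g ?\<xi>"
    using eq J_jet(2)[OF a f(1,2)] J_jet(2)[OF a g'(1,2)] f(3) g'(3) by simp_all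
  obtain V where V: "?\<xi> \<in> V" "smooth_on V (field_rep a f)" using local_section_rep[OF a f(1,2)] by metis
  obtain W where W: "?\<xi> \<in> W" "smooth_on W (field_rep a g)" using local_section_rep[OF a g'(1,2)] by metis
  have "pd \<mu>s (field_rep a g) ?\<xi> = pd \<mu>s (field_rep a f) ?\<xi>" if "length \<mu>s \<le> CARD('k)" for \<mu>s
    using jet_entry_section[OF V(2,1) that] jet_entry_section[OF W(2,1) that] jl by simp
  moreover have "g (fst q) = f (fst q)"
    using jl by (intro section_value_eqI[OF a f(1,2) g'(1,2)]) (simp flip: jlow_Nil)
  ultimately show "q = q'"
    using f(3) g'(3) jet_eq_iff[OF a f(1,2) g'(1)] by metis
qed

lemma poly_section_jet:
  assumes a: "a \<in> adapted_charts B" and x: "(x, \<phi> $ (low [] :: ('n, 'k) lower_index)) \<in> image_of (snd a)"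
    and s: "s = poly_section a CARD('k) (jet_family \<phi> u) x"
  shows "local_section B (uncoords (fst a) x) s" "s (uncoords (fst a) x) = uncoords (snd a) (x, \<phi> $ low [])"
    "s (uncoords (fst a) x) \<in> dom_of (snd a)" "coords (fst a) (uncoords (fst a) x) = x" "jlow a s x = \<phi>" "jtop a s x = u"
proof -
  have 0: "jet_family \<phi> u {#} = \<phi> $ low []" using jet_family_low[of "[]" \<phi> u] by simp
  note ps = poly_section[OF a, where x = x and c = "jet_family \<phi> u" and m = "CARD('k)", unfolded 0, OF x, folded s]
  show "local_section B (uncoords (fst a) x) s" by (rule ps(1))
  show "s (uncoords (fst a) x) = uncoords (snd a) (x, \<phi> $ low [])" by (rule ps(2))
  then show "s (uncoords (fst a) x) \<in> dom_of (snd a)" using uncoords_in_dom[OF x] by simp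
  show "coords (fst a) (uncoords (fst a) x) = x" using total_image_base(1)[OF a x] by (rule coords_uncoords)
  show "jlow a s x = \<phi>"
  proof (rule vec_eq_iff[THEN iffD2, rule_format])
    fix I show "jlow a s x $ I = \<phi> $ I"
      using ps(4)[of "low_list I"] length_low_list[of I] jet_family_low[of "low_list I" \<phi> u] by (simp add: jlow_def)
  qed
  show "jtop a s x = u"
  proof (rule vec_eq_iff[THEN iffD2, rule_format])
    fix I show "jtop a s x $ I = u $ I"
      using ps(4)[of "top_list I"] length_top_list[of I] jet_family_top[of "top_list I" \<phi> u] by (simp add: jtop_def)
  qed
qed

text \<open>Surjectivity of jet coordinates: statements about coordinate tuples may be proved for
  jets of actual sections. The only constraint is on the value; derivatives are
  unrestricted.\<close>

lemma section_of_coords: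
  assumes a: "a \<in> adapted_charts B" and x: "(x, \<phi> $ (low [] :: ('n, 'k) lower_index)) \<in> image_of (snd a)"
  obtains f z where "local_section B z f" "f z \<in> dom_of (snd a)" "f z = uncoords (snd a) (x, \<phi> $ low [])"
    "coords (fst a) z = x" "z = uncoords (fst a) x" "jlow a f x = \<phi>" "jtop a f x = u"
  using poly_section_jet[OF a x refl[of "poly_section a CARD('k) (jet_family \<phi> u) x"]] that by metis

lemma section_coords_image:
  assumes a: "a \<in> adapted_charts B" and f: "local_section B x f" "f x \<in> dom_of (snd a)"
  shows "(coords (fst a) x, jlow a f (coords (fst a) x) $ low []) = coords (snd a) (f x)"
proof -
  obtain V where V: "coords (fst a) x \<in> V"
    "\<And>\<xi>. \<xi> \<in> V \<Longrightarrow> coords (snd a) (f (uncoords (fst a) \<xi>)) = (\<xi>, field_rep a f \<xi>)"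
    using local_section_rep[OF a f] by metis
  from V(2)[OF V(1)] show ?thesis
    using base_uncoords_coords[OF adapted_base[OF a] local_section_base[OF a f]] by (simp add: jlow_Nil)
qed

lemma Q_uncoords_jet:
  assumes a: "a \<in> adapted_charts B" and f: "local_section B x f" "f x \<in> dom_of (snd a)"
  shows "uncoords (Q a) (coords (fst a) x, jlow a f (coords (fst a) x)) = jet B (CARD('k) - 1) f x"
  unfolding uncoords_def Q_jet(2)[OF a f, symmetric] by (rule inv_into_f_f[OF Q_inj[OF a] Q_jet(1)[OF a f]])

lemma J_uncoords_jet:
  assumes a: "a \<in> adapted_charts B" and f: "local_section B x f" "f x \<in> dom_of (snd a)"
  shows "uncoords (J a) (coords (fst a) x, jlow a f (coords (fst a) x), jtop a f (coords (fst a) x)) = jet B CARD('k) f x"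
  unfolding uncoords_def J_jet(2)[OF a f, symmetric] by (rule inv_into_f_f[OF J_inj[OF a] J_jet(1)[OF a f]])

lemma Q_image_iff:
  assumes a: "a \<in> adapted_charts B"
  shows "(x, \<phi>) \<in> image_of (Q a) \<longleftrightarrow> (x, \<phi> $ low []) \<in> image_of (snd a)"
proof
  assume "(x, \<phi>) \<in> image_of (Q a)"
  then obtain q where q: "q \<in> dom_of (Q a)" "coords (Q a) q = (x, \<phi>)" by (auto simp: image_of_def)
  obtain f where f: "local_section B (fst q) f" "f (fst q) \<in> dom_of (snd a)" "q = jet B (CARD('k) - 1) f (fst q)"
    by (rule Q_domE[OF q(1)])
  then show "(x, \<phi> $ low []) \<in> image_of (snd a)"
    using section_coords_image[OF a f(1,2)] Q_jet(2)[OF a f(1,2)] q(2) coords_in_image[OF f(2)] by auto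
next
  assume "(x, \<phi> $ low []) \<in> image_of (snd a)"
  then obtain f z where "local_section B z f" "f z \<in> dom_of (snd a)" "coords (fst a) z = x" "jlow a f x = \<phi>"
    using section_of_coords[OF a] by metis
  then show "(x, \<phi>) \<in> image_of (Q a)" using Q_jet[OF a, of z f] coords_in_image by metis
qed

lemma J_image_iff:
  assumes a: "a \<in> adapted_charts B"
  shows "(x, \<phi>, u) \<in> image_of (J a) \<longleftrightarrow> (x, \<phi> $ low []) \<in> image_of (snd a)"
proof
  assume "(x, \<phi>, u) \<in> image_of (J a)"
  then obtain q where q: "q \<in> dom_of (J a)" "coords (J a) q = (x, \<phi>, u)" by (auto simp: image_of_def)
  obtain f where f: "local_section B (fst q) f" "f (fst q) \<in> dom_of (snd a)" "q = jet B CARD('k) f (fst q)"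
    by (rule J_domE[OF q(1)])
  then show "(x, \<phi> $ low []) \<in> image_of (snd a)"
    using section_coords_image[OF a f(1,2)] J_jet(2)[OF a f(1,2)] q(2) coords_in_image[OF f(2)] by auto
next
  assume "(x, \<phi> $ low []) \<in> image_of (snd a)"
  then obtain f z where "local_section B z f" "f z \<in> dom_of (snd a)" "coords (fst a) z = x" "jlow a f x = \<phi>" "jtop a f x = u"
    using section_of_coords[OF a] by metis
  then show "(x, \<phi>, u) \<in> image_of (J a)" using J_jet[OF a, of z f] coords_in_image by metis
qed

lemma jet_value_uncoords_Q:
  assumes a: "a \<in> adapted_charts B" and "(x, \<phi>) \<in> image_of (Q a)"
  shows "jet_value (uncoords (Q a) (x, \<phi>)) = uncoords (snd a) (x, \<phi> $ low [])"
    "fst (uncoords (Q a) (x, \<phi>)) = uncoords (fst a) x"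
proof -
  obtain f z where f: "local_section B z f" "f z \<in> dom_of (snd a)" "f z = uncoords (snd a) (x, \<phi> $ low [])"
    "coords (fst a) z = x" "z = uncoords (fst a) x" "jlow a f x = \<phi>"
    using section_of_coords[OF a] assms(2) Q_image_iff[OF a] by metis
  then show "jet_value (uncoords (Q a) (x, \<phi>)) = uncoords (snd a) (x, \<phi> $ low [])"
    "fst (uncoords (Q a) (x, \<phi>)) = uncoords (fst a) x"
    using Q_uncoords_jet[OF a f(1,2)] jet_value_jet[OF f(1)] by auto
qed

text \<open>Whether a jet lies in a chart depends only on its value, so domains of jet charts are
  preimages of domains in the total space and inherit their openness.\<close>

lemma Q_overlap_iff:
  assumes a: "a \<in> adapted_charts B" and a': "a' \<in> adapted_charts B"
  shows "(x, \<phi>) \<in> coords (Q a) ` (dom_of (Q a) \<inter> dom_of (Q a')) \<longleftrightarrow>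
    (x, \<phi> $ low []) \<in> coords (snd a) ` (dom_of (snd a) \<inter> dom_of (snd a'))"
proof -
  have "(x, \<phi>) \<in> coords (Q a) ` (dom_of (Q a) \<inter> dom_of (Q a')) \<longleftrightarrow>
     (x, \<phi>) \<in> image_of (Q a) \<and> uncoords (Q a) (x, \<phi>) \<in> dom_of (Q a')"
  proof
    assume "(x, \<phi>) \<in> coords (Q a) ` (dom_of (Q a) \<inter> dom_of (Q a'))"
    then obtain q where "q \<in> dom_of (Q a)" "q \<in> dom_of (Q a')" "(x, \<phi>) = coords (Q a) q" by auto
    then show "(x, \<phi>) \<in> image_of (Q a) \<and> uncoords (Q a) (x, \<phi>) \<in> dom_of (Q a')"
      by (simp add: coords_in_image uncoords_def inv_into_f_f[OF Q_inj[OF a]])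
  qed (use coords_uncoords[of "(x, \<phi>)" "Q a"] uncoords_in_dom[of "(x, \<phi>)" "Q a"] in \<open>auto intro!: image_eqI[of _ _ "uncoords (Q a) (x, \<phi>)"]\<close>)
  also have "\<dots> \<longleftrightarrow> (x, \<phi>) \<in> image_of (Q a) \<and> uncoords (snd a) (x, \<phi> $ low []) \<in> dom_of (snd a')"
    using jet_value_uncoords_Q(1)[OF a, of x \<phi>] uncoords_in_dom[of "(x, \<phi>)" "Q a"]
    by (auto simp: Qchart_def)
  also have "\<dots> \<longleftrightarrow> (x, \<phi> $ low []) \<in> coords (snd a) ` (dom_of (snd a) \<inter> dom_of (snd a'))"
    by (simp add: Q_image_iff[OF a] coords_image_iff[OF total_atlas adapted_total[OF a]])
  finally show ?thesis .
qed

lemma value_coords_smooth: "smooth_on UNIV (\<lambda>y. (fst y, snd y $ low []))"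
  for y :: "('n, 'c, 'k) Qcoord"
  by (intro smooth_on_Pair smooth_on_fst smooth_on_snd smooth_on_nth smooth_on_ident open_UNIV)

lemma Q_image_open:
  assumes a: "a \<in> adapted_charts B"
  shows "open (image_of (Q a))"
proof -
  have "open (image_of (snd a))" using total_atlas adapted_total[OF a] by (simp add: smooth_atlas_def)
  from smooth_on_open_vimage[OF value_coords_smooth this]
  have "open {y \<in> UNIV. (fst y, snd y $ (low [] :: ('n, 'k) lower_index)) \<in> image_of (snd a)}" .
  moreover have "{y \<in> UNIV. (fst y, snd y $ low []) \<in> image_of (snd a)} = image_of (Q a)"
    by (auto simp: Q_image_iff[OF a])
  ultimately show ?thesis by simp
qed

lemma Q_overlap_open:
  assumes a: "a \<in> adapted_charts B" and a': "a' \<in> adapted_charts B"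
  shows "open (coords (Q a) ` (dom_of (Q a) \<inter> dom_of (Q a')))"
proof -
  have "open (coords (snd a) ` (dom_of (snd a) \<inter> dom_of (snd a')))"
    by (rule smooth_onD_open[OF transition_smooth[OF total_atlas adapted_total[OF a] adapted_total[OF a']]])
  from smooth_on_open_vimage[OF value_coords_smooth this]
  have "open {y \<in> UNIV. (fst y, snd y $ (low [] :: ('n, 'k) lower_index)) \<in> coords (snd a) ` (dom_of (snd a) \<inter> dom_of (snd a'))}" .
  moreover have "{y \<in> UNIV. (fst y, snd y $ low []) \<in> coords (snd a) ` (dom_of (snd a) \<inter> dom_of (snd a'))} =
      coords (Q a) ` (dom_of (Q a) \<inter> dom_of (Q a'))"
    by (intro set_eqI) (simp add: split_paired_all Q_overlap_iff[OF a a'])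
  ultimately show ?thesis by simp
qed

lemma adapted_overlap_base:
  assumes a: "a \<in> adapted_charts B" and a': "a' \<in> adapted_charts B"
    and "(x, v) \<in> coords (snd a) ` (dom_of (snd a) \<inter> dom_of (snd a'))"
  shows "x \<in> coords (fst a) ` (dom_of (fst a) \<inter> dom_of (fst a'))"
proof -
  obtain y where y: "y \<in> dom_of (snd a)" "y \<in> dom_of (snd a')" "(x, v) = coords (snd a) y" using assms(3) by auto
  then show ?thesis using adapted_proj[OF a y(1)] adapted_proj(1)[OF a' y(2)] by (metis IntI fst_conv image_eqI)
qed

text \<open>The transition map of the jet coordinates is smooth because it differentiates, with respect to
  the base point only, a Taylor polynomial depending smoothly on its coefficients.\<close>

lemma Q_transition_smooth:
  assumes a: "a \<in> adapted_charts B" and a': "a' \<in> adapted_charts B"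
  shows "smooth_on (coords (Q a) ` (dom_of (Q a) \<inter> dom_of (Q a'))) (coords (Q a') \<circ> uncoords (Q a))"
proof -
  let ?b = "fst a" and ?t = "snd a" and ?b' = "fst a'" and ?t' = "snd a'"
  let ?O = "coords (Q a) ` (dom_of (Q a) \<inter> dom_of (Q a'))"
  let ?Ot = "coords ?t ` (dom_of ?t \<inter> dom_of ?t')"
  let ?\<chi> = "coords ?b \<circ> uncoords ?b'" and ?\<psi> = "coords ?b' \<circ> uncoords ?b" and ?\<Phi> = "coords ?t' \<circ> uncoords ?t"
  note b = adapted_base[OF a] and b' = adapted_base[OF a'] and t = adapted_total[OF a] and t' = adapted_total[OF a']
  let ?\<tau> = "\<lambda>(\<phi> :: ('n, 'c, 'k) fields) x. taylor CARD('k) (jet_family \<phi> (0 :: ('n, 'c, 'k) tops)) x"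
  \<comment> \<open>The base coordinate \<zeta> of the second chart and the jet coordinates of the
    first are treated as independent variables. \<open>G\<close> is then the expression in the
    second chart of the polynomial section with that jet; after differentiation in \<zeta> it is
    evaluated at the image of the base point. The top coefficients are set to 0, which derivatives
    of order below k at that point do not see.\<close>
  define \<Theta> where "\<Theta> y = (?\<chi> (fst y), ?\<tau> (snd (snd y)) (fst (snd y)) (?\<chi> (fst y)))"
    for y :: "(real, 'n) vec \<times> ('n, 'c, 'k) Qcoord"
  define G where "G y = snd (?\<Phi> (\<Theta> y))" for y :: "(real, 'n) vec \<times> ('n, 'c, 'k) Qcoord"
  define D where "D = (coords ?b' ` (dom_of ?b' \<inter> dom_of ?b)) \<times> (UNIV :: ('n, 'c, 'k) Qcoord set)"
  note tr = transition_smooth[OF base_atlas b' b]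
  have opD: "open D" unfolding D_def by (intro open_Times smooth_onD_open[OF tr] open_UNIV)
  have sm\<chi>: "smooth_on D (\<lambda>y. ?\<chi> (fst y))"
    by (rule smooth_on_compose[OF tr smooth_on_fst[OF smooth_on_ident[OF opD]]]) (auto simp: D_def)
  have fam: "smooth_on D (\<lambda>y. jet_family (snd (snd y)) (0 :: ('n, 'c, 'k) tops) I)" for I
    unfolding jet_family_def
    by (cases "size I < CARD('k)") (auto intro!: smooth_on_nth smooth_on_snd smooth_on_ident smooth_on_const opD)
  have sm\<Theta>: "smooth_on D \<Theta>"
    unfolding \<Theta>_def
    by (intro smooth_on_Pair smooth_on_taylor sm\<chi> opD fam smooth_on_fst smooth_on_snd smooth_on_ident)
  define D2 where "D2 = {y \<in> D. \<Theta> y \<in> ?Ot}"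
  note trt = transition_smooth[OF total_atlas t t']
  have opD2: "open D2" unfolding D2_def by (rule smooth_on_open_vimage[OF sm\<Theta> smooth_onD_open[OF trt]])
  have smG: "smooth_on D2 G"
    unfolding G_def by (intro smooth_on_snd smooth_on_compose[OF trt] smooth_on_subset[OF sm\<Theta> opD2]) (auto simp: D2_def)
  have opO: "open ?O" by (rule Q_overlap_open[OF a a'])
  have in_b: "fst y \<in> coords ?b ` (dom_of ?b \<inter> dom_of ?b')" if "y \<in> ?O" for y
    using that Q_overlap_iff[OF a a', of "fst y" "snd y"] adapted_overlap_base[OF a a'] by simp
  have sm\<psi>: "smooth_on ?O (\<lambda>y. ?\<psi> (fst y))"
    by (rule smooth_on_compose[OF transition_smooth[OF base_atlas b b'] smooth_on_fst[OF smooth_on_ident[OF opO]]])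
       (use in_b in auto)
  have fam0: "jet_family \<phi> (0 :: ('n, 'c, 'k) tops) {#} = \<phi> $ low []" for \<phi>
    using jet_family_low[of "[]" \<phi> 0] by simp
  have \<chi>\<psi>: "?\<chi> (?\<psi> (fst y)) = fst y" and \<psi>_in: "?\<psi> (fst y) \<in> coords ?b' ` (dom_of ?b' \<inter> dom_of ?b)" if y: "y \<in> ?O" for y
  proof -
    obtain z where "z \<in> dom_of ?b" "z \<in> dom_of ?b'" "fst y = coords ?b z" using in_b[OF y] by auto
    then show "?\<chi> (?\<psi> (fst y)) = fst y" "?\<psi> (fst y) \<in> coords ?b' ` (dom_of ?b' \<inter> dom_of ?b)"
      by (simp_all add: base_uncoords_coords[OF b] base_uncoords_coords[OF b'])
  qed
  have in_D2: "(?\<psi> (fst y), y) \<in> D2" if "y \<in> ?O" for y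
    using \<chi>\<psi>[OF that] \<psi>_in[OF that] Q_overlap_iff[OF a a', of "fst y" "snd y"] that
    by (auto simp: D2_def D_def \<Theta>_def taylor_center fam0 simp del: o_apply)
  have sub: "(\<lambda>y. (?\<psi> (fst y), y)) ` ?O \<subseteq> D2" using in_D2 by (rule image_subsetI)
  have "smooth_on ?O (\<lambda>y. pd \<mu>s (\<lambda>\<zeta>. G (\<zeta>, y)) (?\<psi> (fst y)))" for \<mu>s
    using smooth_on_compose[OF smooth_on_pd_param[OF smG] smooth_on_Pair[OF sm\<psi> smooth_on_ident[OF opO]] sub, of \<mu>s]
    by (simp only: fst_conv snd_conv)
  then have sm_all: "smooth_on ?O (\<lambda>y. (?\<psi> (fst y), (\<chi> I. pd (low_list I) (\<lambda>\<zeta>. G (\<zeta>, y)) (?\<psi> (fst y))) :: ('n, 'c, 'k) fields))"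
    by (intro smooth_on_Pair[OF sm\<psi> smooth_on_vec[OF opO]]) (simp del: o_apply)
  show ?thesis
  proof (rule smooth_on_cong[OF sm_all])
    fix y assume y: "y \<in> ?O"
    define x \<phi> where "x = fst y" and "\<phi> = snd y"
    have xy: "y = (x, \<phi>)" by (simp add: x_def \<phi>_def)
    have ov: "(x, \<phi> $ low []) \<in> ?Ot" using y Q_overlap_iff[OF a a'] by (simp add: xy)
    then have im: "(x, \<phi> $ low []) \<in> image_of ?t" by (auto simp: image_of_def)
    let ?s = "poly_section a CARD('k) (jet_family \<phi> (0 :: ('n, 'c, 'k) tops)) x" and ?z = "uncoords ?b x"
    note s = poly_section_jet[OF a im refl[of ?s]]
    have s': "?s ?z \<in> dom_of ?t'"
      using ov unfolding s(2) coords_image_iff[OF total_atlas t] by simp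
    have x': "coords ?b' ?z = ?\<psi> x" by simp
    obtain V where V: "open V" "x \<in> V" "\<And>\<xi>. \<xi> \<in> V \<Longrightarrow> field_rep a ?s \<xi> = ?\<tau> \<phi> x \<xi>"
      using poly_section(3)[OF a, of x "jet_family \<phi> (0 :: ('n, 'c, 'k) tops)"] im fam0 by metis
    have V': "open V" "coords ?b ?z \<in> V" using V s(4) by simp_all
    obtain W where W: "open W" "?\<psi> x \<in> W" "?\<chi> ` W \<subseteq> V"
      "\<And>\<zeta>. \<zeta> \<in> W \<Longrightarrow> field_rep a' ?s \<zeta> = snd (?\<Phi> (?\<chi> \<zeta>, field_rep a ?s (?\<chi> \<zeta>)))"
      using field_rep_change[OF a a' s(1,3) s' V'] unfolding x' by metis
    have "pd \<mu>s (field_rep a' ?s) (?\<psi> x) = pd \<mu>s (\<lambda>\<zeta>. G (\<zeta>, y)) (?\<psi> x)" for \<mu>s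
      using W(3) by (intro pd_cong_open[OF W(1) _ W(2)]) (auto simp: W(4) G_def \<Theta>_def xy V(3) simp del: o_apply)
    then have "(\<chi> I. pd (low_list I) (\<lambda>\<zeta>. G (\<zeta>, y)) (?\<psi> x)) = jlow a' ?s (?\<psi> x)"
      by (simp add: jlow_def del: o_apply)
    moreover have "coords (Q a') (uncoords (Q a) y) = (?\<psi> x, jlow a' ?s (?\<psi> x))"
      using Q_uncoords_jet[OF a s(1,3)] Q_jet(2)[OF a' s(1) s'] unfolding s(4,5) xy by simp
    ultimately show "(?\<psi> (fst y), \<chi> I. pd (low_list I) (\<lambda>\<zeta>. G (\<zeta>, y)) (?\<psi> (fst y))) = (coords (Q a') \<circ> uncoords (Q a)) y"
      by (simp add: xy del: o_apply) simp
  qed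
qed

lemma Qatlas_smooth: "smooth_atlas (Qatlas B :: (('m, 'f) jet, ('n, 'c, 'k) Qcoord) chart set)"
  unfolding smooth_atlas_def Qatlas_def using Q_inj Q_image_open Q_transition_smooth by blast

lemma Q_transition_section:
  assumes a: "a \<in> adapted_charts B" and a': "a' \<in> adapted_charts B"
    and f: "local_section B x f" "f x \<in> dom_of (snd a)" "f x \<in> dom_of (snd a')"
  shows "(coords (Q a') \<circ> uncoords (Q a)) (coords (fst a) x, jlow a f (coords (fst a) x)) =
    (coords (fst a') x, jlow a' f (coords (fst a') x))"
  using Q_uncoords_jet[OF a f(1,2)] Q_jet(2)[OF a' f(1,3)] by simp

text \<open>Differentiation along an axis appends an index; from order k - 1 this leaves the lower
  coordinates, and \<open>jtop\<close> supplies the entries.\<close>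

lemma jlow_has_derivative:
  assumes "smooth_on V (field_rep a f)" "\<xi> \<in> V"
  shows "(jlow a f has_derivative jent (jlow a f \<xi>) (jtop a f \<xi>)) (at \<xi>)"
proof -
  have "smooth_on V (jlow a f)"
    unfolding jlow_def by (rule smooth_on_vec[OF smooth_onD_open[OF assms(1)]]) (simp add: smooth_on_pd[OF assms(1)])
  from smooth_on_has_derivative[OF this assms(2)]
  have D: "(jlow a f has_derivative frechet_derivative (jlow a f) (at \<xi>)) (at \<xi>)" .
  have "frechet_derivative (jlow a f) (at \<xi>) e = jent (jlow a f \<xi>) (jtop a f \<xi>) e" for e
  proof (rule vec_eq_iff[THEN iffD2, rule_format])
    fix I :: "('n, 'k) lower_index"
    have "((\<lambda>\<xi>. jlow a f \<xi> $ I) has_derivative (\<lambda>e. frechet_derivative (jlow a f) (at \<xi>) e $ I)) (at \<xi>)"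
      by (rule bounded_linear.has_derivative[OF bounded_linear_vec_nth D])
    then have "frechet_derivative (jlow a f) (at \<xi>) e $ I = frechet_derivative (pd (low_list I) (field_rep a f)) (at \<xi>) e"
      by (simp add: jlow_def frechet_derivative_eqI)
    also have "\<dots> = (\<Sum>\<nu>\<in>UNIV. e $ \<nu> *\<^sub>R pd (\<nu> # low_list I) (field_rep a f) \<xi>)"
      unfolding pd.simps
      by (rule frechet_derivative_sum_axis[OF smooth_on_differentiable[OF smooth_on_pd[OF assms(1)] assms(2)]])
    also have "\<dots> = (\<Sum>\<nu>\<in>UNIV. e $ \<nu> *\<^sub>R jet_entry (jlow a f \<xi>) (jtop a f \<xi>) (low_list I @ [\<nu>]))"
    proof (intro sum.cong refl arg_cong2[where f = "(*\<^sub>R)"])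
      fix \<nu>
      have "pd (\<nu> # low_list I) (field_rep a f) \<xi> = pd (low_list I @ [\<nu>]) (field_rep a f) \<xi>"
        by (rule pd_perm[OF assms]) simp
      also have "\<dots> = jet_entry (jlow a f \<xi>) (jtop a f \<xi>) (low_list I @ [\<nu>])"
        using length_low_list[of I] by (intro jet_entry_section[OF assms, symmetric]) simp
      finally show "pd (\<nu> # low_list I) (field_rep a f) \<xi> = jet_entry (jlow a f \<xi>) (jtop a f \<xi>) (low_list I @ [\<nu>])" .
    qed
    finally show "frechet_derivative (jlow a f) (at \<xi>) e $ I = jent (jlow a f \<xi>) (jtop a f \<xi>) e $ I"
      by (simp add: jent_def)
  qed
  then have "frechet_derivative (jlow a f) (at \<xi>) = jent (jlow a f \<xi>) (jtop a f \<xi>)" by (rule ext)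
  with D show ?thesis by simp
qed

text \<open>The transition maps preserve the contact structure: holonomic directions, i.e. those tangent to
  \<open>(k - 1)\<close>-jets of sections, are mapped to holonomic directions.\<close>

lemma contact_transition:
  assumes a: "a \<in> adapted_charts B" and a': "a' \<in> adapted_charts B"
    and f: "local_section B x f" "f x \<in> dom_of (snd a)" "f x \<in> dom_of (snd a')"
  defines "\<xi> \<equiv> coords (fst a) x" and "\<xi>' \<equiv> coords (fst a') x"
  defines "d\<psi> \<equiv> frechet_derivative (coords (fst a') \<circ> uncoords (fst a)) (at \<xi>)"
  shows "frechet_derivative (coords (Q a') \<circ> uncoords (Q a)) (at (\<xi>, jlow a f \<xi>)) (e, jent (jlow a f \<xi>) (jtop a f \<xi>) e) =
    (d\<psi> e, jent (jlow a' f \<xi>') (jtop a' f \<xi>') (d\<psi> e))"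
proof -
  let ?T = "coords (Q a') \<circ> uncoords (Q a)" and ?\<psi> = "coords (fst a') \<circ> uncoords (fst a)"
  note b = adapted_base[OF a] and b' = adapted_base[OF a']
  have x: "x \<in> dom_of (fst a)" "x \<in> dom_of (fst a')" using local_section_base[OF a f(1,2)] local_section_base[OF a' f(1,3)] .
  obtain V where V: "open V" "\<xi> \<in> V" "V \<subseteq> image_of (fst a)" "smooth_on V (field_rep a f)"
    "\<And>\<xi>. \<xi> \<in> V \<Longrightarrow> f (uncoords (fst a) \<xi>) \<in> dom_of (snd a)" "\<And>\<xi>. \<xi> \<in> V \<Longrightarrow> local_section B (uncoords (fst a) \<xi>) f"
    using local_section_rep[OF a f(1,2)] unfolding \<xi>_def by metis
  obtain V' where V': "open V'" "\<xi>' \<in> V'" "smooth_on V' (field_rep a' f)"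
    "\<And>\<xi>. \<xi> \<in> V' \<Longrightarrow> f (uncoords (fst a') \<xi>) \<in> dom_of (snd a')"
    using local_section_rep[OF a' f(1,3)] unfolding \<xi>'_def by metis
  note tr = transition_smooth[OF base_atlas b b']
  have \<psi>\<xi>: "?\<psi> \<xi> = \<xi>'" by (simp add: \<xi>_def \<xi>'_def base_uncoords_coords[OF b x(1)])
  define U where "U = V \<inter> {\<xi> \<in> coords (fst a) ` (dom_of (fst a) \<inter> dom_of (fst a')). ?\<psi> \<xi> \<in> V'}"
  have opU: "open U" unfolding U_def by (intro open_Int V smooth_on_open_vimage[OF tr V'(1)])
  have \<xi>U: "\<xi> \<in> U" using V(2) V'(2) \<psi>\<xi> x by (auto simp: U_def \<xi>_def)
  have d\<psi>: "(?\<psi> has_derivative d\<psi>) (at \<xi>)"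
    unfolding d\<psi>_def \<xi>_def by (rule transition_has_derivative[OF base_atlas b b' x])
  \<comment> \<open>The transition map sends the prolonged section in one chart to the prolonged
    section in the other, near \<open>\<xi>\<close> and not only at it; the claim is the derivative
    of this identity.\<close>
  have curve: "?T (\<eta>, jlow a f \<eta>) = (?\<psi> \<eta>, jlow a' f (?\<psi> \<eta>))" if "\<eta> \<in> U" for \<eta>
  proof -
    let ?z = "uncoords (fst a) \<eta>"
    have 1: "local_section B ?z f" "f ?z \<in> dom_of (snd a)" and z: "coords (fst a) ?z = \<eta>"
      using that V by (auto simp: U_def intro: coords_uncoords)
    have "?z \<in> dom_of (fst a')" using that by (auto simp: U_def coords_image_iff[OF base_atlas b])
    then have "uncoords (fst a') (?\<psi> \<eta>) = ?z" by (simp add: base_uncoords_coords[OF b'])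
    then have 2: "f ?z \<in> dom_of (snd a')" using that V'(4)[of "?\<psi> \<eta>"] by (auto simp: U_def)
    from Q_transition_section[OF a a' 1 2] show ?thesis by (simp add: z)
  qed
  have fx: "(\<xi>, jlow a f \<xi>) \<in> coords (Q a) ` (dom_of (Q a) \<inter> dom_of (Q a'))"
    using Q_jet[OF a f(1,2)] Q_jet(1)[OF a' f(1,3)] unfolding \<xi>_def by (metis IntI image_eqI)
  have "((\<lambda>\<eta>. (\<eta>, jlow a f \<eta>)) has_derivative (\<lambda>e. (e, jent (jlow a f \<xi>) (jtop a f \<xi>) e))) (at \<xi>)"
    by (intro has_derivative_Pair has_derivative_ident jlow_has_derivative[OF V(4,2)])
  from has_derivative_compose[OF this smooth_on_has_derivative[OF Q_transition_smooth[OF a a'] fx]]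
  have L: "((\<lambda>\<eta>. ?T (\<eta>, jlow a f \<eta>)) has_derivative
     (\<lambda>e. frechet_derivative ?T (at (\<xi>, jlow a f \<xi>)) (e, jent (jlow a f \<xi>) (jtop a f \<xi>) e))) (at \<xi>)" .
  have "(jlow a' f has_derivative jent (jlow a' f \<xi>') (jtop a' f \<xi>')) (at (?\<psi> \<xi>))"
    unfolding \<psi>\<xi> by (rule jlow_has_derivative[OF V'(3,2)])
  from has_derivative_Pair[OF d\<psi> has_derivative_compose[OF d\<psi> this]]
  have "((\<lambda>\<eta>. (?\<psi> \<eta>, jlow a' f (?\<psi> \<eta>))) has_derivative (\<lambda>e. (d\<psi> e, jent (jlow a' f \<xi>') (jtop a' f \<xi>') (d\<psi> e)))) (at \<xi>)" .
  from has_derivative_unique[OF L has_derivative_transform_within_open[OF this opU \<xi>U curve[symmetric]]]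
  show ?thesis by (rule fun_cong)
qed

end

section \<open>The phase bundle\<close>

subsection \<open>The volume form\<close>

lemma volume_linear_first:
  assumes "length es = CARD('n::{finite,linorder}) - 1"
  shows "linear (\<lambda>z :: (real, 'n) vec. volume (z # es))"
proof -
  have lin: "volume ((a *\<^sub>R u + b *\<^sub>R v) # es) = a * volume (u # es) + b * volume (v # es)" for a b :: real and u v :: "(real, 'n) vec"
  proof -
    have "linear \<alpha>" if "\<alpha> \<in> set (map (\<lambda>\<mu> (v :: (real, 'n) vec). v $ \<mu>) base_indices)" for \<alpha>
      using that by (auto intro!: linearI)
    then show ?thesis unfolding volume_def
      using wedge_linear_slot[of "map (\<lambda>\<mu> v. v $ \<mu>) (base_indices :: 'n list)" 0 "u # es" a u b v] assms
      by (simp add: base_indices(3))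
  qed
  show ?thesis
  proof (rule linearI)
    show "volume ((x + y) # es) = volume (x # es) + volume (y # es)" for x y :: "(real, 'n) vec"
      using lin[of 1 x 1 y] by simp
    show "volume ((r *\<^sub>R x) # es) = r *\<^sub>R volume (x # es)" for r and x :: "(real, 'n) vec"
      using lin[of r x 0 0] by simp
  qed
qed

lemma volume_first_sum:
  fixes z :: "(real, 'n::{finite,linorder}) vec"
  assumes "length es = CARD('n) - 1"
  shows "volume (z # es) = (\<Sum>\<kappa>\<in>UNIV. z $ \<kappa> * volume (axis \<kappa> 1 # es))"
proof -
  have "volume ((\<Sum>\<kappa>\<in>UNIV. z $ \<kappa> *\<^sub>R axis \<kappa> 1) # es) = (\<Sum>\<kappa>\<in>UNIV. z $ \<kappa> * volume (axis \<kappa> 1 # es))"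
    by (simp add: linear_sum[OF volume_linear_first[OF assms]] linear_scale[OF volume_linear_first[OF assms]])
  then show ?thesis using basis_expansion[of z] by (simp add: scalar_mult_eq_scaleR)
qed

lemma volume_linear_map:
  fixes A :: "(real, 'n::{finite,linorder}) vec \<Rightarrow> (real, 'n) vec"
  assumes "linear A" "length vs = CARD('n)"
  shows "volume (map A vs) = det (matrix A) * volume vs"
proof -
  obtain G :: "'n \<Rightarrow> (real, 'n) vec" where vs: "vs = map G base_indices"
    using length_eq_map_base_indices[OF assms(2)] by blast
  have "(\<chi> \<mu> \<nu>. (A \<circ> G) \<nu> $ \<mu>) = matrix A ** (\<chi> \<mu> \<nu>. G \<nu> $ \<mu>)"
  proof -
    have "A (G \<nu>) $ \<mu> = (\<Sum>k\<in>UNIV. matrix A $ \<mu> $ k * G \<nu> $ k)" for \<mu> \<nu>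
      using fun_cong[OF matrix_vector_mul(2)[OF assms(1)], of "G \<nu>"] by (simp add: matrix_vector_mult_def vec_eq_iff)
    then show ?thesis by (simp add: vec_eq_iff matrix_matrix_mult_def)
  qed
  then have "volume (map (A \<circ> G) base_indices) = det (matrix A) * volume (map G base_indices)"
    unfolding volume_map by (simp add: det_mul)
  then show ?thesis by (simp add: vs)
qed

lemma volume_axis: "volume (map (\<lambda>\<nu>. axis \<nu> 1) (base_indices :: 'n::{finite,linorder} list)) = 1"
proof -
  have "(\<chi> \<mu> \<nu>. axis \<nu> 1 $ \<mu>) = (mat 1 :: ((real, 'n) vec, 'n) vec)" by (auto simp: vec_eq_iff mat_def axis_def)
  then show ?thesis by (simp add: volume_map)
qed

lemma volume_nondegenerate:
  fixes z :: "(real, 'n::{finite,linorder}) vec"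
  assumes "\<And>es. length es = CARD('n) - 1 \<Longrightarrow> volume (z # es) = 0"
  shows "z = 0"
proof (rule ccontr)
  assume "z \<noteq> 0"
  obtain \<kappa> rest where bs: "(base_indices :: 'n list) = \<kappa> # rest"
    using base_indices(3)[where 'n = 'n] by (cases "base_indices :: 'n list") auto
  have "norm (axis \<kappa> 1 :: (real, 'n) vec) = 1" "norm (z /\<^sub>R norm z) = 1" using \<open>z \<noteq> 0\<close> by simp_all
 \<comment> \<open>A nonzero \<open>z\<close> is completed to a frame of nonzero volume by moving an
   axis onto its direction orthogonally; the images of the other axes are the test vectors.\<close>
 then obtain A :: "(real, 'n) vec \<Rightarrow> (real, 'n) vec" where A: "orthogonal_transformation A" "A (axis \<kappa> 1) = z /\<^sub>R norm z"
    by (rule orthogonal_transformation_exists_1)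
  have lin: "linear A" using A(1) by (simp add: orthogonal_transformation_def)
  let ?es = "map A (map (\<lambda>\<nu>. axis \<nu> 1) rest)"
  have len: "length ?es = CARD('n) - 1" using base_indices(3)[where 'n = 'n] by (simp add: bs)
  have "volume (map A (map (\<lambda>\<nu>. axis \<nu> 1) (base_indices :: 'n list))) = det (matrix A)"
    using volume_linear_map[OF lin, of "map (\<lambda>\<nu>. axis \<nu> 1) (base_indices :: 'n list)"] base_indices(3)[where 'n = 'n]
    by (simp add: volume_axis)
  moreover have "map A (map (\<lambda>\<nu>. axis \<nu> 1) (base_indices :: 'n list)) = (z /\<^sub>R norm z) # ?es"
    by (simp add: bs A(2))
  moreover have "volume ((z /\<^sub>R norm z) # ?es) = inverse (norm z) * volume (z # ?es)"
    using linear_scale[OF volume_linear_first[OF len]] by simp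
  ultimately have "det (matrix A) = 0" using assms[OF len] by simp
  then show False using orthogonal_transformation_det[OF A(1)] by simp
qed

subsection \<open>Pairing of momenta with jet coordinates\<close>

text \<open>Sums run over all index tuples, whereas a coordinate belongs to a multiset; each
  multiset counts with the number of its orderings.\<close>

definition wt :: "('n::{finite,linorder}, 'k::finite) lower_index \<Rightarrow> real" where
  "wt I = real (arrangements (low_list I))"

lemma finite_lists_eq: "finite {\<mu>s :: 'n::finite list. length \<mu>s = m}"
  using finite_lists_length_eq[of "UNIV :: 'n set" m] by simp

lemma arrangements_pos: "arrangements (\<mu>s :: 'n::finite list) > 0"
proof -
  have "{\<nu>s. mset \<nu>s = mset \<mu>s} \<subseteq> {\<nu>s. length \<nu>s = length \<mu>s}" using mset_eq_length by blast
  then have "finite {\<nu>s. mset \<nu>s = mset \<mu>s}" using finite_lists_eq finite_subset by blast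
  then show ?thesis unfolding arrangements_def by (auto simp: card_gt_0_iff)
qed

lemma wt_pos: "wt I > 0"
  by (simp add: wt_def arrangements_pos)

lemma wt_nonzero [simp]: "wt I \<noteq> 0"
  using wt_pos[of I] by simp

lemma sum_lists_low:
  fixes F :: "('n::{finite,linorder}, 'k::finite) lower_index \<Rightarrow> real"
  shows "(\<Sum>m<CARD('k). \<Sum>\<mu>s | length \<mu>s = m. F (low \<mu>s)) = (\<Sum>I\<in>UNIV. wt I * F I)"
proof -
  define S where "S = (\<Union>m\<in>{..<CARD('k)}. {\<mu>s :: 'n list. length \<mu>s = m})"
  have fin: "finite S" by (simp add: S_def finite_lists_eq)
  have "(\<Sum>m<CARD('k). \<Sum>\<mu>s | length \<mu>s = m. F (low \<mu>s)) = (\<Sum>\<mu>s\<in>S. F (low \<mu>s))"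
    unfolding S_def by (rule sum.UNION_disjoint[symmetric]) (auto simp: finite_lists_eq)
  also have "\<dots> = (\<Sum>I\<in>UNIV. \<Sum>\<mu>s\<in>{\<mu>s\<in>S. low \<mu>s = (I :: ('n, 'k) lower_index)}. F (low \<mu>s))"
    by (rule sum.group[symmetric]) (use fin in auto)
  also have "\<dots> = (\<Sum>I\<in>UNIV. wt I * F I)"
  proof (intro sum.cong refl)
    fix I :: "('n, 'k) lower_index"
    have "{\<mu>s\<in>S. low \<mu>s = I} = {\<mu>s. mset \<mu>s = Rep_lower_index I}"
    proof (intro set_eqI iffI)
      fix \<mu>s assume "\<mu>s \<in> {\<mu>s\<in>S. low \<mu>s = I}"
      then show "\<mu>s \<in> {\<mu>s. mset \<mu>s = Rep_lower_index I}" using Rep_low[of \<mu>s, where 'k = 'k] by (auto simp: S_def)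
    next
      fix \<mu>s assume \<mu>s: "\<mu>s \<in> {\<mu>s. mset \<mu>s = Rep_lower_index I}"
      then have "size (mset \<mu>s) < CARD('k)" using Rep_lower_index[of I] by simp
      then show "\<mu>s \<in> {\<mu>s\<in>S. low \<mu>s = I}" using \<mu>s by (auto simp: S_def low_def Rep_lower_index_inverse)
    qed
    then have "(\<Sum>\<mu>s\<in>{\<mu>s\<in>S. low \<mu>s = I}. F (low \<mu>s)) = (\<Sum>\<mu>s\<in>{\<mu>s. mset \<mu>s = Rep_lower_index I}. F I)"
      by (intro sum.cong) (auto simp: low_def Rep_lower_index_inverse)
    then show "(\<Sum>\<mu>s\<in>{\<mu>s\<in>S. low \<mu>s = I}. F (low \<mu>s)) = wt I * F I"
      by (simp add: wt_def arrangements_def)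
  qed
  finally show ?thesis .
qed

text \<open>The vector whose contraction with d^nx is the value of the momentum \<open>p\<close> on
  a vertical vector with components \<open>w\<close>; the weights turn the sum over multisets into
  the sum over all index tuples.\<close>

definition pr :: "('n::{finite,linorder}, 'c::finite, 'k::finite) momenta \<Rightarrow> ('n, 'c, 'k) fields \<Rightarrow> (real, 'n) vec" where
  "pr p w = (\<chi> \<kappa>. \<Sum>I\<in>UNIV. wt I * (p $ I $ \<kappa> \<bullet> w $ I))"

lemma pr_nth: "pr p w $ \<kappa> = (\<Sum>I\<in>UNIV. wt I * (p $ I $ \<kappa> \<bullet> w $ I))"
  by (simp add: pr_def)

lemma sum_pr:
  fixes p :: "('n::{finite,linorder}, 'c::finite, 'k::finite) momenta"
  shows "(\<Sum>m<CARD('k). \<Sum>\<mu>s | length \<mu>s = m. \<Sum>\<kappa>\<in>UNIV. \<Sum>i\<in>UNIV. p $ low \<mu>s $ \<kappa> $ i * w \<kappa> $ low \<mu>s $ i * c \<kappa>) =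
    (\<Sum>\<kappa>\<in>UNIV. pr p (w \<kappa>) $ \<kappa> * c \<kappa>)"
proof -
  have "(\<Sum>m<CARD('k). \<Sum>\<mu>s | length \<mu>s = m. \<Sum>\<kappa>\<in>UNIV. \<Sum>i\<in>UNIV. p $ low \<mu>s $ \<kappa> $ i * w \<kappa> $ low \<mu>s $ i * c \<kappa>) =
    (\<Sum>I\<in>UNIV. wt I * (\<Sum>\<kappa>\<in>UNIV. \<Sum>i\<in>UNIV. p $ I $ \<kappa> $ i * w \<kappa> $ I $ i * c \<kappa>))"
    by (rule sum_lists_low)
  also have "\<dots> = (\<Sum>\<kappa>\<in>UNIV. \<Sum>I\<in>UNIV. wt I * (\<Sum>i\<in>UNIV. p $ I $ \<kappa> $ i * w \<kappa> $ I $ i * c \<kappa>))"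
    unfolding sum_distrib_left by (rule sum.swap)
  finally show ?thesis by (simp add: pr_nth inner_vec_def sum_distrib_left sum_distrib_right mult.assoc)
qed

lemma bilinear_pr: "bounded_bilinear pr"
proof -
  have "bilinear pr"
    unfolding bilinear_def
    by (auto intro!: linearI simp: vec_eq_iff pr_nth inner_add_left inner_add_right algebra_simps sum.distrib sum_distrib_left)
  then show ?thesis by (simp add: bilinear_conv_bounded_bilinear)
qed

lemmas pr_add_right = bounded_bilinear.add_right[OF bilinear_pr]
  and pr_diff_right = bounded_bilinear.diff_right[OF bilinear_pr]
  and pr_scaleR_right = bounded_bilinear.scaleR_right[OF bilinear_pr]

lemma pr_axis: "pr p (axis I (axis i 1)) $ \<kappa> = wt I * p $ I $ \<kappa> $ i"
proof -
  have "p $ L $ \<kappa> \<bullet> (axis I (axis i 1) :: ('a, 'b, 'c) fields) $ L = (if L = I then p $ I $ \<kappa> $ i else 0)" for L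
    by (auto simp: axis_def inner_vec_def if_distrib[of "\<lambda>x. _ * x"] cong: if_cong)
  then show ?thesis by (simp add: pr_nth if_distrib[of "\<lambda>x. _ * x"] cong: if_cong)
qed

lemma pr_eqI:
  assumes "\<And>w. pr p w = pr p' w"
  shows "p = p'"
proof -
  have "p $ I $ \<kappa> $ i = p' $ I $ \<kappa> $ i" for I \<kappa> i
    using arg_cong[OF assms[of "axis I (axis i 1)"], of "\<lambda>v. v $ \<kappa>"] by (simp add: pr_axis)
  then show ?thesis by (simp add: vec_eq_iff)
qed

lemma fields_expand: "w = (\<Sum>I\<in>UNIV. \<Sum>i\<in>UNIV. w $ I $ i *\<^sub>R axis I (axis i 1))"
  for w :: "((real, 'c::finite) vec, 'a::finite) vec"
proof -
  have "(\<Sum>j'\<in>UNIV. if i = i' then if j = j' then w $ i' $ j' else 0 else 0) = (if i = i' then w $ i' $ j else 0)" for i i' j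
    by (cases "i = i'") auto
  then show ?thesis
    by (simp add: vec_eq_iff axis_def if_distrib[of "\<lambda>x. x $ _"] if_distrib[of "\<lambda>x. _ * x"] cong: if_cong)
qed

text \<open>Inverse to \<open>pr\<close>: every linear map from field components to base vectors is
  the pairing with exactly one momentum, so momenta can be transformed by transforming such
  maps.\<close>

definition mom_of :: "(('n::{finite,linorder}, 'c::finite, 'k::finite) fields \<Rightarrow> (real, 'n) vec) \<Rightarrow> ('n, 'c, 'k) momenta" where
  "mom_of g = (\<chi> I \<kappa> i. g (axis I (axis i 1)) $ \<kappa> / wt I)"

lemma pr_mom_of:
  assumes "linear g"
  shows "pr (mom_of g) w = g w"
proof -
  have "g w = (\<Sum>I\<in>UNIV. \<Sum>i\<in>UNIV. w $ I $ i *\<^sub>R g (axis I (axis i 1)))"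
    by (subst fields_expand[of w]) (simp add: linear_sum[OF assms] linear_scale[OF assms])
  then show ?thesis
    by (simp add: vec_eq_iff pr_nth mom_of_def inner_vec_def sum_distrib_left mult.commute)
qed

subsection \<open>Change of coordinates of the momenta\<close>

lemma smooth_on_frechet_at:
  assumes "smooth_on T F" "smooth_on S g" "g ` S \<subseteq> T" "smooth_on S v"
  shows "smooth_on S (\<lambda>x. frechet_derivative F (at (g x)) (v x))"
proof (rule smooth_on_cong)
  show "smooth_on S (\<lambda>x. \<Sum>b\<in>Basis. (v x \<bullet> b) *\<^sub>R frechet_derivative F (at (g x)) b)"
    using assms smooth_onD_open[OF assms(2)]
    by (intro smooth_on_sum smooth_on_scaleR smooth_on_inner smooth_on_const
        smooth_on_compose[OF smooth_on_frechet1[OF assms(1)]]) auto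
  show "(\<Sum>b\<in>Basis. (v x \<bullet> b) *\<^sub>R frechet_derivative F (at (g x)) b) = frechet_derivative F (at (g x)) (v x)" if "x \<in> S" for x
    using assms(3) that
    by (intro frechet_derivative_basis_sum[symmetric] smooth_on_differentiable[OF assms(1)]) auto
qed

lemma smooth_on_det:
  fixes A :: "'a::euclidean_space \<Rightarrow> real^'n^'n"
  assumes "open S" "\<And>i j. smooth_on S (\<lambda>x. A x $ i $ j)"
  shows "smooth_on S (\<lambda>x. det (A x))"
  unfolding det_def by (intro smooth_on_sum smooth_on_mult smooth_on_const smooth_on_prod assms)

context jet_bundle begin

abbreviation "\<psi> a a' \<equiv> coords (fst a') \<circ> uncoords (fst a)"
abbreviation "TQ a a' \<equiv> coords (Q a') \<circ> uncoords (Q a)"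
abbreviation "OQ a a' \<equiv> coords (Q a) ` (dom_of (Q a) \<inter> dom_of (Q a'))"
abbreviation "d\<psi> a a' x \<equiv> frechet_derivative (\<psi> a a') (at x)"
abbreviation "DQ a a' y \<equiv> frechet_derivative (TQ a a') (at y)"

lemma Q_in_atlas: "a \<in> adapted_charts B \<Longrightarrow> Q a \<in> Qatlas B"
  by (simp add: Qatlas_def)

lemma Q_dom_base:
  assumes "a \<in> adapted_charts B" "q \<in> dom_of (Q a)"
  shows "fst q \<in> dom_of (fst a)" "fst (coords (Q a) q) = coords (fst a) (fst q)"
proof -
  obtain f where f: "local_section B (fst q) f" "f (fst q) \<in> dom_of (snd a)" by (rule Q_domE[OF assms(2)])
  show "fst q \<in> dom_of (fst a)" by (rule local_section_base[OF assms(1) f])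
  show "fst (coords (Q a) q) = coords (fst a) (fst q)" by (simp add: Qchart_def)
qed

lemma fst_TQ:
  assumes a: "a \<in> adapted_charts B" and y: "y \<in> image_of (Q a)"
  shows "fst (TQ a a' y) = \<psi> a a' (fst y)"
  using jet_value_uncoords_Q(2)[OF a, of "fst y" "snd y"] y by (simp add: Qchart_def)

lemma OQ_base:
  assumes a: "a \<in> adapted_charts B" and a': "a' \<in> adapted_charts B" and "y \<in> OQ a a'"
  shows "fst y \<in> coords (fst a) ` (dom_of (fst a) \<inter> dom_of (fst a'))"
  using assms(3) Q_overlap_iff[OF a a', of "fst y" "snd y"] adapted_overlap_base[OF a a'] by simp

lemma OQ_image: "y \<in> OQ a a' \<Longrightarrow> y \<in> image_of (Q a)"
  by (auto simp: image_of_def)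

lemma fst_DQ:
  assumes a: "a \<in> adapted_charts B" and a': "a' \<in> adapted_charts B" and y: "y \<in> OQ a a'"
  shows "fst (DQ a a' y v) = d\<psi> a a' (fst y) (fst v)"
proof -
  have A: "((\<lambda>y. fst (TQ a a' y)) has_derivative (\<lambda>v. fst (DQ a a' y v))) (at y)"
    by (intro has_derivative_fst smooth_on_has_derivative[OF Q_transition_smooth[OF a a'] y])
  have B: "((\<lambda>y. \<psi> a a' (fst y)) has_derivative (\<lambda>v. d\<psi> a a' (fst y) (fst v))) (at y)"
    by (rule has_derivative_compose[OF has_derivative_fst[OF has_derivative_ident]
        smooth_on_has_derivative[OF transition_smooth[OF base_atlas adapted_base[OF a] adapted_base[OF a']] OQ_base[OF a a' y]]])
  have "fst (TQ a a' y) = \<psi> a a' (fst y)" if "y \<in> OQ a a'" for y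
    by (rule fst_TQ[OF a OQ_image[OF that]])
  from has_derivative_unique[OF has_derivative_transform_within_open[OF A Q_overlap_open[OF a a'] y this] B]
  show ?thesis by (rule fun_cong)
qed

lemma TQ_in:
  assumes a: "a \<in> adapted_charts B" and y: "y \<in> OQ a a'"
  shows "TQ a a' y \<in> OQ a' a" "a' \<in> adapted_charts B \<Longrightarrow> TQ a' a (TQ a a' y) = y"
proof -
  obtain q where q: "q \<in> dom_of (Q a)" "q \<in> dom_of (Q a')" "y = coords (Q a) q" using y by auto
  have u: "uncoords (Q a) y = q" unfolding q(3) by (rule uncoords_coords[OF Qatlas_smooth Q_in_atlas[OF a] q(1)])
  then show "TQ a a' y \<in> OQ a' a" using q by auto
  assume a': "a' \<in> adapted_charts B"
  show "TQ a' a (TQ a a' y) = y"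
    using u q uncoords_coords[OF Qatlas_smooth Q_in_atlas[OF a'] q(2)] by simp
qed

lemma DQ_linear:
  assumes "a \<in> adapted_charts B" "a' \<in> adapted_charts B" "y \<in> OQ a a'"
  shows "linear (DQ a a' y)"
  by (rule smooth_on_linear[OF Q_transition_smooth[OF assms(1,2)] assms(3)])

lemma DQ_inverse:
  assumes a: "a \<in> adapted_charts B" and a': "a' \<in> adapted_charts B" and y: "y \<in> OQ a a'"
  shows "DQ a' a (TQ a a' y) (DQ a a' y v) = v"
proof -
  obtain q where q: "q \<in> dom_of (Q a)" "q \<in> dom_of (Q a')" "y = coords (Q a) q" using y by auto
  have u: "uncoords (Q a) y = q" unfolding q(3) by (rule uncoords_coords[OF Qatlas_smooth Q_in_atlas[OF a] q(1)])
  show ?thesis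
    using transition_chain[OF Qatlas_smooth Q_in_atlas[OF a] Q_in_atlas[OF a'] Q_in_atlas[OF a] q(1,2,1), of v]
      transition_id[OF Qatlas_smooth Q_in_atlas[OF a] q(1), of v] u by (simp add: q(3))
qed

lemma d\<psi>_linear:
  assumes "a \<in> adapted_charts B" "a' \<in> adapted_charts B" "y \<in> OQ a a'"
  shows "linear (d\<psi> a a' (fst y))"
  by (rule smooth_on_linear[OF transition_smooth[OF base_atlas adapted_base[OF assms(1)] adapted_base[OF assms(2)]] OQ_base[OF assms]])

lemma d\<psi>_inverse:
  assumes a: "a \<in> adapted_charts B" and a': "a' \<in> adapted_charts B" and y: "y \<in> OQ a a'"
  shows "d\<psi> a' a (fst (TQ a a' y)) (d\<psi> a a' (fst y) e) = e"
  using fst_DQ[OF a' a TQ_in(1)[OF a y], of "DQ a a' y (e, 0)"] fst_DQ[OF a a' y, of "(e, 0)"] DQ_inverse[OF a a' y, of "(e, 0)"]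
  by simp

lemma det_d\<psi>:
  assumes a: "a \<in> adapted_charts B" and a': "a' \<in> adapted_charts B" and y: "y \<in> OQ a a'"
  shows "det (matrix (d\<psi> a a' (fst y))) \<noteq> 0"
proof -
  note lin = d\<psi>_linear[OF a a' y] d\<psi>_linear[OF a' a TQ_in(1)[OF a y]]
  have "d\<psi> a' a (fst (TQ a a' y)) \<circ> d\<psi> a a' (fst y) = (\<lambda>e. e)"
    using d\<psi>_inverse[OF a a' y] by (simp add: fun_eq_iff del: o_apply) (simp del: o_apply add: o_apply[of "d\<psi> a' a (fst (TQ a a' y))"])
  then have one: "matrix (d\<psi> a' a (fst (TQ a a' y))) ** matrix (d\<psi> a a' (fst y)) = mat 1"
    using matrix_compose[OF lin] by (simp add: matrix_id_mat_1[unfolded id_def])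
  then have "det (matrix (d\<psi> a' a (fst (TQ a a' y)))) * det (matrix (d\<psi> a a' (fst y))) = 1"
    by (simp only: det_mul[symmetric] one det_I)
  then show ?thesis by auto
qed

text \<open>Momenta transform contragrediently to vertical vectors, and like vector densities in the last index.\<close>

definition mom_trans :: "('m, 'f, 'n, 'c) adapted \<Rightarrow> ('m, 'f, 'n, 'c) adapted \<Rightarrow> ('n, 'c, 'k) Qcoord \<Rightarrow> ('n, 'c, 'k) momenta \<Rightarrow> ('n, 'c, 'k) momenta" where
  "mom_trans a a' y p = mom_of (\<lambda>w'. inverse (det (matrix (d\<psi> a a' (fst y)))) *\<^sub>R
      d\<psi> a a' (fst y) (pr p (snd (DQ a' a (TQ a a' y) (0, w')))))"

lemma pr_mom_trans:
  assumes a: "a \<in> adapted_charts B" and a': "a' \<in> adapted_charts B" and y: "y \<in> OQ a a'"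
  shows "pr (mom_trans a a' y p) w' = inverse (det (matrix (d\<psi> a a' (fst y)))) *\<^sub>R
      d\<psi> a a' (fst y) (pr p (snd (DQ a' a (TQ a a' y) (0, w'))))"
proof -
  note lin = d\<psi>_linear[OF a a' y] DQ_linear[OF a' a TQ_in(1)[OF a y]]
  have 1: "(0 :: (real, 'n) vec, u + v) = (0, u) + (0, v)" "(0 :: (real, 'n) vec, r *\<^sub>R u) = r *\<^sub>R (0, u)" for u v :: "('n, 'c, 'k) fields" and r
    by simp_all
  have "linear (\<lambda>w'. inverse (det (matrix (d\<psi> a a' (fst y)))) *\<^sub>R
      d\<psi> a a' (fst y) (pr p (snd (DQ a' a (TQ a a' y) (0, w')))))"
    by (rule linearI)
       (simp_all only: 1 linear_add[OF lin(2)] linear_scale[OF lin(2)] snd_add snd_scaleR pr_add_right pr_scaleR_right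
         linear_add[OF lin(1)] linear_scale[OF lin(1)] scaleR_add_right scaleR_left_commute)
  then show ?thesis unfolding mom_trans_def by (rule pr_mom_of)
qed

lemma mom_trans_smooth:
  assumes a: "a \<in> adapted_charts B" and a': "a' \<in> adapted_charts B"
    and S: "smooth_on S y" "y ` S \<subseteq> OQ a a'" "smooth_on S p"
  shows "smooth_on S (\<lambda>s. mom_trans a a' (y s) (p s))"
proof -
  note op = smooth_onD_open[OF S(1)]
  note tr = transition_smooth[OF base_atlas adapted_base[OF a] adapted_base[OF a']]
  have fy: "smooth_on S (\<lambda>s. fst (y s))" "(\<lambda>s. fst (y s)) ` S \<subseteq> coords (fst a) ` (dom_of (fst a) \<inter> dom_of (fst a'))"
    using S(2) by (auto intro!: smooth_on_fst[OF S(1)] OQ_base[OF a a'] simp del: split_paired_All)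
  have dp: "smooth_on S (\<lambda>s. d\<psi> a a' (fst (y s)) (v s))" if "smooth_on S v" for v
    by (rule smooth_on_frechet_at[OF tr fy that])
  have Ty: "smooth_on S (\<lambda>s. TQ a a' (y s))" by (rule smooth_on_compose[OF Q_transition_smooth[OF a a'] S(1,2)])
  have Ty_in: "(\<lambda>s. TQ a a' (y s)) ` S \<subseteq> OQ a' a"
  proof (rule image_subsetI)
    fix s assume "s \<in> S"
    then have "y s \<in> OQ a a'" using S(2) by blast
    then show "TQ a a' (y s) \<in> OQ a' a" by (rule TQ_in(1)[OF a])
  qed
  have "smooth_on S (\<lambda>s. det (matrix (d\<psi> a a' (fst (y s)))))"
    by (rule smooth_on_det[OF op]) (simp add: matrix_def, intro smooth_on_nth dp smooth_on_const op)
  then have inv: "smooth_on S (\<lambda>s. inverse (det (matrix (d\<psi> a a' (fst (y s))))))"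
  proof (rule smooth_on_inverse)
    fix s assume "s \<in> S"
    then have "y s \<in> OQ a a'" using S(2) by blast
    then show "det (matrix (d\<psi> a a' (fst (y s)))) \<noteq> 0" by (rule det_d\<psi>[OF a a'])
  qed
  have "smooth_on S (\<lambda>s. inverse (det (matrix (d\<psi> a a' (fst (y s))))) *\<^sub>R
      d\<psi> a a' (fst (y s)) (pr (p s) (snd (DQ a' a (TQ a a' (y s)) (0, w')))))" for w'
    by (intro smooth_on_scaleR inv dp smooth_on_bounded_bilinear[OF bilinear_pr] S(3) smooth_on_snd
        smooth_on_frechet_at[OF Q_transition_smooth[OF a' a] Ty Ty_in] smooth_on_const op)
  then have comp: "smooth_on S (\<lambda>s. mom_trans a a' (y s) (p s) $ I $ \<kappa> $ i)" for I \<kappa> i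
    unfolding mom_trans_def mom_of_def
    by (simp only: vec_lambda_beta divide_inverse) (intro smooth_on_mult smooth_on_nth smooth_on_const op)
  show ?thesis by (intro smooth_on_vec[OF op] comp)
qed

end

subsection \<open>Charts of the phase bundle\<close>

context jet_bundle begin

abbreviation "P \<equiv> (Pchart B :: ('m, 'f, 'n, 'c) adapted \<Rightarrow> (('m, 'f, 'n, 'c, 'k) phase, ('n, 'c, 'k) Pcoord) chart)"
abbreviation "QA \<equiv> (Qatlas B :: (('m, 'f) jet, ('n, 'c, 'k) Qcoord) chart set)"
abbreviation "PA \<equiv> (Patlas B :: (('m, 'f, 'n, 'c, 'k) phase, ('n, 'c, 'k) Pcoord) chart set)"

lemma fst_uncoords_Q:
  assumes a: "a \<in> adapted_charts B" and y: "y \<in> image_of (Q a)"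
  shows "fst (uncoords (Q a) y) = uncoords (fst a) (fst y)" "fst y \<in> image_of (fst a)"
  using jet_value_uncoords_Q(2)[OF a, of "fst y" "snd y"] Q_image_iff[OF a, of "fst y" "snd y"] total_image_base(1)[OF a] y
  by auto

lemma smooth_map_fst: "smooth_map QA (base B) fst"
  unfolding smooth_map_def
proof (intro conjI ballI)
  show "fst ` carrier_of QA \<subseteq> carrier_of (base B)"
  proof (rule image_subsetI)
    fix q assume "q \<in> carrier_of QA"
    then obtain a where a: "a \<in> adapted_charts B" "q \<in> dom_of (Q a)" unfolding carrier_of_def Qatlas_def by blast
    show "fst q \<in> carrier_of (base B)"
      unfolding carrier_of_def using Q_dom_base(1)[OF a] adapted_base[OF a(1)] by blast
  qed
  fix c d assume c: "c \<in> QA" and d: "d \<in> base B"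
  then obtain a where a: "a \<in> adapted_charts B" "c = Q a" by (auto simp: Qatlas_def)
  let ?S = "{y \<in> image_of (Q a). fst y \<in> coords (fst a) ` (dom_of (fst a) \<inter> dom_of d)}"
  note tr = transition_smooth[OF base_atlas adapted_base[OF a(1)] d]
  have fst_sm: "smooth_on (image_of (Q a)) fst"
    by (rule smooth_on_fst[OF smooth_on_ident[OF Q_image_open[OF a(1)]]])
  have S: "coords (Q a) ` (dom_of (Q a) \<inter> fst -` dom_of d) = ?S"
  proof (rule set_eqI)
    fix y show "y \<in> coords (Q a) ` (dom_of (Q a) \<inter> fst -` dom_of d) \<longleftrightarrow> y \<in> ?S"
      unfolding coords_image_iff[OF Qatlas_smooth Q_in_atlas[OF a(1)]] mem_Collect_eq
        coords_image_iff[OF base_atlas adapted_base[OF a(1)]]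
      using fst_uncoords_Q[OF a(1), of y] by auto
  qed
  have op: "open ?S" by (rule smooth_on_open_vimage[OF fst_sm smooth_onD_open[OF tr]])
  have "smooth_on ?S (\<lambda>y. (coords d \<circ> uncoords (fst a)) (fst y))"
    by (rule smooth_on_compose[OF tr smooth_on_subset[OF fst_sm op]]) auto
  then have "smooth_on ?S (coords d \<circ> fst \<circ> uncoords (Q a))"
    by (rule smooth_on_cong) (simp add: fst_uncoords_Q[OF a(1)])
  then show "smooth_on (coords c ` (dom_of c \<inter> fst -` dom_of d)) (coords d \<circ> fst \<circ> uncoords c)"
    unfolding a(2) S .
qed

lemma push_forward_fst:
  assumes a: "a \<in> adapted_charts B" and q: "q \<in> dom_of (Q a)" and v: "v \<in> tangent_space QA q"
    and d: "d \<in> base B" "fst q \<in> dom_of d"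
  shows "push_forward QA (base B) fst q v d =
    frechet_derivative (coords d \<circ> uncoords (fst a)) (at (coords (fst a) (fst q))) (fst (v (Q a)))"
proof -
  let ?y = "coords (Q a) q"
  note fy = Q_dom_base(2)[OF a q]
  have "((\<lambda>y. (coords d \<circ> uncoords (fst a)) (fst y)) has_derivative
    (\<lambda>v. frechet_derivative (coords d \<circ> uncoords (fst a)) (at (fst ?y)) (fst v))) (at ?y)"
    by (rule has_derivative_compose[OF has_derivative_fst[OF has_derivative_ident]
        transition_has_derivative[OF base_atlas adapted_base[OF a] d(1) Q_dom_base(1)[OF a q] d(2), folded fy]])
  then have "((coords d \<circ> fst \<circ> uncoords (Q a)) has_derivative
    (\<lambda>v. frechet_derivative (coords d \<circ> uncoords (fst a)) (at (fst ?y)) (fst v))) (at ?y)"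
    by (rule has_derivative_transform_within_open[OF _ Q_image_open[OF a] coords_in_image[OF q]])
       (simp add: fst_uncoords_Q[OF a])
  then show ?thesis
    unfolding push_forward_eq[OF Qatlas_smooth smooth_map_fst Q_in_atlas[OF a] q d v]
    by (simp add: frechet_derivative_eqI fy)
qed

text \<open>In any chart \<open>Q a\<close> the projection to the base is the first component, so
  the push-forward vanishes in all base charts as soon as that component does.\<close>

lemma vertical_iff:
  assumes a: "a \<in> adapted_charts B" and q: "q \<in> dom_of (Q a)"
  shows "v \<in> vertical_space B q \<longleftrightarrow> v \<in> tangent_space QA q \<and> fst (v (Q a)) = 0"
proof -
  note b = adapted_base[OF a] and qb = Q_dom_base(1)[OF a q]
  have "push_forward QA (base B) fst q v = (\<lambda>_. 0) \<longleftrightarrow> fst (v (Q a)) = 0" if v: "v \<in> tangent_space QA q"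
  proof
    assume "push_forward QA (base B) fst q v = (\<lambda>_. 0)"
    then show "fst (v (Q a)) = 0"
      using push_forward_fst[OF a q v b qb] transition_id[OF base_atlas b qb] by simp
  next
    assume 0: "fst (v (Q a)) = 0"
    have "push_forward QA (base B) fst q v d = 0" for d
    proof (cases "d \<in> base B \<and> fst q \<in> dom_of d")
      case True
      then have d: "d \<in> base B" "fst q \<in> dom_of d" by auto
      show ?thesis
        using push_forward_fst[OF a q v d] linear_0[OF transition_linear[OF base_atlas b d(1) qb d(2)]] 0 by simp
    next
      case False
      then show ?thesis unfolding push_forward_def by (rule if_not_P)
    qed
    then show "push_forward QA (base B) fst q v = (\<lambda>_. 0)" by (rule ext)
  qed
  then show ?thesis by (auto simp: vertical_space_def)
qed

lemma momentum_alt: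
  "momentum B a q p v ws = (if v \<in> vertical_space B q \<and> length ws = CARD('n) - 1 \<and> set ws \<subseteq> tangent_space (base B) (fst q)
     then volume (pr p (snd (v (Q a))) # map (\<lambda>w. w (fst a)) ws) else 0)"
proof (cases "v \<in> vertical_space B q \<and> length ws = CARD('n) - 1 \<and> set ws \<subseteq> tangent_space (base B) (fst q)")
  case True
  then have "length (map (\<lambda>w. w (fst a)) ws) = CARD('n) - 1" by simp
  from volume_first_sum[OF this, of "pr p (snd (v (Q a)))"] True show ?thesis
    unfolding momentum_def using sum_pr[of p "\<lambda>_. snd (v (Q a))" "\<lambda>\<kappa>. volume (axis \<kappa> 1 # map (\<lambda>w. w (fst a)) ws)"]
    by simp
qed (auto simp: momentum_def)

lemma vertical_vector:
  assumes a: "a \<in> adapted_charts B" and q: "q \<in> dom_of (Q a)"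
  shows "coord_vector QA q (Q a) (0, w) \<in> vertical_space B q" "coord_vector QA q (Q a) (0, w) (Q a) = (0, w)"
  using coord_vector_same[OF Qatlas_smooth Q_in_atlas[OF a] q, of "(0, w)"]
    coord_vector_tangent[OF Qatlas_smooth Q_in_atlas[OF a] q, of "(0, w)"]
  by (simp_all add: vertical_iff[OF a q])

text \<open>This justifies the \<open>THE\<close> in \<open>Pchart\<close>. The volume form detects
  every nonzero vector, and the pairing \<open>pr\<close> detects the momentum.\<close>

lemma momentum_inj:
  fixes p p' :: "('n, 'c, 'k) momenta"
  assumes a: "a \<in> adapted_charts B" and q: "q \<in> dom_of (Q a)" and eq: "momentum B a q p = momentum B a q p'"
  shows "p = p'"
proof (rule pr_eqI)
  fix w :: "('n, 'c, 'k) fields"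
  have "volume ((pr p w - pr p' w) # es) = 0" if len: "length es = CARD('n) - 1" for es
  proof -
    let ?v = "coord_vector QA q (Q a) (0, w)" and ?ws = "map (coord_vector (base B) (fst q) (fst a)) es"
    note b = adapted_base[OF a] and qb = Q_dom_base(1)[OF a q]
    have ws: "set ?ws \<subseteq> tangent_space (base B) (fst q)" using coord_vector_tangent[OF base_atlas b qb] by auto
    have "map (\<lambda>w. w (fst a)) ?ws = es" using coord_vector_same[OF base_atlas b qb] by (simp add: o_def)
    then have "momentum B a q p'' ?v ?ws = volume (pr p'' w # es)" for p''
      unfolding momentum_alt using vertical_vector[OF a q] ws len by simp
    then have "volume (pr p w # es) = volume (pr p' w # es)" using eq by metis
    then show ?thesis using linear_diff[OF volume_linear_first[OF len]] by simp
  qed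
  then have "pr p w - pr p' w = 0" by (rule volume_nondegenerate)
  then show "pr p w = pr p' w" by simp
qed

text \<open>The base vectors and the contracted vector are all moved by the Jacobian, so the volume
  acquires its determinant; \<open>mom_trans\<close> contains the inverse of that factor.\<close>

lemma momentum_change:
  assumes a: "a \<in> adapted_charts B" and a': "a' \<in> adapted_charts B" and q: "q \<in> dom_of (Q a)" "q \<in> dom_of (Q a')"
  shows "momentum B a q p = momentum B a' q (mom_trans a a' (coords (Q a) q) p)"
proof (intro ext)
  fix v :: "(('m, 'f) jet, ('n, 'c, 'k) Qcoord) tangent" and ws
  let ?y = "coords (Q a) q" and ?p' = "mom_trans a a' (coords (Q a) q) p"
  note b = adapted_base[OF a] and b' = adapted_base[OF a']
  note qb = Q_dom_base(1)[OF a q(1)] and qb' = Q_dom_base(1)[OF a' q(2)]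
  have y: "?y \<in> OQ a a'" using q by blast
  have u: "TQ a a' ?y = coords (Q a') q" by (simp add: uncoords_coords[OF Qatlas_smooth Q_in_atlas[OF a] q(1)])
  have fy: "fst ?y = coords (fst a) (fst q)" by (rule Q_dom_base(2)[OF a q(1)])
  show "momentum B a q p v ws = momentum B a' q ?p' v ws"
  proof (cases "v \<in> vertical_space B q \<and> length ws = CARD('n) - 1 \<and> set ws \<subseteq> tangent_space (base B) (fst q)")
    case True
    then have v: "v \<in> tangent_space QA q" "fst (v (Q a')) = 0" by (auto simp: vertical_iff[OF a' q(2)])
    have "v (Q a) = DQ a' a (TQ a a' ?y) (0, snd (v (Q a')))"
      using tangentD[OF v(1) Q_in_atlas[OF a'] Q_in_atlas[OF a] q(2,1)] v(2) unfolding u by (metis prod.collapse)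
    then have pr': "pr ?p' (snd (v (Q a'))) = inverse (det (matrix (d\<psi> a a' (fst ?y)))) *\<^sub>R d\<psi> a a' (fst ?y) (pr p (snd (v (Q a))))"
      unfolding pr_mom_trans[OF a a' y] by simp
    have "w (fst a') = d\<psi> a a' (fst ?y) (w (fst a))" if "w \<in> set ws" for w
      using True that tangentD[OF _ b b' qb qb', of w] unfolding fy by blast
    then have ws': "map (\<lambda>w. w (fst a')) ws = map (d\<psi> a a' (fst ?y)) (map (\<lambda>w. w (fst a)) ws)" by simp
    have len: "length (map (d\<psi> a a' (fst ?y)) (map (\<lambda>w. w (fst a)) ws)) = CARD('n) - 1" using True by simp
    have "volume (pr ?p' (snd (v (Q a'))) # map (\<lambda>w. w (fst a')) ws) =
      inverse (det (matrix (d\<psi> a a' (fst ?y)))) * volume (map (d\<psi> a a' (fst ?y)) (pr p (snd (v (Q a))) # map (\<lambda>w. w (fst a)) ws))"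
      unfolding pr' ws' using linear_scale[OF volume_linear_first[OF len]] by simp
    also have "\<dots> = volume (pr p (snd (v (Q a))) # map (\<lambda>w. w (fst a)) ws)"
      using True zero_less_card_finite[where 'a = 'n] det_d\<psi>[OF a a' y]
      by (subst volume_linear_map[OF d\<psi>_linear[OF a a' y]]) auto
    finally show ?thesis using True by (simp add: momentum_alt)
  next
    case False
    show ?thesis unfolding momentum_alt if_not_P[OF False] ..
  qed
qed

lemma Q_domI: "q \<in> dom_of (Q a) \<Longrightarrow> jet_value q \<in> dom_of (snd a') \<Longrightarrow> q \<in> dom_of (Q a')"
  by (simp add: Qchart_def)

lemma jet_value_Q_dom: "q \<in> dom_of (Q a) \<Longrightarrow> jet_value q \<in> dom_of (snd a)"
  by (simp add: Qchart_def)

lemma P_mem: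
  assumes a: "a \<in> adapted_charts B" and q: "q \<in> dom_of (Q a)"
  shows "(q, momentum B a q p) \<in> dom_of (P a)"
    "coords (P a) (q, momentum B a q p) = (fst (coords (Q a) q), snd (coords (Q a) q), p)"
proof -
  show "(q, momentum B a q p) \<in> dom_of (P a)"
  proof -
    have "(q, momentum B a q p) \<in> phase_space B" unfolding phase_space_def using a q by blast
    then show ?thesis using jet_value_Q_dom[OF q] by (simp add: Pchart_def)
  qed
  have "(THE p'. momentum B a q p = momentum B a q p') = p"
    using momentum_inj[OF a q] by (intro the_equality) auto
  then show "coords (P a) (q, momentum B a q p) = (fst (coords (Q a) q), snd (coords (Q a) q), p)"
    by (simp add: Pchart_def Qchart_def)
qed

text \<open>A phase point is introduced through some chart, perhaps not \<open>a\<close>;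
  \<open>momentum_change\<close> rewrites it in any chart containing its jet.\<close>

lemma P_domE:
  assumes a: "a \<in> adapted_charts B" and "X \<in> dom_of (P a)"
  obtains q p where "q \<in> dom_of (Q a)" "X = (q, momentum B a q p)"
proof -
  obtain q a0 p0 where X: "X = (q, momentum B a0 q p0)" "a0 \<in> adapted_charts B" "q \<in> dom_of (Q a0)" "jet_value q \<in> dom_of (snd a)"
    using assms(2) by (auto simp: Pchart_def phase_space_def)
  have q: "q \<in> dom_of (Q a)" by (rule Q_domI[OF X(3,4)])
  show ?thesis using that[OF q] momentum_change[OF X(2) a X(3) q] X(1) by blast
qed

lemma P_inj:
  assumes a: "a \<in> adapted_charts B"
  shows "inj_on (coords (P a)) (dom_of (P a))"
proof (rule inj_onI)
  fix X Y assume X: "X \<in> dom_of (P a)" and Y: "Y \<in> dom_of (P a)" and eq: "coords (P a) X = coords (P a) Y"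
  obtain q p where q: "q \<in> dom_of (Q a)" "X = (q, momentum B a q p)" by (rule P_domE[OF a X])
  obtain q' p' where q': "q' \<in> dom_of (Q a)" "Y = (q', momentum B a q' p')" by (rule P_domE[OF a Y])
  have "coords (Q a) q = coords (Q a) q'" "p = p'"
    using eq P_mem(2)[OF a q(1)] P_mem(2)[OF a q'(1)] q(2) q'(2) by (auto simp: prod_eq_iff)
  moreover have "q = q'" using calculation(1) Q_inj[OF a] q(1) q'(1) by (auto dest: inj_onD)
  ultimately show "X = Y" using q(2) q'(2) by simp
qed

lemma P_uncoords:
  assumes a: "a \<in> adapted_charts B" and y: "(x, \<phi>) \<in> image_of (Q a)"
  shows "uncoords (P a) (x, \<phi>, p) = (uncoords (Q a) (x, \<phi>), momentum B a (uncoords (Q a) (x, \<phi>)) p)"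
    "(x, \<phi>, p) \<in> image_of (P a)"
proof -
  let ?q = "uncoords (Q a) (x, \<phi>)"
  note q = uncoords_in_dom[OF y]
  have c: "coords (P a) (?q, momentum B a ?q p) = (x, \<phi>, p)"
    using P_mem(2)[OF a q, of p] coords_uncoords[OF y] by simp
  show "uncoords (P a) (x, \<phi>, p) = (?q, momentum B a ?q p)"
    unfolding uncoords_def[of "P a"] c[symmetric] by (rule inv_into_f_f[OF P_inj[OF a] P_mem(1)[OF a q]])
  show "(x, \<phi>, p) \<in> image_of (P a)" unfolding c[symmetric] by (rule coords_in_image[OF P_mem(1)[OF a q]])
qed

lemma P_image_iff:
  assumes a: "a \<in> adapted_charts B"
  shows "(x, \<phi>, p) \<in> image_of (P a) \<longleftrightarrow> (x, \<phi>) \<in> image_of (Q a)"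
proof
  assume "(x, \<phi>, p) \<in> image_of (P a)"
  then obtain X where X: "X \<in> dom_of (P a)" "coords (P a) X = (x, \<phi>, p)" by (auto simp: image_of_def)
  obtain q p' where q: "q \<in> dom_of (Q a)" "X = (q, momentum B a q p')" by (rule P_domE[OF a X(1)])
  then have "(fst (coords (Q a) q), snd (coords (Q a) q), p') = (x, \<phi>, p)"
    using X(2) P_mem(2)[OF a q(1), of p'] by simp
  then have "coords (Q a) q = (x, \<phi>)" by (simp add: prod_eq_iff)
  then show "(x, \<phi>) \<in> image_of (Q a)" using coords_in_image[OF q(1)] by simp
qed (rule P_uncoords(2)[OF a])

lemma P_overlap_iff:
  assumes a: "a \<in> adapted_charts B" and a': "a' \<in> adapted_charts B"
  shows "(x, \<phi>, p) \<in> coords (P a) ` (dom_of (P a) \<inter> dom_of (P a')) \<longleftrightarrow> (x, \<phi>) \<in> OQ a a'"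
proof
  assume "(x, \<phi>, p) \<in> coords (P a) ` (dom_of (P a) \<inter> dom_of (P a'))"
  then obtain X where X: "X \<in> dom_of (P a)" "X \<in> dom_of (P a')" "coords (P a) X = (x, \<phi>, p)" by auto
  obtain q p' where q: "q \<in> dom_of (Q a)" "X = (q, momentum B a q p')" by (rule P_domE[OF a X(1)])
  have "(fst (coords (Q a) q), snd (coords (Q a) q), p') = (x, \<phi>, p)"
    using X(3) q P_mem(2)[OF a q(1), of p'] by simp
  then have "coords (Q a) q = (x, \<phi>)" by (simp add: prod_eq_iff)
  moreover have "q \<in> dom_of (Q a')" using X(2) q by (intro Q_domI[OF q(1)]) (simp add: Pchart_def)
  ultimately show "(x, \<phi>) \<in> OQ a a'" using q(1) by (metis IntI image_eqI)
next
  assume y: "(x, \<phi>) \<in> OQ a a'"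
  then obtain q where q: "q \<in> dom_of (Q a)" "q \<in> dom_of (Q a')" "(x, \<phi>) = coords (Q a) q" by auto
  have "(q, momentum B a q p) \<in> dom_of (P a')"
    unfolding momentum_change[OF a a' q(1,2)] by (rule P_mem(1)[OF a' q(2)])
  moreover have "coords (P a) (q, momentum B a q p) = (x, \<phi>, p)"
    using P_mem(2)[OF a q(1)] by (simp add: q(3)[symmetric])
  ultimately show "(x, \<phi>, p) \<in> coords (P a) ` (dom_of (P a) \<inter> dom_of (P a'))"
    using P_mem(1)[OF a q(1)] by (metis IntI image_eqI)
qed

abbreviation "TP a a' \<equiv> coords (P a') \<circ> uncoords (P a)"
abbreviation "OP a a' \<equiv> coords (P a) ` (dom_of (P a) \<inter> dom_of (P a'))"
abbreviation "DP a a' y \<equiv> frechet_derivative (TP a a') (at y)"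

lemma OP_iff:
  assumes "a \<in> adapted_charts B" "a' \<in> adapted_charts B"
  shows "y \<in> OP a a' \<longleftrightarrow> (fst y, fst (snd y)) \<in> OQ a a'"
  using P_overlap_iff[OF assms, of "fst y" "fst (snd y)" "snd (snd y)"] by simp

lemma P_transition:
  assumes a: "a \<in> adapted_charts B" and a': "a' \<in> adapted_charts B" and y: "(x, \<phi>) \<in> OQ a a'"
  shows "TP a a' (x, \<phi>, p) = (fst (TQ a a' (x, \<phi>)), snd (TQ a a' (x, \<phi>)), mom_trans a a' (x, \<phi>) p)"
proof -
  obtain q where q: "q \<in> dom_of (Q a)" "q \<in> dom_of (Q a')" "(x, \<phi>) = coords (Q a) q" using y by auto
  have u: "uncoords (Q a) (x, \<phi>) = q" unfolding q(3) by (rule uncoords_coords[OF Qatlas_smooth Q_in_atlas[OF a] q(1)])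
  have "uncoords (P a) (x, \<phi>, p) = (q, momentum B a' q (mom_trans a a' (x, \<phi>) p))"
    using P_uncoords(1)[OF a OQ_image[OF y], of p] momentum_change[OF a a' q(1,2), of p] by (simp add: u q(3)[symmetric])
  then show ?thesis using P_mem(2)[OF a' q(2)] u by simp
qed

lemma P_image_open:
  assumes a: "a \<in> adapted_charts B"
  shows "open (image_of (P a))"
proof -
  have "smooth_on UNIV (\<lambda>y :: ('n, 'c, 'k) Pcoord. (fst y, fst (snd y)))"
    by (intro smooth_on_Pair smooth_on_fst smooth_on_snd smooth_on_ident open_UNIV)
  from smooth_on_open_vimage[OF this Q_image_open[OF a]]
  have "open {y :: ('n, 'c, 'k) Pcoord. (fst y, fst (snd y)) \<in> image_of (Q a)}" by simp
  moreover have "{y. (fst y, fst (snd y)) \<in> image_of (Q a)} = image_of (P a)"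
    by (intro set_eqI) (simp add: split_paired_all P_image_iff[OF a])
  ultimately show ?thesis by simp
qed

lemma P_transition_smooth:
  assumes a: "a \<in> adapted_charts B" and a': "a' \<in> adapted_charts B"
  shows "smooth_on (OP a a') (TP a a')"
proof -
  have "smooth_on UNIV (\<lambda>y :: ('n, 'c, 'k) Pcoord. (fst y, fst (snd y)))"
    by (intro smooth_on_Pair smooth_on_fst smooth_on_snd smooth_on_ident open_UNIV)
  from smooth_on_open_vimage[OF this Q_overlap_open[OF a a']]
  have "open {y :: ('n, 'c, 'k) Pcoord. (fst y, fst (snd y)) \<in> OQ a a'}" by simp
  moreover have "{y. (fst y, fst (snd y)) \<in> OQ a a'} = OP a a'"
    by (intro set_eqI) (simp add: split_paired_all P_overlap_iff[OF a a'])
  ultimately have op: "open (OP a a')" by simp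
  let ?y = "\<lambda>y :: ('n, 'c, 'k) Pcoord. (fst y, fst (snd y))"
  have y: "smooth_on (OP a a') ?y" "?y ` OP a a' \<subseteq> OQ a a'"
  proof (intro smooth_on_Pair smooth_on_fst smooth_on_snd smooth_on_ident op, rule image_subsetI)
    fix z assume "z \<in> OP a a'"
    then show "?y z \<in> OQ a a'" using OP_iff[OF a a'] by simp
  qed
  note T = smooth_on_compose[OF Q_transition_smooth[OF a a'] y]
  have "smooth_on (OP a a') (\<lambda>y. (fst (TQ a a' (?y y)), snd (TQ a a' (?y y)), mom_trans a a' (?y y) (snd (snd y))))"
    by (intro smooth_on_Pair smooth_on_fst[OF T] smooth_on_snd[OF T] mom_trans_smooth[OF a a' y]
        smooth_on_snd smooth_on_ident op)
  then show ?thesis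
  proof (rule smooth_on_cong)
    fix y assume "y \<in> OP a a'"
    then have "?y y \<in> OQ a a'" using OP_iff[OF a a'] by simp
    from P_transition[OF a a' this, of "snd (snd y)"]
    show "(fst (TQ a a' (?y y)), snd (TQ a a' (?y y)), mom_trans a a' (?y y) (snd (snd y))) = TP a a' y"
      by (simp del: o_apply)
  qed
qed

lemma Patlas_smooth: "smooth_atlas PA"
  unfolding smooth_atlas_def Patlas_def using P_inj P_image_open P_transition_smooth by blast

lemma P_in_atlas: "a \<in> adapted_charts B \<Longrightarrow> P a \<in> PA"
  by (simp add: Patlas_def)

text \<open>The base and jet components of the transition map do not involve the momenta. Since
  \<theta> contains no \<open>dp\<close>, its transformation is governed by the derivative on the
  jet bundle alone.\<close>

lemma DP_fields:
  assumes a: "a \<in> adapted_charts B" and a': "a' \<in> adapted_charts B" and y: "y \<in> OP a a'"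
  shows "(fst (DP a a' y v), fst (snd (DP a a' y v))) = DQ a a' (fst y, fst (snd y)) (fst v, fst (snd v))"
proof -
  let ?y = "\<lambda>y :: ('n, 'c, 'k) Pcoord. (fst y, fst (snd y))"
  have y': "?y y \<in> OQ a a'" using y OP_iff[OF a a'] by simp
  note S = smooth_on_has_derivative[OF P_transition_smooth[OF a a'] y]
  have A: "((\<lambda>y. ?y (TP a a' y)) has_derivative (\<lambda>v. ?y (DP a a' y v))) (at y)"
    by (intro has_derivative_Pair has_derivative_fst has_derivative_snd S)
  have "(?y has_derivative ?y) (at y)"
    by (intro has_derivative_Pair has_derivative_fst has_derivative_snd has_derivative_ident)
  from has_derivative_compose[OF this smooth_on_has_derivative[OF Q_transition_smooth[OF a a'] y']]
  have B: "((\<lambda>y. TQ a a' (?y y)) has_derivative (\<lambda>v. DQ a a' (?y y) (?y v))) (at y)" .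
  have "?y (TP a a' z) = TQ a a' (?y z)" if "z \<in> OP a a'" for z
  proof -
    have "?y z \<in> OQ a a'" using that OP_iff[OF a a'] by simp
    from P_transition[OF a a' this, of "snd (snd z)"] show ?thesis by (simp del: o_apply)
  qed
  from has_derivative_unique[OF has_derivative_transform_within_open[OF A smooth_onD_open[OF P_transition_smooth[OF a a']] y this] B]
  show ?thesis by (rule fun_cong)
qed

end

section \<open>Symmetrised momenta and the Legendre equations\<close>

lemma finite_lists_less: "finite {\<mu>s :: 'n::finite list. length \<mu>s < m}"
proof -
  have "{\<mu>s :: 'n list. length \<mu>s < m} = (\<Union>l\<in>{..<m}. {\<mu>s. length \<mu>s = l})" by auto
  then show ?thesis by (simp add: finite_lists_eq)
qed

definition wtT :: "('n::{finite,linorder}, 'k::finite) top_index \<Rightarrow> real" where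
  "wtT I = real (arrangements (top_list I))"

lemma wtT_nonzero [simp]: "wtT I \<noteq> 0"
  using arrangements_pos[of "top_list I"] by (simp add: wtT_def)

lemma wtT_top_of: "length \<mu>s = CARD('k) \<Longrightarrow>
    wtT (top_of \<mu>s :: ('n::{finite,linorder}, 'k::finite) top_index) = real (arrangements \<mu>s)"
  by (simp add: wtT_def arrangements_def Rep_top_of)

lemma sum_lists_top:
  fixes F :: "('n::{finite,linorder}, 'k::finite) top_index \<Rightarrow> real"
  shows "(\<Sum>\<mu>s | length \<mu>s = CARD('k). F (top_of \<mu>s)) = (\<Sum>I\<in>UNIV. wtT I * F I)"
proof -
  define S where "S = {\<mu>s :: 'n list. length \<mu>s = CARD('k)}"
  have fin: "finite S" by (simp add: S_def finite_lists_eq)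
  have "(\<Sum>\<mu>s\<in>S. F (top_of \<mu>s)) = (\<Sum>I\<in>UNIV. \<Sum>\<mu>s\<in>{\<mu>s\<in>S. top_of \<mu>s = (I :: ('n, 'k) top_index)}. F (top_of \<mu>s))"
    by (rule sum.group[symmetric]) (use fin in auto)
  also have "\<dots> = (\<Sum>I\<in>UNIV. wtT I * F I)"
  proof (intro sum.cong refl)
    fix I :: "('n, 'k) top_index"
    have "{\<mu>s\<in>S. top_of \<mu>s = I} = {\<mu>s. mset \<mu>s = Rep_top_index I}"
    proof (intro set_eqI iffI)
      fix \<mu>s assume "\<mu>s \<in> {\<mu>s\<in>S. top_of \<mu>s = I}"
      then show "\<mu>s \<in> {\<mu>s. mset \<mu>s = Rep_top_index I}" using Rep_top_of[of \<mu>s, where 'k = 'k] by (auto simp: S_def)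
    next
      fix \<mu>s assume \<mu>s: "\<mu>s \<in> {\<mu>s. mset \<mu>s = Rep_top_index I}"
      then have "size (mset \<mu>s) = CARD('k)" using Rep_top_index[of I] by simp
      then show "\<mu>s \<in> {\<mu>s\<in>S. top_of \<mu>s = I}" using \<mu>s by (auto simp: S_def top_of_def Rep_top_index_inverse)
    qed
    then have "(\<Sum>\<mu>s\<in>{\<mu>s\<in>S. top_of \<mu>s = I}. F (top_of \<mu>s)) = (\<Sum>\<mu>s\<in>{\<mu>s. mset \<mu>s = Rep_top_index I}. F I)"
      by (intro sum.cong) (auto simp: top_of_def Rep_top_index_inverse)
    then show "(\<Sum>\<mu>s\<in>{\<mu>s\<in>S. top_of \<mu>s = I}. F (top_of \<mu>s)) = wtT I * F I"
      by (simp add: wtT_def arrangements_def)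
  qed
  finally show ?thesis by (simp add: S_def)
qed

definition pairT :: "('n::{finite,linorder}, 'c::finite, 'k::finite) tops \<Rightarrow> ('n, 'c, 'k) tops \<Rightarrow> real" where
  "pairT u w = (\<Sum>\<mu>s | length \<mu>s = CARD('k). u $ top_of \<mu>s \<bullet> w $ top_of \<mu>s)"

text \<open>Division by \<open>arrangements\<close> is what makes the symmetric coefficients of a
  differential reproduce it through the sum over all index tuples. Both the Legendre equations and
  the top-order derivatives of \<open>h\<close> are read in this way.\<close>

lemma linear_eq_pairT:
  fixes g :: "('n::{finite,linorder}, 'c::finite, 'k::finite) tops \<Rightarrow> real"
  assumes "linear g"
  shows "(\<forall>\<mu>s. length \<mu>s = CARD('k) \<longrightarrow> u $ top_of \<mu>s = (\<chi> i. g (axis (top_of \<mu>s) (axis i 1)) / real (arrangements \<mu>s)))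
    \<longleftrightarrow> (\<forall>w. g w = pairT u w)"
proof -
  have pT: "pairT u w = (\<Sum>I\<in>UNIV. wtT I * (u $ I \<bullet> w $ I))" for w
    unfolding pairT_def by (rule sum_lists_top)
  have gw: "g w = (\<Sum>I\<in>UNIV. \<Sum>i\<in>UNIV. w $ I $ i * g (axis I (axis i 1)))" for w
    by (subst fields_expand[of w]) (simp add: linear_sum[OF assms] linear_scale[OF assms])
  have eq: "(\<forall>\<mu>s. length \<mu>s = CARD('k) \<longrightarrow> u $ top_of \<mu>s = (\<chi> i. g (axis (top_of \<mu>s) (axis i 1)) / real (arrangements \<mu>s)))
    \<longleftrightarrow> (\<forall>I i. wtT I * u $ I $ i = g (axis I (axis i 1)))"
  proof (intro iffI allI impI)
    fix I i assume *: "\<forall>\<mu>s. length \<mu>s = CARD('k) \<longrightarrow> u $ top_of \<mu>s = (\<chi> i. g (axis (top_of \<mu>s) (axis i 1)) / real (arrangements \<mu>s))"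
    have "u $ I = (\<chi> i. g (axis I (axis i 1)) / wtT I)"
      using *[rule_format, OF length_top_list[of I]] by (simp add: wtT_def)
    then show "wtT I * u $ I $ i = g (axis I (axis i 1))" by simp
  next
    fix \<mu>s :: "'n list" assume *: "\<forall>I i. wtT I * u $ I $ i = g (axis I (axis i 1))" and len: "length \<mu>s = CARD('k)"
    show "u $ top_of \<mu>s = (\<chi> i. g (axis (top_of \<mu>s) (axis i 1)) / real (arrangements \<mu>s))"
      unfolding wtT_top_of[OF len, symmetric] *[rule_format, symmetric] by (simp add: vec_eq_iff)
  qed
  show ?thesis unfolding eq
  proof (intro iffI allI)
    fix w assume "\<forall>I i. wtT I * u $ I $ i = g (axis I (axis i 1))"
    then show "g w = pairT u w" unfolding gw[of w] pT inner_vec_def sum_distrib_left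
      by (intro sum.cong refl) (simp add: mult_ac flip: mult.assoc)
  next
    fix I i assume *: "\<forall>w. g w = pairT u w"
    have "u $ L \<bullet> (axis I (axis i 1) :: ('n, 'c, 'k) tops) $ L = (if L = I then u $ I $ i else 0)" for L
      by (auto simp: axis_def inner_vec_def if_distrib[of "\<lambda>x. _ * x"] cong: if_cong)
    then show "wtT I * u $ I $ i = g (axis I (axis i 1))"
      unfolding *[rule_format] pT by (simp add: if_distrib[of "\<lambda>x. _ * x"] cong: if_cong)
  qed
qed

lemma sym_mom_perm:
  assumes "mset \<mu>s = mset \<nu>s"
  shows "sym_mom p \<mu>s = sym_mom p \<nu>s"
proof -
  obtain \<rho> where \<rho>: "\<rho> permutes {..<length \<nu>s}" "permute_list \<rho> \<nu>s = \<mu>s"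
    using mset_eq_permutation[OF assms] by metis
  let ?F = "\<lambda>\<nu>s. p $ low (butlast \<nu>s) $ last \<nu>s"
  have len: "length \<mu>s = length \<nu>s" using assms by (rule mset_eq_length)
  have "(\<Sum>\<pi> | \<pi> permutes {..<length \<nu>s}. ?F (permute_list \<pi> \<nu>s)) =
      (\<Sum>\<pi> | \<pi> permutes {..<length \<nu>s}. ?F (permute_list (\<rho> \<circ> \<pi>) \<nu>s))"
    by (rule setum_permutations_compose_left[OF \<rho>(1)])
  also have "\<dots> = (\<Sum>\<pi> | \<pi> permutes {..<length \<nu>s}. ?F (permute_list \<pi> \<mu>s))"
    by (intro sum.cong refl) (simp add: permute_list_compose \<rho>(2))
  finally show ?thesis by (simp add: sym_mom_def len Let_def)
qed

lemma sum_lists_Suc: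
  "(\<Sum>\<mu>s | length \<mu>s = Suc m. G \<mu>s) = (\<Sum>\<nu>s | length \<nu>s = m. \<Sum>\<kappa>\<in>UNIV. G (\<nu>s @ [\<kappa> :: 'n::finite]))"
proof -
  have "(\<Sum>\<nu>s | length \<nu>s = m. \<Sum>\<kappa>\<in>UNIV. G (\<nu>s @ [\<kappa>])) = (\<Sum>(\<nu>s, \<kappa>)\<in>{\<nu>s. length \<nu>s = m} \<times> UNIV. G (\<nu>s @ [\<kappa>]))"
    by (rule sum.cartesian_product)
  also have "\<dots> = (\<Sum>\<mu>s | length \<mu>s = Suc m. G \<mu>s)"
    by (rule sum.reindex_bij_witness[of _ "\<lambda>\<mu>s. (butlast \<mu>s, last \<mu>s)" "\<lambda>(\<nu>s, \<kappa>). \<nu>s @ [\<kappa>]"])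
       (auto simp: append_butlast_last_id length_0_conv[symmetric] simp del: length_0_conv)
  finally show ?thesis ..
qed

text \<open>Paired with a symmetric family, symmetrisation may be dropped: each permutation in the
  average merely reindexes the sum over tuples.\<close>

lemma sum_sym_mom:
  fixes w :: "'n::{finite,linorder} list \<Rightarrow> (real, 'c::finite) vec"
  assumes w: "\<And>\<mu>s \<nu>s. mset \<mu>s = mset \<nu>s \<Longrightarrow> w \<mu>s = w \<nu>s"
  shows "(\<Sum>\<mu>s | length \<mu>s = Suc m. sym_mom p \<mu>s \<bullet> w \<mu>s) =
    (\<Sum>\<nu>s | length \<nu>s = m. \<Sum>\<kappa>\<in>UNIV. p $ low \<nu>s $ \<kappa> \<bullet> w (\<nu>s @ [\<kappa>]))"
proof -
  let ?G = "\<lambda>\<mu>s. p $ low (butlast \<mu>s) $ last \<mu>s \<bullet> w \<mu>s"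
  have perm: "(\<Sum>\<mu>s | length \<mu>s = Suc m. ?G (permute_list \<pi> \<mu>s)) = (\<Sum>\<mu>s | length \<mu>s = Suc m. ?G \<mu>s)"
    if \<pi>: "\<pi> permutes {..<Suc m}" for \<pi>
  proof (rule sum.reindex_bij_witness[of _ "permute_list (inv \<pi>)" "permute_list \<pi>"])
    fix \<mu>s :: "'n list" assume "\<mu>s \<in> {\<mu>s. length \<mu>s = Suc m}"
    then have len: "length \<mu>s = Suc m" by simp
    show "permute_list (inv \<pi>) (permute_list \<pi> \<mu>s) = \<mu>s"
      using permute_list_compose[of "inv \<pi>" \<mu>s \<pi>] permutes_inv[OF \<pi>] permutes_inv_o(1)[OF \<pi>] len by simp
    show "permute_list \<pi> (permute_list (inv \<pi>) \<mu>s) = \<mu>s"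
      using permute_list_compose[of \<pi> \<mu>s "inv \<pi>"] \<pi> permutes_inv_o(2)[OF \<pi>] len by simp
  qed auto
  have "(\<Sum>\<mu>s | length \<mu>s = Suc m. sym_mom p \<mu>s \<bullet> w \<mu>s) =
     (\<Sum>\<mu>s | length \<mu>s = Suc m. 1 / fact (Suc m) * (\<Sum>\<pi> | \<pi> permutes {..<Suc m}. ?G (permute_list \<pi> \<mu>s)))"
  proof (intro sum.cong refl)
    fix \<mu>s :: "'n list" assume "\<mu>s \<in> {\<mu>s. length \<mu>s = Suc m}"
    then have len: "length \<mu>s = Suc m" by simp
    have "w (permute_list \<pi> \<mu>s) = w \<mu>s" if "\<pi> permutes {..<Suc m}" for \<pi>
      using that len by (intro w) simp
    then have "(\<Sum>\<pi> | \<pi> permutes {..<Suc m}. ?G (permute_list \<pi> \<mu>s)) =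
       (\<Sum>\<pi> | \<pi> permutes {..<Suc m}. p $ low (butlast (permute_list \<pi> \<mu>s)) $ last (permute_list \<pi> \<mu>s) \<bullet> w \<mu>s)"
      by (intro sum.cong) auto
    then show "sym_mom p \<mu>s \<bullet> w \<mu>s = 1 / fact (Suc m) * (\<Sum>\<pi> | \<pi> permutes {..<Suc m}. ?G (permute_list \<pi> \<mu>s))"
      by (simp only: sym_mom_def len Let_def inner_scaleR_left inner_sum_left)
  qed
  also have "\<dots> = 1 / fact (Suc m) * (\<Sum>\<pi> | \<pi> permutes {..<Suc m}. \<Sum>\<mu>s | length \<mu>s = Suc m. ?G (permute_list \<pi> \<mu>s))"
    unfolding sum_distrib_left[symmetric] by (subst sum.swap) (rule refl)
  also have "\<dots> = 1 / fact (Suc m) * (\<Sum>\<pi> | \<pi> permutes {..<Suc m}. \<Sum>\<mu>s | length \<mu>s = Suc m. ?G \<mu>s)"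
    by (intro arg_cong2[where f = "(*)"] sum.cong refl perm) simp
  also have "\<dots> = (\<Sum>\<mu>s | length \<mu>s = Suc m. ?G \<mu>s)"
    by (simp add: card_permutations del: fact_Suc)
  also have "\<dots> = (\<Sum>\<nu>s | length \<nu>s = m. \<Sum>\<kappa>\<in>UNIV. p $ low \<nu>s $ \<kappa> \<bullet> w (\<nu>s @ [\<kappa>]))"
    by (simp add: sum_lists_Suc)
  finally show ?thesis .
qed

lemma jet_entry_add: "jet_entry (\<phi> + \<phi>') (u + u') \<mu>s = jet_entry \<phi> u \<mu>s + jet_entry \<phi>' u' \<mu>s"
  by (simp add: jet_entry_def)

lemma jet_entry_scaleR: "jet_entry (r *\<^sub>R \<phi>) (r *\<^sub>R u) \<mu>s = r *\<^sub>R jet_entry \<phi> u \<mu>s"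
  by (simp add: jet_entry_def)

lemma jent_add: "jent (\<phi> + \<phi>') (u + u') e = jent \<phi> u e + jent \<phi>' u' e"
  by (simp add: vec_eq_iff jent_def jet_entry_add algebra_simps sum.distrib)

lemma jent_scaleR: "jent (r *\<^sub>R \<phi>) (r *\<^sub>R u) e = r *\<^sub>R jent \<phi> u e"
  by (simp add: vec_eq_iff jent_def jet_entry_scaleR sum_distrib_left mult_ac)

lemma jent_linear: "linear (jent \<phi> u)"
  by (rule linearI) (simp_all add: vec_eq_iff jent_def algebra_simps sum.distrib sum_distrib_left)

lemma jent_linear_pair: "linear (\<lambda>y. jent (fst y) (snd y) e)"
  by (rule linearI) (simp_all add: jent_add jent_scaleR)

lemma jent_top: "jent \<phi> u e = jent \<phi> 0 e + jent 0 u e"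
  using jent_add[of \<phi> 0 0 u e] by simp

lemma jent_axis_low:
  "length \<mu>s < CARD('k) \<Longrightarrow> jent \<phi> u (axis \<kappa> 1) $ (low \<mu>s :: ('n::{finite,linorder}, 'k::finite) lower_index) = jet_entry \<phi> u (\<mu>s @ [\<kappa>])"
  by (simp add: jent_low axis_def if_distrib[of "\<lambda>x. x *\<^sub>R _"] cong: if_cong)

lemma sum_entries:
  fixes p :: "('n::{finite,linorder}, 'c::finite, 'k::finite) momenta"
  shows "(\<Sum>m<CARD('k). \<Sum>\<mu>s | length \<mu>s = m. \<Sum>\<kappa>\<in>UNIV. \<Sum>i\<in>UNIV. p $ low \<mu>s $ \<kappa> $ i * jet_entry \<phi> u (\<mu>s @ [\<kappa>]) $ i) =
    (\<Sum>\<kappa>\<in>UNIV. pr p (jent \<phi> u (axis \<kappa> 1)) $ \<kappa>)"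
  using sum_pr[of p "\<lambda>\<kappa>. jent \<phi> u (axis \<kappa> 1)" "\<lambda>_. 1"] by (simp add: jent_axis_low)

text \<open>\<open>jent 0 w\<close> has entries only at order k - 1, so the lower momenta drop out.
  The right-hand side is the trace of a linear endomorphism of the base coordinate space, a form
  suited to changes of coordinates.\<close>

lemma pairT_top_mom:
  fixes p :: "('n::{finite,linorder}, 'c::finite, 'k::finite) momenta"
  shows "pairT (top_mom p) w = (\<Sum>\<kappa>\<in>UNIV. pr p (jent 0 w (axis \<kappa> 1)) $ \<kappa>)"
proof -
  obtain m where m: "CARD('k) = Suc m" using zero_less_card_finite[where 'a = 'k] gr0_conv_Suc by blast
  have top: "top_mom p $ top_of \<mu>s = sym_mom p \<mu>s" if "length \<mu>s = CARD('k)" for \<mu>s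
    unfolding top_mom_def vec_lambda_beta by (rule sym_mom_perm) (simp add: Rep_top_of[OF that])
  have "pairT (top_mom p) w = (\<Sum>\<mu>s | length \<mu>s = CARD('k). sym_mom p \<mu>s \<bullet> w $ top_of \<mu>s)"
    unfolding pairT_def by (rule sum.cong[OF refl]) (simp only: mem_Collect_eq top)
  also have "\<dots> = (\<Sum>\<mu>s | length \<mu>s = Suc m. sym_mom p \<mu>s \<bullet> w $ top_of \<mu>s)"
    unfolding m ..
  also have "\<dots> = (\<Sum>\<nu>s | length \<nu>s = m. \<Sum>\<kappa>\<in>UNIV. p $ low \<nu>s $ \<kappa> \<bullet> w $ top_of (\<nu>s @ [\<kappa>]))"
    by (rule sum_sym_mom) (rule arg_cong[OF top_of_eqI])
  also have "\<dots> = (\<Sum>m<CARD('k). \<Sum>\<mu>s | length \<mu>s = m. \<Sum>\<kappa>\<in>UNIV. \<Sum>i\<in>UNIV. p $ low \<mu>s $ \<kappa> $ i * jet_entry 0 w (\<mu>s @ [\<kappa>]) $ i)"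
  proof -
    let ?f = "\<lambda>\<mu>s. \<Sum>\<kappa>\<in>UNIV. \<Sum>i\<in>UNIV. p $ low \<mu>s $ \<kappa> $ i * jet_entry 0 w (\<mu>s @ [\<kappa>]) $ i"
    have "(\<Sum>\<mu>s | length \<mu>s = l. ?f \<mu>s) = 0" if "l < m" for l
      using that by (intro sum.neutral ballI) (simp add: jet_entry_def m)
    moreover have "(\<Sum>\<mu>s | length \<mu>s = m. ?f \<mu>s) = (\<Sum>\<nu>s | length \<nu>s = m. \<Sum>\<kappa>\<in>UNIV. p $ low \<nu>s $ \<kappa> \<bullet> w $ top_of (\<nu>s @ [\<kappa>]))"
      by (intro sum.cong refl) (simp add: jet_entry_def m inner_vec_def)
    ultimately show ?thesis unfolding m sum.lessThan_Suc by simp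
  qed
  finally show ?thesis unfolding sum_entries .
qed

lemma trace_conj:
  fixes A M A' :: "real^'n \<Rightarrow> real^'n"
  assumes "linear A" "linear M" "linear A'" "\<And>e. A' (A e) = e"
  shows "(\<Sum>\<nu>\<in>UNIV. A (M (A' (axis \<nu> 1))) $ \<nu>) = (\<Sum>\<nu>\<in>UNIV. M (axis \<nu> 1) $ \<nu>)"
proof -
  have tr: "(\<Sum>\<nu>\<in>UNIV. F (axis \<nu> 1) $ \<nu>) = trace (matrix F)" for F :: "real^'n \<Rightarrow> real^'n"
    by (simp add: trace_def matrix_def)
  have comp: "matrix (A \<circ> (M \<circ> A')) = matrix A ** (matrix M ** matrix A')" "matrix (A' \<circ> A) = matrix A' ** matrix A"
    using assms by (simp_all add: matrix_compose linear_compose)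
  have "A' \<circ> A = id" using assms(4) by auto
  then have one: "matrix A' ** matrix A = mat 1" using comp(2) by (simp add: matrix_id_mat_1)
  have "(\<Sum>\<nu>\<in>UNIV. A (M (A' (axis \<nu> 1))) $ \<nu>) = trace (matrix A ** (matrix M ** matrix A'))"
    using tr[of "A \<circ> (M \<circ> A')"] comp(1) by simp
  also have "\<dots> = trace (matrix M ** (matrix A' ** matrix A))"
    by (subst trace_mul_sym) (simp add: matrix_mul_assoc)
  finally show ?thesis by (simp add: one tr)
qed

lemma top_mom_linear: "linear top_mom"
  by (rule linearI)
     (simp_all add: vec_eq_iff top_mom_def sym_mom_def Let_def sum.distrib algebra_simps sum_distrib_left)

section \<open>The Lagrangian and the form \<open>\<Omega>\<close>\<close>

locale lagrangian_bundle = jet_bundle B K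
  for B :: "('m, 'f, 'n::{finite,linorder}, 'c::finite) fibre_bundle" and K :: "'k::finite itself" +
  fixes Lag :: "('m, 'f, 'n) density"
  assumes lag: "lagrangian_density TYPE('k) B Lag"
    and reg: "regular_lagrangian TYPE('k) B Lag"
begin

abbreviation "L a \<equiv> (lagr B Lag a :: ('n, 'c, 'k) Jcoord \<Rightarrow> real)"
abbreviation "usol a \<equiv> (legendre_sol B Lag a :: ('n, 'c, 'k) Jcoord \<Rightarrow> ('n, 'c, 'k) tops)"
abbreviation "H a \<equiv> (hamiltonian B Lag a :: ('n, 'c, 'k) Pcoord \<Rightarrow> real)"

lemma L_smooth: "a \<in> adapted_charts B \<Longrightarrow> smooth_on (image_of (J a)) (L a)"
  using lag by (simp add: lagrangian_density_def)

lemma Lag_alternating: "j \<in> jet_space B CARD('k) \<Longrightarrow> alternating_form (base B) (fst j) CARD('n) (Lag j)"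
  using lag by (simp add: lagrangian_density_def)

lemma J_image_Q: "a \<in> adapted_charts B \<Longrightarrow> (x, \<phi>) \<in> image_of (Q a) \<Longrightarrow> (x, \<phi>, u) \<in> image_of (J a)"
  by (simp add: J_image_iff Q_image_iff)

lemma L_section:
  assumes a: "a \<in> adapted_charts B" and f: "local_section B x f" "f x \<in> dom_of (snd a)"
  shows "L a (coords (fst a) x, jlow a f (coords (fst a) x), jtop a f (coords (fst a) x)) =
    Lag (jet B CARD('k) f x) (map (\<lambda>\<mu>. coord_vector (base B) x (fst a) (axis \<mu> 1)) base_indices)"
  unfolding lagr_def J_uncoords_jet[OF a f] by (simp add: Let_def)

text \<open>The density is an alternating form on the base, so its value on the coordinate frame of
  the first chart is that on the frame of the second times the determinant of the change of
  frame.\<close>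

lemma L_change:
  assumes a: "a \<in> adapted_charts B" and a': "a' \<in> adapted_charts B"
    and f: "local_section B x f" "f x \<in> dom_of (snd a)" "f x \<in> dom_of (snd a')"
  shows "L a (coords (fst a) x, jlow a f (coords (fst a) x), jtop a f (coords (fst a) x)) =
    det (matrix (d\<psi> a a' (coords (fst a) x))) * L a' (coords (fst a') x, jlow a' f (coords (fst a') x), jtop a' f (coords (fst a') x))"
proof -
  let ?j = "jet B CARD('k) f x" and ?d = "d\<psi> a a' (coords (fst a) x)"
  let ?cv = "coord_vector (base B) x (fst a')"
  note b = adapted_base[OF a] and b' = adapted_base[OF a']
  have x: "x \<in> dom_of (fst a)" "x \<in> dom_of (fst a')" using local_section_base[OF a f(1,2)] local_section_base[OF a' f(1,3)] .
  have "?j \<in> jet_space B CARD('k)" using J_jet(1)[OF a f(1,2)] by (simp add: Jchart_def)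
  from Lag_alternating[OF this]
  have alt: "alternating_form (base B) x CARD('n) (Lag ?j)" by simp
  \<comment> \<open>The rows of \<open>A\<close> are the components, in the second chart, of the
    vectors on which the density is evaluated; hence the transposed Jacobian below.\<close>
  define F where "F A = Lag ?j (map (\<lambda>\<mu>. ?cv (A $ \<mu>)) base_indices)" for A :: "((real, 'n) vec, 'n) vec"
  have tan: "?cv e \<in> tangent_space (base B) x" for e by (rule coord_vector_tangent[OF base_atlas b' x(2)])
  have len: "length (map (\<lambda>\<mu>. ?cv (A $ \<mu>)) base_indices) = CARD('n)"
    "set (map (\<lambda>\<mu>. ?cv (A $ \<mu>)) base_indices) \<subseteq> tangent_space (base B) x" for A :: "((real, 'n) vec, 'n) vec"
    using tan by (auto simp: base_indices(3))
  have cv_lin: "?cv (r *\<^sub>R c + s *\<^sub>R d) = (\<lambda>e. r *\<^sub>R ?cv c e + s *\<^sub>R ?cv d e)" for r s c d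
  proof (rule tangent_eqI[OF tan tangent_lincomb[OF base_atlas tan tan] b' x(2)])
    show "?cv (r *\<^sub>R c + s *\<^sub>R d) (fst a') = r *\<^sub>R ?cv c (fst a') + s *\<^sub>R ?cv d (fst a')"
      by (simp add: coord_vector_same[OF base_atlas b' x(2)])
  qed
  have upd: "map (\<lambda>\<mu>. ?cv (set_row k c A $ \<mu>)) base_indices = (map (\<lambda>\<mu>. ?cv (A $ \<mu>)) base_indices)[i := ?cv c]"
    if "(base_indices :: 'n list) ! i = k" "i < CARD('n)" for i k c and A :: "((real, 'n) vec, 'n) vec"
    using that base_indices(2,3)[where 'n = 'n]
    by (intro nth_equalityI) (auto simp: nth_list_update nth_eq_iff_index_eq)
  have idx: "\<exists>i<CARD('n). (base_indices :: 'n list) ! i = \<nu>" for \<nu>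
    using bij_base_indices[where 'n = 'n] unfolding bij_betw_def by (metis UNIV_I imageE lessThan_iff)
  have "F A = det A * F (mat 1)" for A
  proof (rule alternating_rows_det)
    fix A :: "((real, 'n) vec, 'n) vec" and k r c s d
    obtain i where i: "i < CARD('n)" "(base_indices :: 'n list) ! i = k" using idx by blast
    have "Lag ?j ((map (\<lambda>\<mu>. ?cv (A $ \<mu>)) base_indices)[i := (\<lambda>e. r *\<^sub>R ?cv c e + s *\<^sub>R ?cv d e)]) =
      r * Lag ?j ((map (\<lambda>\<mu>. ?cv (A $ \<mu>)) base_indices)[i := ?cv c]) + s * Lag ?j ((map (\<lambda>\<mu>. ?cv (A $ \<mu>)) base_indices)[i := ?cv d])"
      using alt[unfolded alternating_form_def] len[of A] tan i(1) by blast
    then show "F (set_row k (r *\<^sub>R c + s *\<^sub>R d) A) = r * F (set_row k c A) + s * F (set_row k d A)"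
      unfolding F_def upd[OF i(2,1)] cv_lin .
  next
    fix A :: "((real, 'n) vec, 'n) vec" and k l :: 'n assume "k \<noteq> l" and eq: "A $ k = A $ l"
    obtain i where i: "i < CARD('n)" "(base_indices :: 'n list) ! i = k" using idx by blast
    obtain i' where i': "i' < CARD('n)" "(base_indices :: 'n list) ! i' = l" using idx by blast
    have "i \<noteq> i'" using i i' \<open>k \<noteq> l\<close> by auto
    moreover have "map (\<lambda>\<mu>. ?cv (A $ \<mu>)) base_indices ! i = map (\<lambda>\<mu>. ?cv (A $ \<mu>)) base_indices ! i'"
      using i i' eq base_indices(3)[where 'n = 'n] by simp
    ultimately show "F A = 0"
      unfolding F_def using alt[unfolded alternating_form_def] len[of A] i(1) i'(1) by blast
  qed
  from this[of "Finite_Cartesian_Product.transpose (matrix ?d)"]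
  have "F (Finite_Cartesian_Product.transpose (matrix ?d)) = det (matrix ?d) * F (mat 1)" by (simp add: det_transpose)
  moreover have "F (mat 1) = L a' (coords (fst a') x, jlow a' f (coords (fst a') x), jtop a' f (coords (fst a') x))"
  proof -
    have "(mat 1 :: ((real, 'n) vec, 'n) vec) $ \<mu> = axis \<mu> 1" for \<mu> by (auto simp: vec_eq_iff mat_def axis_def)
    then show ?thesis unfolding L_section[OF a' f(1,3)] F_def by simp
  qed
  moreover have "F (Finite_Cartesian_Product.transpose (matrix ?d)) = L a (coords (fst a) x, jlow a f (coords (fst a) x), jtop a f (coords (fst a) x))"
  proof -
    have "coord_vector (base B) x (fst a) (axis \<mu> 1) = ?cv (Finite_Cartesian_Product.transpose (matrix ?d) $ \<mu>)" for \<mu>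
    proof -
      have "coord_vector (base B) x (fst a) (axis \<mu> 1) (fst a') = ?d (axis \<mu> 1)"
        using b' x by (simp add: coord_vector_def)
      moreover have "?d (axis \<mu> 1) = Finite_Cartesian_Product.transpose (matrix ?d) $ \<mu>"
        by (simp add: vec_eq_iff matrix_def Finite_Cartesian_Product.transpose_def)
      ultimately show ?thesis
        using tangent_eq_coord_vector[OF coord_vector_tangent[OF base_atlas b x(1)] b' x(2), of "axis \<mu> 1"] by simp
    qed
    then show ?thesis unfolding L_section[OF a f(1,2)] F_def by simp
  qed
  ultimately show ?thesis by simp
qed

abbreviation "LD a \<equiv> {(x, \<phi>, p). (x, \<phi>) \<in> image_of (Q a)} :: ('n, 'c, 'k) Jcoord set"

lemma usol_smooth: "a \<in> adapted_charts B \<Longrightarrow> smooth_on (LD a) (usol a)"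
  using reg by (simp add: regular_lagrangian_def Let_def)

lemma usol_ex1: "a \<in> adapted_charts B \<Longrightarrow> y \<in> LD a \<Longrightarrow> \<exists>!u. legendre_eqs B Lag a y u"
  using reg unfolding regular_lagrangian_def Let_def by blast

lemma DL_top_linear:
  assumes "a \<in> adapted_charts B" "(x, \<phi>) \<in> image_of (Q a)"
  shows "linear (\<lambda>w. frechet_derivative (L a) (at (x, \<phi>, u)) (0, 0, w))"
proof -
  have lin: "linear (frechet_derivative (L a) (at (x, \<phi>, u)))"
    by (rule smooth_on_linear[OF L_smooth[OF assms(1)] J_image_Q[OF assms]])
  show ?thesis
    using linear_compose[of "\<lambda>w. (0, 0, w)", OF _ lin] by (simp add: o_def linear_iff)
qed

lemma legendre_iff:
  assumes "a \<in> adapted_charts B" "(x, \<phi>) \<in> image_of (Q a)"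
  shows "legendre_eqs B Lag a (x, \<phi>, p) u \<longleftrightarrow> (\<forall>w. frechet_derivative (L a) (at (x, \<phi>, u)) (0, 0, w) = pairT p w)"
  unfolding legendre_eqs_def d_top_def case_prod_conv by (rule linear_eq_pairT[OF DL_top_linear[OF assms]])

lemma usol_legendre:
  assumes "a \<in> adapted_charts B" "(x, \<phi>) \<in> image_of (Q a)"
  shows "frechet_derivative (L a) (at (x, \<phi>, usol a (x, \<phi>, p))) (0, 0, w) = pairT p w"
proof -
  have "legendre_eqs B Lag a (x, \<phi>, p) (usol a (x, \<phi>, p))"
    unfolding legendre_sol_def by (rule theI'[OF usol_ex1[OF assms(1)]]) (simp add: assms(2))
  then show ?thesis using legendre_iff[OF assms] by blast
qed

lemma usol_unique:
  assumes "a \<in> adapted_charts B" "(x, \<phi>) \<in> image_of (Q a)"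
    and "\<And>w. frechet_derivative (L a) (at (x, \<phi>, u)) (0, 0, w) = pairT p w"
  shows "usol a (x, \<phi>, p) = u"
  unfolding legendre_sol_def
proof (rule the1_equality[OF usol_ex1[OF assms(1)]])
  show "legendre_eqs B Lag a (x, \<phi>, p) u" using assms(3) legendre_iff[OF assms(1,2)] by blast
qed (simp add: assms(2))

text \<open>The top-order jet coordinates in a second chart; by the contact property they are an affine
  function of those in the first one.\<close>

definition topmap :: "('m, 'f, 'n, 'c) adapted \<Rightarrow> ('m, 'f, 'n, 'c) adapted \<Rightarrow> ('n, 'c, 'k) Qcoord \<Rightarrow> ('n, 'c, 'k) tops \<Rightarrow> ('n, 'c, 'k) tops" where
  "topmap a a' y u = (\<chi> I. let e = d\<psi> a' a (fst (TQ a a' y)) (axis (last (top_list I)) 1)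
     in snd (DQ a a' y (e, jent (snd y) u e)) $ low (butlast (top_list I)))"

lemma topmap_section:
  assumes a: "a \<in> adapted_charts B" and a': "a' \<in> adapted_charts B"
    and f: "local_section B x f" "f x \<in> dom_of (snd a)" "f x \<in> dom_of (snd a')"
  shows "jtop a' f (coords (fst a') x) = topmap a a' (coords (fst a) x, jlow a f (coords (fst a) x)) (jtop a f (coords (fst a) x))"
proof -
  let ?\<xi> = "coords (fst a) x" and ?\<xi>' = "coords (fst a') x"
  let ?y = "(?\<xi>, jlow a f ?\<xi>)"
  have y: "?y \<in> OQ a a'" using Q_jet[OF a f(1,2)] Q_jet(1)[OF a' f(1,3)] by (metis IntI image_eqI)
  have T: "TQ a a' ?y = (?\<xi>', jlow a' f ?\<xi>')" by (rule Q_transition_section[OF a a' f])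
  show ?thesis
  proof (rule vec_eq_iff[THEN iffD2, rule_format])
    fix I :: "('n, 'k) top_index"
    let ?\<nu> = "last (top_list I)" and ?\<mu>s = "butlast (top_list I)"
    \<comment> \<open>The direction that becomes the axis of the last index of \<open>I\<close> in
      the second chart; the contact property then exhibits the top-order entry as a component of
      order k - 1 of the image vector.\<close>
    define e where "e = d\<psi> a' a (fst (TQ a a' ?y)) (axis ?\<nu> 1)"
    have de: "d\<psi> a a' ?\<xi> e = axis ?\<nu> 1"
      using d\<psi>_inverse[OF a' a TQ_in(1)[OF a y], of "axis ?\<nu> 1"] TQ_in(2)[OF a y a'] by (simp add: e_def del: o_apply)
    have ne: "top_list I \<noteq> []" using length_top_list[of I] by (metis length_0_conv zero_less_card_finite less_irrefl)
    then have split: "top_list I = ?\<mu>s @ [?\<nu>]" by simp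
    have len: "length ?\<mu>s < CARD('k)" using length_top_list[of I] zero_less_card_finite[where 'a = 'k] by simp
    have "snd (DQ a a' ?y (e, jent (jlow a f ?\<xi>) (jtop a f ?\<xi>) e)) = jent (jlow a' f ?\<xi>') (jtop a' f ?\<xi>') (axis ?\<nu> 1)"
      unfolding contact_transition[OF a a' f] de by simp
    moreover have "jent (jlow a' f ?\<xi>') (jtop a' f ?\<xi>') (axis ?\<nu> 1) $ low ?\<mu>s = jtop a' f ?\<xi>' $ I"
      unfolding jent_axis_low[OF len] split[symmetric] by (simp add: jet_entry_def length_top_list)
    ultimately show "jtop a' f ?\<xi>' $ I = topmap a a' ?y (jtop a f ?\<xi>) $ I"
      unfolding topmap_def by (simp add: Let_def e_def[symmetric] del: o_apply)
  qed
qed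

lemma section_at:
  assumes a: "a \<in> adapted_charts B" and a': "a' \<in> adapted_charts B" and y: "(x, \<phi>) \<in> OQ a a'"
  obtains f z where "local_section B z f" "f z \<in> dom_of (snd a)" "f z \<in> dom_of (snd a')" "coords (fst a) z = x"
    "jlow a f x = \<phi>" "jtop a f x = u" "TQ a a' (x, \<phi>) = (coords (fst a') z, jlow a' f (coords (fst a') z))"
    "jtop a' f (coords (fst a') z) = topmap a a' (x, \<phi>) u"
proof -
  have ov: "(x, \<phi> $ low []) \<in> coords (snd a) ` (dom_of (snd a) \<inter> dom_of (snd a'))"
    using y Q_overlap_iff[OF a a'] by simp
  then have im: "(x, \<phi> $ low []) \<in> image_of (snd a)" by (auto simp: image_of_def)
  obtain f z where f: "local_section B z f" "f z \<in> dom_of (snd a)" "f z = uncoords (snd a) (x, \<phi> $ low [])"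
    "coords (fst a) z = x" "z = uncoords (fst a) x" "jlow a f x = \<phi>" "jtop a f x = u"
    by (rule section_of_coords[OF a im])
  have f': "f z \<in> dom_of (snd a')" using ov unfolding coords_image_iff[OF total_atlas adapted_total[OF a]] f(3) by simp
  show ?thesis
    using that[OF f(1,2) f' f(4,6,7)] Q_transition_section[OF a a' f(1,2) f'] topmap_section[OF a a' f(1,2) f'] f(4,6,7)
    by (simp del: o_apply)
qed

lemma contact_coords:
  assumes a: "a \<in> adapted_charts B" and a': "a' \<in> adapted_charts B" and y: "(x, \<phi>) \<in> OQ a a'"
  shows "DQ a a' (x, \<phi>) (e, jent \<phi> u e) =
    (d\<psi> a a' x e, jent (snd (TQ a a' (x, \<phi>))) (topmap a a' (x, \<phi>) u) (d\<psi> a a' x e))"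
proof -
  obtain f z where f: "local_section B z f" "f z \<in> dom_of (snd a)" "f z \<in> dom_of (snd a')" "coords (fst a) z = x"
    "jlow a f x = \<phi>" "jtop a f x = u" "TQ a a' (x, \<phi>) = (coords (fst a') z, jlow a' f (coords (fst a') z))"
    "jtop a' f (coords (fst a') z) = topmap a a' (x, \<phi>) u"
    by (rule section_at[OF a a' y])
  show ?thesis using contact_transition[OF a a' f(1-3), of e] unfolding f(4-8) by simp
qed

lemma L_coords:
  assumes a: "a \<in> adapted_charts B" and a': "a' \<in> adapted_charts B" and y: "(x, \<phi>) \<in> OQ a a'"
  shows "L a (x, \<phi>, u) = det (matrix (d\<psi> a a' x)) *
    L a' (fst (TQ a a' (x, \<phi>)), snd (TQ a a' (x, \<phi>)), topmap a a' (x, \<phi>) u)"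
proof -
  obtain f z where f: "local_section B z f" "f z \<in> dom_of (snd a)" "f z \<in> dom_of (snd a')" "coords (fst a) z = x"
    "jlow a f x = \<phi>" "jtop a f x = u" "TQ a a' (x, \<phi>) = (coords (fst a') z, jlow a' f (coords (fst a') z))"
    "jtop a' f (coords (fst a') z) = topmap a a' (x, \<phi>) u"
    by (rule section_at[OF a a' y])
  show ?thesis using L_change[OF a a' f(1-3)] unfolding f(4-8) by simp
qed

text \<open>A section with the desired top coordinates in the second chart is read in the first.
  Surjectivity lets the Legendre equations of the second chart be tested on all increments.\<close>

lemma topmap_surj:
  assumes a: "a \<in> adapted_charts B" and a': "a' \<in> adapted_charts B" and y: "(x, \<phi>) \<in> OQ a a'"
  shows "\<exists>u. topmap a a' (x, \<phi>) u = v"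
proof -
  obtain x' \<phi>' where T: "TQ a a' (x, \<phi>) = (x', \<phi>')" by fastforce
  have y': "(x', \<phi>') \<in> OQ a' a" using TQ_in(1)[OF a y] T by simp
  obtain f z where f: "local_section B z f" "f z \<in> dom_of (snd a')" "f z \<in> dom_of (snd a)" "coords (fst a') z = x'"
    "jlow a' f x' = \<phi>'" "jtop a' f x' = v" "TQ a' a (x', \<phi>') = (coords (fst a) z, jlow a f (coords (fst a) z))"
    by (rule section_at[OF a' a y'])
  have "(x, \<phi>) = (coords (fst a) z, jlow a f (coords (fst a) z))"
    using TQ_in(2)[OF a y a'] f(7) unfolding T by simp
  then show ?thesis using topmap_section[OF a a' f(1,3,2)] f(4,6) by auto
qed

text \<open>Subtracting two contact directions over the same \<open>e\<close> removes the part
  depending on \<phi>; what remains is linear in \<open>w\<close> and is moved as a vertical vector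
  by the derivative of the jet transition.\<close>

lemma topmap_linear_part:
  assumes a: "a \<in> adapted_charts B" and a': "a' \<in> adapted_charts B" and y: "(x, \<phi>) \<in> OQ a a'"
  defines "U \<equiv> \<lambda>w. topmap a a' (x, \<phi>) w - topmap a a' (x, \<phi>) 0"
  shows "linear U" "jent 0 (U w) (d\<psi> a a' x e) = snd (DQ a a' (x, \<phi>) (0, jent 0 w e))"
proof -
  note lin = DQ_linear[OF a a' y]
  have diff: "DQ a a' (x, \<phi>) (e, jent \<phi> w e) - DQ a a' (x, \<phi>) (e, jent \<phi> 0 e) = DQ a a' (x, \<phi>) (0, jent 0 w e)" for w e
    using linear_diff[OF lin, of "(e, jent \<phi> w e)" "(e, jent \<phi> 0 e)"] jent_top[of \<phi> w e] by simp
  define E where "E I = d\<psi> a' a (fst (TQ a a' (x, \<phi>))) (axis (last (top_list I)) 1)" for I :: "('n, 'k) top_index"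
  have U: "U w = (\<chi> I. snd (DQ a a' (x, \<phi>) (0, jent 0 w (E I))) $ low (butlast (top_list I)))" for w
    unfolding U_def diff[symmetric] E_def topmap_def by (simp add: vec_eq_iff Let_def)
  have lin': "linear (\<lambda>w. snd (DQ a a' (x, \<phi>) (0, jent 0 w e)))" for e
  proof -
    have "linear (\<lambda>w :: ('n, 'c, 'k) tops. (0 :: (real, 'n) vec, jent 0 w e))"
      using jent_add[of 0 0 _ _ e] jent_scaleR[of _ 0 _ e] by (auto intro!: linearI)
    from linear_compose[OF linear_compose[OF this lin] linear_snd] show ?thesis by (simp add: o_def)
  qed
  show "linear U"
    by (rule linearI) (simp_all add: U vec_eq_iff linear_add[OF lin'] linear_scale[OF lin'])
  show "jent 0 (U w) (d\<psi> a a' x e) = snd (DQ a a' (x, \<phi>) (0, jent 0 w e))"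
    unfolding diff[symmetric] contact_coords[OF a a' y] U_def
    using jent_add[of 0 "snd (TQ a a' (x, \<phi>))" "topmap a a' (x, \<phi>) w - topmap a a' (x, \<phi>) 0" "topmap a a' (x, \<phi>) 0" "d\<psi> a a' x e"]
    by simp
qed

lemma pr_mom_trans_DQ:
  assumes a: "a \<in> adapted_charts B" and a': "a' \<in> adapted_charts B" and y: "(x, \<phi>) \<in> OQ a a'"
  shows "pr (mom_trans a a' (x, \<phi>) p) (snd (DQ a a' (x, \<phi>) (0, w))) =
    inverse (det (matrix (d\<psi> a a' x))) *\<^sub>R d\<psi> a a' x (pr p w)"
proof -
  have "(0, snd (DQ a a' (x, \<phi>) (0, w))) = DQ a a' (x, \<phi>) (0, w)"
    using fst_DQ[OF a a' y, of "(0, w)"] linear_0[OF d\<psi>_linear[OF a a' y]] by (metis fst_conv prod.collapse)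
  then show ?thesis unfolding pr_mom_trans[OF a a' y] using DQ_inverse[OF a a' y, of "(0, w)"] by (simp del: o_apply)
qed

text \<open>Along the top-order derivatives, \<open>DL\<close> compares the differentials of the two
  Lagrangian coefficients and \<open>pair\<close> the two momentum pairings. Both contain the same
  nonzero determinant, so the transformed solution satisfies the Legendre equations of the second
  chart, and uniqueness identifies it.\<close>

lemma usol_change:
  assumes a: "a \<in> adapted_charts B" and a': "a' \<in> adapted_charts B" and y: "(x, \<phi>) \<in> OQ a a'"
  shows "usol a' (fst (TQ a a' (x, \<phi>)), snd (TQ a a' (x, \<phi>)), top_mom (mom_trans a a' (x, \<phi>) p)) =
    topmap a a' (x, \<phi>) (usol a (x, \<phi>, top_mom p))"
proof -
  obtain x' \<phi>' where T: "TQ a a' (x, \<phi>) = (x', \<phi>')" by fastforce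
  let ?u = "usol a (x, \<phi>, top_mom p)" and ?p' = "mom_trans a a' (x, \<phi>) p"
  let ?\<tau> = "topmap a a' (x, \<phi>)"
  let ?U = "\<lambda>w. ?\<tau> w - ?\<tau> 0" and ?det = "det (matrix (d\<psi> a a' x))"
  have im: "(x, \<phi>) \<in> image_of (Q a)" by (rule OQ_image[OF y])
  have im': "(x', \<phi>') \<in> image_of (Q a')" using OQ_image[OF TQ_in(1)[OF a y]] T by simp
  note U = topmap_linear_part[OF a a' y]
  have det0: "?det \<noteq> 0" using det_d\<psi>[OF a a' y] by simp
  have DL: "frechet_derivative (L a) (at (x, \<phi>, ?u)) (0, 0, w) = ?det * frechet_derivative (L a') (at (x', \<phi>', ?\<tau> ?u)) (0, 0, ?U w)" for w
  proof -
    have e1: "((\<lambda>v. (x, \<phi>, v)) has_derivative (\<lambda>w. (0, 0, w))) (at ?u)" by (auto intro!: derivative_eq_intros)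
    have L1: "((\<lambda>v. L a (x, \<phi>, v)) has_derivative (\<lambda>w. frechet_derivative (L a) (at (x, \<phi>, ?u)) (0, 0, w))) (at ?u)"
      by (rule has_derivative_compose[OF e1 smooth_on_has_derivative[OF L_smooth[OF a] J_image_Q[OF a im]]])
    have "((\<lambda>v. ?U v + ?\<tau> 0) has_derivative ?U) (at ?u)"
      by (intro has_derivative_add_const linear_imp_has_derivative U(1))
    then have \<tau>: "(?\<tau> has_derivative ?U) (at ?u)" by simp
    have e2: "((\<lambda>v. (x', \<phi>', ?\<tau> v)) has_derivative (\<lambda>w. (0, 0, ?U w))) (at ?u)"
      by (intro has_derivative_Pair has_derivative_const \<tau>)
    have L2: "((\<lambda>v. ?det * L a' (x', \<phi>', ?\<tau> v)) has_derivative
        (\<lambda>w. ?det * frechet_derivative (L a') (at (x', \<phi>', ?\<tau> ?u)) (0, 0, ?U w))) (at ?u)"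
      by (intro has_derivative_mult_right has_derivative_compose[OF e2 smooth_on_has_derivative[OF L_smooth[OF a'] J_image_Q[OF a' im']]])
    have "(\<lambda>v. L a (x, \<phi>, v)) = (\<lambda>v. ?det * L a' (x', \<phi>', ?\<tau> v))"
      using L_coords[OF a a' y] unfolding T by (simp add: fun_eq_iff)
    from has_derivative_unique[OF L1[unfolded this] L2] show ?thesis by (rule fun_cong)
  qed
  \<comment> \<open>Both pairings are traces, and by \<open>A\<close> the endomorphism of the second
    chart is conjugate to that of the first up to the inverse determinant.\<close>
  have pair: "pairT (top_mom p) w = ?det * pairT (top_mom ?p') (?U w)" for w
  proof -
    have A: "pr ?p' (jent 0 (?U w) (axis \<nu> 1)) = inverse ?det *\<^sub>R d\<psi> a a' x (pr p (jent 0 w (d\<psi> a' a x' (axis \<nu> 1))))" for \<nu>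
    proof -
      have inv: "d\<psi> a a' x (d\<psi> a' a x' (axis \<nu> 1)) = axis \<nu> 1"
        using d\<psi>_inverse[OF a' a TQ_in(1)[OF a y], of "axis \<nu> 1"] TQ_in(2)[OF a y a'] by (simp add: T del: o_apply)
      show ?thesis
        using U(2)[of w "d\<psi> a' a x' (axis \<nu> 1)"] pr_mom_trans_DQ[OF a a' y, of p "jent 0 w (d\<psi> a' a x' (axis \<nu> 1))"]
        unfolding inv by simp
    qed
    have lin1: "linear (d\<psi> a a' x)" using d\<psi>_linear[OF a a' y] by simp
    have lin2: "linear (d\<psi> a' a x')" using d\<psi>_linear[OF a' a TQ_in(1)[OF a y]] by (simp add: T del: o_apply)
    have lin3: "linear (\<lambda>e. pr p (jent 0 w e))"
      by (rule linearI) (simp_all add: linear_add[OF jent_linear] linear_scale[OF jent_linear] pr_add_right pr_scaleR_right)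
    have inv': "d\<psi> a' a x' (d\<psi> a a' x e) = e" for e
      using d\<psi>_inverse[OF a a' y, of e] by (simp add: T del: o_apply)
    have "?det * pairT (top_mom ?p') (?U w) = (\<Sum>\<nu>\<in>UNIV. d\<psi> a a' x (pr p (jent 0 w (d\<psi> a' a x' (axis \<nu> 1)))) $ \<nu>)"
    proof -
      have cancel: "?det * (inverse ?det * z) = z" for z using det0 by (simp add: mult.assoc[symmetric])
      show ?thesis
        by (simp only: pairT_top_mom A sum_distrib_left vector_scaleR_component real_scaleR_def cancel)
    qed
    also have "\<dots> = pairT (top_mom p) w"
      unfolding pairT_top_mom by (rule trace_conj[OF lin1 lin3 lin2 inv'])
    finally show ?thesis by simp
  qed
  have "frechet_derivative (L a') (at (x', \<phi>', ?\<tau> ?u)) (0, 0, w') = pairT (top_mom ?p') w'" for w'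
  proof -
    obtain w where "?\<tau> w = w' + ?\<tau> 0" using topmap_surj[OF a a' y] by blast
    then have w: "w' = ?U w" by simp
    have "?det * frechet_derivative (L a') (at (x', \<phi>', ?\<tau> ?u)) (0, 0, ?U w) = ?det * pairT (top_mom ?p') (?U w)"
      unfolding DL[symmetric] pair[symmetric] by (rule usol_legendre[OF a im])
    then show ?thesis using det0 w by simp
  qed
  then have "usol a' (x', \<phi>', top_mom ?p') = ?\<tau> ?u" by (rule usol_unique[OF a' im'])
  then show ?thesis by (simp add: T del: o_apply)
qed

end

lemma nested_sum:
  "(\<Sum>m<k. \<Sum>\<mu>s | length \<mu>s = m. \<Sum>\<kappa>\<in>UNIV. \<Sum>i\<in>UNIV. F \<mu>s \<kappa> i) =
    (\<Sum>(\<mu>s, \<kappa>, i)\<in>{\<mu>s :: 'n::finite list. length \<mu>s < k} \<times> (UNIV :: 'n set) \<times> (UNIV :: 'c::finite set). F \<mu>s \<kappa> i)"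
proof -
  have "{\<mu>s :: 'n list. length \<mu>s < k} = (\<Union>m\<in>{..<k}. {\<mu>s. length \<mu>s = m})" by auto
  then have "(\<Sum>m<k. \<Sum>\<mu>s | length \<mu>s = m. \<Sum>\<kappa>\<in>UNIV. \<Sum>i\<in>UNIV. F \<mu>s \<kappa> i) =
      (\<Sum>\<mu>s | length \<mu>s < k. \<Sum>\<kappa>\<in>UNIV. \<Sum>i\<in>UNIV. F \<mu>s \<kappa> i)"
    by (simp only:) (rule sum.UNION_disjoint[symmetric], auto simp: finite_lists_eq)
  then show ?thesis by (simp add: sum.cartesian_product split_beta)
qed

lemma det_set_row_linear: "linear (\<lambda>r. det (set_row \<kappa> r M))" for M :: "real^'n::finite^'n"
  using det_set_row_lin[of \<kappa> 1 _ 1 _ M] det_set_row_lin[of \<kappa> _ _ 0 _ M] by (auto intro!: linearI)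

lemma dmix_pr:
  fixes p :: "('n::{finite,linorder}, 'c::finite, 'k::finite) momenta" and w :: "'n \<Rightarrow> ('n, 'c, 'k) fields"
  shows "(\<Sum>m<CARD('k). \<Sum>\<mu>s | length \<mu>s = m. \<Sum>\<kappa>\<in>UNIV. \<Sum>i\<in>UNIV.
      p $ low \<mu>s $ \<kappa> $ i * det (set_row \<kappa> (\<chi> \<nu>. w \<nu> $ low \<mu>s $ i) M)) = dmix M (\<chi> \<kappa> \<nu>. pr p (w \<nu>) $ \<kappa>)"
proof -
  have row: "(\<chi> \<nu>. pr p (w \<nu>) $ \<kappa>) = (\<Sum>I\<in>UNIV. \<Sum>i\<in>UNIV. (wt I * p $ I $ \<kappa> $ i) *\<^sub>R (\<chi> \<nu>. w \<nu> $ I $ i))" for \<kappa>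
    by (simp add: vec_eq_iff pr_nth inner_vec_def sum_distrib_left mult.assoc)
  have "(\<Sum>m<CARD('k). \<Sum>\<mu>s | length \<mu>s = m. \<Sum>\<kappa>\<in>UNIV. \<Sum>i\<in>UNIV.
      p $ low \<mu>s $ \<kappa> $ i * det (set_row \<kappa> (\<chi> \<nu>. w \<nu> $ low \<mu>s $ i) M)) =
    (\<Sum>I\<in>UNIV. wt I * (\<Sum>\<kappa>\<in>UNIV. \<Sum>i\<in>UNIV. p $ I $ \<kappa> $ i * det (set_row \<kappa> (\<chi> \<nu>. w \<nu> $ I $ i) M)))"
    by (rule sum_lists_low)
  also have "\<dots> = (\<Sum>\<kappa>\<in>UNIV. \<Sum>I\<in>UNIV. wt I * (\<Sum>i\<in>UNIV. p $ I $ \<kappa> $ i * det (set_row \<kappa> (\<chi> \<nu>. w \<nu> $ I $ i) M)))"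
    unfolding sum_distrib_left by (rule sum.swap)
  also have "\<dots> = dmix M (\<chi> \<kappa> \<nu>. pr p (w \<nu>) $ \<kappa>)"
    unfolding dmix_def vec_lambda_beta row
    by (simp add: linear_sum[OF det_set_row_linear] linear_scale[OF det_set_row_linear] sum_distrib_left mult.assoc)
  finally show ?thesis .
qed

lemma linear_dx: "linear (dx \<mu>)"
  by (rule linearI) (auto simp: dx_def)

lemma linear_dphi: "linear (dphi \<mu>s i)"
  by (rule linearI) (auto simp: dphi_def)

lemma linear_dp: "linear (dp \<mu>s \<kappa> i)"
  by (rule linearI) (auto simp: dp_def)

lemma wedge_uminus_first: "wedge ((\<lambda>v. - \<gamma> v) # \<beta>s) vs = - wedge (\<gamma> # \<beta>s) vs"
  by (simp add: wedge_Cons_def sum_negf)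

section \<open>The Poincare-Cartan form, its invariance and the resulting global form\<close>

context lagrangian_bundle begin

lemma H_alt: "H a (x, \<phi>, p) = (\<Sum>\<kappa>\<in>UNIV. pr p (jent \<phi> (usol a (x, \<phi>, top_mom p)) (axis \<kappa> 1)) $ \<kappa>) - L a (x, \<phi>, usol a (x, \<phi>, top_mom p))"
  by (simp add: hamiltonian_def Let_def sum_entries)

lemma H_smooth:
  assumes a: "a \<in> adapted_charts B"
  shows "smooth_on (image_of (P a)) (H a)"
proof -
  let ?S = "image_of (P a)"
  note op = P_image_open[OF a]
  have im: "(fst y, fst (snd y)) \<in> image_of (Q a)" if "y \<in> ?S" for y
    using that P_image_iff[OF a, of "fst y" "fst (snd y)" "snd (snd y)"] by simp
  have id: "smooth_on ?S (\<lambda>y. fst y)" "smooth_on ?S (\<lambda>y. fst (snd y))" "smooth_on ?S (\<lambda>y. snd (snd y))"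
    by (intro smooth_on_fst smooth_on_snd smooth_on_ident op)+
  have top: "smooth_on ?S (\<lambda>y. top_mom (snd (snd y)))"
    by (rule smooth_on_compose[OF smooth_on_linear_map[OF top_mom_linear open_UNIV] id(3)]) simp
  have u: "smooth_on ?S (\<lambda>y. usol a (fst y, fst (snd y), top_mom (snd (snd y))))"
    by (rule smooth_on_compose[OF usol_smooth[OF a] smooth_on_Pair[OF id(1) smooth_on_Pair[OF id(2) top]]])
       (use im in auto)
  have j: "smooth_on ?S (\<lambda>y. jent (fst (snd y)) (usol a (fst y, fst (snd y), top_mom (snd (snd y)))) e)" for e
    using smooth_on_compose[OF smooth_on_linear_map[OF jent_linear_pair open_UNIV] smooth_on_Pair[OF id(2) u], of e] by simp
  have l: "smooth_on ?S (\<lambda>y. L a (fst y, fst (snd y), usol a (fst y, fst (snd y), top_mom (snd (snd y)))))"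
  proof (rule smooth_on_compose[OF L_smooth[OF a] smooth_on_Pair[OF id(1) smooth_on_Pair[OF id(2) u]]], rule image_subsetI)
    fix y assume "y \<in> ?S"
    from J_image_Q[OF a im[OF this]]
    show "(fst y, fst (snd y), usol a (fst y, fst (snd y), top_mom (snd (snd y)))) \<in> image_of (J a)" .
  qed
  have "smooth_on ?S (\<lambda>y. (\<Sum>\<kappa>\<in>UNIV. pr (snd (snd y)) (jent (fst (snd y)) (usol a (fst y, fst (snd y), top_mom (snd (snd y)))) (axis \<kappa> 1)) $ \<kappa>)
      - L a (fst y, fst (snd y), usol a (fst y, fst (snd y), top_mom (snd (snd y)))))"
    by (intro smooth_on_diff smooth_on_sum smooth_on_nth smooth_on_bounded_bilinear[OF bilinear_pr] id j l op)
  then show ?thesis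
  proof (rule smooth_on_cong)
    fix y :: "('n, 'c, 'k) Pcoord"
    show "(\<Sum>\<kappa>\<in>UNIV. pr (snd (snd y)) (jent (fst (snd y)) (usol a (fst y, fst (snd y), top_mom (snd (snd y)))) (axis \<kappa> 1)) $ \<kappa>)
      - L a (fst y, fst (snd y), usol a (fst y, fst (snd y), top_mom (snd (snd y)))) = H a y"
      using H_alt[of a "fst y" "fst (snd y)" "snd (snd y)"] by simp
  qed
qed

text \<open>Written with \<open>H\<close> rather than with contact forms, so that differentiating
  its coefficients gives \<open>Omega_coord\<close> term by term.\<close>

definition theta :: "('m, 'f, 'n, 'c) adapted \<Rightarrow> ('n, 'c, 'k) Pcoord \<Rightarrow> ('n, 'c, 'k) Pcoord list \<Rightarrow> real" where
  "theta a y vs = (\<Sum>m<CARD('k). \<Sum>\<mu>s | length \<mu>s = m. \<Sum>\<kappa>\<in>UNIV. \<Sum>i\<in>UNIV.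
      snd (snd y) $ low \<mu>s $ \<kappa> $ i * wedge (map (\<lambda>\<nu>. if \<nu> = \<kappa> then dphi \<mu>s i else dx \<nu>) base_indices) vs)
    - H a y * wedge (map dx base_indices) vs"

text \<open>The field components of a vector are split into a contact part and the holonomic part
  determined by its base component. The holonomic part contributes a trace times
  \<open>det M\<close>, which cancels the momentum terms of \<open>H\<close> and leaves
  \<open>L\<close>.\<close>

lemma theta_contact:
  fixes G :: "'n \<Rightarrow> ('n, 'c, 'k) Pcoord"
  defines "M \<equiv> \<chi> \<mu> \<nu>. fst (G \<nu>) $ \<mu>"
  assumes u: "u = usol a (x, \<phi>, top_mom p)"
  shows "theta a (x, \<phi>, p) (map G base_indices) =
    dmix M (\<chi> \<kappa> \<nu>. pr p (fst (snd (G \<nu>)) - jent \<phi> u (fst (G \<nu>))) $ \<kappa>) + L a (x, \<phi>, u) * det M"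
proof -
  let ?C = "(\<chi> \<kappa> \<nu>. pr p (jent \<phi> u (axis \<nu> 1)) $ \<kappa>) :: ((real, 'n) vec, 'n) vec"
  have 1: "wedge (map (\<lambda>\<nu>. if \<nu> = \<kappa> then dphi \<mu>s i else dx \<nu>) base_indices) (map G base_indices) =
      det (set_row \<kappa> (\<chi> \<nu>. fst (snd (G \<nu>)) $ low \<mu>s $ i) M)" for \<kappa> \<mu>s i
  proof -
    have "(\<chi> \<mu> \<nu>. (if \<mu> = \<kappa> then dphi \<mu>s i else dx \<mu>) (G \<nu>)) = set_row \<kappa> (\<chi> \<nu>. fst (snd (G \<nu>)) $ low \<mu>s $ i) M"
      by (auto simp: vec_eq_iff M_def dphi_def dx_def split_beta)
    then show ?thesis unfolding wedge_map_base_indices by simp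
  qed
  have 2: "wedge (map dx base_indices) (map G base_indices) = det M"
    unfolding wedge_map_base_indices by (simp add: M_def dx_def split_beta)
  have lin: "linear (\<lambda>e. pr p (jent \<phi> u e))"
    by (rule linearI) (simp_all add: linear_add[OF jent_linear] linear_scale[OF jent_linear] pr_add_right pr_scaleR_right)
  have "pr p (jent \<phi> u (fst (G \<nu>))) = (\<Sum>l\<in>UNIV. fst (G \<nu>) $ l *\<^sub>R pr p (jent \<phi> u (axis l 1)))" for \<nu>
  proof -
    have "pr p (jent \<phi> u (\<Sum>l\<in>UNIV. fst (G \<nu>) $ l *\<^sub>R axis l 1)) = (\<Sum>l\<in>UNIV. fst (G \<nu>) $ l *\<^sub>R pr p (jent \<phi> u (axis l 1)))"
      by (simp add: linear_sum[OF lin] linear_scale[OF lin])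
    then show ?thesis using basis_expansion[of "fst (G \<nu>)"] by (simp add: scalar_mult_eq_scaleR)
  qed
  then have split: "(\<chi> \<kappa> \<nu>. pr p (fst (snd (G \<nu>))) $ \<kappa>) =
      (\<chi> \<kappa> \<nu>. pr p (fst (snd (G \<nu>)) - jent \<phi> u (fst (G \<nu>))) $ \<kappa>) + ?C ** M"
    by (simp add: vec_eq_iff pr_diff_right matrix_matrix_mult_def M_def mult.commute)
  have "theta a (x, \<phi>, p) (map G base_indices) = dmix M (\<chi> \<kappa> \<nu>. pr p (fst (snd (G \<nu>))) $ \<kappa>) - H a (x, \<phi>, p) * det M"
    unfolding theta_def 1 2 by (simp add: dmix_pr)
  also have "\<dots> = dmix M (\<chi> \<kappa> \<nu>. pr p (fst (snd (G \<nu>)) - jent \<phi> u (fst (G \<nu>))) $ \<kappa>) + L a (x, \<phi>, u) * det M"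
    unfolding split dmix_add dmix_matrix_mult H_alt u[symmetric] by (simp add: algebra_simps)
  finally show ?thesis .
qed

text \<open>The matrices of base components and of paired contact parts are both multiplied by the
  Jacobian, the latter also by the inverse determinant carried by the momenta.
  \<open>dmix_mult\<close> balances these factors, and \<open>L_coords\<close> handles the
  Lagrangian term.\<close>

lemma theta_change:
  assumes a: "a \<in> adapted_charts B" and a': "a' \<in> adapted_charts B" and y: "y \<in> OP a a'" and len: "length vs = CARD('n)"
  shows "theta a y vs = theta a' (TP a a' y) (map (DP a a' y) vs)"
proof -
  obtain G :: "'n \<Rightarrow> ('n, 'c, 'k) Pcoord" where vs: "vs = map G base_indices"
    using length_eq_map_base_indices[OF len] by blast
  obtain x \<phi> p where xy: "y = (x, \<phi>, p)" by (cases y)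
  obtain x' \<phi>' where T: "TQ a a' (x, \<phi>) = (x', \<phi>')" by fastforce
  have yQ: "(x, \<phi>) \<in> OQ a a'" using y OP_iff[OF a a'] xy by simp
  let ?p' = "mom_trans a a' (x, \<phi>) p" and ?u = "usol a (x, \<phi>, top_mom p)" and ?d = "d\<psi> a a' x"
  let ?u' = "topmap a a' (x, \<phi>) ?u"
  let ?M = "(\<chi> \<mu> \<nu>. fst (G \<nu>) $ \<mu>) :: ((real, 'n) vec, 'n) vec"
  define \<omega> where "\<omega> \<nu> = fst (snd (G \<nu>)) - jent \<phi> ?u (fst (G \<nu>))" for \<nu>
  let ?W = "(\<chi> \<kappa> \<nu>. pr p (\<omega> \<nu>) $ \<kappa>) :: ((real, 'n) vec, 'n) vec"
  have TPy: "TP a a' y = (x', \<phi>', ?p')" unfolding xy P_transition[OF a a' yQ] T by simp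
  have u': "?u' = usol a' (x', \<phi>', top_mom ?p')" using usol_change[OF a a' yQ, of p] by (simp add: T del: o_apply)
  have lind: "linear ?d" using d\<psi>_linear[OF a a' yQ] by simp
  have det0: "det (matrix ?d) \<noteq> 0" using det_d\<psi>[OF a a' yQ] by simp
  have mat: "?d e = matrix ?d *v e" for e using fun_cong[OF matrix_vector_mul(2)[OF lind], of e] by simp
  \<comment> \<open>The holonomic part of the vector is carried over by
    \<open>contact_coords\<close>, the contact part \<open>\<omega> \<nu>\<close> by the linear map
    \<open>DQ\<close>; that the Legendre solution is carried to itself by \<open>u'\<close> makes
    the two splittings correspond.\<close>
  have D: "fst (DP a a' y (G \<nu>)) = ?d (fst (G \<nu>))"
    "fst (snd (DP a a' y (G \<nu>))) = jent \<phi>' ?u' (?d (fst (G \<nu>))) + snd (DQ a a' (x, \<phi>) (0, \<omega> \<nu>))" for \<nu>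
  proof -
    have F: "(fst (DP a a' y (G \<nu>)), fst (snd (DP a a' y (G \<nu>)))) = DQ a a' (x, \<phi>) (fst (G \<nu>), fst (snd (G \<nu>)))"
      using DP_fields[OF a a' y, of "G \<nu>"] by (simp add: xy)
    have dec: "(fst (G \<nu>), fst (snd (G \<nu>))) = (fst (G \<nu>), jent \<phi> ?u (fst (G \<nu>))) + (0, \<omega> \<nu>)" by (simp add: \<omega>_def)
    have S: "DQ a a' (x, \<phi>) (fst (G \<nu>), fst (snd (G \<nu>))) =
        (?d (fst (G \<nu>)), jent \<phi>' ?u' (?d (fst (G \<nu>)))) + DQ a a' (x, \<phi>) (0, \<omega> \<nu>)"
      by (simp only: dec linear_add[OF DQ_linear[OF a a' yQ]] contact_coords[OF a a' yQ] T snd_conv)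
    have "fst (DQ a a' (x, \<phi>) (0, \<omega> \<nu>)) = 0" using fst_DQ[OF a a' yQ] linear_0[OF lind] by simp
    then show "fst (DP a a' y (G \<nu>)) = ?d (fst (G \<nu>))"
      "fst (snd (DP a a' y (G \<nu>))) = jent \<phi>' ?u' (?d (fst (G \<nu>))) + snd (DQ a a' (x, \<phi>) (0, \<omega> \<nu>))"
      using F S by (simp_all add: prod_eq_iff)
  qed
  have M': "(\<chi> \<mu> \<nu>. fst ((DP a a' y \<circ> G) \<nu>) $ \<mu>) = matrix ?d ** ?M"
    by (simp add: vec_eq_iff D mat matrix_matrix_mult_def matrix_vector_mult_def)
  have W': "(\<chi> \<kappa> \<nu>. pr ?p' (fst (snd ((DP a a' y \<circ> G) \<nu>)) - jent \<phi>' ?u' (fst ((DP a a' y \<circ> G) \<nu>))) $ \<kappa>) =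
      inverse (det (matrix ?d)) *\<^sub>R (matrix ?d ** ?W)"
    by (simp add: vec_eq_iff D pr_mom_trans_DQ[OF a a' yQ] mat matrix_matrix_mult_def matrix_vector_mult_def)
  have "theta a' (TP a a' y) (map (DP a a' y) vs) = theta a' (x', \<phi>', ?p') (map (DP a a' y \<circ> G) base_indices)"
    unfolding TPy vs by simp
  also have "\<dots> = dmix (matrix ?d ** ?M) (inverse (det (matrix ?d)) *\<^sub>R (matrix ?d ** ?W)) + L a' (x', \<phi>', ?u') * det (matrix ?d ** ?M)"
    unfolding theta_contact[OF u'] M' W' ..
  also have "\<dots> = dmix ?M ?W + L a (x, \<phi>, ?u) * det ?M"
    using det0 L_coords[OF a a' yQ, of ?u] unfolding dmix_scaleR dmix_mult det_mul T by simp
  also have "\<dots> = theta a y vs"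
    unfolding vs xy theta_contact[OF refl] \<omega>_def ..
  finally show ?thesis ..
qed

text \<open>One index set for all terms of \<theta>, with \<open>None\<close> for the Hamiltonian
  term, so that \<open>exterior_derivative_pull_back\<close> applies to a single finite sum.\<close>

definition form_indices :: "('n list \<times> 'n \<times> 'c) option set" where
  "form_indices = insert None (Some ` ({\<mu>s. length \<mu>s < CARD('k)} \<times> UNIV \<times> UNIV))"

definition coeff :: "('m, 'f, 'n, 'c) adapted \<Rightarrow> ('n list \<times> 'n \<times> 'c) option \<Rightarrow> ('n, 'c, 'k) Pcoord \<Rightarrow> real" where
  "coeff a j y = (case j of None \<Rightarrow> - H a y | Some (\<mu>s, \<kappa>, i) \<Rightarrow> dp \<mu>s \<kappa> i y)"

definition dcoeff :: "('m, 'f, 'n, 'c) adapted \<Rightarrow> ('n, 'c, 'k) Pcoord \<Rightarrow> ('n list \<times> 'n \<times> 'c) option \<Rightarrow> ('n, 'c, 'k) Pcoord \<Rightarrow> real" where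
  "dcoeff a y j v = (case j of None \<Rightarrow> - frechet_derivative (H a) (at y) v | Some (\<mu>s, \<kappa>, i) \<Rightarrow> dp \<mu>s \<kappa> i v)"

definition covs :: "('n list \<times> 'n \<times> 'c) option \<Rightarrow> (('n, 'c, 'k) Pcoord \<Rightarrow> real) list" where
  "covs j = (case j of None \<Rightarrow> map dx base_indices
     | Some (\<mu>s, \<kappa>, i) \<Rightarrow> map (\<lambda>\<nu>. if \<nu> = \<kappa> then dphi \<mu>s i else dx \<nu>) base_indices)"

lemma sum_form_indices:
  "(\<Sum>j\<in>form_indices. F j) = F None + (\<Sum>m<CARD('k). \<Sum>\<mu>s | length \<mu>s = m. \<Sum>\<kappa>\<in>UNIV. \<Sum>i\<in>UNIV. F (Some (\<mu>s, \<kappa>, i)))"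
proof -
  have "(\<Sum>j\<in>Some ` ({\<mu>s. length \<mu>s < CARD('k)} \<times> UNIV \<times> UNIV). F j) =
      (\<Sum>(\<mu>s, \<kappa>, i)\<in>{\<mu>s. length \<mu>s < CARD('k)} \<times> UNIV \<times> UNIV. F (Some (\<mu>s, \<kappa>, i)))"
    by (subst sum.reindex) (auto simp: split_beta)
  then show ?thesis unfolding form_indices_def nested_sum
    by (subst sum.insert) (auto simp: finite_lists_less)
qed

lemma theta_sum: "theta a y vs = (\<Sum>j\<in>form_indices. coeff a j y * wedge (covs j) vs)"
  unfolding sum_form_indices theta_def by (simp add: coeff_def covs_def dp_def split_beta cong: if_cong)

lemma Omega_sum: "Omega_coord B Lag a y vs = (\<Sum>j\<in>form_indices. wedge (dcoeff a y j # covs j) vs)"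
  unfolding sum_form_indices Omega_coord_def
  by (simp add: dcoeff_def[abs_def] covs_def wedge_uminus_first)

lemma length_covs: "length (covs j) = CARD('n)"
  by (auto simp: covs_def base_indices(3) split: option.split)

lemma covs_linear: "\<beta> \<in> set (covs j) \<Longrightarrow> linear \<beta>"
  by (auto simp: covs_def linear_dx linear_dphi split: option.splits if_splits)

lemma dcoeff_linear:
  assumes "a \<in> adapted_charts B" "y \<in> image_of (P a)"
  shows "linear (dcoeff a y j)"
proof (cases j)
  case None
  have "linear (\<lambda>v. - frechet_derivative (H a) (at y) v)"
    using linear_compose_neg[OF smooth_on_linear[OF H_smooth[OF assms(1)] assms(2)]] .
  then show ?thesis by (simp add: dcoeff_def[abs_def] None)
next
  case (Some t)
  then show ?thesis using linear_dp by (cases t) (simp add: dcoeff_def[abs_def])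
qed

lemma coeff_has_derivative:
  assumes "a \<in> adapted_charts B" "y \<in> image_of (P a)"
  shows "(coeff a j has_derivative dcoeff a y j) (at y)"
proof (cases j)
  case None
  show ?thesis unfolding None coeff_def[abs_def] dcoeff_def[abs_def] option.case
    by (intro has_derivative_minus smooth_on_has_derivative[OF H_smooth[OF assms(1)] assms(2)])
next
  case (Some t)
  then show ?thesis using linear_imp_has_derivative[OF linear_dp] by (cases t) (simp add: coeff_def[abs_def] dcoeff_def[abs_def])
qed

lemma Omega_change:
  assumes a: "a \<in> adapted_charts B" and a': "a' \<in> adapted_charts B" and y: "y \<in> OP a a'" and len: "length vs = Suc CARD('n)"
  shows "Omega_coord B Lag a y vs = Omega_coord B Lag a' (TP a a' y) (map (DP a a' y) vs)"
  unfolding Omega_sum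
proof (rule exterior_derivative_pull_back[OF P_transition_smooth[OF a a'] y, where n = "CARD('n)"])
  obtain X where X: "X \<in> dom_of (P a)" "X \<in> dom_of (P a')" "y = coords (P a) X" using y by auto
  show "(coeff a j has_derivative dcoeff a y j) (at y)" for j
    using X by (intro coeff_has_derivative[OF a]) (simp add: coords_in_image)
  show "(coeff a' j has_derivative dcoeff a' (TP a a' y) j) (at (TP a a' y))" for j
    using X by (intro coeff_has_derivative[OF a']) (simp add: coords_in_image uncoords_coords[OF Patlas_smooth P_in_atlas[OF a]])
  show "bounded_linear b" if "b \<in> set (covs j)" for j b
    using covs_linear[OF that] by (simp add: linear_conv_bounded_linear)
  show "(\<Sum>j\<in>form_indices. coeff a j z * wedge (covs j) ws) =
      (\<Sum>j\<in>form_indices. coeff a' j (TP a a' z) * wedge (covs j) (map (DP a a' z) ws))"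
    if "z \<in> OP a a'" "length ws = CARD('n)" for z ws
    using theta_change[OF a a' that] unfolding theta_sum .
qed (simp_all add: length_covs len)

lemma Omega_slot_linear:
  assumes a: "a \<in> adapted_charts B" and y: "y \<in> image_of (P a)" and vs: "length vs = Suc CARD('n)" "i < Suc CARD('n)"
  shows "Omega_coord B Lag a y (vs[i := r *\<^sub>R u + s *\<^sub>R v]) =
    r * Omega_coord B Lag a y (vs[i := u]) + s * Omega_coord B Lag a y (vs[i := v])"
proof -
  have "linear \<beta>" if "\<beta> \<in> set (dcoeff a y j # covs j)" for \<beta> j
    using that covs_linear dcoeff_linear[OF a y] by auto
  then have "wedge (dcoeff a y j # covs j) (vs[i := r *\<^sub>R u + s *\<^sub>R v]) =
      r * wedge (dcoeff a y j # covs j) (vs[i := u]) + s * wedge (dcoeff a y j # covs j) (vs[i := v])" for j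
    using vs by (intro wedge_linear_slot) (auto simp: length_covs)
  then show ?thesis unfolding Omega_sum by (simp add: sum.distrib sum_distrib_left)
qed

lemma Omega_equal_slots:
  fixes vs :: "('n, 'c, 'k) Pcoord list"
  assumes "i < Suc CARD('n)" "j < Suc CARD('n)" "i \<noteq> j" "vs ! i = vs ! j"
  shows "Omega_coord B Lag a y vs = 0"
  unfolding Omega_sum using assms by (intro sum.neutral ballI wedge_equal_vectors[of i _ j]) (auto simp: length_covs)

lemma Omega_smooth:
  assumes a: "a \<in> adapted_charts B"
  shows "smooth_on (image_of (P a)) (\<lambda>y. Omega_coord B Lag a y es)"
proof -
  note op = P_image_open[OF a]
  have "smooth_on (image_of (P a)) (\<lambda>y. dcoeff a y j e)" for j e
    by (cases j) (auto simp: dcoeff_def intro!: smooth_on_uminus smooth_on_frechet1[OF H_smooth[OF a]] smooth_on_const op split: prod.split)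
  then show ?thesis
    unfolding Omega_sum wedge_Cons_def
    by (intro smooth_on_sum smooth_on_mult smooth_on_const op)
qed

text \<open>By \<open>Omega_change\<close> the choice of chart is immaterial. The value 0 elsewhere
  follows the conventions of \<open>differential_form\<close>, which make the form unique as a
  function.\<close>

definition Om :: "('m, 'f, 'n, 'c, 'k) phase \<Rightarrow> (('m, 'f, 'n, 'c, 'k) phase, ('n, 'c, 'k) Pcoord) tangent list \<Rightarrow> real" where
  "Om X vs = (if X \<in> carrier_of PA \<and> length vs = Suc CARD('n) \<and> set vs \<subseteq> tangent_space PA X then
     let a = (SOME a. a \<in> adapted_charts B \<and> X \<in> dom_of (P a))
     in Omega_coord B Lag a (coords (P a) X) (map (\<lambda>v. v (P a)) vs) else 0)"

lemma Om_eq: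
  assumes a: "a \<in> adapted_charts B" and X: "X \<in> dom_of (P a)"
    and vs: "length vs = Suc CARD('n)" "set vs \<subseteq> tangent_space PA X"
  shows "Om X vs = Omega_coord B Lag a (coords (P a) X) (map (\<lambda>v. v (P a)) vs)"
proof -
  define a0 where "a0 = (SOME a. a \<in> adapted_charts B \<and> X \<in> dom_of (P a))"
  have a0: "a0 \<in> adapted_charts B" "X \<in> dom_of (P a0)"
    using someI[of "\<lambda>a. a \<in> adapted_charts B \<and> X \<in> dom_of (P a)" a] a X unfolding a0_def by auto
  have "X \<in> carrier_of PA" using X a by (auto simp: carrier_of_def Patlas_def)
  then have "Om X vs = Omega_coord B Lag a0 (coords (P a0) X) (map (\<lambda>v. v (P a0)) vs)"
    using vs by (simp add: Om_def a0_def[symmetric] Let_def)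
  also have "\<dots> = Omega_coord B Lag a (TP a0 a (coords (P a0) X)) (map (DP a0 a (coords (P a0) X)) (map (\<lambda>v. v (P a0)) vs))"
    using a0 X vs by (intro Omega_change[OF a0(1) a]) auto
  also have "TP a0 a (coords (P a0) X) = coords (P a) X"
    by (simp add: uncoords_coords[OF Patlas_smooth P_in_atlas[OF a0(1)] a0(2)])
  also have "map (DP a0 a (coords (P a0) X)) (map (\<lambda>v. v (P a0)) vs) = map (\<lambda>v. v (P a)) vs"
  proof -
    have "DP a0 a (coords (P a0) X) (v (P a0)) = v (P a)" if "v \<in> set vs" for v
      using tangentD[OF _ P_in_atlas[OF a0(1)] P_in_atlas[OF a] a0(2) X, of v] vs(2) that by auto
    then show ?thesis by simp
  qed
  finally show ?thesis .
qed

lemma Om_differential_form: "differential_form PA (Suc CARD('n)) Om"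
  unfolding differential_form_def
proof (intro conjI ballI allI impI)
  fix X assume X: "X \<in> carrier_of PA"
  then obtain a where a: "a \<in> adapted_charts B" "X \<in> dom_of (P a)" unfolding carrier_of_def Patlas_def by blast
  note im = coords_in_image[OF a(2)]
  have slot: "Om X (vs[i := w]) = Omega_coord B Lag a (coords (P a) X) ((map (\<lambda>v. v (P a)) vs)[i := w (P a)])"
    if "length vs = Suc CARD('n)" "set vs \<subseteq> tangent_space PA X" "w \<in> tangent_space PA X" for vs i w
  proof -
    have "set (vs[i := w]) \<subseteq> tangent_space PA X" using that(2,3) set_update_subset_insert[of vs i w] by blast
    then show ?thesis using Om_eq[OF a, of "vs[i := w]"] that(1) by (simp add: map_update)
  qed
  show "alternating_form PA X (Suc CARD('n)) (Om X)"
    unfolding alternating_form_def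
  proof (intro conjI allI impI ballI)
    fix vs i u v and r s :: real
    assume vs: "length vs = Suc CARD('n) \<and> set vs \<subseteq> tangent_space PA X" and i: "i < Suc CARD('n)"
      and u: "u \<in> tangent_space PA X" and v: "v \<in> tangent_space PA X"
    show "Om X (vs[i := \<lambda>c. r *\<^sub>R u c + s *\<^sub>R v c]) = r * Om X (vs[i := u]) + s * Om X (vs[i := v])"
      using vs i u v tangent_lincomb[OF Patlas_smooth u v] by (simp add: slot Omega_slot_linear[OF a(1) im])
  next
    fix vs i j
    assume vs: "length vs = Suc CARD('n) \<and> set vs \<subseteq> tangent_space PA X" and ij: "i < Suc CARD('n)" "j < Suc CARD('n)"
      "i \<noteq> j \<and> vs ! i = vs ! j"
    show "Om X vs = 0" using vs ij Om_eq[OF a, of vs] by (simp add: Omega_equal_slots[of i j])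
  next
    fix vs assume "\<not> (length vs = Suc CARD('n) \<and> set vs \<subseteq> tangent_space PA X)"
    then show "Om X vs = 0" unfolding Om_def by (intro if_not_P) blast
  qed
next
  fix X assume "X \<notin> carrier_of PA"
  then show "Om X = (\<lambda>_. 0)" by (simp add: Om_def fun_eq_iff)
next
  fix c and es :: "('n, 'c, 'k) Pcoord list" assume "c \<in> PA" and es: "length es = Suc CARD('n)"
  then obtain a where a: "a \<in> adapted_charts B" "c = P a" unfolding Patlas_def by blast
  show "smooth_on (image_of c) (\<lambda>y. Om (uncoords c y) (map (coord_vector PA (uncoords c y) c) es))"
    unfolding a(2)
  proof (rule smooth_on_cong[OF Omega_smooth[OF a(1), of es]])
    fix y assume y: "y \<in> image_of (P a)"
    let ?X = "uncoords (P a) y"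
    note X = uncoords_in_dom[OF y]
    have "set (map (coord_vector PA ?X (P a)) es) \<subseteq> tangent_space PA ?X"
      using coord_vector_tangent[OF Patlas_smooth P_in_atlas[OF a(1)] X] by auto
    from Om_eq[OF a(1) X _ this] es
    have "Om ?X (map (coord_vector PA ?X (P a)) es) =
       Omega_coord B Lag a y (map (\<lambda>e. coord_vector PA ?X (P a) e (P a)) es)"
      by (simp add: coords_uncoords[OF y] o_def)
    then show "Omega_coord B Lag a y es = Om ?X (map (coord_vector PA ?X (P a)) es)"
      by (simp add: coord_vector_same[OF Patlas_smooth P_in_atlas[OF a(1)] X])
  qed
qed

lemma Om_represented: "represented_by_Omega B Lag Om"
  unfolding represented_by_Omega_def using Om_eq by blast

lemma Omega_form_unique:
  assumes "differential_form PA (Suc CARD('n)) \<Omega>" "represented_by_Omega B Lag \<Omega>"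
  shows "\<Omega> = Om"
proof (intro ext)
  fix X vs
  show "\<Omega> X vs = Om X vs"
  proof (cases "X \<in> carrier_of PA \<and> length vs = Suc CARD('n) \<and> set vs \<subseteq> tangent_space PA X")
    case True
    then obtain a where a: "a \<in> adapted_charts B" "X \<in> dom_of (P a)" unfolding carrier_of_def Patlas_def by blast
    have "\<Omega> X vs = Omega_coord B Lag a (coords (P a) X) (map (\<lambda>v. v (P a)) vs)"
      using assms(2) a True unfolding represented_by_Omega_def by blast
    then show ?thesis using Om_eq[OF a] True by simp
  next
    case False
    have "\<Omega> X vs = 0"
    proof (cases "X \<in> carrier_of PA")
      case True
      then have "alternating_form PA X (Suc CARD('n)) (\<Omega> X)" using assms(1) unfolding differential_form_def by blast
      then show ?thesis using False True unfolding alternating_form_def by blast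
    next
      case False
      then have "\<Omega> X = (\<lambda>_. 0)" using assms(1) unfolding differential_form_def by blast
      then show ?thesis by simp
    qed
    then show ?thesis unfolding Om_def if_not_P[OF False] .
  qed
qed

end

section \<open>Vector fields with prescribed value at a point\<close>

context jet_bundle begin

lemma P_value_coords:
  assumes a: "a \<in> adapted_charts B" and X: "X \<in> dom_of (P a)"
  shows "jet_value (fst X) \<in> dom_of (snd a)"
    "coords (snd a) (jet_value (fst X)) = (fst (coords (P a) X), fst (snd (coords (P a) X)) $ low [])"
    "fst (fst X) \<in> dom_of (fst a)" "fst (coords (P a) X) = coords (fst a) (fst (fst X))"
    "fst X \<in> dom_of (Q a)" "coords (Q a) (fst X) = (fst (coords (P a) X), fst (snd (coords (P a) X)))"
proof -
  obtain q p where q: "q \<in> dom_of (Q a)" "X = (q, momentum B a q p)" by (rule P_domE[OF a X])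
  obtain f where f: "local_section B (fst q) f" "f (fst q) \<in> dom_of (snd a)" "q = jet B (CARD('k) - 1) f (fst q)"
    by (rule Q_domE[OF q(1)])
  have v: "jet_value q = f (fst q)" using jet_value_jet[OF f(1)] f(3) by metis
  have c: "coords (P a) X = (fst (coords (Q a) q), snd (coords (Q a) q), p)" unfolding q(2) by (rule P_mem(2)[OF a q(1)])
  have cq: "coords (Q a) q = (coords (fst a) (fst q), jlow a f (coords (fst a) (fst q)))"
    using Q_jet(2)[OF a f(1,2)] f(3) by metis
  have fX: "fst X = q" by (simp add: q(2))
  show "jet_value (fst X) \<in> dom_of (snd a)" unfolding fX v by (rule f(2))
  show "coords (snd a) (jet_value (fst X)) = (fst (coords (P a) X), fst (snd (coords (P a) X)) $ low [])"
    unfolding fX v c cq using section_coords_image[OF a f(1,2)] by simp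
  show "fst (fst X) \<in> dom_of (fst a)" unfolding fX by (rule Q_dom_base(1)[OF a q(1)])
  show "fst (coords (P a) X) = coords (fst a) (fst (fst X))" unfolding fX c by (simp add: Q_dom_base(2)[OF a q(1)])
  show "fst X \<in> dom_of (Q a)" unfolding fX by (rule q(1))
  show "coords (Q a) (fst X) = (fst (coords (P a) X), fst (snd (coords (P a) X)))" unfolding fX c by simp
qed

lemma P_domI: "X \<in> carrier_of PA \<Longrightarrow> jet_value (fst X) \<in> dom_of (snd a) \<Longrightarrow> X \<in> dom_of (P a)"
  by (auto simp: carrier_of_def Patlas_def Pchart_def)

text \<open>The constant field \<open>e\<close> in chart \<open>a\<close> is multiplied by a bump
  function of the base coordinates and the field value only, pulled back from the total space. Its
  support need not be compact in the phase bundle, but the extension by zero is smooth because the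
  corresponding compact set is closed in the Hausdorff total space.\<close>

lemma vector_field_through:
  assumes a: "a \<in> adapted_charts B" and X0: "X0 \<in> dom_of (P a)"
  shows "\<exists>X. smooth_vector_field PA X \<and> X X0 (P a) = e"
proof -
  let ?t = "snd a"
  note t = adapted_total[OF a]
  let ?val = "\<lambda>y :: ('n, 'c, 'k) Pcoord. (fst y, fst (snd y) $ (low [] :: ('n, 'k) lower_index))"
  have smval: "smooth_on S (\<lambda>x. ?val (g x))" if "smooth_on S g" for S and g :: "'z::euclidean_space \<Rightarrow> ('n, 'c, 'k) Pcoord"
    by (intro smooth_on_Pair smooth_on_fst smooth_on_snd smooth_on_nth that)
  have "open (image_of ?t)" using total_atlas t by (simp add: smooth_atlas_def)
  moreover have "?val (coords (P a) X0) \<in> image_of ?t"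
    using P_value_coords(1,2)[OF a X0] coords_in_image by metis
  ultimately obtain r where r: "r > 0" "cball (?val (coords (P a) X0)) r \<subseteq> image_of ?t"
    using open_contains_cball by blast
  define C where "C = cball (?val (coords (P a) X0)) r"
  obtain \<beta> where \<beta>: "smooth_on UNIV \<beta>" "\<beta> (?val (coords (P a) X0)) = (1 :: real)" "\<And>z. z \<notin> C \<Longrightarrow> \<beta> z = 0"
    using bump_function[OF r(1), of "?val (coords (P a) X0)"] unfolding C_def by blast
  define bf where "bf X = (if X \<in> dom_of (P a) then \<beta> (?val (coords (P a) X)) else 0)" for X
  define W where "W X = (\<lambda>d. bf X *\<^sub>R coord_vector PA X (P a) e d)" for X
  have "smooth_vector_field PA W"
    unfolding smooth_vector_field_def
  proof (intro conjI ballI)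
    fix X assume X: "X \<in> carrier_of PA"
    show "W X \<in> tangent_space PA X"
    proof (cases "X \<in> dom_of (P a)")
      case True
      note tan = coord_vector_tangent[OF Patlas_smooth P_in_atlas[OF a] True, of e]
      from tangent_lincomb[OF Patlas_smooth tan tan, of "bf X" 0] show ?thesis by (simp add: W_def)
    next
      case False
      then have "W X = (\<lambda>_. 0)" by (simp add: W_def bf_def)
      moreover have "(\<lambda>_. 0) \<in> tangent_space PA X"
        by (rule tangentI) (simp_all add: linear_0[OF transition_linear[OF Patlas_smooth]])
      ultimately show ?thesis by simp
    qed
  next
    fix c assume "c \<in> PA"
    then obtain a' where a': "a' \<in> adapted_charts B" "c = P a'" unfolding Patlas_def by blast
    note t' = adapted_total[OF a'(1)]
    show "smooth_on (image_of c) (\<lambda>y. W (uncoords c y) c)"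
      unfolding a'(2)
    proof (rule smooth_on_local)
      fix y assume y: "y \<in> image_of (P a')"
      let ?X = "uncoords (P a') y"
      note X = uncoords_in_dom[OF y]
      show "\<exists>U. y \<in> U \<and> U \<subseteq> image_of (P a') \<and> smooth_on U (\<lambda>y. W (uncoords (P a') y) (P a'))"
      proof (cases "?X \<in> dom_of (P a)")
        case True
        have yO: "y \<in> OP a' a" using X True coords_uncoords[OF y] by (metis IntI image_eqI)
        have "TP a' a ` OP a' a \<subseteq> OP a a'"
          using uncoords_coords[OF Patlas_smooth P_in_atlas[OF a'(1)]] by auto
        note D = smooth_on_compose[OF smooth_on_frechet1[OF P_transition_smooth[OF a a'(1)]] P_transition_smooth[OF a'(1) a] this, of e]
        have "smooth_on (OP a' a) (\<lambda>y. \<beta> (?val (TP a' a y)) *\<^sub>R DP a a' (TP a' a y) e)"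
          by (rule smooth_on_scaleR[OF smooth_on_compose[OF \<beta>(1) smval[OF P_transition_smooth[OF a'(1) a]]] D]) simp
        then have "smooth_on (OP a' a) (\<lambda>y. W (uncoords (P a') y) (P a'))"
        proof (rule smooth_on_cong)
          fix y assume "y \<in> OP a' a"
          then have yX: "y \<in> image_of (P a')" "uncoords (P a') y \<in> dom_of (P a)"
            using coords_image_iff[OF Patlas_smooth P_in_atlas[OF a'(1)]] by simp_all
          with uncoords_in_dom[OF yX(1)]
          show "\<beta> (?val (TP a' a y)) *\<^sub>R DP a a' (TP a' a y) e = W (uncoords (P a') y) (P a')"
            by (simp add: W_def bf_def coord_vector_def P_in_atlas[OF a'(1)])
        qed
        moreover have "OP a' a \<subseteq> image_of (P a')" unfolding image_of_def by (rule image_mono) (rule Int_lower1)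
        ultimately show ?thesis by (intro exI[of _ "OP a' a"] conjI yO)
      next
        case False
        \<comment> \<open>At a point outside the chart \<open>a\<close> the field vanishes on a
          neighbourhood: the jet value avoids the image of \<open>C\<close>, and this remains so
          nearby.\<close>
        let ?V = "coords (snd a') ` (dom_of (snd a') \<inter> - uncoords ?t ` C)"
        let ?U = "{y \<in> image_of (P a'). ?val y \<in> ?V}"
        have C: "compact C" "C \<subseteq> image_of ?t" using r(2) by (simp_all add: C_def)
        have opV: "open ?V" by (rule open_uncoords_notin_compact[OF total_atlas total_Hausdorff t t' C])
        have opU: "open ?U"
          by (rule smooth_on_open_vimage[OF smval[OF smooth_on_ident[OF P_image_open[OF a'(1)]]] opV])
        have val: "?val y' = coords (snd a') (jet_value (fst (uncoords (P a') y')))" "jet_value (fst (uncoords (P a') y')) \<in> dom_of (snd a')"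
          if "y' \<in> image_of (P a')" for y'
          using P_value_coords(1,2)[OF a'(1) uncoords_in_dom[OF that]] coords_uncoords[OF that] by simp_all
        have "jet_value (fst ?X) \<notin> dom_of ?t"
        proof
          assume *: "jet_value (fst ?X) \<in> dom_of ?t"
          have "?X \<in> carrier_of PA" unfolding carrier_of_def by (rule UN_I[where B = dom_of, OF P_in_atlas[OF a'(1)] X])
          from P_domI[OF this *] False show False by simp
        qed
        moreover have "uncoords ?t ` C \<subseteq> dom_of ?t" using C(2) uncoords_in_dom[of _ ?t] by (auto dest: subsetD)
        ultimately have "jet_value (fst ?X) \<notin> uncoords ?t ` C" by (rule contra_subsetD[rotated])
        then have yU: "y \<in> ?U" using val[OF y] y by simp
        have "smooth_on ?U (\<lambda>y. 0 :: ('n, 'c, 'k) Pcoord)" by (rule smooth_on_const[OF opU])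
        then have "smooth_on ?U (\<lambda>y. W (uncoords (P a') y) (P a'))"
        proof (rule smooth_on_cong)
          fix y' assume y': "y' \<in> ?U"
          let ?Y = "uncoords (P a') y'"
          have im: "y' \<in> image_of (P a')" using y' by simp
          have nin: "jet_value (fst ?Y) \<notin> uncoords ?t ` C"
          proof -
            obtain z where z: "z \<in> dom_of (snd a')" "z \<notin> uncoords ?t ` C" "?val y' = coords (snd a') z" using y' by auto
            have "z = jet_value (fst ?Y)"
              using inj_onD[OF smooth_atlas_inj[OF total_atlas t'] _ z(1) val(2)[OF im]] z(3) val(1)[OF im] by simp
            then show ?thesis using z(2) by simp
          qed
          have "bf ?Y = 0"
          proof (cases "?Y \<in> dom_of (P a)")
            case True
            note pv = P_value_coords(1,2)[OF a True]
            have "coords ?t (jet_value (fst ?Y)) \<notin> C"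
              using nin imageI[of "coords ?t (jet_value (fst ?Y))" C "uncoords ?t"] total_uncoords_coords[OF t pv(1)] by auto
            then show ?thesis using \<beta>(3) pv(2) True by (simp add: bf_def)
          qed (simp add: bf_def)
          then show "0 = W ?Y (P a')" by (simp add: W_def)
        qed
        then show ?thesis by (intro exI[of _ ?U] conjI yU) (rule Collect_subset)
      qed
    qed
  qed
  moreover have "W X0 (P a) = e"
    using X0 \<beta>(2) by (simp add: W_def bf_def coord_vector_same[OF Patlas_smooth P_in_atlas[OF a]])
  ultimately show ?thesis by blast
qed

end

section \<open>The field equations\<close>

lemma d_low_perm: "mset \<mu>s = mset \<nu>s \<Longrightarrow> d_low h y \<mu>s = d_low h y \<nu>s"
  by (simp add: d_low_def low_def arrangements_def)

lemma d_top_perm: "mset \<mu>s = mset \<nu>s \<Longrightarrow> d_top h y \<mu>s = d_top h y \<nu>s"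
  by (simp add: d_top_def top_of_def arrangements_def)

lemma pairT_commute: "pairT u w = pairT w u"
  by (simp add: pairT_def inner_commute)

text \<open>A momentum of order m pairs with a jet entry of order m + 1, so the sum shifts by one:
  the entries of order k are 0 here, and no momentum pairs with order 0, which gives the exception
  for the empty list.\<close>

lemma sum_sym_mom_low:
  fixes p :: "('n::{finite,linorder}, 'c::finite, 'k::finite) momenta"
  shows "(\<Sum>\<kappa>\<in>UNIV. pr p (jent w 0 (axis \<kappa> 1)) $ \<kappa>) =
    (\<Sum>m<CARD('k). \<Sum>\<mu>s | length \<mu>s = m. (if \<mu>s = [] then 0 else sym_mom p \<mu>s) \<bullet> w $ low \<mu>s)"
proof -
  obtain l where l: "CARD('k) = Suc l" using zero_less_card_finite[where 'a = 'k] gr0_conv_Suc by blast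
  let ?w = "jet_entry w (0 :: ('n, 'c, 'k) tops)"
  let ?s = "\<lambda>\<mu>s. (if \<mu>s = [] then 0 else sym_mom p \<mu>s) \<bullet> w $ low \<mu>s"
  have step: "(\<Sum>\<mu>s | length \<mu>s = m. \<Sum>\<kappa>\<in>UNIV. \<Sum>i\<in>UNIV. p $ low \<mu>s $ \<kappa> $ i * ?w (\<mu>s @ [\<kappa>]) $ i) =
      (\<Sum>\<mu>s | length \<mu>s = Suc m. sym_mom p \<mu>s \<bullet> ?w \<mu>s)" for m
    using sum_sym_mom[of ?w p m, OF jet_entry_eqI] by (simp add: inner_vec_def)
  have top: "(\<Sum>\<mu>s | length \<mu>s = Suc l. sym_mom p \<mu>s \<bullet> ?w \<mu>s) = 0"
    by (intro sum.neutral ballI) (simp add: jet_entry_def l)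
  have low: "(\<Sum>\<mu>s | length \<mu>s = Suc m. sym_mom p \<mu>s \<bullet> ?w \<mu>s) = (\<Sum>\<mu>s | length \<mu>s = Suc m. ?s \<mu>s)" if "m < l" for m
    by (intro sum.cong refl) (use that in \<open>auto simp: jet_entry_def l\<close>)
  have "(\<Sum>\<kappa>\<in>UNIV. pr p (jent w 0 (axis \<kappa> 1)) $ \<kappa>) = (\<Sum>m<Suc l. \<Sum>\<mu>s | length \<mu>s = Suc m. sym_mom p \<mu>s \<bullet> ?w \<mu>s)"
    unfolding sum_entries[symmetric] step l ..
  also have "\<dots> = (\<Sum>m<l. \<Sum>\<mu>s | length \<mu>s = Suc m. ?s \<mu>s)"
    by (simp add: top low)
  also have "\<dots> = (\<Sum>m<Suc l. \<Sum>\<mu>s | length \<mu>s = m. ?s \<mu>s)"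
    by (subst sum.lessThan_Suc_shift) simp
  finally show ?thesis unfolding l .
qed

section \<open>The differential of H in vertical directions and the coefficient equations of
  \<Omega>\<close>

context lagrangian_bundle begin

abbreviation "h a \<equiv> (legendre_h B Lag a :: ('n, 'c, 'k) Jcoord \<Rightarrow> real)"

lemma h_alt: "h a (x, \<phi>, p) = pairT p (usol a (x, \<phi>, p)) - L a (x, \<phi>, usol a (x, \<phi>, p))"
  by (simp add: legendre_h_def Let_def pairT_def inner_vec_def)

lemma H_h: "H a (x, \<phi>, p) = (\<Sum>\<kappa>\<in>UNIV. pr p (jent \<phi> 0 (axis \<kappa> 1)) $ \<kappa>) + h a (x, \<phi>, top_mom p)"
  unfolding H_alt h_alt pairT_top_mom jent_top[of \<phi> "usol a (x, \<phi>, top_mom p)"]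
  by (simp add: pr_add_right sum.distrib)

lemma h_smooth:
  assumes a: "a \<in> adapted_charts B"
  shows "smooth_on (LD a) (h a)"
proof -
  note u = usol_smooth[OF a]
  note op = smooth_onD_open[OF u]
  have id: "smooth_on (LD a) (\<lambda>y. fst y)" "smooth_on (LD a) (\<lambda>y. fst (snd y))" "smooth_on (LD a) (\<lambda>y. snd (snd y))"
    by (intro smooth_on_fst smooth_on_snd smooth_on_ident op)+
  have l: "smooth_on (LD a) (\<lambda>y. L a (fst y, fst (snd y), usol a y))"
  proof (rule smooth_on_compose[OF L_smooth[OF a] smooth_on_Pair[OF id(1) smooth_on_Pair[OF id(2) u]]], rule image_subsetI)
    fix y assume "y \<in> LD a"
    then have "(fst y, fst (snd y)) \<in> image_of (Q a)" by auto
    from J_image_Q[OF a this] show "(fst y, fst (snd y), usol a y) \<in> image_of (J a)" .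
  qed
  have "smooth_on (LD a) (\<lambda>y. pairT (snd (snd y)) (usol a y) - L a (fst y, fst (snd y), usol a y))"
    unfolding pairT_def by (intro smooth_on_diff smooth_on_sum smooth_on_inner smooth_on_nth id u l op)
  then show ?thesis
  proof (rule smooth_on_cong)
    fix y :: "('n, 'c, 'k) Jcoord"
    show "pairT (snd (snd y)) (usol a y) - L a (fst y, fst (snd y), usol a y) = h a y"
      using h_alt[of a "fst y" "fst (snd y)" "snd (snd y)"] by simp
  qed
qed

text \<open>The values that the first field equation prescribes for the top-order derivatives,
  collected as top coordinates.\<close>

definition uh :: "('m, 'f, 'n, 'c) adapted \<Rightarrow> ('n, 'c, 'k) Jcoord \<Rightarrow> ('n, 'c, 'k) tops" where
  "uh a y = (\<chi> I. d_top (h a) y (top_list I))"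

lemma uh_top_of: "length \<mu>s = CARD('k) \<Longrightarrow> uh a y $ top_of \<mu>s = d_top (h a) y \<mu>s"
  unfolding uh_def vec_lambda_beta by (rule d_top_perm) (simp add: Rep_top_of)

text \<open>By \<open>H_h\<close> the momenta enter \<open>H\<close> bilinearly with the lower jet
  coordinates, and through \<open>top_mom\<close> in \<open>h\<close>. The derivative of the latter
  part has the same trace form with \<open>uh\<close> as top entries, so both combine into one
  \<open>jent\<close>.\<close>

lemma DH_vertical:
  assumes a: "a \<in> adapted_charts B" and y: "(x, \<phi>, p) \<in> image_of (P a)"
  shows "frechet_derivative (H a) (at (x, \<phi>, p)) (0, w, q) =
    (\<Sum>\<kappa>\<in>UNIV. pr q (jent \<phi> (uh a (x, \<phi>, top_mom p)) (axis \<kappa> 1)) $ \<kappa>) +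
    (\<Sum>\<kappa>\<in>UNIV. pr p (jent w 0 (axis \<kappa> 1)) $ \<kappa>) +
    frechet_derivative (h a) (at (x, \<phi>, top_mom p)) (0, w, 0)"
proof -
  let ?y = "(x, \<phi>, p)" and ?z = "(x, \<phi>, top_mom p)"
  have z: "?z \<in> LD a" using y P_image_iff[OF a] by simp
  define Dh where "Dh = frechet_derivative (h a) (at ?z)"
  have Dh: "(h a has_derivative Dh) (at ?z)" unfolding Dh_def by (rule smooth_on_has_derivative[OF h_smooth[OF a] z])
  have linh: "linear Dh" using Dh by (rule has_derivative_linear)
  let ?c = "\<lambda>y :: ('n, 'c, 'k) Pcoord. \<Sum>\<kappa>\<in>UNIV. pr (snd (snd y)) (jent (fst (snd y)) 0 (axis \<kappa> 1)) $ \<kappa>"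
  have dj: "((\<lambda>y :: ('n, 'c, 'k) Pcoord. jent (fst (snd y)) (0 :: ('n, 'c, 'k) tops) e) has_derivative (\<lambda>v. jent (fst (snd v)) 0 e)) (at ?y)" for e
  proof -
    have "linear (\<lambda>y :: ('n, 'c, 'k) Pcoord. jent (fst (snd y)) (0 :: ('n, 'c, 'k) tops) e)"
      using jent_add[of _ _ 0 0 e] jent_scaleR[of _ _ 0 e] by (auto intro!: linearI)
    then show ?thesis by (rule linear_imp_has_derivative)
  qed
  have dc: "(?c has_derivative (\<lambda>v. \<Sum>\<kappa>\<in>UNIV. (pr p (jent (fst (snd v)) 0 (axis \<kappa> 1)) + pr (snd (snd v)) (jent \<phi> 0 (axis \<kappa> 1))) $ \<kappa>)) (at ?y)"
  proof (intro has_derivative_sum bounded_linear.has_derivative[OF bounded_linear_vec_nth])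
    fix \<kappa> :: 'n
    have "((\<lambda>y :: ('n, 'c, 'k) Pcoord. snd (snd y)) has_derivative (\<lambda>v. snd (snd v))) (at ?y)"
      by (intro has_derivative_snd has_derivative_ident)
    from bounded_bilinear.FDERIV[OF bilinear_pr this dj]
    show "((\<lambda>y. pr (snd (snd y)) (jent (fst (snd y)) 0 (axis \<kappa> 1))) has_derivative
      (\<lambda>v. pr p (jent (fst (snd v)) 0 (axis \<kappa> 1)) + pr (snd (snd v)) (jent \<phi> 0 (axis \<kappa> 1)))) (at ?y)" by simp
  qed
  have dm: "((\<lambda>y :: ('n, 'c, 'k) Pcoord. (fst y, fst (snd y), top_mom (snd (snd y)))) has_derivative
      (\<lambda>v. (fst v, fst (snd v), top_mom (snd (snd v))))) (at ?y)"
    by (intro has_derivative_Pair has_derivative_fst has_derivative_snd has_derivative_ident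
        has_derivative_compose[OF _ linear_imp_has_derivative[OF top_mom_linear]])
  have dh: "((\<lambda>y. h a (fst y, fst (snd y), top_mom (snd (snd y)))) has_derivative
      (\<lambda>v. Dh (fst v, fst (snd v), top_mom (snd (snd v))))) (at ?y)"
    by (rule has_derivative_compose[OF dm]) (simp add: Dh)
  have "H a = (\<lambda>y. ?c y + h a (fst y, fst (snd y), top_mom (snd (snd y))))"
    using H_h by (simp add: fun_eq_iff)
  with has_derivative_add[OF dc dh]
  have "(H a has_derivative (\<lambda>v. (\<Sum>\<kappa>\<in>UNIV. (pr p (jent (fst (snd v)) 0 (axis \<kappa> 1)) + pr (snd (snd v)) (jent \<phi> 0 (axis \<kappa> 1))) $ \<kappa>)
      + Dh (fst v, fst (snd v), top_mom (snd (snd v))))) (at ?y)" by simp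
  from fun_cong[OF frechet_derivative_eqI[OF this], of "(0, w, q)"]
  have 1: "frechet_derivative (H a) (at ?y) (0, w, q) =
      (\<Sum>\<kappa>\<in>UNIV. pr p (jent w 0 (axis \<kappa> 1)) $ \<kappa>) + (\<Sum>\<kappa>\<in>UNIV. pr q (jent \<phi> 0 (axis \<kappa> 1)) $ \<kappa>) + Dh (0, w, top_mom q)"
    by (simp add: sum.distrib)
  have "linear (\<lambda>u. Dh (0, 0, u))"
    using linear_compose[of "\<lambda>u. (0, 0, u)", OF _ linh] by (simp add: o_def linear_iff)
  from linear_eq_pairT[OF this, of "uh a ?z"]
  have "Dh (0, 0, u) = pairT (uh a ?z) u" for u
    using uh_top_of[of _ a ?z] unfolding d_top_def Dh_def by blast
  then have 2: "Dh (0, 0, top_mom q) = (\<Sum>\<kappa>\<in>UNIV. pr q (jent 0 (uh a ?z) (axis \<kappa> 1)) $ \<kappa>)"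
    by (simp add: pairT_commute[of "uh a ?z"] pairT_top_mom)
  have 3: "Dh (0, w, top_mom q) = Dh (0, w, 0) + Dh (0, 0, top_mom q)"
    using linear_add[OF linh, of "(0, w, 0)" "(0, 0, top_mom q)"] by simp
  show ?thesis
    unfolding 1 3 2 Dh_def[symmetric] by (subst jent_top[of \<phi> "uh a ?z"]) (simp add: pr_add_right sum.distrib)
qed

text \<open>The difference of the two sides of the momentum field equation with index list
  \<open>\<mu>s\<close>, where \<open>D \<kappa>\<close> stands for the derivative of the momenta
  along the \<kappa>-th axis. At order 0 there is no momentum term.\<close>

definition residual :: "('m, 'f, 'n, 'c) adapted \<Rightarrow> ('n, 'c, 'k) Pcoord \<Rightarrow> ('n \<Rightarrow> ('n, 'c, 'k) momenta) \<Rightarrow> 'n list \<Rightarrow> (real, 'c) vec" where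
  "residual a y D \<mu>s = (\<Sum>\<kappa>\<in>UNIV. D \<kappa> $ low \<mu>s $ \<kappa>) + (if \<mu>s = [] then 0 else sym_mom (snd (snd y)) \<mu>s)
     + d_low (h a) (fst y, fst (snd y), top_mom (snd (snd y))) \<mu>s"

lemma residual_perm:
  assumes m: "mset \<mu>s = mset \<nu>s"
  shows "residual a y D \<mu>s = residual a y D \<nu>s"
proof -
  have "(low \<mu>s :: ('n, 'k) lower_index) = low \<nu>s" by (rule low_eqI[OF m])
  moreover have "sym_mom (snd (snd y)) \<mu>s = sym_mom (snd (snd y)) \<nu>s" by (rule sym_mom_perm[OF m])
  moreover have "d_low (h a) z \<mu>s = d_low (h a) z \<nu>s" for z by (rule d_low_perm[OF m])
  moreover have "\<mu>s = [] \<longleftrightarrow> \<nu>s = []" using m by (metis mset_zero_iff)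
  ultimately show ?thesis unfolding residual_def by simp
qed

lemma residual_sum:
  assumes a: "a \<in> adapted_charts B" and y: "(x, \<phi>, p) \<in> image_of (P a)"
  shows "(\<Sum>m<CARD('k). \<Sum>\<mu>s | length \<mu>s = m. \<Sum>\<kappa>\<in>UNIV. \<Sum>i\<in>UNIV. D \<kappa> $ low \<mu>s $ \<kappa> $ i * w $ low \<mu>s $ i) +
    (\<Sum>\<kappa>\<in>UNIV. pr p (jent w 0 (axis \<kappa> 1)) $ \<kappa>) + frechet_derivative (h a) (at (x, \<phi>, top_mom p)) (0, w, 0)
    = (\<Sum>I\<in>UNIV. wt I * (residual a (x, \<phi>, p) D (low_list I) \<bullet> w $ I))"
proof -
  let ?z = "(x, \<phi>, top_mom p)"
  define Dh where "Dh = frechet_derivative (h a) (at ?z)"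
  have linh: "linear Dh"
    unfolding Dh_def using y P_image_iff[OF a] by (intro smooth_on_linear[OF h_smooth[OF a]]) simp
  have "linear (\<lambda>w :: ('n, 'c, 'k) fields. (0 :: (real, 'n) vec, w, 0 :: ('n, 'c, 'k) tops))" by (auto intro!: linearI)
  from linear_compose[OF this linh] have lin: "linear (\<lambda>w. Dh (0, w, 0))" by (simp add: o_def)
  have "Dh (0, w, 0) = (\<Sum>I\<in>UNIV. \<Sum>i\<in>UNIV. w $ I $ i * Dh (0, axis I (axis i 1), 0))"
  proof -
    have "Dh (0, (\<Sum>I\<in>UNIV. \<Sum>i\<in>UNIV. w $ I $ i *\<^sub>R axis I (axis i 1)), 0) = (\<Sum>I\<in>UNIV. \<Sum>i\<in>UNIV. w $ I $ i * Dh (0, axis I (axis i 1), 0))"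
      by (simp add: linear_sum[OF lin] linear_scale[OF lin])
    then show ?thesis using fields_expand[of w] by simp
  qed
  also have "\<dots> = (\<Sum>I\<in>UNIV. wt I * (d_low (h a) ?z (low_list I) \<bullet> w $ I))"
  proof (intro sum.cong refl)
    fix I :: "('n, 'k) lower_index"
    have "real (arrangements (low_list I)) \<noteq> 0" using wt_nonzero[of I] by (simp add: wt_def)
    then show "(\<Sum>i\<in>UNIV. w $ I $ i * Dh (0, axis I (axis i 1), 0)) = wt I * (d_low (h a) ?z (low_list I) \<bullet> w $ I)"
      by (simp add: d_low_def inner_vec_def sum_distrib_left Dh_def wt_def mult.commute)
  qed
  finally have 1: "Dh (0, w, 0) = (\<Sum>I\<in>UNIV. wt I * (d_low (h a) ?z (low_list I) \<bullet> w $ I))" .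
  have 2: "(\<Sum>m<CARD('k). \<Sum>\<mu>s | length \<mu>s = m. \<Sum>\<kappa>\<in>UNIV. \<Sum>i\<in>UNIV. D \<kappa> $ low \<mu>s $ \<kappa> $ i * w $ low \<mu>s $ i)
     = (\<Sum>I\<in>UNIV. wt I * ((\<Sum>\<kappa>\<in>UNIV. D \<kappa> $ I $ \<kappa>) \<bullet> w $ I))"
  proof -
    have "(\<Sum>\<kappa>\<in>UNIV. \<Sum>i\<in>UNIV. D \<kappa> $ I $ \<kappa> $ i * w $ I $ i) = (\<Sum>\<kappa>\<in>UNIV. D \<kappa> $ I $ \<kappa>) \<bullet> w $ I" for I
      unfolding inner_sum_left by (simp add: inner_vec_def)
    then show ?thesis using sum_lists_low[of "\<lambda>I. \<Sum>\<kappa>\<in>UNIV. \<Sum>i\<in>UNIV. D \<kappa> $ I $ \<kappa> $ i * w $ I $ i"] by simp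
  qed
  have 3: "(\<Sum>\<kappa>\<in>UNIV. pr p (jent w 0 (axis \<kappa> 1)) $ \<kappa>) =
      (\<Sum>I\<in>UNIV. wt I * ((if low_list I = [] then 0 else sym_mom p (low_list I)) \<bullet> w $ I))"
  proof -
    let ?s = "\<lambda>\<mu>s. if \<mu>s = [] then 0 else sym_mom p \<mu>s"
    have "?s (low_list (low \<mu>s :: ('n, 'k) lower_index)) = ?s \<mu>s" if "length \<mu>s < CARD('k)" for \<mu>s
    proof -
      have m: "mset (low_list (low \<mu>s :: ('n, 'k) lower_index)) = mset \<mu>s" by (simp add: Rep_low[OF that])
      then have "low_list (low \<mu>s :: ('n, 'k) lower_index) = [] \<longleftrightarrow> \<mu>s = []" by (metis mset_zero_iff)
      then show ?thesis using sym_mom_perm[OF m, of p] by simp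
    qed
    then show ?thesis
      unfolding sum_sym_mom_low sum_lists_low[symmetric] by (intro sum.cong refl) simp
  qed
  show ?thesis
    unfolding 1[unfolded Dh_def] 2 3 by (simp add: residual_def inner_add_left snd_conv cong: if_cong add: algebra_simps sum.distrib)
qed

text \<open>The coefficient of the volume form in \<open>\<sigma>\<^sup>*(X \<lrcorner> \<Omega>)\<close> for a vertical \<open>X\<close> with components \<open>v\<close>, where \<open>S\<close>
  is the differential of \<open>\<sigma>\<close>.\<close>

definition euler :: "('m, 'f, 'n, 'c) adapted \<Rightarrow> ('n, 'c, 'k) Pcoord \<Rightarrow> ((real, 'n) vec \<Rightarrow> ('n, 'c, 'k) Pcoord) \<Rightarrow> ('n, 'c, 'k) Pcoord \<Rightarrow> real" where
  "euler a y S v = (\<Sum>m<CARD('k). \<Sum>\<mu>s | length \<mu>s = m. \<Sum>\<kappa>\<in>UNIV. \<Sum>i\<in>UNIV.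
      dp \<mu>s \<kappa> i v * dphi \<mu>s i (S (axis \<kappa> 1)) - dp \<mu>s \<kappa> i (S (axis \<kappa> 1)) * dphi \<mu>s i v)
    - frechet_derivative (H a) (at y) v"

text \<open>On the image of \<open>S\<close> every linear form is a combination of the
  \<open>dx\<close>, because \<open>S\<close> is a right inverse of the base projection. Then
  \<open>wedge_transversal\<close> replaces \<open>X\<close> by \<open>X - S (fst X)\<close>, whose
  base component is zero.\<close>

lemma Omega_euler:
  assumes a: "a \<in> adapted_charts B" and y: "y \<in> image_of (P a)" and S: "linear S" "\<And>e. fst (S e) = e"
    and len: "length es = CARD('n)"
  shows "Omega_coord B Lag a y (X # map S es) = euler a y S (X - S (fst X)) * volume es"
proof -
  have comb: "\<gamma> (S e) = (\<Sum>\<nu>\<in>UNIV. (\<chi> \<nu>. \<gamma> (S (axis \<nu> 1))) $ \<nu> * dx \<nu> (S e))" if "linear \<gamma>" for \<gamma> :: "('n, 'c, 'k) Pcoord \<Rightarrow> real" and e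
  proof -
    have lin: "linear (\<lambda>e. \<gamma> (S e))" using linear_compose[OF S(1) that] by (simp add: o_def)
    have "\<gamma> (S (\<Sum>\<nu>\<in>UNIV. e $ \<nu> *\<^sub>R axis \<nu> 1)) = (\<Sum>\<nu>\<in>UNIV. e $ \<nu> * \<gamma> (S (axis \<nu> 1)))"
      by (simp add: linear_sum[OF lin] linear_scale[OF lin])
    then show ?thesis using basis_expansion[of e] S(2)[of e]
      by (simp add: scalar_mult_eq_scaleR dx_def split_beta mult.commute)
  qed
  have dxX: "dx \<nu> (S (fst X)) = dx \<nu> X" for \<nu> using S(2)[of "fst X"] by (simp add: dx_def split_beta)
  have diff: "\<gamma> X - (\<Sum>\<nu>\<in>UNIV. (\<chi> \<nu>. \<gamma> (S (axis \<nu> 1))) $ \<nu> * dx \<nu> X) = \<gamma> (X - S (fst X))" if "linear \<gamma>" for \<gamma> :: "('n, 'c, 'k) Pcoord \<Rightarrow> real"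
    using comb[OF that, of "fst X"] linear_diff[OF that, of X "S (fst X)"] by (simp add: dxX)
  have vol: "wedge (map dx base_indices) (map S es) = volume es"
    unfolding volume_def using len S(2) by (intro wedge_cong) (auto simp: base_indices(3) dx_def split_beta)
  have len': "length (map S es) = CARD('n)" using len by simp
  have linH: "linear (frechet_derivative (H a) (at y))" by (rule smooth_on_linear[OF H_smooth[OF a] y])
  have 1: "wedge (dp \<mu>s \<kappa> i # map (\<lambda>\<nu>. if \<nu> = \<kappa> then dphi \<mu>s i else dx \<nu>) base_indices) (X # map S es) =
      (dp \<mu>s \<kappa> i (X - S (fst X)) * dphi \<mu>s i (S (axis \<kappa> 1)) - dp \<mu>s \<kappa> i (S (axis \<kappa> 1)) * dphi \<mu>s i (X - S (fst X))) * volume es" for \<mu>s \<kappa> i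
    unfolding vol[symmetric] diff[OF linear_dp, symmetric] diff[OF linear_dphi, symmetric]
    by (subst wedge_transversal(2)[OF len', where g = "\<chi> \<nu>. dp \<mu>s \<kappa> i (S (axis \<nu> 1))" and b = "\<chi> \<nu>. dphi \<mu>s i (S (axis \<nu> 1))"])
      (auto simp: comb[OF linear_dp, of \<mu>s \<kappa> i, simplified, symmetric] comb[OF linear_dphi, of \<mu>s i, simplified, symmetric])
  have 2: "wedge (frechet_derivative (H a) (at y) # map dx base_indices) (X # map S es) = frechet_derivative (H a) (at y) (X - S (fst X)) * volume es"
    unfolding vol[symmetric] diff[OF linH, symmetric]
    by (rule wedge_transversal(1)[OF len']) (auto simp only: set_map intro: comb[OF linH])
  show ?thesis unfolding Omega_coord_def 1 2 euler_def by (simp add: sum_distrib_right left_diff_distrib)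
qed

lemma euler_vertical:
  assumes a: "a \<in> adapted_charts B" and y: "(x, \<phi>, p) \<in> image_of (P a)"
  shows "euler a (x, \<phi>, p) S (0, w, q) =
    (\<Sum>\<kappa>\<in>UNIV. pr q (fst (snd (S (axis \<kappa> 1))) - jent \<phi> (uh a (x, \<phi>, top_mom p)) (axis \<kappa> 1)) $ \<kappa>)
    - (\<Sum>I\<in>UNIV. wt I * (residual a (x, \<phi>, p) (\<lambda>\<kappa>. snd (snd (S (axis \<kappa> 1)))) (low_list I) \<bullet> w $ I))"
proof -
  have "(\<Sum>m<CARD('k). \<Sum>\<mu>s | length \<mu>s = m. \<Sum>\<kappa>\<in>UNIV. \<Sum>i\<in>UNIV. dp \<mu>s \<kappa> i (0, w, q) * dphi \<mu>s i (S (axis \<kappa> 1))) =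
      (\<Sum>\<kappa>\<in>UNIV. pr q (fst (snd (S (axis \<kappa> 1)))) $ \<kappa>)"
    using sum_pr[of q "\<lambda>\<kappa>. fst (snd (S (axis \<kappa> 1)))" "\<lambda>_. 1"] by (simp add: dp_def dphi_def split_beta)
  moreover have "(\<Sum>m<CARD('k). \<Sum>\<mu>s | length \<mu>s = m. \<Sum>\<kappa>\<in>UNIV. \<Sum>i\<in>UNIV. dp \<mu>s \<kappa> i (S (axis \<kappa> 1)) * dphi \<mu>s i (0, w, q)) =
     (\<Sum>m<CARD('k). \<Sum>\<mu>s | length \<mu>s = m. \<Sum>\<kappa>\<in>UNIV. \<Sum>i\<in>UNIV. snd (snd (S (axis \<kappa> 1))) $ low \<mu>s $ \<kappa> $ i * w $ low \<mu>s $ i)"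
    by (simp add: dp_def dphi_def split_beta)
  ultimately show ?thesis
    unfolding euler_def sum_subtractf DH_vertical[OF a y] residual_sum[OF a y, symmetric]
    by (simp add: pr_diff_right sum_subtractf)
qed

lemma euler_zero_iff:
  assumes a: "a \<in> adapted_charts B" and y: "(x, \<phi>, p) \<in> image_of (P a)"
  shows "(\<forall>w q. euler a (x, \<phi>, p) S (0, w, q) = 0) \<longleftrightarrow>
    (\<forall>\<kappa>. fst (snd (S (axis \<kappa> 1))) = jent \<phi> (uh a (x, \<phi>, top_mom p)) (axis \<kappa> 1)) \<and>
    (\<forall>\<mu>s. length \<mu>s < CARD('k) \<longrightarrow> residual a (x, \<phi>, p) (\<lambda>\<kappa>. snd (snd (S (axis \<kappa> 1)))) \<mu>s = 0)"
proof -
  let ?z = "\<lambda>\<kappa>. fst (snd (S (axis \<kappa> 1))) - jent \<phi> (uh a (x, \<phi>, top_mom p)) (axis \<kappa> 1)"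
  let ?R = "residual a (x, \<phi>, p) (\<lambda>\<kappa>. snd (snd (S (axis \<kappa> 1))))"
  have E: "euler a (x, \<phi>, p) S (0, w, q) = (\<Sum>\<kappa>\<in>UNIV. pr q (?z \<kappa>) $ \<kappa>) - (\<Sum>I\<in>UNIV. wt I * (?R (low_list I) \<bullet> w $ I))" for w q
    by (rule euler_vertical[OF a y])
  show ?thesis
  proof (intro iffI conjI allI impI)
    assume 0: "\<forall>w q. euler a (x, \<phi>, p) S (0, w, q) = 0"
    have "?z \<kappa> $ I $ i = 0" for \<kappa> I i
    proof -
      \<comment> \<open>A momentum with a single nonzero component isolates one component of the
        contact equations.\<close>
      let ?q = "axis I (axis \<kappa> (axis i 1)) :: ('n, 'c, 'k) momenta"
      have "?q $ L $ l \<bullet> v $ L = (if L = I then if l = \<kappa> then v $ I $ i else 0 else 0)" for L l and v :: "('n, 'c, 'k) fields"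
        by (auto simp: axis_def inner_vec_def if_distrib[of "\<lambda>x. x * _"] cong: if_cong)
      then have "pr ?q v $ l = (if l = \<kappa> then wt I * v $ I $ i else 0)" for l v
        by (cases "l = \<kappa>") (simp_all add: pr_nth if_distrib[of "\<lambda>x. _ * x"] cong: if_cong)
      then have "(\<Sum>l\<in>UNIV. pr ?q (?z l) $ l) = wt I * ?z \<kappa> $ I $ i" by simp
      moreover have "(\<Sum>l\<in>UNIV. pr ?q (?z l) $ l) = 0" using 0 E[of 0 ?q] by simp
      ultimately show ?thesis by simp
    qed
    then show "fst (snd (S (axis \<kappa> 1))) = jent \<phi> (uh a (x, \<phi>, top_mom p)) (axis \<kappa> 1)" for \<kappa>
      by (simp add: vec_eq_iff)
    fix \<mu>s :: "'n list" assume len: "length \<mu>s < CARD('k)"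
    let ?I = "low \<mu>s :: ('n, 'k) lower_index"
    have "pr 0 v = 0" for v :: "('n, 'c, 'k) fields" by (rule bounded_bilinear.zero_left[OF bilinear_pr])
    then have "(\<Sum>I\<in>UNIV. wt I * (?R (low_list I) \<bullet> w $ I)) = 0" for w :: "('n, 'c, 'k) fields"
      using 0 E[of w 0] by simp
    \<comment> \<open>Testing with the residual itself, placed at the single multi-index
      \<open>?I\<close>, gives a positive multiple of its squared norm.\<close>
    from this[of "axis ?I (?R (low_list ?I))"]
    have "wt ?I * (?R (low_list ?I) \<bullet> ?R (low_list ?I)) = 0"
      by (simp add: axis_def if_distrib[of "\<lambda>x. _ \<bullet> x"] if_distrib[of "\<lambda>x. _ * x"] cong: if_cong)
    then have "?R (low_list ?I) = 0" by simp
    moreover have "?R (low_list ?I) = ?R \<mu>s" by (rule residual_perm) (simp add: Rep_low[OF len])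
    ultimately show "?R \<mu>s = 0" by simp
  next
    fix w :: "('n, 'c, 'k) fields" and q :: "('n, 'c, 'k) momenta"
    assume "(\<forall>\<kappa>. fst (snd (S (axis \<kappa> 1))) = jent \<phi> (uh a (x, \<phi>, top_mom p)) (axis \<kappa> 1)) \<and>
      (\<forall>\<mu>s. length \<mu>s < CARD('k) \<longrightarrow> ?R \<mu>s = 0)"
    moreover have "pr q 0 = 0" by (rule bounded_bilinear.zero_right[OF bilinear_pr])
    ultimately show "euler a (x, \<phi>, p) S (0, w, q) = 0" unfolding E by (simp add: length_low_list)
  qed
qed

end

section \<open>Sections of the phase bundle\<close>

locale lagrangian_section = lagrangian_bundle B K Lag
  for B :: "('m, 'f, 'n::{finite,linorder}, 'c::finite) fibre_bundle" and K :: "'k::finite itself"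
    and Lag :: "('m, 'f, 'n) density" +
  fixes \<sigma> :: "'m \<Rightarrow> ('m, 'f, 'n, 'c, 'k) phase"
  assumes phase_sec: "phase_section B \<sigma>"
begin

lemma sigma_smooth: "smooth_map (base B) PA \<sigma>"
  using phase_sec by (simp add: phase_section_def)

lemma sigma_base: "x \<in> carrier_of (base B) \<Longrightarrow> fst (fst (\<sigma> x)) = x"
  using phase_sec by (simp add: phase_section_def)

lemma sigma_carrier: "x \<in> carrier_of (base B) \<Longrightarrow> \<sigma> x \<in> carrier_of PA"
  using sigma_smooth by (auto simp: smooth_map_def)

lemma ex_chart:
  assumes "x \<in> carrier_of (base B)"
  obtains a where "a \<in> adapted_charts B" "\<sigma> x \<in> dom_of (P a)"
proof -
  obtain c where "c \<in> PA" "\<sigma> x \<in> dom_of c" using sigma_carrier[OF assms] unfolding carrier_of_def by (rule UN_E)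
  then show thesis using that unfolding Patlas_def by (elim imageE) simp
qed

definition rep :: "('m, 'f, 'n, 'c) adapted \<Rightarrow> (real, 'n) vec \<Rightarrow> ('n, 'c, 'k) Pcoord" where
  "rep a = coords (P a) \<circ> \<sigma> \<circ> uncoords (fst a)"

definition rdom :: "('m, 'f, 'n, 'c) adapted \<Rightarrow> (real, 'n) vec set" where
  "rdom a = coords (fst a) ` (dom_of (fst a) \<inter> \<sigma> -` dom_of (P a))"

abbreviation "Phi a \<xi> \<equiv> fst (snd (rep a \<xi>))"
abbreviation "Mom a \<xi> \<equiv> snd (snd (rep a \<xi>))"
abbreviation "dsec a \<xi> \<equiv> frechet_derivative (rep a) (at \<xi>)"
abbreviation "hpt a \<xi> \<equiv> (\<xi>, Phi a \<xi>, top_mom (Mom a \<xi>))"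

lemma rep_smooth: "a \<in> adapted_charts B \<Longrightarrow> smooth_on (rdom a) (rep a)"
  unfolding rdom_def rep_def by (rule smooth_mapD[OF sigma_smooth adapted_base P_in_atlas])

lemma rdom_open: "a \<in> adapted_charts B \<Longrightarrow> open (rdom a)"
  by (rule smooth_onD_open[OF rep_smooth])

lemma rdomD:
  assumes a: "a \<in> adapted_charts B" and \<xi>: "\<xi> \<in> rdom a"
  shows "uncoords (fst a) \<xi> \<in> dom_of (fst a)" "\<sigma> (uncoords (fst a) \<xi>) \<in> dom_of (P a)"
    "coords (fst a) (uncoords (fst a) \<xi>) = \<xi>" "uncoords (fst a) \<xi> \<in> carrier_of (base B)"
    "coords (P a) (\<sigma> (uncoords (fst a) \<xi>)) = rep a \<xi>"
proof -
  have *: "\<xi> \<in> image_of (fst a)" "uncoords (fst a) \<xi> \<in> \<sigma> -` dom_of (P a)"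
    using coords_image_iff[OF base_atlas adapted_base[OF a]] \<xi> unfolding rdom_def by auto
  show d: "uncoords (fst a) \<xi> \<in> dom_of (fst a)" by (rule uncoords_in_dom[OF *(1)])
  show "\<sigma> (uncoords (fst a) \<xi>) \<in> dom_of (P a)" using *(2) by simp
  show "coords (fst a) (uncoords (fst a) \<xi>) = \<xi>" by (rule coords_uncoords[OF *(1)])
  show "uncoords (fst a) \<xi> \<in> carrier_of (base B)"
    unfolding carrier_of_def by (rule UN_I[where B = dom_of, OF adapted_base[OF a] d])
  show "coords (P a) (\<sigma> (uncoords (fst a) \<xi>)) = rep a \<xi>" by (simp add: rep_def)
qed

lemma fst_rep:
  assumes a: "a \<in> adapted_charts B" and \<xi>: "\<xi> \<in> rdom a"
  shows "fst (rep a \<xi>) = \<xi>"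
  using P_value_coords(4)[OF a rdomD(2)[OF a \<xi>]] sigma_base[OF rdomD(4)[OF a \<xi>]] rdomD(3,5)[OF a \<xi>] by simp

lemma rep_eq: "a \<in> adapted_charts B \<Longrightarrow> \<xi> \<in> rdom a \<Longrightarrow> rep a \<xi> = (\<xi>, Phi a \<xi>, Mom a \<xi>)"
  using fst_rep by (simp add: prod_eq_iff)

lemma rep_in_image: "a \<in> adapted_charts B \<Longrightarrow> \<xi> \<in> rdom a \<Longrightarrow> rep a \<xi> \<in> image_of (P a)"
  using coords_in_image[OF rdomD(2)] rdomD(5) by metis

lemma rdomI:
  assumes a: "a \<in> adapted_charts B" and x: "x \<in> carrier_of (base B)" "\<sigma> x \<in> dom_of (P a)"
  shows "x \<in> dom_of (fst a)" "coords (fst a) x \<in> rdom a" "uncoords (fst a) (coords (fst a) x) = x"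
proof -
  show d: "x \<in> dom_of (fst a)" using P_value_coords(3)[OF a x(2)] sigma_base[OF x(1)] by simp
  show "coords (fst a) x \<in> rdom a" unfolding rdom_def using d x(2) by (intro imageI) simp
  show "uncoords (fst a) (coords (fst a) x) = x" by (rule base_uncoords_coords[OF adapted_base[OF a] d])
qed

lemma dsec:
  assumes a: "a \<in> adapted_charts B" and \<xi>: "\<xi> \<in> rdom a"
  shows "(rep a has_derivative dsec a \<xi>) (at \<xi>)" "linear (dsec a \<xi>)" "fst (dsec a \<xi> e) = e"
proof -
  show d: "(rep a has_derivative dsec a \<xi>) (at \<xi>)" by (rule smooth_on_has_derivative[OF rep_smooth[OF a] \<xi>])
  show "linear (dsec a \<xi>)" by (rule has_derivative_linear[OF d])
  have "frechet_derivative (\<lambda>\<xi>. fst (rep a \<xi>)) (at \<xi>) = frechet_derivative (\<lambda>\<xi>. \<xi>) (at \<xi>)"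
    by (rule frechet_derivative_cong_open[OF rdom_open[OF a] \<xi>]) (rule fst_rep[OF a])
  moreover have "frechet_derivative (\<lambda>\<xi>. fst (rep a \<xi>)) (at \<xi>) = (\<lambda>e. fst (dsec a \<xi> e))"
    by (rule frechet_derivative_eqI[OF has_derivative_fst[OF d]])
  moreover have "frechet_derivative (\<lambda>\<xi> :: (real, 'n) vec. \<xi>) (at \<xi>) = (\<lambda>e. e)"
    by (rule frechet_derivative_eqI[OF has_derivative_ident])
  ultimately have "(\<lambda>e. fst (dsec a \<xi> e)) = (\<lambda>e. e)" by (simp only:)
  from fun_cong[OF this, of e] show "fst (dsec a \<xi> e) = e" by (simp only:)
qed

lemma dsec_components:
  assumes a: "a \<in> adapted_charts B" and \<xi>: "\<xi> \<in> rdom a"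
  shows "frechet_derivative (\<lambda>\<xi>. Phi a \<xi>) (at \<xi>) e = fst (snd (dsec a \<xi> e))"
    "frechet_derivative (\<lambda>\<xi>. Phi a \<xi> $ I) (at \<xi>) e = fst (snd (dsec a \<xi> e)) $ I"
    "frechet_derivative (\<lambda>\<xi>. Mom a \<xi> $ I $ \<kappa>) (at \<xi>) e = snd (snd (dsec a \<xi> e)) $ I $ \<kappa>"
proof -
  note d = has_derivative_snd[OF dsec(1)[OF a \<xi>]]
  note dP = has_derivative_fst[OF d] and dM = has_derivative_snd[OF d]
  show "frechet_derivative (\<lambda>\<xi>. Phi a \<xi>) (at \<xi>) e = fst (snd (dsec a \<xi> e))"
    by (rule fun_cong[OF frechet_derivative_eqI[OF dP]])
  show "frechet_derivative (\<lambda>\<xi>. Phi a \<xi> $ I) (at \<xi>) e = fst (snd (dsec a \<xi> e)) $ I"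
    by (rule fun_cong[OF frechet_derivative_eqI[OF bounded_linear.has_derivative[OF bounded_linear_vec_nth dP]]])
  show "frechet_derivative (\<lambda>\<xi>. Mom a \<xi> $ I $ \<kappa>) (at \<xi>) e = snd (snd (dsec a \<xi> e)) $ I $ \<kappa>"
    by (rule fun_cong[OF frechet_derivative_eqI[OF bounded_linear.has_derivative[OF bounded_linear_vec_nth
      bounded_linear.has_derivative[OF bounded_linear_vec_nth dM]]]])
qed

lemma pull_back_eval:
  assumes a: "a \<in> adapted_charts B" and \<xi>: "\<xi> \<in> rdom a" and X: "smooth_vector_field PA X"
    and vs: "length vs = CARD('n)" "set vs \<subseteq> tangent_space (base B) (uncoords (fst a) \<xi>)"
  shows "pull_back (base B) PA \<sigma> (interior_product X Om) (uncoords (fst a) \<xi>) vs =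
    (let u = X (\<sigma> (uncoords (fst a) \<xi>)) (P a) in
      euler a (rep a \<xi>) (dsec a \<xi>) (u - dsec a \<xi> (fst u)) * volume (map (\<lambda>v. v (fst a)) vs))"
proof -
  let ?x = "uncoords (fst a) \<xi>"
  let ?pf = "push_forward (base B) PA \<sigma> ?x"
  note r = rdomD[OF a \<xi>]
  have pf: "?pf v (P a) = dsec a \<xi> (v (fst a))" if "v \<in> tangent_space (base B) ?x" for v
    using push_forward_eq[OF base_atlas sigma_smooth adapted_base[OF a] r(1) P_in_atlas[OF a] r(2) that]
    unfolding r(3) rep_def by simp
  have X': "X (\<sigma> ?x) \<in> tangent_space PA (\<sigma> ?x)"
    using X sigma_carrier[OF r(4)] by (simp add: smooth_vector_field_def)
  have "set (X (\<sigma> ?x) # map ?pf vs) \<subseteq> tangent_space PA (\<sigma> ?x)"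
    using X' vs(2) push_forward_tangent[OF base_atlas Patlas_smooth sigma_smooth r(4)] by auto
  then have "pull_back (base B) PA \<sigma> (interior_product X Om) ?x vs =
      Omega_coord B Lag a (rep a \<xi>) (map (\<lambda>v. v (P a)) (X (\<sigma> ?x) # map ?pf vs))"
    unfolding pull_back_def interior_product_def
    by (subst Om_eq[OF a r(2)]) (simp_all add: vs(1) r(5) del: set_map)
  also have "map (\<lambda>v. v (P a)) (X (\<sigma> ?x) # map ?pf vs) = X (\<sigma> ?x) (P a) # map (dsec a \<xi>) (map (\<lambda>v. v (fst a)) vs)"
    using vs(2) by (simp add: pf subset_iff)
  also have "Omega_coord B Lag a (rep a \<xi>) \<dots> = (let u = X (\<sigma> ?x) (P a) in
      euler a (rep a \<xi>) (dsec a \<xi>) (u - dsec a \<xi> (fst u)) * volume (map (\<lambda>v. v (fst a)) vs))"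
    unfolding Let_def
    by (rule Omega_euler[OF a rep_in_image[OF a \<xi>] dsec(2,3)[OF a \<xi>]]) (simp add: vs(1))
  finally show ?thesis .
qed

text \<open>Forward, a vector field with an arbitrary prescribed vertical value is evaluated on a
  coordinate frame, whose volume is 1. Backward, the base component of
  \<open>u - dsec a \<xi> (fst u)\<close> is zero, so only vertical arguments of
  \<open>euler\<close> occur.\<close>

lemma vanishing_iff_euler:
  "(\<forall>X. smooth_vector_field PA X \<longrightarrow>
      form_vanishes (base B) CARD('n) (pull_back (base B) PA \<sigma> (interior_product X Om))) \<longleftrightarrow>
    (\<forall>a\<in>adapted_charts B. \<forall>\<xi>\<in>rdom a. \<forall>w q. euler a (rep a \<xi>) (dsec a \<xi>) (0, w, q) = 0)"
proof (intro iffI ballI allI impI)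
  fix a \<xi> w q
  assume 0: "\<forall>X. smooth_vector_field PA X \<longrightarrow>
      form_vanishes (base B) CARD('n) (pull_back (base B) PA \<sigma> (interior_product X Om))"
    and a: "a \<in> adapted_charts B" and \<xi>: "\<xi> \<in> rdom a"
  let ?x = "uncoords (fst a) \<xi>"
  note r = rdomD[OF a \<xi>]
  obtain X where X: "smooth_vector_field PA X" "X (\<sigma> ?x) (P a) = (0, w, q)"
    using vector_field_through[OF a r(2)] by blast
  let ?vs = "map (\<lambda>\<nu>. coord_vector (base B) ?x (fst a) (axis \<nu> 1)) base_indices"
  note ba = base_atlas adapted_base[OF a] r(1)
  have vs: "length ?vs = CARD('n)" "set ?vs \<subseteq> tangent_space (base B) ?x"
    using coord_vector_tangent[OF ba] by (auto simp: base_indices)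
  have "map (\<lambda>v. v (fst a)) ?vs = map (\<lambda>\<nu>. axis \<nu> 1) base_indices"
    by (simp add: coord_vector_same[OF ba])
  then have vol: "volume (map (\<lambda>v. v (fst a)) ?vs) = 1" by (simp only: volume_axis)
  have "pull_back (base B) PA \<sigma> (interior_product X Om) ?x ?vs = 0"
    using 0 X(1) vs r(4) unfolding form_vanishes_def by simp
  then show "euler a (rep a \<xi>) (dsec a \<xi>) (0, w, q) = 0"
    unfolding pull_back_eval[OF a \<xi> X(1) vs] Let_def X(2) vol by (simp add: linear_0[OF dsec(2)[OF a \<xi>]])
next
  fix X
  assume E: "\<forall>a\<in>adapted_charts B. \<forall>\<xi>\<in>rdom a. \<forall>w q. euler a (rep a \<xi>) (dsec a \<xi>) (0, w, q) = 0"
    and X: "smooth_vector_field PA X"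
  show "form_vanishes (base B) CARD('n) (pull_back (base B) PA \<sigma> (interior_product X Om))"
    unfolding form_vanishes_def
  proof (intro ballI allI impI)
    fix x vs
    assume x: "x \<in> carrier_of (base B)" and vs: "length vs = CARD('n) \<and> set vs \<subseteq> tangent_space (base B) x"
    obtain a where a: "a \<in> adapted_charts B" "\<sigma> x \<in> dom_of (P a)" by (rule ex_chart[OF x])
    let ?\<xi> = "coords (fst a) x"
    note r = rdomI[OF a(1) x a(2)]
    have vs': "length vs = CARD('n)" "set vs \<subseteq> tangent_space (base B) (uncoords (fst a) ?\<xi>)"
      using vs r(3) by simp_all
    have "euler a (rep a ?\<xi>) (dsec a ?\<xi>) (u - dsec a ?\<xi> (fst u)) = 0" for u
    proof -
      obtain x' w q where v: "u - dsec a ?\<xi> (fst u) = (x', w, q)" by (metis prod.exhaust)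
      have "fst (u - dsec a ?\<xi> (fst u)) = 0" by (simp add: dsec(3)[OF a(1) r(2)])
      then have "x' = 0" unfolding v by simp
      then show ?thesis unfolding v using E a(1) r(2) by simp
    qed
    then show "pull_back (base B) PA \<sigma> (interior_product X Om) x vs = 0"
      using pull_back_eval[OF a(1) r(2) X vs'] unfolding r(3) Let_def by simp
  qed
qed

definition contact_eq :: "('m, 'f, 'n, 'c) adapted \<Rightarrow> (real, 'n) vec \<Rightarrow> bool" where
  "contact_eq a \<xi> \<longleftrightarrow> (\<forall>\<kappa>. fst (snd (dsec a \<xi> (axis \<kappa> 1))) = jent (Phi a \<xi>) (uh a (hpt a \<xi>)) (axis \<kappa> 1))"

definition momentum_eq :: "('m, 'f, 'n, 'c) adapted \<Rightarrow> (real, 'n) vec \<Rightarrow> bool" where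
  "momentum_eq a \<xi> \<longleftrightarrow> (\<forall>\<mu>s. length \<mu>s < CARD('k) \<longrightarrow>
     residual a (rep a \<xi>) (\<lambda>\<kappa>. snd (snd (dsec a \<xi> (axis \<kappa> 1)))) \<mu>s = 0)"

lemma vanishing_iff:
  "(\<forall>X. smooth_vector_field PA X \<longrightarrow>
      form_vanishes (base B) CARD('n) (pull_back (base B) PA \<sigma> (interior_product X Om))) \<longleftrightarrow>
    (\<forall>a\<in>adapted_charts B. \<forall>\<xi>\<in>rdom a. contact_eq a \<xi> \<and> momentum_eq a \<xi>)"
proof -
  have "(\<forall>w q. euler a (rep a \<xi>) (dsec a \<xi>) (0, w, q) = 0) \<longleftrightarrow> contact_eq a \<xi> \<and> momentum_eq a \<xi>"
    if a: "a \<in> adapted_charts B" and \<xi>: "\<xi> \<in> rdom a" for a \<xi>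
  proof -
    have "(\<xi>, Phi a \<xi>, Mom a \<xi>) \<in> image_of (P a)" using rep_in_image[OF a \<xi>] rep_eq[OF a \<xi>] by simp
    from euler_zero_iff[OF a this, of "dsec a \<xi>"]
    show ?thesis unfolding contact_eq_def momentum_eq_def rep_eq[OF a \<xi>, symmetric] .
  qed
  then show ?thesis unfolding vanishing_iff_euler by simp
qed

section \<open>The section of \<Phi> underlying \<sigma>, and the field equations\<close>

definition base_field :: "'m \<Rightarrow> 'f" where
  "base_field x = jet_value (fst (\<sigma> x))"

lemma base_field_coords:
  assumes a: "a \<in> adapted_charts B" and \<xi>: "\<xi> \<in> rdom a"
  shows "base_field (uncoords (fst a) \<xi>) \<in> dom_of (snd a)"
    "coords (snd a) (base_field (uncoords (fst a) \<xi>)) = (\<xi>, Phi a \<xi> $ low [])"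
    "field_rep a base_field \<xi> = Phi a \<xi> $ low []"
proof -
  note pv = P_value_coords[OF a rdomD(2)[OF a \<xi>]]
  show "base_field (uncoords (fst a) \<xi>) \<in> dom_of (snd a)" unfolding base_field_def by (rule pv(1))
  show *: "coords (snd a) (base_field (uncoords (fst a) \<xi>)) = (\<xi>, Phi a \<xi> $ low [])"
    unfolding base_field_def pv(2) rdomD(5)[OF a \<xi>] by (simp add: fst_rep[OF a \<xi>])
  show "field_rep a base_field \<xi> = Phi a \<xi> $ low []" unfolding field_rep_def using * by simp
qed

lemma field_rep_base_field_smooth: "a \<in> adapted_charts B \<Longrightarrow> smooth_on (rdom a) (field_rep a base_field)"
  by (rule smooth_on_cong[OF smooth_on_nth[OF smooth_on_fst[OF smooth_on_snd[OF rep_smooth]]]])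
    (simp_all add: base_field_coords(3))

lemma base_field_domain:
  assumes a: "a \<in> adapted_charts B" and x: "x \<in> carrier_of (base B)" "base_field x \<in> dom_of (snd a)"
  shows "\<sigma> x \<in> dom_of (P a)"
  using P_domI[OF sigma_carrier[OF x(1)]] x(2) by (simp add: base_field_def)

lemma base_field_proj:
  assumes x: "x \<in> carrier_of (base B)"
  shows "proj B (base_field x) = x"
proof -
  obtain a where a: "a \<in> adapted_charts B" "\<sigma> x \<in> dom_of (P a)" by (rule ex_chart[OF x])
  note r = rdomI[OF a(1) x a(2)]
  note bf = base_field_coords[OF a(1) r(2), unfolded r(3)]
  have "coords (fst a) (proj B (base_field x)) = coords (fst a) x"
    using adapted_proj(2)[OF a(1) bf(1)] bf(2) by simp
  then show ?thesis
    using inj_onD[OF smooth_atlas_inj[OF base_atlas adapted_base[OF a(1)]] _ adapted_proj(1)[OF a(1) bf(1)] r(1)] by simp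
qed

text \<open>Smoothness has to be checked in arbitrary charts \<open>c\<close> and \<open>d\<close>,
  not only in adapted ones; near each point the map factors through an adapted chart, where its
  expression is a component of \<open>rep\<close>.\<close>

lemma base_field_section: "global_section B base_field"
  unfolding global_section_def smooth_map_def
proof (intro conjI ballI)
  show "base_field ` carrier_of (base B) \<subseteq> carrier_of (total B)"
  proof (rule image_subsetI)
    fix x assume x: "x \<in> carrier_of (base B)"
    obtain a where a: "a \<in> adapted_charts B" "\<sigma> x \<in> dom_of (P a)" by (rule ex_chart[OF x])
    show "base_field x \<in> carrier_of (total B)"
      using P_value_coords(1)[OF a] adapted_total[OF a(1)] unfolding base_field_def carrier_of_def by (rule_tac UN_I)
  qed
  show "proj B (base_field x) = x" if "x \<in> carrier_of (base B)" for x by (rule base_field_proj[OF that])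
  fix c d assume c: "c \<in> base B" and d: "d \<in> total B"
  show "smooth_on (coords c ` (dom_of c \<inter> base_field -` dom_of d)) (coords d \<circ> base_field \<circ> uncoords c)"
  proof (rule smooth_on_local)
    fix \<zeta> assume "\<zeta> \<in> coords c ` (dom_of c \<inter> base_field -` dom_of d)"
    then obtain x where x: "x \<in> dom_of c" "base_field x \<in> dom_of d" "\<zeta> = coords c x" by auto
    have xc: "x \<in> carrier_of (base B)" unfolding carrier_of_def by (rule UN_I[where B = dom_of, OF c x(1)])
    obtain a where a: "a \<in> adapted_charts B" "\<sigma> x \<in> dom_of (P a)" by (rule ex_chart[OF xc])
    note b = adapted_base[OF a(1)] and t = adapted_total[OF a(1)]
    note r = rdomI[OF a(1) xc a(2)]
    let ?\<psi> = "\<lambda>\<zeta>. coords (fst a) (uncoords c \<zeta>)"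
    let ?val = "\<lambda>\<xi>. (\<xi>, Phi a \<xi> $ (low [] :: ('n, 'k) lower_index))"
    let ?W = "coords c ` (dom_of c \<inter> dom_of (fst a))"
    let ?O = "coords (snd a) ` (dom_of (snd a) \<inter> dom_of d)"
    define U1 where "U1 = {\<zeta> \<in> ?W. ?\<psi> \<zeta> \<in> rdom a}"
    define U where "U = {\<zeta> \<in> U1. ?val (?\<psi> \<zeta>) \<in> ?O}"
    have \<psi>: "smooth_on ?W ?\<psi>" using transition_smooth[OF base_atlas c b] by (simp add: o_def)
    have "open U1" unfolding U1_def by (rule smooth_on_open_vimage[OF \<psi> rdom_open[OF a(1)]])
    then have \<psi>1: "smooth_on U1 ?\<psi>" by (rule smooth_on_subset[OF \<psi>]) (auto simp: U1_def)
    have "smooth_on (rdom a) ?val"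
      by (intro smooth_on_Pair smooth_on_ident rdom_open[OF a(1)] smooth_on_nth smooth_on_fst smooth_on_snd rep_smooth[OF a(1)])
    from smooth_on_compose[OF this \<psi>1] have val: "smooth_on U1 (\<lambda>\<zeta>. ?val (?\<psi> \<zeta>))" by (auto simp: U1_def)
    have T: "smooth_on ?O (\<lambda>y. coords d (uncoords (snd a) y))"
      using transition_smooth[OF total_atlas t d] by (simp add: o_def)
    have "open U" unfolding U_def by (rule smooth_on_open_vimage[OF val smooth_onD_open[OF T]])
    then have "smooth_on U (\<lambda>\<zeta>. ?val (?\<psi> \<zeta>))" by (rule smooth_on_subset[OF val]) (auto simp: U_def)
    from smooth_on_compose[OF T this]
    have sm: "smooth_on U (\<lambda>\<zeta>. coords d (uncoords (snd a) (?val (?\<psi> \<zeta>))))" by (auto simp: U_def)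
    have z: "uncoords c \<zeta> \<in> dom_of c" "base_field (uncoords c \<zeta>) \<in> dom_of d" "coords c (uncoords c \<zeta>) = \<zeta>"
      "uncoords (snd a) (?val (?\<psi> \<zeta>)) = base_field (uncoords c \<zeta>)" if "\<zeta> \<in> U" for \<zeta>
    proof -
      have W: "\<zeta> \<in> ?W" and R: "?\<psi> \<zeta> \<in> rdom a" and O: "?val (?\<psi> \<zeta>) \<in> ?O"
        using that unfolding U_def U1_def by simp_all
      have im: "\<zeta> \<in> image_of c" "uncoords c \<zeta> \<in> dom_of (fst a)" using W coords_image_iff[OF base_atlas c] by simp_all
      show "uncoords c \<zeta> \<in> dom_of c" by (rule uncoords_in_dom[OF im(1)])
      show "coords c (uncoords c \<zeta>) = \<zeta>" by (rule coords_uncoords[OF im(1)])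
      have e: "uncoords (fst a) (?\<psi> \<zeta>) = uncoords c \<zeta>" by (rule base_uncoords_coords[OF b im(2)])
      note bf = base_field_coords[OF a(1) R, unfolded e]
      show *: "uncoords (snd a) (?val (?\<psi> \<zeta>)) = base_field (uncoords c \<zeta>)"
        using total_uncoords_coords[OF t bf(1)] unfolding bf(2) .
      have "uncoords (snd a) (?val (?\<psi> \<zeta>)) \<in> dom_of d" using O coords_image_iff[OF total_atlas t] by blast
      then show "base_field (uncoords c \<zeta>) \<in> dom_of d" unfolding * .
    qed
    have "smooth_on U (coords d \<circ> base_field \<circ> uncoords c)"
      by (rule smooth_on_cong[OF sm]) (simp add: z(4))
    moreover have "U \<subseteq> coords c ` (dom_of c \<inter> base_field -` dom_of d)"
    proof
      fix \<zeta> assume "\<zeta> \<in> U"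
      note z = z[OF this]
      have "uncoords c \<zeta> \<in> dom_of c \<inter> base_field -` dom_of d" using z(1,2) by simp
      from imageI[OF this, of "coords c"] show "\<zeta> \<in> coords c ` (dom_of c \<inter> base_field -` dom_of d)" unfolding z(3) .
    qed
    moreover have "\<zeta> \<in> U"
    proof -
      have u: "uncoords c \<zeta> = x" unfolding x(3) by (rule base_uncoords_coords[OF c x(1)])
      have bf: "base_field x \<in> dom_of (snd a)" "coords (snd a) (base_field x) = ?val (coords (fst a) x)"
        using base_field_coords[OF a(1) r(2)] unfolding r(3) by simp_all
      have "coords (snd a) (base_field x) \<in> ?O" using bf(1) x(2) by simp
      moreover have "\<zeta> \<in> ?W" using x(1,3) r(1) by simp
      ultimately show ?thesis unfolding U_def U1_def using u r(2) bf(2) by simp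
    qed
    ultimately show "\<exists>U. \<zeta> \<in> U \<and> U \<subseteq> coords c ` (dom_of c \<inter> base_field -` dom_of d) \<and>
        smooth_on U (coords d \<circ> base_field \<circ> uncoords c)" by (intro exI[of _ U] conjI)
  qed
qed

lemma global_section_local:
  assumes f: "global_section B f" and x: "x \<in> carrier_of (base B)"
  shows "local_section B x f"
proof -
  have "restrict_atlas (base B) (carrier_of (base B)) = base B"
  proof -
    have "(dom_of c \<inter> carrier_of (base B), coords c) = c" if "c \<in> base B" for c
      using that by (auto simp: carrier_of_def prod_eq_iff)
    then show ?thesis unfolding restrict_atlas_def by simp
  qed
  then show ?thesis
    unfolding local_section_def using f x openin_carrier[of "base B"] by (auto simp: global_section_def)
qed

text \<open>The contact equations say that differentiating a coordinate of order m yields those of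
  order m + 1, with \<open>uh\<close> at order k. The induction differentiates the identity for the
  shorter list, which therefore has to hold on all of \<open>rdom a\<close>.\<close>

lemma pd_base_field:
  assumes a: "a \<in> adapted_charts B" and C: "\<And>\<xi>. \<xi> \<in> rdom a \<Longrightarrow> contact_eq a \<xi>"
  shows "length \<mu>s \<le> CARD('k) \<Longrightarrow> \<xi> \<in> rdom a \<Longrightarrow>
    pd \<mu>s (field_rep a base_field) \<xi> = jet_entry (Phi a \<xi>) (uh a (hpt a \<xi>)) \<mu>s"
proof (induction \<mu>s arbitrary: \<xi>)
  case Nil
  then show ?case by (simp add: jet_entry_def base_field_coords(3)[OF a])
next
  case (Cons \<kappa> \<mu>s)
  then have len: "length \<mu>s < CARD('k)" by simp
  have "frechet_derivative (pd \<mu>s (field_rep a base_field)) (at \<xi>) = frechet_derivative (\<lambda>\<xi>. Phi a \<xi> $ low \<mu>s) (at \<xi>)"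
    by (rule frechet_derivative_cong_open[OF rdom_open[OF a] Cons.prems(2)])
      (use Cons.IH len in \<open>simp add: jet_entry_def\<close>)
  then have "pd (\<kappa> # \<mu>s) (field_rep a base_field) \<xi> = fst (snd (dsec a \<xi> (axis \<kappa> 1))) $ low \<mu>s"
    by (simp add: dsec_components(2)[OF a Cons.prems(2)])
  also have "\<dots> = jet_entry (Phi a \<xi>) (uh a (hpt a \<xi>)) (\<mu>s @ [\<kappa>])"
    using C[OF Cons.prems(2)] unfolding contact_eq_def by (simp add: jent_axis_low[OF len])
  also have "\<dots> = jet_entry (Phi a \<xi>) (uh a (hpt a \<xi>)) (\<kappa> # \<mu>s)"
    by (rule jet_entry_eqI) simp
  finally show ?case .
qed

lemma divergence_rep:
  assumes a: "a \<in> adapted_charts B" and \<xi>: "\<xi> \<in> rdom a"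
  shows "divergence (mom_rep B a \<sigma>) \<xi> \<mu>s = (\<Sum>\<kappa>\<in>UNIV. snd (snd (dsec a \<xi> (axis \<kappa> 1))) $ low \<mu>s $ \<kappa>)"
proof -
  have "mom_rep B a \<sigma> = (\<lambda>\<xi>. Mom a \<xi>)" by (simp add: mom_rep_def rep_def)
  then show ?thesis unfolding divergence_def by (simp add: dsec_components(3)[OF a \<xi>])
qed

text \<open>The field equations quantify over base points and the charts containing
  \<open>f x\<close>; because \<open>f\<close> agrees with \<open>base_field\<close>, these
  correspond exactly to the coordinates in \<open>rdom a\<close>. The equations of order 0 and of
  orders 1 to k - 1 merge into \<open>momentum_eq\<close>.\<close>

lemma field_equations_iff:
  assumes f: "\<And>x. x \<in> carrier_of (base B) \<Longrightarrow> f x = base_field x"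
  shows "field_equations B Lag \<sigma> f \<longleftrightarrow> (\<forall>a\<in>adapted_charts B. \<forall>\<xi>\<in>rdom a.
    (\<forall>\<mu>s. length \<mu>s = CARD('k) \<longrightarrow> pd \<mu>s (field_rep a f) \<xi> = d_top (h a) (hpt a \<xi>) \<mu>s) \<and> momentum_eq a \<xi>)"
proof -
  have eq: "(let \<xi> = coords (fst a) x; \<phi> = fst (snd (coords (P a) (\<sigma> x))); p = mom_rep B a \<sigma>; h = h a; y = (\<xi>, \<phi>, top_mom (p \<xi>))
      in (\<forall>\<mu>s. length \<mu>s = CARD('k) \<longrightarrow> pd \<mu>s (field_rep a f) \<xi> = d_top h y \<mu>s) \<and>
         (\<forall>\<mu>s. 1 \<le> length \<mu>s \<and> length \<mu>s \<le> CARD('k) - 1 \<longrightarrow> sym_mom (p \<xi>) \<mu>s = - d_low h y \<mu>s - divergence p \<xi> \<mu>s) \<and>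
         0 = - d_low h y [] - divergence p \<xi> []) \<longleftrightarrow>
    (\<forall>\<mu>s. length \<mu>s = CARD('k) \<longrightarrow> pd \<mu>s (field_rep a f) (coords (fst a) x) = d_top (h a) (hpt a (coords (fst a) x)) \<mu>s) \<and>
      momentum_eq a (coords (fst a) x)"
    if a: "a \<in> adapted_charts B" and x: "x \<in> carrier_of (base B)" "\<sigma> x \<in> dom_of (P a)" for a x
  proof -
    let ?\<xi> = "coords (fst a) x"
    let ?D = "\<lambda>\<kappa>. snd (snd (dsec a ?\<xi> (axis \<kappa> 1)))"
    note r = rdomI[OF a x]
    have c: "coords (P a) (\<sigma> x) = rep a ?\<xi>" using rdomD(5)[OF a r(2)] unfolding r(3) .
    have m: "mom_rep B a \<sigma> ?\<xi> = Mom a ?\<xi>" by (simp add: mom_rep_def rep_def)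
    have res: "residual a (rep a ?\<xi>) ?D \<mu>s = divergence (mom_rep B a \<sigma>) ?\<xi> \<mu>s +
        (if \<mu>s = [] then 0 else sym_mom (Mom a ?\<xi>) \<mu>s) + d_low (h a) (hpt a ?\<xi>) \<mu>s" for \<mu>s
      unfolding residual_def divergence_rep[OF a r(2)] fst_rep[OF a r(2)] ..
    have "momentum_eq a ?\<xi> \<longleftrightarrow>
        (\<forall>\<mu>s. 1 \<le> length \<mu>s \<and> length \<mu>s \<le> CARD('k) - 1 \<longrightarrow> residual a (rep a ?\<xi>) ?D \<mu>s = 0) \<and> residual a (rep a ?\<xi>) ?D [] = 0"
      (is "_ \<longleftrightarrow> ?R")
    proof
      assume "momentum_eq a ?\<xi>"
      moreover have "length \<mu>s < CARD('k)" if "length \<mu>s \<le> CARD('k) - 1" for \<mu>s :: "'n list"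
        using that zero_less_card_finite[where 'a = 'k] by linarith
      ultimately show ?R by (auto simp: momentum_eq_def)
    next
      assume R: ?R
      show "momentum_eq a ?\<xi>" unfolding momentum_eq_def
      proof (intro allI impI)
        fix \<mu>s :: "'n list" assume "length \<mu>s < CARD('k)"
        then show "residual a (rep a ?\<xi>) ?D \<mu>s = 0" using R by (cases \<mu>s) simp_all
      qed
    qed
    moreover have "residual a (rep a ?\<xi>) ?D \<mu>s = 0 \<longleftrightarrow>
        sym_mom (Mom a ?\<xi>) \<mu>s = - d_low (h a) (hpt a ?\<xi>) \<mu>s - divergence (mom_rep B a \<sigma>) ?\<xi> \<mu>s" if "1 \<le> length \<mu>s" for \<mu>s
      unfolding res using that by (auto simp: algebra_simps eq_neg_iff_add_eq_0)
    moreover have "residual a (rep a ?\<xi>) ?D [] = 0 \<longleftrightarrow>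
        0 = - d_low (h a) (hpt a ?\<xi>) [] - divergence (mom_rep B a \<sigma>) ?\<xi> []"
      unfolding res by (auto simp: algebra_simps eq_neg_iff_add_eq_0)
    ultimately show ?thesis unfolding Let_def c m by simp
  qed
  have dom: "f x \<in> dom_of (snd a) \<longleftrightarrow> \<sigma> x \<in> dom_of (P a)"
    if "a \<in> adapted_charts B" "x \<in> carrier_of (base B)" for a x
    using base_field_domain[OF that] P_value_coords(1)[OF that(1), of "\<sigma> x"] f[OF that(2)] by (auto simp: base_field_def)
  show ?thesis
    unfolding field_equations_def
  proof (intro iffI ballI impI)
    fix a \<xi>
    assume F: "\<forall>a\<in>adapted_charts B. \<forall>x\<in>carrier_of (base B). f x \<in> dom_of (snd a) \<longrightarrow>
        (let \<xi> = coords (fst a) x; \<phi> = fst (snd (coords (P a) (\<sigma> x))); p = mom_rep B a \<sigma>; h = h a; y = (\<xi>, \<phi>, top_mom (p \<xi>))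
      in (\<forall>\<mu>s. length \<mu>s = CARD('k) \<longrightarrow> pd \<mu>s (field_rep a f) \<xi> = d_top h y \<mu>s) \<and>
         (\<forall>\<mu>s. 1 \<le> length \<mu>s \<and> length \<mu>s \<le> CARD('k) - 1 \<longrightarrow> sym_mom (p \<xi>) \<mu>s = - d_low h y \<mu>s - divergence p \<xi> \<mu>s) \<and>
         0 = - d_low h y [] - divergence p \<xi> [])"
      and a: "a \<in> adapted_charts B" and \<xi>: "\<xi> \<in> rdom a"
    note r = rdomD[OF a \<xi>]
    from iffD1[OF eq[OF a r(4,2)] mp[OF bspec[OF bspec[OF F a] r(4)] iffD2[OF dom[OF a r(4)] r(2)]]]
    show "(\<forall>\<mu>s. length \<mu>s = CARD('k) \<longrightarrow> pd \<mu>s (field_rep a f) \<xi> = d_top (h a) (hpt a \<xi>) \<mu>s) \<and> momentum_eq a \<xi>"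
      unfolding r(3) .
  next
    fix a x
    assume "\<forall>a\<in>adapted_charts B. \<forall>\<xi>\<in>rdom a.
      (\<forall>\<mu>s. length \<mu>s = CARD('k) \<longrightarrow> pd \<mu>s (field_rep a f) \<xi> = d_top (h a) (hpt a \<xi>) \<mu>s) \<and> momentum_eq a \<xi>"
      and a: "a \<in> adapted_charts B" and x: "x \<in> carrier_of (base B)" and "f x \<in> dom_of (snd a)"
    then have \<sigma>: "\<sigma> x \<in> dom_of (P a)" and
      R: "(\<forall>\<mu>s. length \<mu>s = CARD('k) \<longrightarrow> pd \<mu>s (field_rep a f) (coords (fst a) x) = d_top (h a) (hpt a (coords (fst a) x)) \<mu>s) \<and>
      momentum_eq a (coords (fst a) x)"
      using dom[OF a x] rdomI(2)[OF a x] by simp_all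
    from iffD2[OF eq[OF a x \<sigma>] R]
    show "let \<xi> = coords (fst a) x; \<phi> = fst (snd (coords (P a) (\<sigma> x))); p = mom_rep B a \<sigma>; h = h a; y = (\<xi>, \<phi>, top_mom (p \<xi>))
      in (\<forall>\<mu>s. length \<mu>s = CARD('k) \<longrightarrow> pd \<mu>s (field_rep a f) \<xi> = d_top h y \<mu>s) \<and>
         (\<forall>\<mu>s. 1 \<le> length \<mu>s \<and> length \<mu>s \<le> CARD('k) - 1 \<longrightarrow> sym_mom (p \<xi>) \<mu>s = - d_low h y \<mu>s - divergence p \<xi> \<mu>s) \<and>
         0 = - d_low h y [] - divergence p \<xi> []" .
  qed
qed

text \<open>The witness is \<open>base_field\<close>: the contact equations make its derivatives the
  jet coordinates of \<sigma> below order k and \<open>uh\<close> at order k. Conversely, a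
  holonomic \<sigma> has lower coordinates \<open>jlow a f\<close>, whose derivative is a
  \<open>jent\<close> with \<open>jtop\<close> as top entries, and the first field equation
  identifies these with \<open>uh\<close>.\<close>

theorem vanishing_iff_field_equations:
  "(\<forall>X. smooth_vector_field PA X \<longrightarrow>
      form_vanishes (base B) CARD('n) (pull_back (base B) PA \<sigma> (interior_product X Om))) \<longleftrightarrow>
    (\<exists>f. holonomic_with B \<sigma> f \<and> field_equations B Lag \<sigma> f)"
  unfolding vanishing_iff
proof (intro iffI)
  assume E: "\<forall>a\<in>adapted_charts B. \<forall>\<xi>\<in>rdom a. contact_eq a \<xi> \<and> momentum_eq a \<xi>"
  have pd: "pd \<mu>s (field_rep a base_field) \<xi> = jet_entry (Phi a \<xi>) (uh a (hpt a \<xi>)) \<mu>s"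
    if "a \<in> adapted_charts B" "\<xi> \<in> rdom a" "length \<mu>s \<le> CARD('k)" for a \<xi> \<mu>s
    using pd_base_field[OF that(1) _ that(3,2)] E that(1) by simp
  have "fst (\<sigma> x) = jet B (CARD('k) - 1) base_field x" if x: "x \<in> carrier_of (base B)" for x
  proof -
    obtain a where a: "a \<in> adapted_charts B" "\<sigma> x \<in> dom_of (P a)" by (rule ex_chart[OF x])
    note r = rdomI[OF a(1) x a(2)]
    note pv = P_value_coords[OF a]
    have v: "base_field x \<in> dom_of (snd a)" unfolding base_field_def by (rule pv(1))
    note qj = Q_jet[OF a(1) global_section_local[OF base_field_section x] v]
    have "jlow a base_field (coords (fst a) x) = Phi a (coords (fst a) x)"
    proof (rule iffD2[OF vec_eq_iff, OF allI])
      fix I :: "('n, 'k) lower_index"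
      show "jlow a base_field (coords (fst a) x) $ I = Phi a (coords (fst a) x) $ I"
        using pd[OF a(1) r(2), of "low_list I"] length_low_list[of I] by (simp add: jlow_def jet_entry_def)
    qed
    moreover have "coords (P a) (\<sigma> x) = rep a (coords (fst a) x)" using rdomD(5)[OF a(1) r(2)] unfolding r(3) .
    ultimately have "coords (Q a) (fst (\<sigma> x)) = coords (Q a) (jet B (CARD('k) - 1) base_field x)"
      unfolding pv(6) qj(2) by (simp add: fst_rep[OF a(1) r(2)])
    then show ?thesis by (rule inj_onD[OF Q_inj[OF a(1)] _ pv(5) qj(1)])
  qed
  then have "holonomic_with B \<sigma> base_field" unfolding holonomic_with_def using base_field_section by simp
  moreover have "field_equations B Lag \<sigma> base_field"
    unfolding field_equations_iff[OF refl]
  proof (intro ballI conjI allI impI)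
    fix a \<xi> and \<mu>s :: "'n list"
    assume a: "a \<in> adapted_charts B" "\<xi> \<in> rdom a" and len: "length \<mu>s = CARD('k)"
    show "pd \<mu>s (field_rep a base_field) \<xi> = d_top (h a) (hpt a \<xi>) \<mu>s"
      using pd[OF a, of \<mu>s] len by (simp add: jet_entry_def uh_top_of)
  qed (use E in simp)
  ultimately show "\<exists>f. holonomic_with B \<sigma> f \<and> field_equations B Lag \<sigma> f" by (intro exI conjI)
next
  assume "\<exists>f. holonomic_with B \<sigma> f \<and> field_equations B Lag \<sigma> f"
  then obtain f where f: "global_section B f" "\<And>x. x \<in> carrier_of (base B) \<Longrightarrow> fst (\<sigma> x) = jet B (CARD('k) - 1) f x"
    and F: "field_equations B Lag \<sigma> f" unfolding holonomic_with_def by (elim exE conjE) simp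
  have fb: "f x = base_field x" if "x \<in> carrier_of (base B)" for x
    unfolding base_field_def f(2)[OF that] by (rule jet_value_jet[OF global_section_local[OF f(1) that], symmetric])
  have "field_equations B Lag \<sigma> f \<longleftrightarrow> (\<forall>a\<in>adapted_charts B. \<forall>\<xi>\<in>rdom a.
      (\<forall>\<mu>s. length \<mu>s = CARD('k) \<longrightarrow> pd \<mu>s (field_rep a f) \<xi> = d_top (h a) (hpt a \<xi>) \<mu>s) \<and> momentum_eq a \<xi>)"
    by (rule field_equations_iff) (rule fb)
  note F = iffD1[OF this F]
  show "\<forall>a\<in>adapted_charts B. \<forall>\<xi>\<in>rdom a. contact_eq a \<xi> \<and> momentum_eq a \<xi>"
  proof (intro ballI conjI)
    fix a \<xi> assume a: "a \<in> adapted_charts B" and \<xi>: "\<xi> \<in> rdom a"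
    note F = bspec[OF bspec[OF F a] \<xi>]
    show "momentum_eq a \<xi>" using F by simp
    have sm: "smooth_on (rdom a) (field_rep a f)"
    proof (rule smooth_on_cong[OF field_rep_base_field_smooth[OF a]])
      fix \<xi> assume "\<xi> \<in> rdom a"
      from fb[OF rdomD(4)[OF a this]] show "field_rep a base_field \<xi> = field_rep a f \<xi>" by (simp add: field_rep_def)
    qed
    have low: "Phi a \<xi> = jlow a f \<xi>" if \<xi>: "\<xi> \<in> rdom a" for \<xi>
    proof -
      let ?x = "uncoords (fst a) \<xi>"
      note r = rdomD[OF a \<xi>]
      have "f ?x \<in> dom_of (snd a)" using base_field_coords(1)[OF a \<xi>] fb[OF r(4)] by simp
      note qj = Q_jet(2)[OF a global_section_local[OF f(1) r(4)] this]
      show ?thesis using P_value_coords(6)[OF a r(2)] unfolding f(2)[OF r(4)] qj r(3,5) by simp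
    qed
    have top: "jtop a f \<xi> = uh a (hpt a \<xi>)"
      using F length_top_list[where 'n = 'n and 'k = 'k] by (simp add: vec_eq_iff jtop_def uh_def)
    have "frechet_derivative (\<lambda>\<xi>. Phi a \<xi>) (at \<xi>) = frechet_derivative (jlow a f) (at \<xi>)"
      by (rule frechet_derivative_cong_open[OF rdom_open[OF a] \<xi> low])
    also have "\<dots> = jent (jlow a f \<xi>) (jtop a f \<xi>)"
      by (rule frechet_derivative_eqI[OF jlow_has_derivative[OF sm \<xi>]])
    finally show "contact_eq a \<xi>"
      unfolding contact_eq_def dsec_components(1)[OF a \<xi>, symmetric] top low[OF \<xi>, symmetric] by simp
  qed
qed

end

text \<open>Independence of trivialisation and coordinates is rendered as the existence of one form
  on the phase bundle having the given expression in every adapted chart; uniqueness then identifies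
  the form of the second claim with the constructed one.\<close>

theorem theorem9:
  fixes B :: "('m, 'f, 'n::{finite,linorder}, 'c::finite) fibre_bundle"
    and F :: "('g, real^'c) chart set"
    and Lag :: "('m, 'f, 'n) density"
  assumes "smooth_fibre_bundle B F"
    and "lagrangian_density TYPE('k::finite) B Lag"
    and "regular_lagrangian TYPE('k) B Lag"
  shows "(\<exists>!\<Omega> :: ('m, 'f, 'n, 'c, 'k) phase
              \<Rightarrow> (('m, 'f, 'n, 'c, 'k) phase, ('n, 'c, 'k) Pcoord) tangent list \<Rightarrow> real.
            differential_form (Patlas B) (Suc CARD('n)) \<Omega> \<and> represented_by_Omega B Lag \<Omega>) \<and>
         (\<forall>\<Omega> :: ('m, 'f, 'n, 'c, 'k) phase
              \<Rightarrow> (('m, 'f, 'n, 'c, 'k) phase, ('n, 'c, 'k) Pcoord) tangent list \<Rightarrow> real.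
          \<forall>\<sigma> :: 'm \<Rightarrow> ('m, 'f, 'n, 'c, 'k) phase.
            differential_form (Patlas B) (Suc CARD('n)) \<Omega> \<and> represented_by_Omega B Lag \<Omega> \<and>
            phase_section B \<sigma> \<longrightarrow>
            ((\<forall>X. smooth_vector_field (Patlas B) X \<longrightarrow>
                 form_vanishes (base B) CARD('n)
                   (pull_back (base B) (Patlas B) \<sigma> (interior_product X \<Omega>)))
             \<longleftrightarrow>
             (\<exists>f. holonomic_with B \<sigma> f \<and> field_equations B Lag \<sigma> f)))"
proof -
  have man: "smooth_manifold (base B)" "smooth_manifold (total B)"
    using assms(1) by (simp_all add: smooth_fibre_bundle_def)
  interpret lagrangian_bundle B "TYPE('k)" Lag
    by unfold_locales (use man assms(2,3) in \<open>simp_all only: smooth_manifold_def\<close>)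
  show ?thesis
  proof (intro conjI allI impI)
    show "\<exists>!\<Omega>. differential_form PA (Suc CARD('n)) \<Omega> \<and> represented_by_Omega B Lag \<Omega>"
    proof (rule ex1I)
      show "differential_form PA (Suc CARD('n)) Om \<and> represented_by_Omega B Lag Om"
        by (rule conjI[OF Om_differential_form Om_represented])
    qed (elim conjE, rule Omega_form_unique)
    fix \<Omega> and \<sigma> :: "'m \<Rightarrow> ('m, 'f, 'n, 'c, 'k) phase"
    assume "differential_form PA (Suc CARD('n)) \<Omega> \<and> represented_by_Omega B Lag \<Omega> \<and> phase_section B \<sigma>"
    then have \<Omega>: "differential_form PA (Suc CARD('n)) \<Omega>" "represented_by_Omega B Lag \<Omega>" and \<sigma>: "phase_section B \<sigma>"
      by simp_all
    interpret lagrangian_section B "TYPE('k)" Lag \<sigma> by unfold_locales (rule \<sigma>)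
    show "(\<forall>X. smooth_vector_field PA X \<longrightarrow>
          form_vanishes (base B) CARD('n) (pull_back (base B) PA \<sigma> (interior_product X \<Omega>))) \<longleftrightarrow>
        (\<exists>f. holonomic_with B \<sigma> f \<and> field_equations B Lag \<sigma> f)"
      unfolding Omega_form_unique[OF \<Omega>] by (rule vanishing_iff_field_equations)
  qed
qed

end
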